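(* Let $\alpha<0$ be a real number and let $c_1>0$ and $c_2>0$ be arbitrary constants. Let $B_{R_1}\subset\mathbb{R}^2$ be a disk of perimeter $|\partial B_{R_1}|=c_1$ and let $B_{R_2}\subset\mathbb{R}^2$ be a disk of area $|B_{R_2}|=c_2$. Then $$\max_{\Omega \text{ convex},\ |\partial\Omega|=c_1}\lambda_1^\alpha(\Omega^{\mathrm{ext}})=\lambda_1^\alpha(B_{R_1}^{\mathrm{ext}})\qquad\text{and}\qquad \max_{\Omega \text{ convex},\ |\Omega|=c_2}\lambda_1^\alpha(\Omega^{\mathrm{ext}})=\lambda_1^\alpha(B_{R_2}^{\mathrm{ext}}),$$ where the maxima are taken over all convex smooth bounded open sets $\Omega\subset\mathbb{R}^2$ with perimeter $|\partial\Omega|=c_1$, respectively with area $|\Omega|=c_2$.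
   Context: For an open set $\Omega\subset\mathbb{R}^2$, $\Omega^{\mathrm{ext}}:=\mathbb{R}^2\setminus\overline{\Omega}$ (similarly $B_R^{\mathrm{ext}}$ for a disk $B_R$ of radius $R$). "Smooth" means that the boundary is $C^\infty$-smooth. $|\Omega|$ denotes the 2-dimensional Lebesgue measure of $\Omega$ and $|\partial\Omega|$ the 1-dimensional Hausdorff measure of its boundary. For $\alpha\in\mathbb{R}$ and $\Omega$ a smooth bounded open set, $$\lambda_1^\alpha(\Omega^{\mathrm{ext}}):=\inf_{u\in W^{1,2}(\Omega^{\mathrm{ext}}),\ u\neq 0}\frac{\int_{\Omega^{\mathrm{ext}}}|\nabla u|^2+\alpha\int_{\partial\Omega}|u|^2}{\int_{\Omega^{\mathrm{ext}}}|u|^2},$$ where the boundary values of $u$ are understood in the sense of traces $W^{1,2}(\Omega^{\mathrm{ext}})\hookrightarrow L^2(\partial\Omega)$ and the boundary integral is with respect to arc length. *)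

theory Defs
  imports "HOL-Analysis.Analysis"
begin

primrec Ck :: "nat \<Rightarrow> ('a::euclidean_space \<Rightarrow> 'b::real_normed_vector) \<Rightarrow> bool" where
  "Ck 0 f \<longleftrightarrow> continuous_on UNIV f"
| "Ck (Suc k) f \<longleftrightarrow> (\<forall>x. f differentiable (at x)) \<and>
     (\<forall>b\<in>Basis. Ck k (\<lambda>x. frechet_derivative f (at x) b))"

definition smooth :: "('a::euclidean_space \<Rightarrow> 'b::real_normed_vector) \<Rightarrow> bool" where
  "smooth f \<longleftrightarrow> (\<forall>k. Ck k f)"

definition test_functions ::
    "'a::euclidean_space set \<Rightarrow> ('a \<Rightarrow> 'b::real_normed_vector) set" where
  "test_functions E = {f. smooth f \<and> compact (closure {x. f x \<noteq> 0}) \<and> closure {x. f x \<noteq> 0} \<subseteq> E}"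

definition grad :: "(real^2 \<Rightarrow> 'b::real_normed_vector) \<Rightarrow> real^2 \<Rightarrow> 'b^2" where
  "grad f x = (\<chi> i. frechet_derivative f (at x) (axis i 1))"

text \<open>The boundary is locally, after a rotation or reflection of the coordinate axes, the graph of
  a smooth function, with the set lying strictly on one side of the graph.\<close>

definition smooth_boundary :: "(real^2) set \<Rightarrow> bool" where
  "smooth_boundary \<Omega> \<longleftrightarrow>
     (\<forall>p\<in>frontier \<Omega>. \<exists>r>0. \<exists>T :: real^2 \<Rightarrow> real^2. \<exists>\<gamma> :: real \<Rightarrow> real.
        orthogonal_transformation T \<and> smooth \<gamma> \<and>
        \<Omega> \<inter> ball p r = {x \<in> ball p r. T x $ 2 > \<gamma> (T x $ 1)})"

text \<open>One-dimensional Hausdorff measure. In dimension one the normalising constant is 1, so that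
  the measure of a rectifiable arc is its length. The coverings are required to be bounded because
  \<^const>\<open>diameter\<close> is only meaningful for bounded sets.\<close>

definition hausdorff1_pre :: "real \<Rightarrow> 'a::metric_space set \<Rightarrow> ennreal" where
  "hausdorff1_pre \<delta> A =
     (INF C \<in> {C :: nat \<Rightarrow> 'a set. A \<subseteq> (\<Union>i. C i) \<and> (\<forall>i. bounded (C i) \<and> diameter (C i) \<le> \<delta>)}.
        \<Sum>i. ennreal (diameter (C i)))"

definition hausdorff1_outer :: "'a::metric_space set \<Rightarrow> ennreal" where
  "hausdorff1_outer A = (SUP \<delta> \<in> {0<..}. hausdorff1_pre \<delta> A)"

definition hausdorff1 :: "'a::metric_space measure" where
  "hausdorff1 = measure_of UNIV (sets borel) hausdorff1_outer"

definition perimeter :: "(real^2) set \<Rightarrow> real" where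
  "perimeter \<Omega> = measure hausdorff1 (frontier \<Omega>)"

abbreviation arc_length_on :: "(real^2) set \<Rightarrow> (real^2) measure" where
  "arc_length_on S \<equiv> restrict_space hausdorff1 S"

definition L2 :: "'a measure \<Rightarrow> ('a \<Rightarrow> 'b::real_normed_vector) set" where
  "L2 M = {f \<in> borel_measurable M. integrable M (\<lambda>x. (norm (f x))\<^sup>2)}"

definition L2_tendsto ::
    "'a measure \<Rightarrow> (nat \<Rightarrow> 'a \<Rightarrow> 'b::real_normed_vector) \<Rightarrow> ('a \<Rightarrow> 'b) \<Rightarrow> bool" where
  "L2_tendsto M v f \<longleftrightarrow>
     (\<lambda>n. \<integral>\<^sup>+x. ennreal ((norm (v n x - f x))\<^sup>2) \<partial>M) \<longlonglongrightarrow> 0"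

text \<open>\<open>W12_with_grad E u G\<close>: \<open>u\<close> lies in the Sobolev space \<open>W\<close>$^{1,2}$ of the open set \<open>E\<close>, and
  \<open>G\<close> is (a representative of) its distributional gradient.\<close>

definition W12_with_grad ::
    "(real^2) set \<Rightarrow> (real^2 \<Rightarrow> complex) \<Rightarrow> (real^2 \<Rightarrow> complex^2) \<Rightarrow> bool" where
  "W12_with_grad E u G \<longleftrightarrow>
     u \<in> L2 (lebesgue_on E) \<and> G \<in> L2 (lebesgue_on E) \<and>
     (\<forall>\<phi> :: real^2 \<Rightarrow> real. \<phi> \<in> test_functions E \<longrightarrow> (\<forall>i.
        (LINT x|lebesgue_on E. (grad \<phi> x $ i) *\<^sub>R u x) =
        - (LINT x|lebesgue_on E. \<phi> x *\<^sub>R (G x $ i))))"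

definition ext :: "(real^2) set \<Rightarrow> (real^2) set" where
  "ext \<Omega> = - closure \<Omega>"

text \<open>The trace operator is the continuous extension, from \<open>W\<close>$^{1,2}$ of the exterior to the
  square-integrable functions on the boundary, of the restriction map on smooth compactly supported
  functions of the plane. These are dense when the boundary is smooth and compact, so every \<open>u\<close> has a
  trace and it is unique almost everywhere on the boundary; the relation below is the graph of that
  extension.\<close>

definition has_trace ::
    "(real^2) set \<Rightarrow> (real^2 \<Rightarrow> complex) \<Rightarrow> (real^2 \<Rightarrow> complex) \<Rightarrow> bool" where
  "has_trace \<Omega> u g \<longleftrightarrow>
     g \<in> L2 (arc_length_on (frontier \<Omega>)) \<and>
     (\<exists>G v. W12_with_grad (ext \<Omega>) u G \<and> (\<forall>n. v n \<in> test_functions UNIV) \<and>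
        L2_tendsto (lebesgue_on (ext \<Omega>)) v u \<and>
        L2_tendsto (lebesgue_on (ext \<Omega>)) (\<lambda>n. grad (v n)) G \<and>
        L2_tendsto (arc_length_on (frontier \<Omega>)) v g)"

text \<open>The infimum is taken in the extended reals, so that it is meaningful without a prior proof
  that the Rayleigh quotients are bounded below.\<close>

definition robin_ext_eigenvalue :: "real \<Rightarrow> (real^2) set \<Rightarrow> ereal" where
  "robin_ext_eigenvalue \<alpha> \<Omega> =
     Inf {ereal (((LINT x|lebesgue_on (ext \<Omega>). (norm (G x))\<^sup>2) +
                  \<alpha> * (LINT x|arc_length_on (frontier \<Omega>). (norm (g x))\<^sup>2)) /
                 (LINT x|lebesgue_on (ext \<Omega>). (norm (u x))\<^sup>2)) | u G g.
            W12_with_grad (ext \<Omega>) u G \<and> has_trace \<Omega> u g \<and>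
            \<not> (AE x in lebesgue_on (ext \<Omega>). u x = 0)}"

definition convex_smooth_domain :: "(real^2) set \<Rightarrow> bool" where
  "convex_smooth_domain \<Omega> \<longleftrightarrow> open \<Omega> \<and> bounded \<Omega> \<and> convex \<Omega> \<and> smooth_boundary \<Omega>"

definition is_maximum :: "'a::order set \<Rightarrow> 'a \<Rightarrow> bool" where
  "is_maximum A m \<longleftrightarrow> m \<in> A \<and> (\<forall>a\<in>A. a \<le> m)"

end

theory Submission
  imports Defs
begin

text \<open>Trial functions of the form \<open>u x = \<psi> (dist x \<Omega>)\<close> turn the Rayleigh quotient of a convex domain
  into a one-dimensional one, which by Steiner's formula depends only on the perimeter \<open>L\<close>: the exterior
  parallel curve at distance \<open>t\<close> has length \<open>L + 2 \<pi> t\<close>. Hence every \<open>\<mu>\<close> below the eigenvalue of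
  \<open>\<Omega>\<close> satisfies the one-dimensional inequality
  \<open>\<mu> \<integral> \<psi>\<^sup>2 (L + 2 \<pi> t) dt \<le> \<integral> \<psi>'\<^sup>2 (L + 2 \<pi> t) dt + \<alpha> L \<psi>(0)\<^sup>2\<close> for all profiles \<open>\<psi>\<close>.
  For the disk of the same perimeter this inequality, applied along every ray and integrated over the
  angle, gives the inequality for all functions in the exterior of the disk, so that \<open>\<mu>\<close> is at most
  the eigenvalue of the disk; radial symmetry of minimisers is never needed. In the case of equal area the
  isoperimetric inequality makes the perimeter of the disk the smaller one. As \<open>\<mu> \<le> 0\<close>, the
  one-dimensional inequality, divided by \<open>L\<close>, becomes weaker when \<open>L\<close> decreases.\<close>

section \<open>One-dimensional Hausdorff measure\<close>

text \<open>The trial functions are not smooth, and the competitors outside the disk are arbitrary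
  Sobolev functions, while traces are defined through smooth compactly supported functions. Both
  gaps are closed by approximation: the trial function is Lipschitz on the whole plane and is
  mollified, with convergence of gradients from strict differentiability of the distance; the
  inequality for competitors is proved for test functions and passed to the limit. The gradient in
  the Rayleigh quotient and the one inside \<open>has_trace\<close> are chosen separately, whence
  the uniqueness of weak gradients. The local geometry of the boundary gives the parallel area as a
  quadratic polynomial whose linear coefficient is the perimeter; the quadratic coefficient \<pi> is
  forced by comparison with large disks. Applied to a disk, the formula also yields its perimeter
  and, after averaging over rotations, polar coordinates. The bound \<mu> \<le> 0 comes from
  profiles spread over a long interval: the weight grows linearly, so their mass is unbounded while
  their energy is not.\<close>

lemma hausdorff1_pre_le:
  assumes "A \<subseteq> (\<Union>i. C i)" "\<And>i. bounded (C i)" "\<And>i. diameter (C i) \<le> \<delta>"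
  shows "hausdorff1_pre \<delta> A \<le> (\<Sum>i. ennreal (diameter (C i)))"
  unfolding hausdorff1_pre_def by (rule INF_lower) (use assms in auto)

lemma hausdorff1_pre_lessE:
  assumes "hausdorff1_pre \<delta> A < x"
  obtains C where "A \<subseteq> (\<Union>i. C i)" "\<And>i. bounded (C i)" "\<And>i. diameter (C i) \<le> \<delta>"
    "(\<Sum>i. ennreal (diameter (C i))) < x"
  using assms unfolding hausdorff1_pre_def INF_less_iff by auto

lemma hausdorff1_pre_antimono:
  assumes "\<delta> \<le> \<delta>'"
  shows "hausdorff1_pre \<delta>' A \<le> hausdorff1_pre \<delta> A"
  unfolding hausdorff1_pre_def by (rule INF_superset_mono) (use assms in \<open>auto intro: order_trans\<close>)

text \<open>Near-optimal coverings of the pieces, with errors e/2, e/4, and so on, are merged into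
  one sequence by a pairing of indices; the mesh bound survives because it holds set by set.\<close>

lemma hausdorff1_pre_UN_le:
  "hausdorff1_pre \<delta> (\<Union>i. A i) \<le> (\<Sum>i. hausdorff1_pre \<delta> (A i))"
proof (rule ennreal_le_epsilon)
  fix e :: real assume e: "0 < e" and fin: "(\<Sum>i. hausdorff1_pre \<delta> (A i)) < top"
  have lt: "hausdorff1_pre \<delta> (A i) < hausdorff1_pre \<delta> (A i) + ennreal (e * (1/2)^Suc i)" for i
  proof -
    have "hausdorff1_pre \<delta> (A i) \<le> (\<Sum>i. hausdorff1_pre \<delta> (A i))"
      using sum_le_suminf[of "\<lambda>i. hausdorff1_pre \<delta> (A i)" "{i}"] by simp
    with fin have "hausdorff1_pre \<delta> (A i) \<noteq> top" by (metis leD)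
    then show ?thesis using e by (simp add: ennreal_add_left_cancel_less)
  qed
  have "\<exists>C. A i \<subseteq> (\<Union>j. C j) \<and> (\<forall>j. bounded (C j)) \<and> (\<forall>j. diameter (C j) \<le> \<delta>) \<and>
      (\<Sum>j. ennreal (diameter (C j))) < hausdorff1_pre \<delta> (A i) + ennreal (e * (1/2)^Suc i)" for i
    by (rule hausdorff1_pre_lessE[OF lt[of i]]) blast
  then obtain C where C: "\<And>i. A i \<subseteq> (\<Union>j. C i j)" "\<And>i j. bounded (C i j)"
      "\<And>i j. diameter (C i j) \<le> \<delta>"
      "\<And>i. (\<Sum>j. ennreal (diameter (C i j))) < hausdorff1_pre \<delta> (A i) + ennreal (e * (1/2)^Suc i)"
    by metis
  define D where "D k = (case prod_decode k of (i, j) \<Rightarrow> C i j)" for k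
  have cov: "(\<Union>i. A i) \<subseteq> (\<Union>k. D k)"
  proof
    fix x assume "x \<in> (\<Union>i. A i)"
    then obtain i j where "x \<in> C i j" using C(1) by blast
    then have "x \<in> D (prod_encode (i, j))" by (simp add: D_def)
    then show "x \<in> (\<Union>k. D k)" by blast
  qed
  have "hausdorff1_pre \<delta> (\<Union>i. A i) \<le> (\<Sum>k. ennreal (diameter (D k)))"
    by (rule hausdorff1_pre_le[OF cov]) (auto simp: D_def C split: prod.split)
  also have "\<dots> = (\<Sum>k. (\<lambda>(i,j). ennreal (diameter (C i j))) (prod_decode k))"
    by (simp add: D_def split_beta)
  also have "\<dots> = (\<Sum>i. \<Sum>j. ennreal (diameter (C i j)))"
    by (rule suminf_ennreal_2dimen) auto
  also have "\<dots> \<le> (\<Sum>i. hausdorff1_pre \<delta> (A i) + ennreal (e * (1/2)^Suc i))"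
    by (intro suminf_le) (use C(4) in \<open>auto intro: less_imp_le\<close>)
  also have "\<dots> = (\<Sum>i. hausdorff1_pre \<delta> (A i)) + (\<Sum>i. ennreal (e * (1/2)^Suc i))"
    by (simp add: suminf_add)
  also have "(\<Sum>i. ennreal (e * (1/2)^Suc i)) = ennreal e"
  proof -
    have "(\<lambda>i. e * (1/2)^Suc i) sums (e * 1)" by (intro sums_mult power_half_series)
    then show ?thesis using e by (intro suminf_ennreal_eq) auto
  qed
  finally show "hausdorff1_pre \<delta> (\<Union>i. A i) \<le> (\<Sum>i. hausdorff1_pre \<delta> (A i)) + ennreal e" .
qed

lemma hausdorff1_pre_le_outer: "0 < \<delta> \<Longrightarrow> hausdorff1_pre \<delta> A \<le> hausdorff1_outer A"
  unfolding hausdorff1_outer_def by (rule SUP_upper) simp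

lemma hausdorff1_outer_empty [simp]: "hausdorff1_outer {} = 0"
proof -
  have "hausdorff1_outer ({}::'a set) \<le> 0" unfolding hausdorff1_outer_def
  proof (rule SUP_least)
    fix \<delta> :: real assume "\<delta> \<in> {0<..}"
    then show "hausdorff1_pre \<delta> ({}::'a set) \<le> 0"
      using hausdorff1_pre_le[of "{}" "\<lambda>_. {}" \<delta>] by auto
  qed
  then show ?thesis by simp
qed

lemma hausdorff1_pre_mono: "A \<subseteq> B \<Longrightarrow> hausdorff1_pre \<delta> A \<le> hausdorff1_pre \<delta> B"
  unfolding hausdorff1_pre_def by (rule INF_superset_mono) auto

lemma hausdorff1_outer_mono: "A \<subseteq> B \<Longrightarrow> hausdorff1_outer A \<le> hausdorff1_outer B"
  unfolding hausdorff1_outer_def by (rule SUP_mono) (use hausdorff1_pre_mono in blast)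

lemma hausdorff1_outer_UN_le: "hausdorff1_outer (\<Union>i. A i) \<le> (\<Sum>i. hausdorff1_outer (A i))"
proof -
  have "hausdorff1_pre \<delta> (\<Union>i. A i) \<le> (\<Sum>i. hausdorff1_outer (A i))" if "0 < \<delta>" for \<delta>
    using hausdorff1_pre_UN_le[of \<delta> A]
    by (rule order_trans) (intro suminf_le hausdorff1_pre_le_outer that summableI)
  then show ?thesis unfolding hausdorff1_outer_def[of "\<Union>i. A i"] by (auto intro: SUP_least)
qed

lemma outer_measure_space_hausdorff1: "outer_measure_space (Pow UNIV) hausdorff1_outer"
  unfolding outer_measure_space_def positive_def increasing_def countably_subadditive_def
  using hausdorff1_outer_mono hausdorff1_outer_UN_le by auto

lemma hausdorff1_outer_Un_le: "hausdorff1_outer (A \<union> B) \<le> hausdorff1_outer A + hausdorff1_outer B"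
proof -
  define C where "C = (\<lambda>i::nat. if i = 0 then A else if i = 1 then B else {})"
  have "A \<union> B = (\<Union>i. C i)" by (auto simp: C_def split: if_splits)
  then have "hausdorff1_outer (A \<union> B) \<le> (\<Sum>i. hausdorff1_outer (C i))"
    using hausdorff1_outer_UN_le by metis
  also have "\<dots> = (\<Sum>i\<in>{0,1}. hausdorff1_outer (C i))"
    by (rule suminf_finite) (auto simp: C_def)
  finally show ?thesis by (simp add: C_def)
qed

text \<open>A covering of mesh below the gap \<open>\<eta>\<close> splits into the sets that meet
  \<open>A\<close> and those that meet \<open>B\<close>, since no set can meet both. This makes the
  outer measure a metric one, which is what Caratheodory's criterion needs.\<close>

lemma hausdorff1_outer_separated:
  assumes \<eta>: "0 < \<eta>" and sep: "\<And>x y. x \<in> A \<Longrightarrow> y \<in> B \<Longrightarrow> \<eta> \<le> dist x y"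
  shows "hausdorff1_outer A + hausdorff1_outer B \<le> hausdorff1_outer (A \<union> B)"
proof -
  have small: "hausdorff1_pre \<delta> A + hausdorff1_pre \<delta> B \<le> hausdorff1_pre \<delta> (A \<union> B)"
    if \<delta>: "0 < \<delta>" "\<delta> < \<eta>" for \<delta>
    unfolding hausdorff1_pre_def[of \<delta> "A \<union> B"]
  proof (rule INF_greatest, clarify)
    fix C assume cov: "A \<union> B \<subseteq> (\<Union>i::nat. C i)" and C: "\<forall>i. bounded (C i) \<and> diameter (C i) \<le> \<delta>"
    define CA where "CA i = (if C i \<inter> A = {} then {} else C i)" for i
    define CB where "CB i = (if C i \<inter> B = {} then {} else C i)" for i
    have "hausdorff1_pre \<delta> A \<le> (\<Sum>i. ennreal (diameter (CA i)))"
      by (rule hausdorff1_pre_le) (use C cov \<delta> in \<open>auto simp: CA_def\<close>, fastforce+)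
    moreover have "hausdorff1_pre \<delta> B \<le> (\<Sum>i. ennreal (diameter (CB i)))"
      by (rule hausdorff1_pre_le) (use C cov \<delta> in \<open>auto simp: CB_def\<close>, fastforce+)
    ultimately have "hausdorff1_pre \<delta> A + hausdorff1_pre \<delta> B
        \<le> (\<Sum>i. ennreal (diameter (CA i)) + ennreal (diameter (CB i)))"
      by (subst suminf_add[symmetric]) (auto intro: add_mono)
    also have "\<dots> \<le> (\<Sum>i. ennreal (diameter (C i)))"
    proof (intro suminf_le)
      fix i
      have "C i \<inter> A = {} \<or> C i \<inter> B = {}"
      proof (rule ccontr)
        assume "\<not> ?thesis"
        then obtain x y where xy: "x \<in> C i" "x \<in> A" "y \<in> C i" "y \<in> B" by blast
        then have "dist x y \<le> diameter (C i)" using C by (simp add: diameter_bounded_bound)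
        then show False using sep[OF xy(2,4)] C \<delta> by (meson not_le order_trans)
      qed
      then show "ennreal (diameter (CA i)) + ennreal (diameter (CB i)) \<le> ennreal (diameter (C i))"
        by (auto simp: CA_def CB_def)
    qed auto
    finally show "hausdorff1_pre \<delta> A + hausdorff1_pre \<delta> B \<le> (\<Sum>i. ennreal (diameter (C i)))" .
  qed
  \<comment> \<open>Independent meshes for \<open>A\<close> and \<open>B\<close> let the two suprema
    be taken one after the other; monotonicity in the mesh reduces both to a common small
    one.\<close>
  have "hausdorff1_pre \<delta> A + hausdorff1_pre \<delta>' B \<le> hausdorff1_outer (A \<union> B)"
    if "0 < \<delta>" "0 < \<delta>'" for \<delta> \<delta>'
  proof -
    define e where "e = min (min \<delta> \<delta>') (\<eta>/2)"
    have e: "0 < e" "e < \<eta>" "e \<le> \<delta>" "e \<le> \<delta>'" using that \<eta> by (auto simp: e_def)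
    have "hausdorff1_pre \<delta> A + hausdorff1_pre \<delta>' B \<le> hausdorff1_pre e A + hausdorff1_pre e B"
      using e by (intro add_mono hausdorff1_pre_antimono)
    also have "\<dots> \<le> hausdorff1_pre e (A \<union> B)" using small e by simp
    also have "\<dots> \<le> hausdorff1_outer (A \<union> B)" using e by (intro hausdorff1_pre_le_outer)
    finally show ?thesis .
  qed
  then have "hausdorff1_pre \<delta> A + hausdorff1_outer B \<le> hausdorff1_outer (A \<union> B)" if "0 < \<delta>" for \<delta>
    unfolding hausdorff1_outer_def[of B] ennreal_SUP_add_right[OF greaterThan_non_empty]
    by (rule SUP_least) (simp_all add: that)
  then show ?thesis
    unfolding hausdorff1_outer_def[of A] ennreal_SUP_add_left[OF greaterThan_non_empty, symmetric]
    by (intro SUP_least) simp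
qed

lemma hausdorff1_outer_finite_UN_separated:
  fixes R :: "nat \<Rightarrow> 'a::metric_space set"
  assumes sep: "\<And>i j. i < j \<Longrightarrow> j < n \<Longrightarrow> \<exists>\<eta>>0. \<forall>x\<in>R i. \<forall>y\<in>R j. \<eta> \<le> dist x y"
  shows "(\<Sum>i<n. hausdorff1_outer (R i)) \<le> hausdorff1_outer (\<Union>i<n. R i)"
  using assms
proof (induction n)
  case (Suc n)
  have "\<exists>\<eta>. \<forall>i<n. \<eta> i > 0 \<and> (\<forall>x\<in>R i. \<forall>y\<in>R n. \<eta> i \<le> dist x y)"
    using Suc.prems[of _ n] by (auto intro!: choice)
  then obtain \<eta> where \<eta>: "\<And>i. i < n \<Longrightarrow> \<eta> i > 0"
      "\<And>i x y. i < n \<Longrightarrow> x \<in> R i \<Longrightarrow> y \<in> R n \<Longrightarrow> \<eta> i \<le> dist x y" by blast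
  define e where "e = Min (insert 1 (\<eta> ` {..<n}))"
  have e: "e > 0" unfolding e_def using \<eta> by (subst Min_gr_iff) auto
  have e_le: "e \<le> \<eta> i" if "i < n" for i unfolding e_def using that by (intro Min_le) auto
  have "(\<Sum>i<Suc n. hausdorff1_outer (R i)) \<le> hausdorff1_outer (\<Union>i<n. R i) + hausdorff1_outer (R n)"
    using Suc by (simp add: add_right_mono)
  also have "\<dots> \<le> hausdorff1_outer ((\<Union>i<n. R i) \<union> R n)"
    by (rule hausdorff1_outer_separated[OF e]) (use \<eta> e_le order_trans in blast)
  also have "(\<Union>i<n. R i) \<union> R n = (\<Union>i<Suc n. R i)" by (auto simp: less_Suc_eq)
  finally show ?case .
qed simp

text \<open>Caratheodory's criterion. The part of \<open>A\<close> at distance at least 1/(n+1) from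
  \<open>F\<close> is separated from \<open>A \<inter> F\<close>, so additivity holds up to the rest
  of \<open>A - F\<close>, which is cut into shells \<open>R k\<close> by distance. The measures of
  the shells are summable, so the error tends to 0.\<close>

lemma closed_in_hausdorff1_lambda_system:
  fixes F :: "'a::metric_space set"
  assumes "closed F"
  shows "F \<in> lambda_system UNIV (Pow UNIV) hausdorff1_outer"
proof -
  interpret algebra UNIV "Pow (UNIV :: 'a set)" by (rule algebra_Pow)
  let ?H = "hausdorff1_outer :: 'a set \<Rightarrow> ennreal"
  have "?H (A \<inter> F) + ?H (A - F) \<le> ?H A" for A
  proof (cases "F = {} \<or> ?H A = top")
    case False
    then have F: "F \<noteq> {}" and fin: "?H A \<noteq> top" by auto
    define d where "d x = infdist x F" for x
    define Ak where "Ak k = {x\<in>A. 1 / Suc k \<le> d x}" for k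
    define R where "R k = {x\<in>A. 1 / Suc (Suc k) \<le> d x \<and> d x < 1 / Suc k}" for k
    have lip: "d x - d y \<le> dist x y" for x y unfolding d_def
      using infdist_triangle[of x F y] by simp
    \<comment> \<open>Adjacent shells may touch; shells whose indices differ by at least 2 have a
      positive gap because the distance to \<open>F\<close> is 1-Lipschitz. Summability is therefore
      proved separately for even and for odd indices.\<close>
    have sepR: "\<exists>\<eta>>0. \<forall>x\<in>R i. \<forall>y\<in>R j. \<eta> \<le> dist x y" if "Suc i < j" for i j
    proof (intro exI conjI ballI)
      show "0 < 1 / real (Suc (Suc i)) - 1 / real (Suc j)"
        using that by (simp add: frac_less2)
      fix x y assume "x \<in> R i" "y \<in> R j"
      then show "1 / real (Suc (Suc i)) - 1 / real (Suc j) \<le> dist x y"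
        using lip[of x y] by (auto simp: R_def)
    qed
    have sumH: "(\<Sum>i<n. ?H (R (2*i + c))) \<le> ?H A" for n c
    proof -
      have "(\<Sum>i<n. ?H (R (2*i + c))) \<le> ?H (\<Union>i<n. R (2*i + c))"
        by (rule hausdorff1_outer_finite_UN_separated) (rule sepR, simp)
      also have "\<dots> \<le> ?H A" by (rule hausdorff1_outer_mono) (auto simp: R_def)
      finally show ?thesis .
    qed
    have tot: "(\<Sum>i<2*n. ?H (R i)) \<le> 2 * ?H A" for n
    proof -
      have "(\<Sum>i<2*n. ?H (R i)) = (\<Sum>i<n. ?H (R (2*i + 0))) + (\<Sum>i<n. ?H (R (2*i + 1)))"
        by (induction n) (auto simp: algebra_simps)
      also have "\<dots> \<le> ?H A + ?H A" by (intro add_mono sumH)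
      finally show ?thesis by (simp add: mult_2)
    qed
    have "(\<Sum>i. ?H (R i)) \<le> 2 * ?H A"
    proof (rule suminf_le_const)
      fix n
      have "(\<Sum>i<n. ?H (R i)) \<le> (\<Sum>i<2*n. ?H (R i))" by (rule sum_mono2) auto
      then show "(\<Sum>i<n. ?H (R i)) \<le> 2 * ?H A" using tot[of n] by simp
    qed auto
    moreover have "2 * ?H A < top" using fin by (simp add: ennreal_mult_less_top less_top)
    ultimately have finR: "(\<Sum>i. ?H (R i)) < top" by simp
    have "?H (A \<inter> F) + ?H (A - F) \<le> ?H A + (\<Sum>i. ?H (R (i + n)))" for n
    proof -
      have "A - F \<subseteq> Ak n \<union> (\<Union>i. R (i + n))"
      proof
        fix x assume x: "x \<in> A - F"
        then have dx: "d x > 0" unfolding d_def using assms F in_closed_iff_infdist_zero[of F x]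
          infdist_nonneg[of x F] by (metis DiffD2 less_eq_real_def)
        define P where "P k \<longleftrightarrow> 1 / Suc k \<le> d x" for k
        obtain m where "1 / Suc m < d x" using dx by (metis nat_approx_posE)
        then have ex: "P m" by (simp add: P_def)
        \<comment> \<open>The least index \<open>l\<close> with 1/(l+1) \<le> \<open>d x\<close>
          places \<open>x\<close> in the shell with index l - 1, unless l \<le> n and
          \<open>x\<close> is already in \<open>Ak n\<close>.\<close>
        define l where "l = (LEAST k. P k)"
        have Pl: "P l" unfolding l_def using ex by (rule LeastI)
        show "x \<in> Ak n \<union> (\<Union>i. R (i + n))"
        proof (cases "l \<le> n")
          case True
          then have "1 / Suc n \<le> 1 / real (Suc l)" by (simp add: field_simps)
          then show ?thesis using Pl x by (auto simp: Ak_def P_def)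
        next
          case False
          then obtain k where k: "l = Suc k" "n \<le> k" by (cases l) auto
          then have "\<not> P k" unfolding l_def using not_less_Least[of k P] by (simp add: l_def)
          then have "x \<in> R ((k - n) + n)" using Pl k x by (auto simp: R_def P_def)
          then show ?thesis by blast
        qed
      qed
      then have "?H (A - F) \<le> ?H (Ak n) + ?H (\<Union>i. R (i + n))"
        using hausdorff1_outer_mono hausdorff1_outer_Un_le order_trans by meson
      also have "\<dots> \<le> ?H (Ak n) + (\<Sum>i. ?H (R (i + n)))"
        by (intro add_left_mono hausdorff1_outer_UN_le)
      finally have "?H (A \<inter> F) + ?H (A - F) \<le> (?H (A \<inter> F) + ?H (Ak n)) + (\<Sum>i. ?H (R (i + n)))"
        by (simp add: add.assoc add_left_mono)
      also have "?H (A \<inter> F) + ?H (Ak n) \<le> ?H ((A \<inter> F) \<union> Ak n)"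
      proof (rule hausdorff1_outer_separated[of "1 / Suc n"])
        fix x y assume "x \<in> A \<inter> F" "y \<in> Ak n"
        then show "1 / real (Suc n) \<le> dist x y"
          using infdist_le[of x F y] by (auto simp: Ak_def d_def dist_commute)
      qed simp
      also have "\<dots> \<le> ?H A" by (rule hausdorff1_outer_mono) (auto simp: Ak_def)
      finally show ?thesis by (simp add: add_right_mono)
    qed
    moreover have "(\<lambda>n. ?H A + (\<Sum>i. ?H (R (i + n)))) \<longlonglongrightarrow> ?H A + 0"
    proof (intro tendsto_add tendsto_const)
      define r where "r i = enn2real (?H (R i))" for i
      have fr: "?H (R i) = ennreal (r i)" for i
        using finR ennreal_suminf_lessD[OF finR] by (simp add: r_def)
      have sm: "summable r" using finR unfolding fr
        using summable_suminf_not_top[of r] by (auto simp: r_def less_top)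
      have "(\<Sum>i. ?H (R (i + n))) = ennreal (\<Sum>i. r (i + n))" for n
        unfolding fr by (intro suminf_ennreal2 summable_ignore_initial_segment[OF sm]) (simp add: r_def)
      moreover have "(\<lambda>n. ennreal (\<Sum>i. r (i + n))) \<longlonglongrightarrow> ennreal 0"
        using suminf_exist_split2[OF sm] by (intro tendsto_ennrealI)
      ultimately show "(\<lambda>n. \<Sum>i. ?H (R (i + n))) \<longlonglongrightarrow> 0" by simp
    qed
    ultimately show ?thesis by (intro LIMSEQ_le_const[of _ "?H A"]) auto
  qed auto
  moreover have "?H A \<le> ?H (A \<inter> F) + ?H (A - F)" for A
    using hausdorff1_outer_Un_le[of "A \<inter> F" "A - F"] by (simp add: Int_Diff_Un)
  ultimately show ?thesis unfolding lambda_system_eq by (simp add: antisym)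
qed

lemma sets_hausdorff1 [simp, measurable_cong]: "sets hausdorff1 = sets borel"
  unfolding hausdorff1_def by (simp add: sets.sigma_sets_eq[of borel, simplified])

lemma space_hausdorff1 [simp]: "space hausdorff1 = UNIV"
  unfolding hausdorff1_def by (simp add: space_measure_of_conv)

text \<open>The closed sets generate the Borel sets and lie in the sigma-algebra of
  Caratheodory-measurable sets, so the outer measure is countably additive on Borel sets; only then
  does \<open>measure_of\<close> return it rather than the zero measure.\<close>

lemma emeasure_hausdorff1:
  fixes A :: "'a::metric_space set"
  assumes "A \<in> sets borel"
  shows "emeasure hausdorff1 A = hausdorff1_outer A"
proof -
  let ?L = "lambda_system UNIV (Pow UNIV) (hausdorff1_outer :: 'a set \<Rightarrow> ennreal)"
  have ms: "measure_space UNIV ?L hausdorff1_outer"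
    by (rule sigma_algebra.caratheodory_lemma[OF sigma_algebra_Pow outer_measure_space_hausdorff1])
  then have sa: "sigma_algebra UNIV ?L" by (simp add: measure_space_def)
  have "sets (borel::'a measure) \<subseteq> ?L"
    unfolding borel_eq_closed sets_measure_of[OF subset_UNIV[of "Collect closed", folded Pow_UNIV]]
    by (rule sigma_algebra.sigma_sets_subset[OF sa]) (use closed_in_hausdorff1_lambda_system in blast)
  then have "countably_additive (sets borel) (hausdorff1_outer :: 'a set \<Rightarrow> ennreal)"
    using ms unfolding measure_space_def countably_additive_def by blast
  then show ?thesis
    unfolding hausdorff1_def
    by (intro emeasure_measure_of_sigma)
       (use assms sets.sigma_algebra_axioms[of "borel::'a measure"] in \<open>auto simp: positive_def\<close>)
qed

section \<open>Lipschitz images, and intervals of the line\<close>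

lemma diameter_bounded_le:
  assumes "0 \<le> c" "\<And>x y. x \<in> S \<Longrightarrow> y \<in> S \<Longrightarrow> dist x y \<le> c"
  shows "diameter S \<le> c"
  unfolding diameter_def using assms by (auto intro!: cSUP_least)

lemma hausdorff1_outer_lipschitz_image:
  fixes f :: "'a::metric_space \<Rightarrow> 'b::metric_space"
  assumes B: "B > 0" and lip: "\<And>x y. x \<in> A \<Longrightarrow> y \<in> A \<Longrightarrow> dist (f x) (f y) \<le> B * dist x y"
  shows "hausdorff1_outer (f ` A) \<le> ennreal B * hausdorff1_outer A"
  unfolding hausdorff1_outer_def[of "f ` A"]
proof (rule SUP_least)
  fix \<delta> :: real assume "\<delta> \<in> {0<..}"
  then have \<delta>: "0 < \<delta>" by simp
  \<comment> \<open>The factor is moved to the left by division so that the infimum over all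
    coverings of \<open>A\<close> can be taken on the right.\<close>
  have "hausdorff1_pre \<delta> (f ` A) / ennreal B \<le> hausdorff1_pre (\<delta> / B) A"
    unfolding hausdorff1_pre_def[of "\<delta> / B" A]
    proof (rule INF_greatest, clarify)
      fix C assume cov: "A \<subseteq> (\<Union>i::nat. C i)" and C: "\<forall>i. bounded (C i) \<and> diameter (C i) \<le> \<delta> / B"
      have im: "dist x y \<le> B * diameter (C i)" if "x \<in> f ` (C i \<inter> A)" "y \<in> f ` (C i \<inter> A)" for x y i
        using that lip C diameter_bounded_bound[of "C i"] B by (smt (verit, best) IntE imageE mult_left_mono)
      have d0: "0 \<le> diameter (C i)" for i using C diameter_ge_0 by blast
      have bd: "bounded (f ` (C i \<inter> A))" for i
        unfolding bounded_def using im by blast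
      have dm: "diameter (f ` (C i \<inter> A)) \<le> B * diameter (C i)" for i
        by (rule diameter_bounded_le) (use im d0 B in auto)
      have "hausdorff1_pre \<delta> (f ` A) \<le> (\<Sum>i. ennreal (diameter (f ` (C i \<inter> A))))"
      proof (rule hausdorff1_pre_le)
        show "f ` A \<subseteq> (\<Union>i. f ` (C i \<inter> A))" using cov by blast
        show "diameter (f ` (C i \<inter> A)) \<le> \<delta>" for i
          using dm[of i] C B by (smt (verit, best) mult.commute pos_le_divide_eq)
      qed (rule bd)
      also have "\<dots> \<le> (\<Sum>i. ennreal B * ennreal (diameter (C i)))"
        using dm B d0 by (intro suminf_le) (auto simp: ennreal_mult[symmetric] intro!: ennreal_leI)
      finally show "hausdorff1_pre \<delta> (f ` A) / ennreal B \<le> (\<Sum>i. ennreal (diameter (C i)))"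
        using B by (intro divide_le_posI_ennreal) auto
    qed
  then have "ennreal B * (hausdorff1_pre \<delta> (f ` A) / ennreal B) \<le> ennreal B * hausdorff1_pre (\<delta> / B) A"
    by (rule mult_left_mono) simp
  then have "hausdorff1_pre \<delta> (f ` A) \<le> ennreal B * hausdorff1_pre (\<delta> / B) A"
    using B by (simp add: ennreal_times_divide mult.commute[of "ennreal B"] ennreal_mult_divide_eq)
  also have "\<dots> \<le> ennreal B * hausdorff1_outer A"
    using \<delta> B by (intro mult_left_mono hausdorff1_pre_le_outer) auto
  finally show "hausdorff1_pre \<delta> (f ` A) \<le> ennreal B * hausdorff1_outer A" .
qed

text \<open>Each nonempty covering set lies in the closed interval from its infimum to its supremum,
  whose length is at most the diameter. Hence already coverings of mesh 1 have total diameter at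
  least the Lebesgue measure.\<close>

lemma emeasure_lborel_le_hausdorff1_outer:
  fixes A :: "real set"
  assumes "A \<in> sets borel"
  shows "emeasure lborel A \<le> hausdorff1_outer A"
proof -
  have "emeasure lborel A \<le> hausdorff1_pre 1 A"
    unfolding hausdorff1_pre_def
  proof (rule INF_greatest, clarify)
    fix C assume cov: "A \<subseteq> (\<Union>i::nat. C i)" and C: "\<forall>i. bounded (C i) \<and> diameter (C i) \<le> 1"
    define J where "J i = (if C i = {} then {} else {Inf (C i)..Sup (C i)})" for i
    have sub: "C i \<subseteq> J i" for i
      using C unfolding J_def by (auto intro!: cInf_lower cSup_upper bounded_imp_bdd_above bounded_imp_bdd_below)
    have len: "emeasure lborel (J i) \<le> ennreal (diameter (C i))" for i
    proof (cases "C i = {}")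
      case False
      have "Sup (C i) \<le> Inf (C i) + diameter (C i)"
      proof (rule cSup_least[OF False])
        fix x assume x: "x \<in> C i"
        have "x - diameter (C i) \<le> Inf (C i)"
        proof (rule cInf_greatest[OF False])
          fix y assume "y \<in> C i"
          then have "dist x y \<le> diameter (C i)" using C x by (simp add: diameter_bounded_bound)
          then show "x - diameter (C i) \<le> y" by (simp add: dist_real_def)
        qed
        then show "x \<le> Inf (C i) + diameter (C i)" by simp
      qed
      moreover have "Inf (C i) \<le> Sup (C i)"
        using C False by (intro cInf_le_cSup) (auto intro: bounded_imp_bdd_above bounded_imp_bdd_below)
      ultimately show ?thesis using False by (simp add: J_def ennreal_leI)
    qed (simp add: J_def)
    have "emeasure lborel A \<le> emeasure lborel (\<Union>i. J i)"
      by (rule emeasure_mono) (use cov sub in \<open>blast, simp add: J_def\<close>)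
    also have "\<dots> \<le> (\<Sum>i. emeasure lborel (J i))"
      by (rule emeasure_subadditive_countably) (auto simp: J_def)
    also have "\<dots> \<le> (\<Sum>i. ennreal (diameter (C i)))" by (intro suminf_le len) auto
    finally show "emeasure lborel A \<le> (\<Sum>i. ennreal (diameter (C i)))" .
  qed
  also have "\<dots> \<le> hausdorff1_outer A" by (rule hausdorff1_pre_le_outer) simp
  finally show ?thesis .
qed

lemma hausdorff1_outer_interval_le:
  fixes a b :: real
  assumes "a \<le> b"
  shows "hausdorff1_outer {a..b} \<le> ennreal (b - a)"
  unfolding hausdorff1_outer_def
proof (rule SUP_least)
  fix \<delta> :: real assume "\<delta> \<in> {0<..}"
  then have \<delta>: "0 < \<delta>" by simp
  obtain n :: nat where n: "(b - a) / \<delta> < real n" using reals_Archimedean2 by blast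
  then have n0: "n > 0" using assms \<delta> by (metis divide_nonneg_pos diff_ge_0_iff_ge gr0I less_le_not_le of_nat_0)
  \<comment> \<open>Cutting into \<open>n\<close> equal pieces of length \<open>h\<close> \<le>
    \<open>\<delta>\<close> gives total diameter at most \<open>b - a\<close>, whatever the
    mesh.\<close>
  define h where "h = (b - a) / n"
  have h: "0 \<le> h" "h \<le> \<delta>" "n * h = b - a"
    using n n0 \<delta> assms by (auto simp: h_def field_simps)
  define C where "C i = (if i < n then {a + real i * h .. a + (real i + 1) * h} else {})" for i :: nat
  have dC: "diameter (C i) \<le> (if i < n then h else 0)" for i
    unfolding C_def using h(1) by (auto intro!: diameter_le simp: algebra_simps abs_le_iff)
  have cov: "{a..b} \<subseteq> (\<Union>i. C i)"
  proof
    fix x assume x: "x \<in> {a..b}"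
    have "\<exists>i<n. a + real i * h \<le> x \<and> x \<le> a + (real i + 1) * h"
    proof -
      have *: "x \<le> a + real k * h \<Longrightarrow> k > 0 \<Longrightarrow> \<exists>i<k. a + real i * h \<le> x \<and> x \<le> a + (real i + 1) * h" for k :: nat
      proof (induction k)
        case (Suc k)
        show ?case
        proof (cases "x \<le> a + real k * h \<and> k > 0")
          case True then show ?thesis using Suc by (meson less_Suc_eq)
        next
          case False
          then have "a + real k * h \<le> x" using x by (cases "k = 0") auto
          then show ?thesis using Suc.prems by (intro exI[of _ k]) (simp add: algebra_simps)
        qed
      qed simp
      show ?thesis by (rule *) (use x h n0 in auto)
    qed
    then show "x \<in> (\<Union>i. C i)" by (auto simp: C_def)
  qed
  have "hausdorff1_pre \<delta> {a..b} \<le> (\<Sum>i. ennreal (diameter (C i)))"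
    by (rule hausdorff1_pre_le[OF cov]) (use dC h \<delta> in \<open>auto simp: C_def algebra_simps split: if_splits intro: order_trans\<close>)
  also have "\<dots> \<le> (\<Sum>i. ennreal (if i < n then h else 0))"
    by (intro suminf_le ennreal_leI dC) auto
  also have "\<dots> = (\<Sum>i<n. ennreal (if i < n then h else 0))"
    by (rule suminf_finite) auto
  also have "\<dots> = (\<Sum>i<n. ennreal h)" by simp
  also have "\<dots> = ennreal (n * h)" using h by (simp add: ennreal_of_nat_eq_real_of_nat flip: ennreal_mult)
  also have "\<dots> = ennreal (b - a)" using h by simp
  finally show "hausdorff1_pre \<delta> {a..b} \<le> ennreal (b - a)" .
qed

section \<open>Derivatives of smooth real functions, and coordinates of the plane\<close>

lemma has_real_derivative_frechet:
  fixes f :: "real \<Rightarrow> real"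
  assumes "f differentiable (at x)"
  shows "(f has_real_derivative frechet_derivative f (at x) 1) (at x)"
proof -
  have D: "(f has_derivative frechet_derivative f (at x)) (at x)"
    by (rule iffD1[OF frechet_derivative_works assms])
  have "frechet_derivative f (at x) h = frechet_derivative f (at x) 1 * h" for h
    using linear_cmul[OF has_derivative_linear[OF D], of h 1] by (simp add: mult.commute)
  then have "frechet_derivative f (at x) = (\<lambda>h. frechet_derivative f (at x) 1 * h)" by blast
  then show ?thesis using D unfolding has_field_derivative_def by metis
qed

lemma smooth_real_two_derivatives:
  fixes \<gamma> :: "real \<Rightarrow> real"
  assumes "smooth \<gamma>"
  obtains g1 g2 where "\<And>x. (\<gamma> has_real_derivative g1 x) (at x)"
    "\<And>x. (g1 has_real_derivative g2 x) (at x)" "continuous_on UNIV g1" "continuous_on UNIV g2"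
proof -
  define g1 where "g1 = (\<lambda>x. frechet_derivative \<gamma> (at x) 1)"
  define g2 where "g2 = (\<lambda>x. frechet_derivative g1 (at x) 1)"
  have "Ck (Suc (Suc (Suc 0))) \<gamma>" using assms unfolding smooth_def by blast
  then have *: "\<And>x. \<gamma> differentiable (at x)" "\<And>x. g1 differentiable (at x)" "\<And>x. g2 differentiable (at x)"
    by (simp_all add: g1_def g2_def)
  have c: "continuous_on UNIV g1" "continuous_on UNIV g2"
    using *(2,3) by (auto intro: differentiable_imp_continuous_on simp: differentiable_on_def)
  show ?thesis
  proof (rule that)
    show "(\<gamma> has_real_derivative g1 x) (at x)" for x
      unfolding g1_def by (rule has_real_derivative_frechet[OF *(1)])
    show "(g1 has_real_derivative g2 x) (at x)" for x
      unfolding g2_def by (rule has_real_derivative_frechet[OF *(2)])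
    show "continuous_on UNIV g1" "continuous_on UNIV g2" by (fact c)+
  qed
qed

text \<open>Transports Fubini's theorem from the product of two lines to
  \<open>real^2\<close>.\<close>

definition xy :: "real \<times> real \<Rightarrow> real^2" where
  "xy p = fst p *\<^sub>R axis 1 1 + snd p *\<^sub>R axis 2 1"

lemma xy_nth [simp]: "xy p $ 1 = fst p" "xy p $ 2 = snd p"
  by (simp_all add: xy_def axis_def)

lemma continuous_on_xy: "continuous_on A xy"
  unfolding xy_def by (intro continuous_intros)

lemma borel_measurable_xy [measurable]: "xy \<in> borel \<rightarrow>\<^sub>M borel"
  by (rule borel_measurable_continuous_onI[OF continuous_on_xy])

lemma distr_xy: "distr lborel borel xy = (lborel :: (real^2) measure)"
proof (rule lborel_eqI[symmetric])
  fix l u :: "real^2" assume le: "\<And>b. b \<in> Basis \<Longrightarrow> l \<bullet> b \<le> u \<bullet> b"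
  have le': "l $ i \<le> u $ i" for i using le[of "axis i 1"] by (simp add: inner_axis axis_in_Basis_iff)
  have "xy -` box l u = box (l$1, l$2) (u$1, u$2)"
  proof (intro set_eqI)
    fix p :: "real \<times> real"
    have "p \<in> box (l$1, l$2) (u$1, u$2) \<longleftrightarrow> (l$1 < fst p \<and> fst p < u$1) \<and> (l$2 < snd p \<and> snd p < u$2)"
      by (simp add: box_def Basis_prod_def ball_Un) (cases p, auto)
    then show "p \<in> xy -` box l u \<longleftrightarrow> p \<in> box (l$1, l$2) (u$1, u$2)"
      by (simp add: mem_box_cart forall_2)
  qed
  then have "emeasure (distr lborel borel xy) (box l u) = emeasure lborel (box (l$1, l$2) (u$1, u$2))"
    by (simp add: emeasure_distr)
  also have "\<dots> = ennreal ((u$1 - l$1) * (u$2 - l$2))"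
    using le' by (subst emeasure_lborel_box)
      (auto simp: Basis_prod_def prod.union_disjoint image_iff prod.reindex inj_on_def)
  also have "(u$1 - l$1) * (u$2 - l$2) = prod ((\<bullet>) (u - l)) Basis"
  proof -
    have "(\<Union>i::2. {axis i 1 :: real^2}) = {axis 1 1, axis 2 1}"
      unfolding UNIV_2 by blast
    then have B: "(Basis :: (real^2) set) = {axis 1 1, axis 2 1}" by (simp add: Basis_vec_def)
    have "axis 1 1 \<noteq> (axis 2 1 :: real^2)" by (simp add: axis_eq_axis)
    then show ?thesis unfolding B by (subst prod.insert) (auto simp: inner_axis)
  qed
  finally show "emeasure (distr lborel borel xy) (box l u) = ennreal (prod ((\<bullet>) (u - l)) Basis)" .
qed simp

lemma nn_integral_lborel_vec2:
  assumes [measurable]: "f \<in> borel_measurable (borel :: (real^2) measure)"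
  shows "(\<integral>\<^sup>+z. f z \<partial>lborel) = (\<integral>\<^sup>+x. \<integral>\<^sup>+y. f (xy (x, y)) \<partial>lborel \<partial>lborel)"
proof -
  have "(\<integral>\<^sup>+z. f z \<partial>lborel) = (\<integral>\<^sup>+p. f (xy p) \<partial>lborel)"
    by (subst distr_xy[symmetric], subst nn_integral_distr) auto
  also have "\<dots> = (\<integral>\<^sup>+p. f (xy p) \<partial>(lborel \<Otimes>\<^sub>M lborel))" by (simp add: lborel_prod)
  also have "\<dots> = (\<integral>\<^sup>+x. \<integral>\<^sup>+y. f (xy (x, y)) \<partial>lborel \<partial>lborel)"
  proof (rule lborel.nn_integral_fst[symmetric])
    have "(\<lambda>p. f (xy p)) \<in> borel_measurable borel" by measurable
    then show "(\<lambda>p. f (xy p)) \<in> borel_measurable (lborel \<Otimes>\<^sub>M lborel)" by (simp add: lborel_prod)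
  qed
  finally show ?thesis .
qed

section \<open>Arc length of a graph\<close>

text \<open>The orthogonal map in \<open>smooth_boundary\<close> is replaced by an orthonormal frame
  \<open>e\<close>, \<open>f\<close>, so that the boundary curve can be studied in place, without
  rotating the domain.\<close>

locale graph_curve =
  fixes e f :: "'a::euclidean_space" and \<gamma> g1 :: "real \<Rightarrow> real"
  assumes frame: "norm e = 1" "norm f = 1" "e \<bullet> f = 0"
    and deriv1: "\<And>x. (\<gamma> has_real_derivative g1 x) (at x)"
    and cont1: "continuous_on UNIV g1"
begin

definition c :: "real \<Rightarrow> 'a" where "c x = x *\<^sub>R e + \<gamma> x *\<^sub>R f"
definition q :: "real \<Rightarrow> real" where "q x = sqrt (1 + (g1 x)\<^sup>2)"

lemma frame': "e \<bullet> e = 1" "f \<bullet> f = 1" "f \<bullet> e = 0"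
  using frame by (simp_all add: norm_eq_1 inner_commute)

lemma c_inner [simp]: "c x \<bullet> e = x" "c x \<bullet> f = \<gamma> x"
  by (simp_all add: c_def inner_add_left frame' frame)

lemma q_pos: "0 < q x" and q_ge_1: "1 \<le> q x"
  by (simp_all add: q_def add_pos_nonneg)

lemma continuous_q: "continuous_on UNIV q"
  unfolding q_def by (intro continuous_intros cont1)

lemma continuous_c: "continuous_on UNIV c"
  unfolding c_def using deriv1
  by (intro continuous_intros) (auto intro!: DERIV_isCont continuous_at_imp_continuous_on)

lemma inj_c: "inj_on c A"
  by (metis c_inner(1) inj_onI)

lemma dist_c: "dist (c x) (c y) = sqrt ((x - y)\<^sup>2 + (\<gamma> x - \<gamma> y)\<^sup>2)"
proof -
  have "c x - c y = (x - y) *\<^sub>R e + (\<gamma> x - \<gamma> y) *\<^sub>R f" by (simp add: c_def algebra_simps)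
  then have "(norm (c x - c y))\<^sup>2 = (x - y)\<^sup>2 + (\<gamma> x - \<gamma> y)\<^sup>2"
    unfolding power2_norm_eq_inner
    by (simp add: inner_add_left inner_add_right frame frame' power2_eq_square)
  then show ?thesis by (metis dist_norm norm_ge_zero real_sqrt_unique)
qed

text \<open>The mean value theorem for \<open>\<gamma>\<close> turns the chord into the increment of
  the parameter times the speed \<open>q\<close> at an intermediate point; two-sided bounds on
  \<open>q\<close> thus make the parametrisation bi-Lipschitz.\<close>

lemma dist_c_mvt:
  obtains z where "z \<in> closed_segment x y" "dist (c x) (c y) = \<bar>x - y\<bar> * q z"
proof -
  have *: "\<exists>z\<in>{x..y}. dist (c x) (c y) = \<bar>x - y\<bar> * q z" if "x < y" for x y
  proof -
    have "\<exists>z>x. z < y \<and> \<gamma> y - \<gamma> x = (y - x) * g1 z"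
      using deriv1 by (intro MVT2[OF that]) blast
    then obtain z where z: "x < z" "z < y" "\<gamma> y - \<gamma> x = (y - x) * g1 z" by blast
    then have *: "\<gamma> x - \<gamma> y = (x - y) * g1 z" by (simp add: algebra_simps)
    have "(x - y)\<^sup>2 + (\<gamma> x - \<gamma> y)\<^sup>2 = (x - y)\<^sup>2 * (1 + (g1 z)\<^sup>2)"
      unfolding * power_mult_distrib by (simp add: distrib_left)
    then have "dist (c x) (c y) = \<bar>x - y\<bar> * q z" by (simp add: dist_c q_def real_sqrt_mult)
    then show ?thesis using z by (intro bexI[of _ z]) auto
  qed
  consider "x < y" | "x = y" | "y < x" by linarith
  then show ?thesis
  proof cases
    case 1 then show ?thesis using *[of x y] that by (auto simp: closed_segment_eq_real_ivl)
  next
    case 2 then show ?thesis using that[of x] by simp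
  next
    case 3 then show ?thesis using *[of y x] that
      by (auto simp: closed_segment_eq_real_ivl dist_commute abs_minus_commute)
  qed
qed

text \<open>The parametrisation is Lipschitz with constant \<open>M\<close>, and its inverse, the
  projection onto \<open>e\<close>, is Lipschitz with constant 1/m; both bounds then reduce to the
  length of an interval.\<close>

lemma hausdorff1_arc_bounds:
  assumes ab: "a \<le> b" and m: "0 < m" "\<And>x. a \<le> x \<Longrightarrow> x \<le> b \<Longrightarrow> m \<le> q x"
    and M: "\<And>x. a \<le> x \<Longrightarrow> x \<le> b \<Longrightarrow> q x \<le> M"
  shows "ennreal (m * (b - a)) \<le> hausdorff1_outer (c ` {a..b})"
    and "hausdorff1_outer (c ` {a..b}) \<le> ennreal (M * (b - a))"
proof -
  have M0: "0 < M" using m M ab by (smt (verit))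
  have bd: "m * dist x y \<le> dist (c x) (c y) \<and> dist (c x) (c y) \<le> M * dist x y"
    if "x \<in> {a..b}" "y \<in> {a..b}" for x y
  proof -
    obtain z where z: "z \<in> closed_segment x y" "dist (c x) (c y) = \<bar>x - y\<bar> * q z"
      by (rule dist_c_mvt)
    then have "a \<le> z" "z \<le> b" using that by (auto simp: closed_segment_eq_real_ivl split: if_splits)
    then show ?thesis unfolding z(2) dist_real_def using m M
      by (auto simp: mult.commute[of "\<bar>x - y\<bar>"] intro: mult_right_mono)
  qed
  have "hausdorff1_outer (c ` {a..b}) \<le> ennreal M * hausdorff1_outer {a..b}"
    by (rule hausdorff1_outer_lipschitz_image[OF M0]) (use bd in auto)
  also have "\<dots> \<le> ennreal M * ennreal (b - a)"
    by (intro mult_left_mono hausdorff1_outer_interval_le ab) auto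
  finally show "hausdorff1_outer (c ` {a..b}) \<le> ennreal (M * (b - a))"
    using M0 ab by (simp add: ennreal_mult)
  have im: "(\<lambda>y. y \<bullet> e) ` (c ` {a..b}) = {a..b}" by (auto simp: image_image)
  have "ennreal (b - a) \<le> hausdorff1_outer {a..b}"
    using emeasure_lborel_le_hausdorff1_outer[of "{a..b}"] ab by simp
  also have "\<dots> = hausdorff1_outer ((\<lambda>y. y \<bullet> e) ` (c ` {a..b}))" by (simp only: im)
  also have "\<dots> \<le> ennreal (1/m) * hausdorff1_outer (c ` {a..b})"
  proof (rule hausdorff1_outer_lipschitz_image)
    fix u v assume "u \<in> c ` {a..b}" "v \<in> c ` {a..b}"
    then obtain x y where xy: "u = c x" "v = c y" "x \<in> {a..b}" "y \<in> {a..b}" by blast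
    show "dist (u \<bullet> e) (v \<bullet> e) \<le> 1 / m * dist u v"
      using bd[OF xy(3,4)] m(1) xy(1,2) by (simp add: field_simps)
  qed (use m in simp)
  finally have "ennreal m * ennreal (b - a) \<le> ennreal m * (ennreal (1/m) * hausdorff1_outer (c ` {a..b}))"
    by (rule mult_left_mono) simp
  also have "\<dots> = ennreal (m * (1/m)) * hausdorff1_outer (c ` {a..b})"
    using m(1) by (simp only: ennreal_mult mult.assoc[symmetric] less_imp_le divide_nonneg_nonneg zero_le_one)
  also have "\<dots> = hausdorff1_outer (c ` {a..b})" using m(1) by simp
  finally show "ennreal (m * (b - a)) \<le> hausdorff1_outer (c ` {a..b})"
    using m(1) ab by (simp add: ennreal_mult)
qed

lemma compact_arc: "compact (c ` {a..b})"
  by (intro compact_continuous_image continuous_on_subset[OF continuous_c]) auto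

lemma arc_borel [measurable]: "c ` {a..b} \<in> sets borel"
  using compact_arc by (intro borel_closed compact_imp_closed)

lemma q_bounds_exist:
  obtains m M where "0 < m" "\<And>x. a \<le> x \<Longrightarrow> x \<le> b \<Longrightarrow> m \<le> q x" "\<And>x. a \<le> x \<Longrightarrow> x \<le> b \<Longrightarrow> q x \<le> M"
proof -
  have "bounded (q ` {a..b})"
    by (intro compact_imp_bounded compact_continuous_image continuous_on_subset[OF continuous_q]) auto
  then obtain M where "\<forall>x\<in>{a..b}. norm (q x) \<le> M" by (auto simp: bounded_iff)
  then have "q x \<le> M" if "a \<le> x" "x \<le> b" for x using that by (auto simp: abs_le_iff)
  then show ?thesis by (intro that[of 1 M] q_ge_1) simp_all
qed

lemma hausdorff1_arc_finite: "emeasure hausdorff1 (c ` {a..b}) < \<infinity>"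
proof (cases "a \<le> b")
  case True
  obtain m M where "0 < m" "\<And>x. a \<le> x \<Longrightarrow> x \<le> b \<Longrightarrow> m \<le> q x" "\<And>x. a \<le> x \<Longrightarrow> x \<le> b \<Longrightarrow> q x \<le> M"
    using q_bounds_exist[of a b] by metis
  from hausdorff1_arc_bounds(2)[OF True this] show ?thesis
    by (simp add: emeasure_hausdorff1 order_le_less_trans[OF _ ennreal_less_top])
qed simp

lemma hausdorff1_arc_add:
  assumes "a \<le> b" "b \<le> d"
  shows "emeasure hausdorff1 (c ` {a..d}) = emeasure hausdorff1 (c ` {a..b}) + emeasure hausdorff1 (c ` {b..d})"
proof -
  have pt: "emeasure hausdorff1 (c ` {b..b}) = 0"
    using hausdorff1_arc_bounds(2)[of b b "q b" "q b"] q_pos by (simp add: emeasure_hausdorff1)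
  have "emeasure hausdorff1 (c ` {b..d}) = emeasure hausdorff1 (c ` {b..b} \<union> (c ` {b..d} - c ` {b..b}))"
    using assms by (intro arg_cong[where f="emeasure hausdorff1"]) auto
  also have "\<dots> = emeasure hausdorff1 (c ` {b..b}) + emeasure hausdorff1 (c ` {b..d} - c ` {b..b})"
    by (intro plus_emeasure[symmetric]) auto
  finally have 1: "emeasure hausdorff1 (c ` {b..d}) = emeasure hausdorff1 (c ` {b..d} - c ` {b..b})"
    using pt by simp
  have "{a..d} = {a..b} \<union> ({b..d} - {b..b})" using assms by auto
  then have "c ` {a..d} = c ` {a..b} \<union> (c ` {b..d} - c ` {b..b})"
    by (simp only: image_Un image_set_diff[OF inj_c[of UNIV]])
  then have "emeasure hausdorff1 (c ` {a..d}) = emeasure hausdorff1 (c ` {a..b} \<union> (c ` {b..d} - c ` {b..b}))"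
    by simp
  also have "\<dots> = emeasure hausdorff1 (c ` {a..b}) + emeasure hausdorff1 (c ` {b..d} - c ` {b..b})"
  proof (rule plus_emeasure[symmetric])
    show "c ` {a..b} \<inter> (c ` {b..d} - c ` {b..b}) = {}"
    proof (rule equals0I)
      fix z assume z: "z \<in> c ` {a..b} \<inter> (c ` {b..d} - c ` {b..b})"
      then obtain u v where uv: "u \<in> {a..b}" "v \<in> {b..d}" "z = c u" "z = c v" by blast
      then have "u = v" using c_inner(1) by metis
      then have "z = c b" using uv by auto
      then show False using z by auto
    qed
  qed auto
  finally show ?thesis using 1 by simp
qed

text \<open>On a short arc the speed is almost constant, so the two-sided bounds squeeze the
  difference quotient of the arc length function; its derivative is \<open>q\<close>, and the
  fundamental theorem of calculus gives the integral.\<close>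

lemma hausdorff1_arc:
  assumes "a \<le> b"
  shows "emeasure hausdorff1 (c ` {a..b}) = (\<integral>\<^sup>+x. ennreal (q x) * indicator {a..b} x \<partial>lborel)"
proof -
  \<comment> \<open>Signed arc length measured from \<open>a\<close>; the negative branch makes the
    increment formula, and so two-sided differentiability, hold at every point including
    \<open>a\<close>.\<close>
  define F where "F x = (if a \<le> x then measure hausdorff1 (c ` {a..x}) else - measure hausdorff1 (c ` {x..a}))" for x
  have inc: "F y - F x = measure hausdorff1 (c ` {x..y})" if "x \<le> y" for x y
  proof -
    have add: "measure hausdorff1 (c ` {u..w}) = measure hausdorff1 (c ` {u..v}) + measure hausdorff1 (c ` {v..w})"
      if "u \<le> v" "v \<le> w" for u v w
      using hausdorff1_arc_add[OF that] hausdorff1_arc_finite unfolding measure_def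
      by (simp add: enn2real_plus)
    show ?thesis using that add[of a x y] add[of x a y] add[of x y a] by (auto simp: F_def)
  qed
  have bnd: "m * (y - x) \<le> F y - F x" "F y - F x \<le> M * (y - x)"
    if "x \<le> y" "0 < m" "\<And>z. x \<le> z \<Longrightarrow> z \<le> y \<Longrightarrow> m \<le> q z \<and> q z \<le> M" for x y m M
  proof -
    have eq: "hausdorff1_outer (c ` {x..y}) = ennreal (F y - F x)"
      unfolding inc[OF that(1)] emeasure_hausdorff1[OF arc_borel, symmetric]
      using hausdorff1_arc_finite by (simp add: emeasure_eq_ennreal_measure less_top)
    have M0: "0 \<le> M" using that by (smt (verit))
    have "0 \<le> F y - F x" using inc[OF that(1)] by simp
    then show "m * (y - x) \<le> F y - F x" "F y - F x \<le> M * (y - x)"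
      using hausdorff1_arc_bounds[of x y m M] that M0 unfolding eq by (auto simp: ennreal_le_iff)
  qed
  have der: "(F has_real_derivative q x) (at x)" for x
    unfolding has_field_derivative_iff tendsto_iff
  proof (intro allI impI)
    fix r :: real assume r: "0 < r"
    \<comment> \<open>Since \<open>q\<close> \<ge> 1, an error of at most 1/2 keeps the lower speed
      bound \<open>q x - r'\<close> positive, as \<open>bnd\<close> requires.\<close>
    define r' where "r' = min (r/2) (1/2)"
    have r': "0 < r'" "r' < r" "r' < 1" using r by (auto simp: r'_def)
    obtain d where d: "d > 0" "\<And>z. \<bar>z - x\<bar> < d \<Longrightarrow> \<bar>q z - q x\<bar> < r'"
      using continuous_q r' unfolding continuous_on_iff dist_real_def by (metis UNIV_I)
    have m0: "0 < q x - r'" using q_ge_1[of x] r' by simp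
    show "\<forall>\<^sub>F y in at x. dist ((F y - F x) / (y - x)) (q x) < r"
      unfolding eventually_at
    proof (intro exI[of _ d] conjI ballI impI)
      fix y assume y: "y \<noteq> x \<and> dist y x < d"
      have near: "q x - r' \<le> q z \<and> q z \<le> q x + r'"
        if "u \<le> z" "z \<le> v" "u = x \<and> v = y \<or> u = y \<and> v = x" for u v z
      proof -
        have "\<bar>z - x\<bar> < d" using that y by (auto simp: dist_real_def)
        then show ?thesis using d(2)[of z] by (simp add: abs_less_iff)
      qed
      have "\<bar>(F y - F x) / (y - x) - q x\<bar> \<le> r'"
      proof (cases "x \<le> y")
        case True
        then have "(q x - r') * (y - x) \<le> F y - F x" "F y - F x \<le> (q x + r') * (y - x)"
          using bnd[OF True m0, of "q x + r'", OF near] by simp_all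
        then show ?thesis using True y by (simp add: abs_le_iff field_simps)
      next
        case False
        then have *: "y \<le> x" by simp
        have "(q x - r') * (x - y) \<le> F x - F y" "F x - F y \<le> (q x + r') * (x - y)"
          using bnd[OF * m0, of "q x + r'", OF near] by simp_all
        then show ?thesis using False y by (simp add: abs_le_iff field_simps)
      qed
      then show "dist ((F y - F x) / (y - x)) (q x) < r" using r' by (simp add: dist_real_def)
    qed (use d in simp)
  qed
  have "(\<integral>\<^sup>+x. ennreal (q x) * indicator {a..b} x \<partial>lborel) = ennreal (F b - F a)"
    by (rule nn_integral_FTC_Icc)
       (use assms der borel_measurable_continuous_onI[OF continuous_q] q_pos in \<open>auto intro: less_imp_le DERIV_subset\<close>)
  also have "F b - F a = measure hausdorff1 (c ` {a..b})" by (rule inc[OF assms])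
  finally show ?thesis using hausdorff1_arc_finite by (simp add: emeasure_eq_ennreal_measure less_top)
qed

text \<open>Both sides are measures in \<open>E\<close>: the projection of the arc measure and the
  measure with density \<open>q\<close>. They are finite and equal on the half-lines
  \<open>{x<..}\<close>, which correspond to subarcs, so they agree on all Borel sets.\<close>

lemma hausdorff1_arc_borel:
  assumes "a \<le> b" and [measurable]: "E \<in> sets borel"
  shows "emeasure hausdorff1 {y \<in> c ` {a..b}. y \<bullet> e \<in> E}
       = (\<integral>\<^sup>+x. ennreal (q x) * indicator {a..b} x * indicator E x \<partial>lborel)"
proof -
  let ?A = "c ` {a..b}"
  have [measurable]: "q \<in> borel_measurable borel" by (rule borel_measurable_continuous_onI[OF continuous_q])
  let ?M = "distr (restrict_space hausdorff1 ?A) borel (\<lambda>y. y \<bullet> e)"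
  let ?N = "density lborel (\<lambda>x. ennreal (q x) * indicator {a..b} x)"
  have msr: "(\<lambda>y. y \<bullet> e) \<in> restrict_space hausdorff1 ?A \<rightarrow>\<^sub>M borel"
    by (rule measurable_restrict_space1) simp
  have M: "emeasure ?M X = emeasure hausdorff1 {y \<in> ?A. y \<bullet> e \<in> X}" if [measurable]: "X \<in> sets borel" for X
  proof -
    have eq: "(\<lambda>y. y \<bullet> e) -` X \<inter> space (restrict_space hausdorff1 ?A) = {y \<in> ?A. y \<bullet> e \<in> X}"
      by (auto simp: space_restrict_space)
    show ?thesis
      by (subst emeasure_distr[OF msr that], subst eq, subst emeasure_restrict_space) auto
  qed
  have N: "emeasure ?N X = (\<integral>\<^sup>+x. ennreal (q x) * indicator {a..b} x * indicator X x \<partial>lborel)"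
    if [measurable]: "X \<in> sets borel" for X
    by (subst emeasure_density) auto
  have "?M = ?N"
  proof (rule measure_eqI_lessThan)
    fix x :: real
    show "emeasure ?M {x<..} < \<infinity>"
      using M[of "{x<..}"] emeasure_mono[of "{y \<in> ?A. x < y \<bullet> e}" ?A hausdorff1] hausdorff1_arc_finite[of a b]
      by (auto simp: order_le_less_trans)
    have eq: "emeasure hausdorff1 {y \<in> ?A. y \<bullet> e \<in> {x<..}} =
      (\<integral>\<^sup>+z. ennreal (q z) * indicator {a..b} z * indicator {x<..} z \<partial>lborel)"
    proof -
      consider "x < a" | "b \<le> x" | "a \<le> x" "x < b" by linarith
      then show ?thesis
      proof cases
        case 1
        then have "{y \<in> ?A. y \<bullet> e \<in> {x<..}} = ?A" by auto
        moreover have "(\<integral>\<^sup>+z. ennreal (q z) * indicator {a..b} z * indicator {x<..} z \<partial>lborel)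
            = (\<integral>\<^sup>+z. ennreal (q z) * indicator {a..b} z \<partial>lborel)"
          using 1 by (intro nn_integral_cong) (auto simp: indicator_def)
        ultimately show ?thesis using hausdorff1_arc[OF assms(1)] by simp
      next
        case 2
        then have "{y \<in> ?A. y \<bullet> e \<in> {x<..}} = {}" by auto
        moreover have "(\<integral>\<^sup>+z. ennreal (q z) * indicator {a..b} z * indicator {x<..} z \<partial>lborel) = (\<integral>\<^sup>+(z::real). 0 \<partial>lborel)"
          using 2 by (intro nn_integral_cong) (auto simp: indicator_def)
        ultimately show ?thesis by (simp only: emeasure_empty nn_integral_const mult_zero_left)
      next
        case 3
        \<comment> \<open>The half-open subarc is a closed one minus its endpoint, which has measure
          zero by the upper bound on a degenerate arc.\<close>
        have "{y \<in> ?A. y \<bullet> e \<in> {x<..}} = c ` {x..b} - c ` {x..x}" using 3 by (auto simp: order_less_le)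
        also have "emeasure hausdorff1 \<dots> = emeasure hausdorff1 (c ` {x..b}) - emeasure hausdorff1 (c ` {x..x})"
          using 3 hausdorff1_arc_finite[of x x] by (intro emeasure_Diff) auto
        also have "\<dots> = emeasure hausdorff1 (c ` {x..b})"
          using hausdorff1_arc_bounds(2)[of x x "q x" "q x"] q_pos emeasure_hausdorff1[OF arc_borel[of x x]] by simp
        also have "\<dots> = (\<integral>\<^sup>+z. ennreal (q z) * indicator {x..b} z \<partial>lborel)" using 3 by (intro hausdorff1_arc) auto
        also have "\<dots> = (\<integral>\<^sup>+z. ennreal (q z) * indicator {a..b} z * indicator {x<..} z \<partial>lborel)"
        proof (rule nn_integral_cong_AE)
          have "AE z in lborel. z \<noteq> x" by (rule AE_lborel_singleton)
          then show "AE z in lborel. ennreal (q z) * indicator {x..b} z = ennreal (q z) * indicator {a..b} z * indicator {x<..} z"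
            by eventually_elim (use 3 in \<open>auto simp: indicator_def\<close>)
        qed
        finally show ?thesis .
      qed
    qed
    show "emeasure ?M {x<..} = emeasure ?N {x<..}" using M[of "{x<..}"] N[of "{x<..}"] eq by simp
  qed auto
  then show ?thesis using M[OF assms(2)] N[OF assms(2)] by simp
qed

end

section \<open>Convex arcs\<close>

lemma det_frame:
  fixes e f :: "real^2"
  assumes "norm e = 1" "norm f = 1" "e \<bullet> f = 0"
  shows "\<bar>e$1 * f$2 - e$2 * f$1\<bar> = 1"
proof -
  have *: "e$1*e$1 + e$2*e$2 = 1" "f$1*f$1 + f$2*f$2 = 1" "e$1*f$1 + e$2*f$2 = 0"
    using assms by (simp_all add: norm_eq_1 inner_vec_def sum_2)
  then have "(e$1 * f$2 - e$2 * f$1)^2 = 1" by algebra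
  then show ?thesis by (metis abs_1 abs_square_eq_1)
qed

lemma frame_expansion:
  fixes e f v :: "real^2"
  assumes "norm e = 1" "norm f = 1" "e \<bullet> f = 0"
  shows "v = (v \<bullet> e) *\<^sub>R e + (v \<bullet> f) *\<^sub>R f"
proof -
  have *: "e$1*e$1 + e$2*e$2 = 1" "f$1*f$1 + f$2*f$2 = 1" "e$1*f$1 + e$2*f$2 = 0"
    using assms by (simp_all add: norm_eq_1 inner_vec_def sum_2)
  have "v$1 = (v$1*e$1 + v$2*e$2)*e$1 + (v$1*f$1 + v$2*f$2)*f$1" using * by algebra
  moreover have "v$2 = (v$1*e$1 + v$2*e$2)*e$2 + (v$1*f$1 + v$2*f$2)*f$2" using * by algebra
  ultimately show ?thesis by (simp add: vec_eq_iff forall_2 inner_vec_def sum_2)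
qed

lemma infdist_closest_point:
  assumes "closed K" "K \<noteq> {}"
  shows "infdist y K = dist y (closest_point K y)"
  using setdist_closest_point[OF assms, of y] assms by (simp add: infdist_eq_setdist)

lemma closest_point_fibre_borel:
  fixes K :: "'a::euclidean_space set"
  assumes "closed K" "convex K" "K \<noteq> {}" "S \<in> sets borel"
  shows "{y. y \<notin> K \<and> infdist y K < t \<and> closest_point K y \<in> S} \<in> sets borel"
proof -
  have "closest_point K \<in> borel_measurable borel"
    using assms by (intro borel_measurable_continuous_onI continuous_on_closest_point)
  then have "closest_point K -` S \<in> sets borel" using measurable_sets[of _ borel borel S] assms by simp
  moreover have "open {y. infdist y K < t}" by (intro open_Collect_less continuous_intros)
  ultimately have "- K \<inter> {y. infdist y K < t} \<inter> closest_point K -` S \<in> sets borel"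
    using assms by (intro sets.Int) auto
  also have "- K \<inter> {y. infdist y K < t} \<inter> closest_point K -` S
      = {y. y \<notin> K \<and> infdist y K < t \<and> closest_point K y \<in> S}" by auto
  finally show ?thesis .
qed

lemma nn_integral_affine:
  fixes a b t :: real
  assumes "0 \<le> a" "0 \<le> b" "0 < t"
  shows "(\<integral>\<^sup>+y. ennreal (a + y * b) * indicator {0<..<t} y \<partial>lborel) = ennreal (t * a + t\<^sup>2 * (b / 2))"
proof -
  have "(\<integral>\<^sup>+y. ennreal (a + y * b) * indicator {0<..<t} y \<partial>lborel)
      = (\<integral>\<^sup>+y. ennreal (a + y * b) * indicator {0..t} y \<partial>lborel)"
  proof (rule nn_integral_cong_AE)
    have "AE y in lborel. y \<noteq> 0" "AE y in lborel. y \<noteq> t" by (rule AE_lborel_singleton)+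
    then show "AE y in lborel. ennreal (a + y * b) * indicator {0<..<t} y = ennreal (a + y * b) * indicator {0..t} y"
      by eventually_elim (auto simp: indicator_def)
  qed
  also have "\<dots> = ennreal ((t * a + t\<^sup>2 * (b / 2)) - (0 * a + 0\<^sup>2 * (b / 2)))"
  proof (rule nn_integral_FTC_Icc)
    fix y :: real assume "y \<in> {0..t}"
    show "((\<lambda>y. y * a + y\<^sup>2 * (b / 2)) has_real_derivative a + y * b) (at y)"
      by (auto intro!: derivative_eq_intros)
  qed (use assms in auto)
  finally show ?thesis by simp
qed

text \<open>An open boundary arc of a convex domain, written as a graph in the frame
  \<open>e\<close>, \<open>f\<close>. The assumption \<open>above\<close> records on which side of
  the graph the domain lies and so fixes the sign of the outer normal.\<close>

locale convex_arc = graph_curve e f \<gamma> g1 for e f :: "real^2" and \<gamma> g1 +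
  fixes g2 :: "real \<Rightarrow> real" and \<Omega> :: "(real^2) set" and lo hi :: real
  assumes deriv2: "\<And>x. (g1 has_real_derivative g2 x) (at x)"
    and cont2: "continuous_on UNIV g2"
    and dom: "open \<Omega>" "convex \<Omega>" "\<Omega> \<noteq> {}"
    and on_frontier: "\<And>x. lo < x \<Longrightarrow> x < hi \<Longrightarrow> c x \<in> frontier \<Omega>"
    and above: "\<And>x. lo < x \<Longrightarrow> x < hi \<Longrightarrow> \<exists>\<epsilon>>0. c x + \<epsilon> *\<^sub>R f \<in> closure \<Omega>"
begin

abbreviation K where "K \<equiv> closure \<Omega>"

definition n :: "real \<Rightarrow> real^2" where "n x = (1 / q x) *\<^sub>R (g1 x *\<^sub>R e - f)"

lemma q_square: "(q x)\<^sup>2 = 1 + (g1 x)\<^sup>2"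
  by (simp add: q_def add_nonneg_nonneg)

lemma norm_n: "norm (n x) = 1"
proof -
  have "(norm (g1 x *\<^sub>R e - f))\<^sup>2 = (q x)\<^sup>2"
    unfolding power2_norm_eq_inner q_square
    by (simp add: inner_diff_left inner_diff_right frame frame' power2_eq_square)
  then have "norm (g1 x *\<^sub>R e - f) = q x" using q_pos[of x] by (simp add: power2_eq_iff_nonneg)
  then show ?thesis using q_pos[of x] by (simp add: n_def)
qed

lemma K: "closed K" "convex K" "K \<noteq> {}"
  using dom by (auto simp: convex_closure)

lemma arc_in_K: "lo < x \<Longrightarrow> x < hi \<Longrightarrow> c x \<in> K"
  using on_frontier by (auto simp: frontier_def)

text \<open>A vector that supports the closure at \<open>c x\<close> has a maximum along the
  boundary curve there, so it is orthogonal to the tangent; the point of the closure above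
  \<open>c x\<close> settles its sign. The normal cone at a smooth boundary point is thus a single
  ray.\<close>

lemma normal_unique:
  assumes x: "lo < x" "x < hi" and v: "\<And>y. y \<in> K \<Longrightarrow> v \<bullet> (y - c x) \<le> 0"
  shows "v = norm v *\<^sub>R n x"
proof -
  let ?\<phi> = "\<lambda>z. (v \<bullet> e) * z + (v \<bullet> f) * \<gamma> z"
  have \<phi>: "v \<bullet> (c z - c x) = ?\<phi> z - ?\<phi> x" for z
    by (simp add: c_def inner_diff_right inner_add_right algebra_simps)
  have "(?\<phi> has_real_derivative (v \<bullet> e) + (v \<bullet> f) * g1 x) (at x)"
    by (auto intro!: derivative_eq_intros deriv1)
  then have "(v \<bullet> e) + (v \<bullet> f) * g1 x = 0"
  proof (rule DERIV_local_max)
    show "0 < min (x - lo) (hi - x)" using x by simp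
    show "\<forall>y. \<bar>x - y\<bar> < min (x - lo) (hi - x) \<longrightarrow> ?\<phi> y \<le> ?\<phi> x"
    proof (intro allI impI)
      fix y assume "\<bar>x - y\<bar> < min (x - lo) (hi - x)"
      then have "c y \<in> K" by (intro arc_in_K) (auto simp: abs_less_iff)
      from v[OF this] show "?\<phi> y \<le> ?\<phi> x" unfolding \<phi> by simp
    qed
  qed
  then have ve: "v \<bullet> e = - (v \<bullet> f) * g1 x" by simp
  obtain \<epsilon> where \<epsilon>: "\<epsilon> > 0" "c x + \<epsilon> *\<^sub>R f \<in> K" using above[OF x] by blast
  have "\<epsilon> * (v \<bullet> f) \<le> 0" using v[OF \<epsilon>(2)] by simp
  then have vf: "v \<bullet> f \<le> 0" using \<epsilon>(1) by (simp add: mult_le_0_iff)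
  have "v = (v \<bullet> e) *\<^sub>R e + (v \<bullet> f) *\<^sub>R f" by (rule frame_expansion) (fact frame)+
  also have "\<dots> = (- (v \<bullet> f)) *\<^sub>R (g1 x *\<^sub>R e - f)" unfolding ve by (simp add: algebra_simps)
  also have "\<dots> = (- (v \<bullet> f) * q x) *\<^sub>R n x" using q_pos[of x] by (simp add: n_def)
  finally have eq: "v = (- (v \<bullet> f) * q x) *\<^sub>R n x" .
  have "0 \<le> - (v \<bullet> f) * q x" using vf q_pos[of x] by (intro mult_nonneg_nonneg) auto
  then have "norm v = - (v \<bullet> f) * q x" by (subst eq) (simp add: norm_n)
  then show ?thesis using eq by simp
qed

text \<open>Convexity supplies some supporting hyperplane at \<open>c x\<close>; by uniqueness of
  the normal direction it is the one orthogonal to \<open>n x\<close>.\<close>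

lemma n_halfspace:
  assumes x: "lo < x" "x < hi" and y: "y \<in> K"
  shows "n x \<bullet> (y - c x) \<le> 0"
proof -
  have "c x \<notin> rel_interior \<Omega>" using on_frontier[OF x] dom(1)
    by (simp add: rel_interior_open frontier_def interior_open)
  then obtain a where a: "a \<noteq> 0" "\<And>y. y \<in> K \<Longrightarrow> a \<bullet> c x \<le> a \<bullet> y"
    using supporting_hyperplane_relative_frontier[OF dom(2) arc_in_K[OF x]] by metis
  have "- a = norm (- a) *\<^sub>R n x"
    by (rule normal_unique[OF x]) (use a(2) in \<open>simp add: inner_diff_right\<close>)
  moreover have "(- a) \<bullet> (y - c x) \<le> 0" using a(2)[OF y] by (simp add: inner_diff_right)
  ultimately have "norm (- a) * (n x \<bullet> (y - c x)) \<le> 0" by (metis inner_scaleR_left)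
  then show ?thesis using a(1) by (simp add: mult_le_0_iff)
qed

text \<open>When the square of the distance from the point on the normal to a point of the closure
  is expanded, the half-space property makes the cross term nonnegative, so no point of the closure
  is closer than \<open>s\<close>.\<close>

lemma closest_point_normal:
  assumes x: "lo < x" "x < hi" and s: "0 \<le> s"
  shows "closest_point K (c x + s *\<^sub>R n x) = c x" and "infdist (c x + s *\<^sub>R n x) K = s"
proof -
  have "dist (c x + s *\<^sub>R n x) (c x) \<le> dist (c x + s *\<^sub>R n x) y" if "y \<in> K" for y
  proof -
    have nn: "n x \<bullet> n x = 1" using norm_n[of x] by (simp add: norm_eq_1)
    have "s * (n x \<bullet> (y - c x)) \<le> 0" using n_halfspace[OF x that] s by (simp add: mult_nonneg_nonpos)
    moreover have "(norm (c x + s *\<^sub>R n x - y))\<^sup>2 = s\<^sup>2 - 2 * (s * (n x \<bullet> (y - c x))) + (norm (y - c x))\<^sup>2"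
      unfolding power2_norm_eq_inner
      by (simp add: inner_add_left inner_add_right inner_diff_left inner_diff_right nn inner_commute power2_eq_square algebra_simps)
    moreover have "0 \<le> (norm (y - c x))\<^sup>2" by simp
    ultimately have "s\<^sup>2 \<le> (norm (c x + s *\<^sub>R n x - y))\<^sup>2" by linarith
    then have "s \<le> norm (c x + s *\<^sub>R n x - y)" by (rule power2_le_imp_le) simp
    then show ?thesis using s by (simp add: dist_norm norm_n)
  qed
  then show cp: "closest_point K (c x + s *\<^sub>R n x) = c x"
    using closest_point_unique[OF K(2,1) arc_in_K[OF x]] by metis
  show "infdist (c x + s *\<^sub>R n x) K = s"
    using s by (simp add: infdist_closest_point[OF K(1,3)] cp dist_norm norm_n)
qed

lemma normal_of_closest_point:
  assumes x: "lo < x" "x < hi" and y: "closest_point K y = c x"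
  shows "y = c x + infdist y K *\<^sub>R n x"
proof -
  have "y - c x = norm (y - c x) *\<^sub>R n x"
    by (rule normal_unique[OF x]) (use closest_point_dot[OF K(2,1), of _ y] y in simp)
  then show ?thesis by (simp add: infdist_closest_point[OF K(1,3)] y dist_norm algebra_simps)
qed

text \<open>The supporting lines are the tangents of the graph, so \<open>\<gamma>\<close> lies
  above its tangents; applied at two points this makes \<open>g1\<close> nondecreasing. A negative
  \<open>g2\<close> would force a decrease to the right.\<close>

lemma g2_nonneg:
  assumes x: "lo < x" "x < hi"
  shows "0 \<le> g2 x"
proof (rule ccontr)
  assume "\<not> 0 \<le> g2 x"
  then obtain d where d: "d > 0" "\<And>h. 0 < h \<Longrightarrow> h < d \<Longrightarrow> g1 (x + h) < g1 x"
    using DERIV_neg_dec_right[OF deriv2[of x]] by auto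
  define h where "h = min (d/2) ((hi - x)/2)"
  have h: "0 < h" "h < d" "x + h < hi" using d x by (auto simp: h_def min_def field_simps)
  have tangent: "g1 u * (w - u) \<le> \<gamma> w - \<gamma> u" if "lo < u" "u < hi" "lo < w" "w < hi" for u w
  proof -
    have "n u \<bullet> (c w - c u) = (1 / q u) * (g1 u * (w - u) - (\<gamma> w - \<gamma> u))"
      by (simp add: n_def inner_diff_right inner_diff_left inner_commute[of _ "c _"] algebra_simps)
    then have "(1 / q u) * (g1 u * (w - u) - (\<gamma> w - \<gamma> u)) \<le> 0"
      using n_halfspace[OF that(1,2) arc_in_K[OF that(3,4)]] by simp
    then show ?thesis using q_pos[of u] by (simp add: mult_le_0_iff divide_le_0_iff)
  qed
  have "g1 x * h \<le> \<gamma> (x + h) - \<gamma> x" using tangent[of x "x + h"] x h by simp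
  moreover have "g1 (x + h) * (- h) \<le> \<gamma> x - \<gamma> (x + h)" using tangent[of "x + h" x] x h by simp
  ultimately have "g1 x * h \<le> g1 (x + h) * h" by simp
  then show False using d(2)[OF h(1,2)] h(1) by simp
qed

text \<open>Normal coordinates outside the domain: the first coordinate is the parameter of the foot
  point, the second the distance to it.\<close>

definition \<Phi> :: "real^2 \<Rightarrow> real^2" where "\<Phi> z = c (z$1) + (z$2) *\<^sub>R n (z$1)"

text \<open>Curvature times arc length density: the curvature of the graph is
  \<open>g2 x / (q x)^3\<close> and the length element is \<open>q x dx\<close>.\<close>

definition \<kappa> :: "real \<Rightarrow> real" where "\<kappa> x = g2 x / (q x)\<^sup>2"

text \<open>The Jacobian of \<open>\<Phi>\<close>: the length element times one plus distance times
  curvature.\<close>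

definition J :: "real^2 \<Rightarrow> real" where "J z = q (z$1) + z$2 * \<kappa> (z$1)"

text \<open>By the Frenet formulas the tangential derivative of \<open>\<Phi>\<close> is the tangent
  of the curve stretched by \<open>a\<close>, which is one plus distance times curvature; the normal
  derivative is the unit normal.\<close>

definition \<Phi>' :: "real^2 \<Rightarrow> real^2 \<Rightarrow> real^2" where
  "\<Phi>' z h = (let a = 1 + z$2 * (g2 (z$1) / (q (z$1))^3) in
     (h$1 * a + h$2 * (g1 (z$1) / q (z$1))) *\<^sub>R e + (h$1 * (g1 (z$1) * a) - h$2 * (1 / q (z$1))) *\<^sub>R f)"

lemma deriv_q: "(q has_real_derivative g1 x * g2 x / q x) (at x)"
proof -
  have "0 < 1 + (g1 x)\<^sup>2" by (simp add: add_pos_nonneg)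
  then show ?thesis unfolding q_def
    by (auto intro!: derivative_eq_intros deriv2 simp: field_simps)
qed

lemma deriv_n_coeffs:
  "((\<lambda>x. g1 x / q x) has_real_derivative g2 x / (q x)^3) (at x)"
  "((\<lambda>x. 1 / q x) has_real_derivative - (g1 x * g2 x / (q x)^3)) (at x)"
proof -
  have q0: "q x \<noteq> 0" using q_pos[of x] by simp
  have "((\<lambda>x. g1 x / q x) has_real_derivative (g2 x * q x - g1 x * (g1 x * g2 x / q x)) / (q x * q x)) (at x)"
    using q0 by (intro DERIV_divide deriv2 deriv_q)
  also have "(g2 x * q x - g1 x * (g1 x * g2 x / q x)) / (q x * q x) = g2 x * ((q x)\<^sup>2 - (g1 x)\<^sup>2) / (q x)^3"
    using q0 by (simp add: field_simps power2_eq_square power3_eq_cube)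
  also have "\<dots> = g2 x / (q x)^3" by (simp add: q_square)
  finally show "((\<lambda>x. g1 x / q x) has_real_derivative g2 x / (q x)^3) (at x)" .
  have "((\<lambda>x. 1 / q x) has_real_derivative (0 * q x - 1 * (g1 x * g2 x / q x)) / (q x * q x)) (at x)"
    using q0 by (intro DERIV_divide DERIV_const deriv_q)
  then show "((\<lambda>x. 1 / q x) has_real_derivative - (g1 x * g2 x / (q x)^3)) (at x)"
    using q0 by (simp add: field_simps power3_eq_cube)
qed

lemma has_derivative_nth1:
  assumes "(P has_real_derivative p) (at (z$1))"
  shows "((\<lambda>z::real^2. P (z$1)) has_derivative (\<lambda>h. p * h$1)) (at z)"
  using has_derivative_compose[OF bounded_linear.has_derivative[OF bounded_linear_vec_nth has_derivative_ident], of P "\<lambda>h. p * h" z 1]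
    assms by (simp add: has_field_derivative_def)

lemma has_derivative_nth2: "((\<lambda>z::real^2. z$2) has_derivative (\<lambda>h. h$2)) (at z)"
  by (rule bounded_linear.has_derivative[OF bounded_linear_vec_nth has_derivative_ident])

lemma \<Phi>_deriv: "(\<Phi> has_derivative \<Phi>' z) (at z)"
proof -
  have \<Phi>_eq: "\<Phi> = (\<lambda>z. (z$1 + z$2 * (g1 (z$1) / q (z$1))) *\<^sub>R e + (\<gamma> (z$1) - z$2 * (1 / q (z$1))) *\<^sub>R f)"
    by (auto simp: \<Phi>_def c_def n_def algebra_simps)
  have "(\<Phi> has_derivative (\<lambda>h. (1 * h$1 + (z$2 * (g2 (z$1) / (q (z$1))^3 * h$1) + h$2 * (g1 (z$1) / q (z$1)))) *\<^sub>R e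
     + (g1 (z$1) * h$1 - (z$2 * (- (g1 (z$1) * g2 (z$1) / (q (z$1))^3) * h$1) + h$2 * (1 / q (z$1)))) *\<^sub>R f)) (at z)"
    unfolding \<Phi>_eq
    by (intro has_derivative_add has_derivative_diff has_derivative_mult has_derivative_nth2
        bounded_linear.has_derivative[OF bounded_linear_scaleR_left]
        has_derivative_nth1[OF deriv_n_coeffs(1)] has_derivative_nth1[OF deriv_n_coeffs(2)]
        has_derivative_nth1[OF deriv1] has_derivative_nth1[OF DERIV_ident])
  moreover have "(\<lambda>h. (1 * h$1 + (z$2 * (g2 (z$1) / (q (z$1))^3 * h$1) + h$2 * (g1 (z$1) / q (z$1)))) *\<^sub>R e
     + (g1 (z$1) * h$1 - (z$2 * (- (g1 (z$1) * g2 (z$1) / (q (z$1))^3) * h$1) + h$2 * (1 / q (z$1)))) *\<^sub>R f) = \<Phi>' z"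
    by (rule ext) (simp add: \<Phi>'_def Let_def algebra_simps)
  ultimately show ?thesis by simp
qed

text \<open>Tangent and normal are orthogonal, so the determinant is the stretched length element.
  Convexity keeps the stretching factor \<open>a\<close> nonnegative at every distance: exterior
  normals never focus.\<close>

lemma \<Phi>_det:
  assumes "lo < z$1" "z$1 < hi" "0 \<le> z$2"
  shows "\<bar>det (matrix (\<Phi>' z))\<bar> = J z" "0 \<le> J z"
proof -
  have q0: "q (z$1) > 0" by (rule q_pos)
  define a where "a = 1 + z$2 * (g2 (z$1) / (q (z$1))^3)"
  have a0: "0 \<le> a" unfolding a_def using g2_nonneg[OF assms(1,2)] assms(3) q0 by simp
  have J: "J z = a * q (z$1)"
    using q0 by (simp add: J_def \<kappa>_def a_def field_simps power2_eq_square power3_eq_cube)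
  then show "0 \<le> J z" using a0 q0 by simp
  have m: "matrix (\<Phi>' z) $ i $ 1 = a * e$i + (g1 (z$1) * a) * f$i"
     "matrix (\<Phi>' z) $ i $ 2 = (g1 (z$1) / q (z$1)) * e$i - (1 / q (z$1)) * f$i" for i
    by (simp_all add: matrix_def \<Phi>'_def Let_def a_def axis_def)
  have "det (matrix (\<Phi>' z)) = - (a / q (z$1)) * (1 + (g1 (z$1))\<^sup>2) * (e$1 * f$2 - e$2 * f$1)"
    unfolding det_2 m using q0 by (simp add: field_simps power2_eq_square)
  also have "\<dots> = - (a * q (z$1)) * (e$1 * f$2 - e$2 * f$1)"
    unfolding q_square[symmetric] using q0 by (simp add: power2_eq_square)
  finally show "\<bar>det (matrix (\<Phi>' z))\<bar> = J z"
    using det_frame[OF frame] a0 q0 by (simp add: J abs_mult)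
qed

text \<open>Points on a normal have the expected foot point and distance; conversely a point outside
  lies on the normal through its foot point because the normal direction there is unique.\<close>

lemma \<Phi>_image:
  assumes "E \<subseteq> {lo<..<hi}"
  shows "\<Phi> ` {z. z$1 \<in> E \<and> 0 < z$2 \<and> z$2 < t}
    = {y. y \<notin> K \<and> infdist y K < t \<and> closest_point K y \<in> c ` E}" (is "?L = ?R")
proof (intro set_eqI iffI)
  fix y assume "y \<in> ?L"
  then obtain z where z: "y = \<Phi> z" "z$1 \<in> E" "0 < z$2" "z$2 < t" by blast
  have x: "lo < z$1" "z$1 < hi" using z(2) assms by auto
  note cp = closest_point_normal[OF x, of "z$2", folded \<Phi>_def]
  have "y \<notin> K" using cp(2) z infdist_zero[of y K] by auto
  then show "y \<in> ?R" using cp z by auto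
next
  fix y assume "y \<in> ?R"
  then obtain x where x: "y \<notin> K" "infdist y K < t" "x \<in> E" "closest_point K y = c x" by blast
  have l: "lo < x" "x < hi" using x(3) assms by auto
  have "0 < infdist y K" using x(1) K in_closed_iff_infdist_zero infdist_nonneg[of y K] by (metis less_eq_real_def)
  moreover have "y = \<Phi> (xy (x, infdist y K))" unfolding \<Phi>_def using normal_of_closest_point[OF l x(4)] by simp
  ultimately show "y \<in> ?L" using x by (intro image_eqI[of _ _ "xy (x, infdist y K)"]) auto
qed

text \<open>The foot point and the distance of \<open>\<Phi> z\<close> give back both coordinates of
  \<open>z\<close>.\<close>

lemma inj_\<Phi>: "inj_on \<Phi> {z. lo < z$1 \<and> z$1 < hi \<and> 0 < z$2}"
proof (rule inj_onI)
  fix z w assume z: "z \<in> {z. lo < z$1 \<and> z$1 < hi \<and> 0 < z$2}" and w: "w \<in> {z. lo < z$1 \<and> z$1 < hi \<and> 0 < z$2}"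
    and eq: "\<Phi> z = \<Phi> w"
  have *: "closest_point K (\<Phi> u) = c (u$1)" "infdist (\<Phi> u) K = u$2"
    if "u \<in> {z. lo < z$1 \<and> z$1 < hi \<and> 0 < z$2}" for u
    using closest_point_normal[of "u$1" "u$2"] that by (simp_all add: \<Phi>_def)
  have "c (z$1) = c (w$1)" unfolding *(1)[OF z, symmetric] *(1)[OF w, symmetric] eq ..
  then have "c (z$1) \<bullet> e = c (w$1) \<bullet> e" by (rule arg_cong)
  then have "z$1 = w$1" unfolding c_inner .
  moreover have "z$2 = w$2" unfolding *(2)[OF z, symmetric] *(2)[OF w, symmetric] eq ..
  ultimately show "z = w" by (simp add: vec_eq_iff forall_2)
qed

text \<open>Change of variables in normal coordinates. The Jacobian is affine in the distance, so
  integrating it along each normal yields a linear term with the length of the piece and a quadratic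
  term with half its total curvature, the witness for \<open>k\<close>.\<close>

lemma steiner_arc:
  assumes ab: "lo < a" "a \<le> b" "b < hi" and E: "E \<in> sets borel" "E \<subseteq> {a..b}"
  shows "\<exists>k<\<infinity>. \<forall>t>0. emeasure lborel {y. y \<notin> K \<and> infdist y K < t \<and> closest_point K y \<in> c ` E}
     = ennreal t * emeasure hausdorff1 (c ` E) + ennreal (t\<^sup>2) * k"
proof (intro exI[of _ "\<integral>\<^sup>+x. ennreal (\<kappa> x / 2) * indicator E x \<partial>lborel"] conjI allI impI)
  have cont_\<kappa>: "continuous_on UNIV \<kappa>"
    unfolding \<kappa>_def using q_pos by (intro continuous_intros cont2 continuous_q) (metis less_irrefl power2_eq_square mult_eq_0_iff)
  have [measurable]: "q \<in> borel_measurable borel" "\<kappa> \<in> borel_measurable borel"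
    by (intro borel_measurable_continuous_onI continuous_q cont_\<kappa>)+
  note [measurable] = E(1)
  have Eio: "E \<subseteq> {lo<..<hi}" using E ab by auto
  have \<kappa>0: "0 \<le> \<kappa> x" if "x \<in> E" for x using g2_nonneg[of x] Eio that by (auto simp: \<kappa>_def)
  have "compact (\<kappa> ` {a..b})"
    by (intro compact_continuous_image continuous_on_subset[OF cont_\<kappa>]) auto
  then have bdd: "\<exists>B. \<forall>x\<in>{a..b}. norm (\<kappa> x) \<le> B"
    by (auto dest!: compact_imp_bounded simp: bounded_iff)
  then obtain B where B: "\<And>x. x \<in> {a..b} \<Longrightarrow> norm (\<kappa> x) \<le> B" by blast
  have half: "u / 2 \<le> v" if "0 \<le> u" "u \<le> v" for u v :: real using that by simp
  have "(\<integral>\<^sup>+x. ennreal (\<kappa> x / 2) * indicator E x \<partial>lborel) \<le> (\<integral>\<^sup>+x. ennreal B * indicator {a..b} x \<partial>lborel)"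
  proof (rule nn_integral_mono)
    fix x show "ennreal (\<kappa> x / 2) * indicator E x \<le> ennreal B * indicator {a..b} x"
    proof (cases "x \<in> E")
      case True
      then have x: "x \<in> {a..b}" using E by blast
      have "\<kappa> x \<le> B" using B[OF x] by (simp only: real_norm_def abs_le_iff)
      then have "\<kappa> x / 2 \<le> B" using half \<kappa>0[OF True] by blast
      then show ?thesis using True x by (simp add: ennreal_leI)
    qed simp
  qed
  also have "\<dots> < \<infinity>" using ab by (simp add: nn_integral_cmult_indicator ennreal_mult_less_top)
  finally show k: "(\<integral>\<^sup>+x. ennreal (\<kappa> x / 2) * indicator E x \<partial>lborel) < \<infinity>" .
  have cE: "c ` E = {y \<in> c ` {a..b}. y \<bullet> e \<in> E}" using E by auto
  have H: "emeasure hausdorff1 (c ` E) = (\<integral>\<^sup>+x. ennreal (q x) * indicator E x \<partial>lborel)"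
    unfolding cE hausdorff1_arc_borel[OF ab(2) E(1)]
    using E(2) by (intro nn_integral_cong) (auto simp: indicator_def)
  have Hfin: "emeasure hausdorff1 (c ` E) < \<infinity>"
    using hausdorff1_arc_finite[of a b] emeasure_mono[OF image_mono[OF E(2), of c], of hausdorff1]
    by (simp add: order_le_less_trans)
  fix t :: real assume t: "0 < t"
  let ?S = "{z::real^2. z$1 \<in> E \<and> 0 < z$2 \<and> z$2 < t}"
  let ?r = "ennreal t * emeasure hausdorff1 (c ` E) + ennreal (t\<^sup>2) * (\<integral>\<^sup>+x. ennreal (\<kappa> x / 2) * indicator E x \<partial>lborel)"
  have [measurable]: "(\<lambda>z::real^2. z $ i) \<in> borel_measurable borel" for i
    by (intro borel_measurable_continuous_onI continuous_intros)
  have S[measurable]: "?S \<in> sets borel" by measurable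
  have [measurable]: "J \<in> borel_measurable borel" unfolding J_def by measurable
  have Sio: "?S \<subseteq> {z. lo < z$1 \<and> z$1 < hi \<and> 0 < z$2}" using Eio by auto
  have J0: "0 \<le> J z" "\<bar>det (matrix (\<Phi>' z))\<bar> = J z" if "z \<in> ?S" for z
    using \<Phi>_det[of z] that Sio by auto
  have split: "ennreal (t * u + t\<^sup>2 * v) = ennreal t * ennreal u + ennreal (t\<^sup>2) * ennreal v"
    if "0 \<le> u" "0 \<le> v" for u v
    using that t by (simp add: ennreal_mult)
  have fub: "(\<integral>\<^sup>+z. ennreal (J z * indicator ?S z) \<partial>lborel) = ?r"
  proof -
    have "(\<integral>\<^sup>+z. ennreal (J z * indicator ?S z) \<partial>lborel)
        = (\<integral>\<^sup>+x. \<integral>\<^sup>+y. ennreal (J (xy (x,y)) * indicator ?S (xy (x,y))) \<partial>lborel \<partial>lborel)"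
      by (rule nn_integral_lborel_vec2) measurable
    also have "\<dots> = (\<integral>\<^sup>+x. (ennreal t * (ennreal (q x) * indicator E x) + ennreal (t\<^sup>2) * (ennreal (\<kappa> x / 2) * indicator E x)) \<partial>lborel)"
    proof (rule nn_integral_cong)
      fix x :: real
      show "(\<integral>\<^sup>+y. ennreal (J (xy (x,y)) * indicator ?S (xy (x,y))) \<partial>lborel)
        = ennreal t * (ennreal (q x) * indicator E x) + ennreal (t\<^sup>2) * (ennreal (\<kappa> x / 2) * indicator E x)"
      proof (cases "x \<in> E")
        case True
        have "(\<integral>\<^sup>+y. ennreal (J (xy (x,y)) * indicator ?S (xy (x,y))) \<partial>lborel)
            = (\<integral>\<^sup>+y. ennreal (q x + y * \<kappa> x) * indicator {0<..<t} y \<partial>lborel)"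
          using True by (intro nn_integral_cong) (auto simp: J_def indicator_def)
        also have "\<dots> = ennreal (t * q x + t\<^sup>2 * (\<kappa> x / 2))"
          using q_pos[of x] \<kappa>0[OF True] t by (intro nn_integral_affine) auto
        also have "\<dots> = ennreal t * ennreal (q x) + ennreal (t\<^sup>2) * ennreal (\<kappa> x / 2)"
          using q_pos[of x] \<kappa>0[OF True] by (intro split) auto
        finally show ?thesis using True by simp
      qed (simp add: indicator_def)
    qed
    also have "\<dots> = ?r" unfolding H by (subst nn_integral_add) (auto simp: nn_integral_cmult)
    finally show ?thesis .
  qed
  have rfin: "?r < \<infinity>" using Hfin k by (simp add: ennreal_mult_less_top)
  \<comment> \<open>The change of variables is carried out with the gauge integral, so the finite
    nonnegative integral is converted first.\<close>
  have hi: "((\<lambda>z. J z * indicator ?S z) has_integral enn2real ?r) UNIV"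
  proof (rule nn_integral_has_integral)
    show "0 \<le> J z * indicator ?S z" for z using J0(1)[of z] by (auto simp: indicator_def)
    show "(\<integral>\<^sup>+z. ennreal (J z * indicator ?S z) \<partial>lborel) = ennreal (enn2real ?r)"
      unfolding fub using rfin by simp
  qed auto
  have eq: "(\<lambda>z. if z \<in> ?S then J z else 0) = (\<lambda>z. J z * indicator ?S z)"
    by (rule ext) (auto simp: indicator_def)
  have hS: "(J has_integral enn2real ?r) ?S"
    by (rule iffD1[OF has_integral_restrict_UNIV]) (unfold eq, rule hi)
  then have hS': "((\<lambda>z. \<bar>det (matrix (\<Phi>' z))\<bar>) has_integral enn2real ?r) ?S"
    by (rule has_integral_eq[rotated]) (simp add: J0)
  have der: "(\<Phi> has_derivative \<Phi>' z) (at z within ?S)" for z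
    using \<Phi>_deriv has_derivative_at_withinI by blast
  have inj: "inj_on \<Phi> ?S" by (rule inj_on_subset[OF inj_\<Phi> Sio])
  have Sl: "?S \<in> sets lebesgue" using S by simp
  have lm: "\<Phi> ` ?S \<in> lmeasurable"
    by (rule measurable_differentiable_image[OF Sl der has_integral_integrable[OF hS']])
  have "measure lebesgue (\<Phi> ` ?S) = enn2real ?r"
    unfolding measure_differentiable_image_eq[OF Sl der inj has_integral_integrable[OF hS']]
    by (rule integral_unique[OF hS'])
  then have em: "emeasure lebesgue (\<Phi> ` ?S) = ?r"
    unfolding emeasure_eq_measure2[OF lm] using rfin by simp
  have "c ` E \<in> sets borel" unfolding cE by measurable
  then have "{y. y \<notin> K \<and> infdist y K < t \<and> closest_point K y \<in> c ` E} \<in> sets borel"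
    by (intro closest_point_fibre_borel K)
  then show "emeasure lborel {y. y \<notin> K \<and> infdist y K < t \<and> closest_point K y \<in> c ` E} = ?r"
    using em unfolding \<Phi>_image[OF Eio] by simp
qed

end

section \<open>The Steiner formula\<close>

text \<open>The frame consists of the preimages of the coordinate axes under \<open>T\<close>; as
  \<open>T\<close> preserves inner products, the coordinates of \<open>T x\<close> are inner
  products of \<open>x\<close> with the frame.\<close>

lemma smooth_boundary_graph:
  assumes "smooth_boundary \<Omega>" "p \<in> frontier \<Omega>"
  obtains e f :: "real^2" and \<gamma> r where "0 < r" "norm e = 1" "norm f = 1" "e \<bullet> f = 0" "smooth \<gamma>"
    "\<And>x. x \<in> ball p r \<Longrightarrow> x \<in> \<Omega> \<longleftrightarrow> \<gamma> (x \<bullet> e) < x \<bullet> f"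
proof -
  obtain r and T :: "real^2 \<Rightarrow> real^2" and \<gamma> where r: "r > 0" and T: "orthogonal_transformation T" and \<gamma>: "smooth \<gamma>"
    and eq: "\<Omega> \<inter> ball p r = {x \<in> ball p r. T x $ 2 > \<gamma> (T x $ 1)}"
    using assms unfolding smooth_boundary_def by blast
  obtain e f where ef: "T e = axis 1 1" "T f = axis 2 1"
    using orthogonal_transformation_surj[OF T] by (metis surjD)
  have inner: "T x \<bullet> T y = x \<bullet> y" for x y using T by (simp add: orthogonal_transformation_def)
  have comp: "T x $ 1 = x \<bullet> e" "T x $ 2 = x \<bullet> f" for x
    using inner[of x e] inner[of x f] by (simp_all add: ef inner_axis)
  have "x \<in> \<Omega> \<longleftrightarrow> \<gamma> (x \<bullet> e) < x \<bullet> f" if x: "x \<in> ball p r" for x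
  proof -
    have "x \<in> \<Omega> \<inter> ball p r \<longleftrightarrow> \<gamma> (T x $ 1) < T x $ 2" unfolding eq using x by simp
    then show ?thesis using x by (simp add: comp)
  qed
  moreover have "norm e = 1" "norm f = 1"
    using orthogonal_transformation_norm[OF T, of e] orthogonal_transformation_norm[OF T, of f] by (simp_all add: ef)
  moreover have "e \<bullet> f = 0" using inner[of e f] by (simp add: ef inner_axis_axis)
  ultimately show ?thesis using that[of r e f \<gamma>] r \<gamma> by blast
qed

text \<open>A local Steiner formula for the points whose foot point lies in \<open>S\<close>. The
  quadratic coefficient is left existential: the property then passes to disjoint unions, and the
  coefficient is determined only for the whole boundary.\<close>

definition steiner_additive :: "(real^2) set \<Rightarrow> (real^2) set \<Rightarrow> bool" where
  "steiner_additive K S \<longleftrightarrow> emeasure hausdorff1 S < \<infinity> \<and>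
     (\<exists>k<\<infinity>. \<forall>t>0. emeasure lborel {y. y \<notin> K \<and> infdist y K < t \<and> closest_point K y \<in> S}
        = ennreal t * emeasure hausdorff1 S + ennreal (t\<^sup>2) * k)"

lemma steiner_additive_Un:
  assumes K: "closed K" "convex K" "K \<noteq> {}"
    and A: "A \<in> sets borel" "steiner_additive K A" and B: "B \<in> sets borel" "steiner_additive K B"
    and disj: "A \<inter> B = {}"
  shows "steiner_additive K (A \<union> B)"
proof -
  let ?M = "\<lambda>t S. {y. y \<notin> K \<and> infdist y K < t \<and> closest_point K y \<in> S}"
  obtain k l where kl: "k < \<infinity>" "l < \<infinity>"
    "\<And>t. t > 0 \<Longrightarrow> emeasure lborel (?M t A) = ennreal t * emeasure hausdorff1 A + ennreal (t\<^sup>2) * k"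
    "\<And>t. t > 0 \<Longrightarrow> emeasure lborel (?M t B) = ennreal t * emeasure hausdorff1 B + ennreal (t\<^sup>2) * l"
    using A(2) B(2) unfolding steiner_additive_def by blast
  have H: "emeasure hausdorff1 (A \<union> B) = emeasure hausdorff1 A + emeasure hausdorff1 B"
    using A(1) B(1) disj by (intro plus_emeasure[symmetric]) auto
  show ?thesis unfolding steiner_additive_def
  proof (intro conjI exI[of _ "k + l"] allI impI)
    show "emeasure hausdorff1 (A \<union> B) < \<infinity>" "k + l < \<infinity>"
      using A(2) B(2) kl(1,2) by (auto simp: H steiner_additive_def)
    fix t :: real assume t: "0 < t"
    have "?M t (A \<union> B) = ?M t A \<union> ?M t B" by auto
    then have "emeasure lborel (?M t (A \<union> B)) = emeasure lborel (?M t A \<union> ?M t B)" by simp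
    also have "\<dots> = emeasure lborel (?M t A) + emeasure lborel (?M t B)"
    proof (rule plus_emeasure[symmetric])
      show "?M t A \<inter> ?M t B = {}" using disj by auto
    qed (simp_all add: closest_point_fibre_borel K A B)
    also have "\<dots> = ennreal t * emeasure hausdorff1 (A \<union> B) + ennreal (t\<^sup>2) * (k + l)"
      unfolding kl(3)[OF t] kl(4)[OF t] H by (simp add: distrib_left add_ac)
    finally show "emeasure lborel (?M t (A \<union> B)) = ennreal t * emeasure hausdorff1 (A \<union> B) + ennreal (t\<^sup>2) * (k + l)" .
  qed
qed

text \<open>In a ball where the boundary is a graph, the Borel pieces of the boundary near
  \<open>p\<close> are images of Borel parameter sets, to which the computation in normal
  coordinates applies.\<close>

lemma steiner_local:
  assumes dom: "open \<Omega>" "convex \<Omega>" "\<Omega> \<noteq> {}" "smooth_boundary \<Omega>" and p: "p \<in> frontier \<Omega>"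
  obtains \<rho> where "\<rho> > 0"
    "\<And>S. S \<in> sets borel \<Longrightarrow> S \<subseteq> frontier \<Omega> \<inter> ball p \<rho> \<Longrightarrow> steiner_additive (closure \<Omega>) S"
proof -
  obtain e f :: "real^2" and \<gamma> r where r: "0 < r" and frame: "norm e = 1" "norm f = 1" "e \<bullet> f = 0" and sm: "smooth \<gamma>"
    and gr: "\<And>x. x \<in> ball p r \<Longrightarrow> x \<in> \<Omega> \<longleftrightarrow> \<gamma> (x \<bullet> e) < x \<bullet> f"
    using smooth_boundary_graph[OF dom(4) p] by metis
  obtain g1 g2 where g: "\<And>x. (\<gamma> has_real_derivative g1 x) (at x)"
    "\<And>x. (g1 has_real_derivative g2 x) (at x)" "continuous_on UNIV g1" "continuous_on UNIV g2"
    using smooth_real_two_derivatives[OF sm] by blast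
  interpret graph_curve e f \<gamma> g1 by standard (use frame g in auto)
  have cont\<gamma>: "continuous_on UNIV \<gamma>"
    using g(1) by (auto intro!: DERIV_isCont continuous_at_imp_continuous_on)
  \<comment> \<open>A boundary point is not in the open set, so it cannot lie above the graph; below
    the graph a whole neighbourhood misses the set. Hence it lies on the graph.\<close>
  have fr: "y \<bullet> f = \<gamma> (y \<bullet> e)" if y: "y \<in> frontier \<Omega>" "y \<in> ball p r" for y
  proof (rule ccontr)
    assume ne: "y \<bullet> f \<noteq> \<gamma> (y \<bullet> e)"
    have "y \<notin> \<Omega>" using y(1) dom(1) by (simp add: frontier_def interior_open)
    then have "y \<bullet> f < \<gamma> (y \<bullet> e)" using gr[OF y(2)] ne by simp
    define U where "U = ball p r \<inter> {z. z \<bullet> f < \<gamma> (z \<bullet> e)}"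
    have "open {z. z \<bullet> f < \<gamma> (z \<bullet> e)}"
      by (intro open_Collect_less continuous_intros continuous_on_compose2[OF cont\<gamma>]) auto
    then have "open U" unfolding U_def by (intro open_Int) auto
    moreover have "y \<in> U" using y \<open>y \<bullet> f < \<gamma> (y \<bullet> e)\<close> by (simp add: U_def)
    moreover have "U \<inter> \<Omega> = {}" using gr by (force simp: U_def)
    ultimately have "y \<notin> closure \<Omega>" by (metis IntI disjoint_iff open_Int_closure_eq_empty)
    then show False using y(1) by (simp add: frontier_def)
  qed
  have cy: "y = c (y \<bullet> e)" if y: "y \<in> frontier \<Omega>" "y \<in> ball p r" for y
    using frame_expansion[OF frame, of y] fr[OF y] by (simp add: c_def)
  define x0 where "x0 = p \<bullet> e"
  have cx0: "c x0 = p" using cy[OF p] r by (simp add: x0_def)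
  obtain \<delta> where \<delta>: "\<delta> > 0" "\<And>x. \<bar>x - x0\<bar> < \<delta> \<Longrightarrow> c x \<in> ball p r"
    using continuous_c r cx0 unfolding continuous_on_iff dist_real_def mem_ball by (metis UNIV_I dist_commute)
  have above: "\<exists>\<epsilon>0>0. \<forall>\<epsilon>. 0 < \<epsilon> \<and> \<epsilon> < \<epsilon>0 \<longrightarrow> c x + \<epsilon> *\<^sub>R f \<in> \<Omega>" if "\<bar>x - x0\<bar> < \<delta>" for x
  proof (intro exI[of _ "r - dist p (c x)"] conjI allI impI)
    show "0 < r - dist p (c x)" using \<delta>(2)[OF that] by simp
    fix \<epsilon> assume \<epsilon>: "0 < \<epsilon> \<and> \<epsilon> < r - dist p (c x)"
    have "dist p (c x + \<epsilon> *\<^sub>R f) \<le> dist p (c x) + dist (c x) (c x + \<epsilon> *\<^sub>R f)" by (rule dist_triangle)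
    also have "\<dots> < r" using \<epsilon> frame by (simp add: dist_norm)
    finally have "c x + \<epsilon> *\<^sub>R f \<in> ball p r" by simp
    then show "c x + \<epsilon> *\<^sub>R f \<in> \<Omega>" using \<epsilon> frame' frame by (simp add: gr inner_add_left)
  qed
  have onfr: "c x \<in> frontier \<Omega>" if x: "\<bar>x - x0\<bar> < \<delta>" for x
  proof -
    obtain \<epsilon>0 where \<epsilon>0: "\<epsilon>0 > 0" "\<And>\<epsilon>. 0 < \<epsilon> \<Longrightarrow> \<epsilon> < \<epsilon>0 \<Longrightarrow> c x + \<epsilon> *\<^sub>R f \<in> \<Omega>" using above[OF x] by blast
    have "c x \<in> closure \<Omega>" unfolding closure_approachable
    proof (intro allI impI)
      fix d :: real assume "0 < d"
      define \<epsilon> where "\<epsilon> = min (\<epsilon>0/2) (d/2)"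
      have "0 < \<epsilon>" "\<epsilon> < \<epsilon>0" "\<epsilon> < d" using \<open>0 < d\<close> \<epsilon>0(1) by (auto simp: \<epsilon>_def)
      then show "\<exists>y\<in>\<Omega>. dist y (c x) < d"
        using \<epsilon>0(2) frame by (intro bexI[of _ "c x + \<epsilon> *\<^sub>R f"]) (auto simp: dist_norm)
    qed
    moreover have "c x \<notin> \<Omega>" using gr[OF \<delta>(2)[OF x]] by simp
    ultimately show ?thesis using dom(1) by (simp add: frontier_def interior_open)
  qed
  interpret convex_arc e f \<gamma> g1 g2 \<Omega> "x0 - \<delta>" "x0 + \<delta>"
  proof
    fix x assume "x0 - \<delta> < x" "x < x0 + \<delta>"
    then have x: "\<bar>x - x0\<bar> < \<delta>" by auto
    show "c x \<in> frontier \<Omega>" by (rule onfr[OF x])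
    obtain \<epsilon>0 where "\<epsilon>0 > 0" "\<And>\<epsilon>. 0 < \<epsilon> \<Longrightarrow> \<epsilon> < \<epsilon>0 \<Longrightarrow> c x + \<epsilon> *\<^sub>R f \<in> \<Omega>" using above[OF x] by blast
    then show "\<exists>\<epsilon>>0. c x + \<epsilon> *\<^sub>R f \<in> closure \<Omega>"
      by (intro exI[of _ "\<epsilon>0/2"]) (auto intro: closure_subset[THEN subsetD])
  qed (use g dom in auto)
  show ?thesis
  proof (rule that)
    \<comment> \<open>Half of \<open>\<delta>\<close> leaves the closed parameter interval strictly
      inside the open one on which the arc is known to be boundary; within radius \<open>r\<close>
      each boundary point is recovered from its coordinate along \<open>e\<close>.\<close>
    show "0 < min (\<delta>/2) r" using \<delta> r by simp
    fix S :: "(real^2) set" assume S: "S \<in> sets borel" "S \<subseteq> frontier \<Omega> \<inter> ball p (min (\<delta>/2) r)"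
    let ?a = "x0 - \<delta>/2" and ?b = "x0 + \<delta>/2"
    define E where "E = {x \<in> {?a..?b}. c x \<in> S}"
    have "E = {?a..?b} \<inter> c -` S" by (auto simp: E_def)
    moreover have "c -` S \<in> sets borel"
      using measurable_sets[OF borel_measurable_continuous_onI[OF continuous_c] S(1)] by simp
    ultimately have E: "E \<in> sets borel" by simp
    have "S = c ` E"
    proof (intro set_eqI iffI)
      fix y assume y: "y \<in> S"
      then have y': "y \<in> frontier \<Omega>" "y \<in> ball p r" "dist p y < \<delta>/2" using S(2) by auto
      have "\<bar>y \<bullet> e - x0\<bar> = \<bar>(y - p) \<bullet> e\<bar>" by (simp add: x0_def inner_diff_left)
      also have "\<dots> \<le> norm (y - p) * norm e" by (rule Cauchy_Schwarz_ineq2)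
      also have "\<dots> < \<delta>/2" using y'(3) frame by (simp add: dist_norm norm_minus_commute)
      finally have "\<bar>y \<bullet> e - x0\<bar> < \<delta>/2" .
      then have "x0 - \<delta>/2 \<le> y \<bullet> e" "y \<bullet> e \<le> x0 + \<delta>/2" by linarith+
      then have "y \<bullet> e \<in> E" using y cy[OF y'(1,2)] by (simp add: E_def)
      then show "y \<in> c ` E" using cy[OF y'(1,2)] by blast
    qed (auto simp: E_def)
    moreover have Eab: "E \<subseteq> {?a..?b}" by (auto simp: E_def)
    moreover have "emeasure hausdorff1 (c ` E) < \<infinity>"
      using hausdorff1_arc_finite[of ?a ?b] emeasure_mono[OF image_mono[OF Eab, of c], of hausdorff1]
      by (simp add: order_le_less_trans)
    ultimately show "steiner_additive (closure \<Omega>) S"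
      unfolding steiner_additive_def using steiner_arc[of ?a ?b E] \<delta>(1) E by auto
  qed
qed

text \<open>The closest point lies on the relative frontier of the closure; since the interior of
  the closure of an open convex set is the set itself, this is the frontier of the set.\<close>

lemma closest_point_in_frontier:
  fixes \<Omega> :: "'a::euclidean_space set"
  assumes "open \<Omega>" "convex \<Omega>" "\<Omega> \<noteq> {}" "y \<notin> closure \<Omega>"
  shows "closest_point (closure \<Omega>) y \<in> frontier \<Omega>"
proof -
  have int: "interior (closure \<Omega>) = \<Omega>" using assms by (simp add: convex_interior_closure interior_open)
  have ne: "interior (closure \<Omega>) \<noteq> {}" using assms int by simp
  have "closest_point (closure \<Omega>) y \<in> rel_frontier (closure \<Omega>)"
    using assms affine_hull_nonempty_interior[OF ne] interior_subset[of "closure \<Omega>"]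
    by (intro closest_point_in_rel_frontier) (auto simp: rel_interior_nonempty_interior[OF ne])
  also have "rel_frontier (closure \<Omega>) = frontier (closure \<Omega>)" by (rule rel_frontier_nonempty_interior[OF ne])
  also have "\<dots> = frontier \<Omega>" using assms int by (simp add: frontier_def interior_open)
  finally show ?thesis .
qed

text \<open>Compactness covers the boundary by finitely many balls in which the local formula holds;
  a Borel piece is cut along one ball at a time, so overlaps are never counted twice.\<close>

lemma steiner_additive_frontier:
  assumes "convex_smooth_domain \<Omega>" "\<Omega> \<noteq> {}"
  shows "steiner_additive (closure \<Omega>) (frontier \<Omega>)"
proof -
  have dom: "open \<Omega>" "convex \<Omega>" "\<Omega> \<noteq> {}" "smooth_boundary \<Omega>" "bounded \<Omega>"
    using assms by (auto simp: convex_smooth_domain_def)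
  let ?K = "closure \<Omega>"
  have K: "closed ?K" "convex ?K" "?K \<noteq> {}" using dom by (auto simp: convex_closure)
  have "\<forall>p\<in>frontier \<Omega>. \<exists>\<rho>>0. \<forall>S\<in>sets borel. S \<subseteq> frontier \<Omega> \<inter> ball p \<rho> \<longrightarrow> steiner_additive ?K S"
    using steiner_local[OF dom(1-4)] by metis
  then obtain \<rho> where \<rho>: "\<And>p. p \<in> frontier \<Omega> \<Longrightarrow> \<rho> p > 0"
    "\<And>p S. p \<in> frontier \<Omega> \<Longrightarrow> S \<in> sets borel \<Longrightarrow> S \<subseteq> frontier \<Omega> \<inter> ball p (\<rho> p) \<Longrightarrow> steiner_additive ?K S"
    by metis
  have "compact (frontier \<Omega>)" using dom(5) by (rule compact_frontier_bounded)
  then obtain D where D: "D \<subseteq> frontier \<Omega>" "finite D" "frontier \<Omega> \<subseteq> (\<Union>p\<in>D. ball p (\<rho> p))"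
  proof (rule compactE_image)
    show "frontier \<Omega> \<subseteq> (\<Union>p\<in>frontier \<Omega>. ball p (\<rho> p))" using \<rho>(1) by force
  qed auto
  have "steiner_additive ?K S" if "S \<in> sets borel" "S \<subseteq> frontier \<Omega> \<inter> (\<Union>p\<in>D. ball p (\<rho> p))" for S
    using D(2,1) that
  proof (induction D arbitrary: S)
    case empty
    then have "S = {}" by auto
    then show ?case by (auto simp: steiner_additive_def intro!: exI[of _ 0])
  next
    case (insert p D)
    have "steiner_additive ?K ((S \<inter> ball p (\<rho> p)) \<union> (S - ball p (\<rho> p)))"
    proof (rule steiner_additive_Un[OF K])
      show "steiner_additive ?K (S \<inter> ball p (\<rho> p))"
        using insert.prems by (intro \<rho>(2)[of p]) auto
      show "steiner_additive ?K (S - ball p (\<rho> p))"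
        using insert.prems by (intro insert.IH) auto
    qed (use insert.prems in auto)
    then show ?case by (simp add: Int_Diff_Un)
  qed
  then show ?thesis using D(3) by (simp add: borel_closed)
qed

lemma quadratic_growth_nonpos:
  fixes a b c :: real
  assumes "\<And>t. t > 0 \<Longrightarrow> a * t\<^sup>2 \<le> b * t + c"
  shows "a \<le> 0"
proof (rule ccontr)
  assume "\<not> a \<le> 0"
  then have a: "a > 0" by simp
  \<comment> \<open>Chosen so that \<open>t \<ge> 1\<close> and
    \<open>a * t = a + \<bar>b\<bar> + \<bar>c\<bar>\<close>; the quadratic term then exceeds the
    affine bound.\<close>
  define t where "t = 1 + (\<bar>b\<bar> + \<bar>c\<bar>) / a"
  have t: "t \<ge> 1" "a * t = a + \<bar>b\<bar> + \<bar>c\<bar>" using a by (auto simp: t_def field_simps)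
  have "a * t\<^sup>2 = t * (a * t)" by (simp add: power2_eq_square)
  also have "\<dots> = t * a + t * \<bar>b\<bar> + t * \<bar>c\<bar>" unfolding t(2) by (simp add: algebra_simps)
  finally have "a * t\<^sup>2 = t * a + t * \<bar>b\<bar> + t * \<bar>c\<bar>" .
  moreover have "t * a > 0" using t a by simp
  moreover have "b * t \<le> t * \<bar>b\<bar>" using t by (simp add: mult.commute mult_left_mono)
  moreover have "c \<le> t * \<bar>c\<bar>" using t mult_right_mono[of 1 t "\<bar>c\<bar>"] by linarith
  ultimately show False using assms[of t] t by linarith
qed

lemma emeasure_ball_2: "0 \<le> r \<Longrightarrow> emeasure lborel (ball (x::real^2) r) = ennreal (pi * r\<^sup>2)"
  by (simp add: emeasure_ball unit_ball_vol_2)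

text \<open>The boundary pieces give the area of the parallel ring as \<open>L t + k t^2\<close>
  with an unknown \<open>k\<close>. The ring lies in a disk of radius \<open>D + t\<close>, and
  together with a fixed disk it covers one of radius \<open>t\<close>; comparing the growth for
  large \<open>t\<close> forces \<open>k = pi\<close>, without a computation of the total
  curvature.\<close>

theorem steiner_formula:
  assumes "convex_smooth_domain \<Omega>" "\<Omega> \<noteq> {}"
  shows "emeasure hausdorff1 (frontier \<Omega>) = ennreal (perimeter \<Omega>)"
    and "t > 0 \<Longrightarrow> emeasure lborel {y. y \<notin> closure \<Omega> \<and> infdist y (closure \<Omega>) < t}
           = ennreal (perimeter \<Omega> * t + pi * t\<^sup>2)"
proof -
  have dom: "open \<Omega>" "convex \<Omega>" "\<Omega> \<noteq> {}" "bounded \<Omega>"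
    using assms by (auto simp: convex_smooth_domain_def)
  let ?K = "closure \<Omega>" and ?L = "perimeter \<Omega>"
  define A where "A t = {y. y \<notin> ?K \<and> infdist y ?K < t}" for t
  have Aeq: "{y. y \<notin> ?K \<and> infdist y ?K < t \<and> closest_point ?K y \<in> frontier \<Omega>} = A t" for t
    using closest_point_in_frontier[OF dom(1-3)] by (auto simp: A_def)
  have fin: "emeasure hausdorff1 (frontier \<Omega>) < \<infinity>"
    using steiner_additive_frontier[OF assms] by (simp add: steiner_additive_def)
  then show HL: "emeasure hausdorff1 (frontier \<Omega>) = ennreal ?L"
    unfolding perimeter_def by (intro emeasure_eq_ennreal_measure) auto
  obtain k' where k': "k' < \<infinity>" "\<And>t. t > 0 \<Longrightarrow> emeasure lborel (A t) = ennreal t * ennreal ?L + ennreal (t\<^sup>2) * k'"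
    using steiner_additive_frontier[OF assms] unfolding steiner_additive_def Aeq HL by blast
  define k where "k = enn2real k'"
  have k0: "0 \<le> k" by (simp add: k_def)
  have L0: "0 \<le> ?L" by (simp add: perimeter_def)
  have A: "emeasure lborel (A t) = ennreal (?L * t + k * t\<^sup>2)" if "t > 0" for t
  proof -
    have "k' = ennreal k" using k'(1) by (simp add: k_def)
    then show ?thesis using k'(2)[OF that] that k0 L0 by (simp add: ennreal_mult mult.commute)
  qed
  obtain x0 where x0: "x0 \<in> \<Omega>" using dom by blast
  obtain D where D: "D > 0" "?K \<subseteq> ball x0 D"
    using bounded_subset_ballD[OF bounded_closure[OF dom(4)], of x0] by blast
  have up: "?L * t + k * t\<^sup>2 \<le> pi * (D + t)\<^sup>2" if "t > 0" for t
  proof -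
    have "A t \<subseteq> ball x0 (D + t)"
    proof
      fix y assume y: "y \<in> A t"
      have cp: "closest_point ?K y \<in> ?K" using dom by (intro closest_point_in_set) auto
      have "dist x0 y \<le> dist x0 (closest_point ?K y) + dist (closest_point ?K y) y" by (rule dist_triangle)
      also have "\<dots> < D + t" using D(2) cp y dom
        by (intro add_strict_mono) (auto simp: A_def infdist_closest_point dist_commute)
      finally show "y \<in> ball x0 (D + t)" by simp
    qed
    then have "emeasure lborel (A t) \<le> emeasure lborel (ball x0 (D + t))" by (intro emeasure_mono) auto
    then show ?thesis using D that by (simp add: A emeasure_ball_2 ennreal_le_iff)
  qed
  have low: "pi * t\<^sup>2 \<le> pi * D\<^sup>2 + (?L * t + k * t\<^sup>2)" if "t > 0" for t
  proof -
    have Ab: "A t \<in> sets borel"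
      using closest_point_fibre_borel[of ?K UNIV t] dom by (simp add: A_def convex_closure)
    have "ball x0 t \<subseteq> ball x0 D \<union> A t"
    proof
      fix y assume y: "y \<in> ball x0 t"
      have "infdist y ?K \<le> dist y x0" using x0 closure_subset by (intro infdist_le) auto
      then show "y \<in> ball x0 D \<union> A t" using y D(2) by (auto simp: A_def dist_commute)
    qed
    then have "emeasure lborel (ball x0 t) \<le> emeasure lborel (ball x0 D \<union> A t)" using Ab by (intro emeasure_mono) auto
    also have "\<dots> \<le> emeasure lborel (ball x0 D) + emeasure lborel (A t)"
      using Ab by (intro emeasure_subadditive) auto
    finally show ?thesis using D that k0 L0
      by (simp add: A emeasure_ball_2 ennreal_le_iff flip: ennreal_plus)
  qed
  have "k - pi \<le> 0"
    by (rule quadratic_growth_nonpos[of _ "2 * pi * D - ?L" "pi * D\<^sup>2"])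
       (use up in \<open>simp add: algebra_simps power2_eq_square\<close>)
  moreover have "pi - k \<le> 0"
    by (rule quadratic_growth_nonpos[of _ ?L "pi * D\<^sup>2"]) (use low in \<open>simp add: algebra_simps\<close>)
  ultimately have "k = pi" by simp
  then show "emeasure lborel {y. y \<notin> ?K \<and> infdist y ?K < t} = ennreal (?L * t + pi * t\<^sup>2)" if "t > 0"
    using A[OF that] by (simp add: A_def)
qed

text \<open>Steiner's formula is the distribution function of the distance on the exterior, and
  \<open>L + 2 \<pi> t\<close> is its derivative. The two measures on the line agree on the
  half-lines \<open>{..<x}\<close>, which generate the Borel sets, and are finite there.\<close>

lemma nn_integral_parallel:
  assumes dom: "convex_smooth_domain \<Omega>" "\<Omega> \<noteq> {}" and [measurable]: "F \<in> borel_measurable (borel :: real measure)"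
  shows "(\<integral>\<^sup>+y. F (infdist y (closure \<Omega>)) * indicator (- closure \<Omega>) y \<partial>lborel)
       = (\<integral>\<^sup>+t. F t * (ennreal (perimeter \<Omega> + t * (2 * pi)) * indicator {0<..} t) \<partial>lborel)"
proof -
  let ?K = "closure \<Omega>" and ?L = "perimeter \<Omega>"
  have L0: "0 \<le> ?L" by (simp add: perimeter_def)
  have [measurable]: "(\<lambda>y. infdist y ?K) \<in> borel_measurable borel"
    by (intro borel_measurable_continuous_onI continuous_intros)
  have [measurable]: "- ?K \<in> sets borel" by (intro borel_open) auto
  let ?M = "distr (density lborel (indicator (- ?K))) borel (\<lambda>y. infdist y ?K)"
  let ?N = "density lborel (\<lambda>t. ennreal (?L + t * (2 * pi)) * indicator {0<..} t)"
  have M: "emeasure ?M {..<x} = emeasure lborel {y. y \<notin> ?K \<and> infdist y ?K < x}" for x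
  proof -
    have "emeasure ?M {..<x} = emeasure (density lborel (indicator (- ?K))) {y. infdist y ?K < x}"
      by (subst emeasure_distr) (auto simp: vimage_def)
    also have "\<dots> = (\<integral>\<^sup>+y. indicator {y. y \<notin> ?K \<and> infdist y ?K < x} y \<partial>lborel)"
      by (subst emeasure_density) (auto intro!: nn_integral_cong simp: indicator_def)
    also have "\<dots> = emeasure lborel {y. y \<notin> ?K \<and> infdist y ?K < x}"
    proof (rule nn_integral_indicator)
      have "- ?K \<inter> {y. infdist y ?K < x} \<in> sets lborel" by measurable
      then show "{y. y \<notin> ?K \<and> infdist y ?K < x} \<in> sets lborel" by (simp add: Int_def)
    qed
    finally show ?thesis .
  qed
  have N: "emeasure ?N {..<x} = (\<integral>\<^sup>+t. ennreal (?L + t * (2 * pi)) * indicator {0<..<x} t \<partial>lborel)" for x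
    by (subst emeasure_density) (auto intro!: nn_integral_cong simp: indicator_def)
  have eq: "emeasure ?M {..<x} = emeasure ?N {..<x}" for x
  proof (cases "x > 0")
    case True
    then show ?thesis unfolding M N steiner_formula(2)[OF dom True]
      by (subst nn_integral_affine) (auto simp: L0 algebra_simps)
  next
    case False
    then have "{y. y \<notin> ?K \<and> infdist y ?K < x} = {}" using infdist_nonneg[of _ ?K] by (auto simp: not_less intro: order_trans)
    then have "emeasure ?M {..<x} = 0" unfolding M by (simp only: emeasure_empty)
    then show ?thesis unfolding N using False by simp
  qed
  have "?M = ?N"
  proof (rule measure_eqI_generator_eq[where E="range lessThan" and \<Omega>=UNIV and A="\<lambda>i. {..<real i}"])
    show "Int_stable (range (lessThan :: real \<Rightarrow> _))"
    proof -
      have "{..<a} \<inter> {..<b} = {..<min a b}" for a b :: real by auto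
      then show ?thesis unfolding Int_stable_def by auto
    qed
    show "sets ?M = sigma_sets UNIV (range lessThan)" "sets ?N = sigma_sets UNIV (range lessThan)"
      by (simp_all add: borel_Iio)
    show "(\<Union>i. {..<real i}) = UNIV" using reals_Archimedean2 by auto
    show "emeasure ?M {..<real i} \<noteq> \<infinity>" for i
      unfolding M using steiner_formula(2)[OF dom, of "real i"] M[of 0] eq[of 0] N[of 0] by (cases "i = 0") auto
  qed (use eq in auto)
  then have "(\<integral>\<^sup>+t. F t \<partial>?M) = (\<integral>\<^sup>+t. F t \<partial>?N)" by simp
  then show ?thesis
    by (simp add: nn_integral_distr nn_integral_density mult.commute)
qed

section \<open>Brunn-Minkowski and isoperimetric inequalities\<close>

text \<open>With \<open>M\<close> the maximum of \<open>A\<close> and \<open>m\<close> the minimum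
  of \<open>B\<close>, the translates \<open>m + A\<close> and \<open>M + B\<close> both lie in the
  sumset and meet at most in the point \<open>M + m\<close>.\<close>

lemma brunn_minkowski_1_compact:
  fixes A B :: "real set"
  assumes A: "compact A" "A \<noteq> {}" and B: "compact B" "B \<noteq> {}" and C: "C \<in> sets borel"
    and sub: "\<And>x y. x \<in> A \<Longrightarrow> y \<in> B \<Longrightarrow> x + y \<in> C"
  shows "emeasure lborel A + emeasure lborel B \<le> emeasure lborel C"
proof -
  obtain M where M: "M \<in> A" "\<And>x. x \<in> A \<Longrightarrow> x \<le> M" using compact_attains_sup[OF A] by blast
  obtain m where m: "m \<in> B" "\<And>x. x \<in> B \<Longrightarrow> m \<le> x" using compact_attains_inf[OF B] by blast
  have tr: "emeasure lborel ((\<lambda>x. c + x) ` S) = emeasure lborel S" if "compact S" for c and S :: "real set"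
  proof -
    have cS: "(\<lambda>x. c + x) ` S \<in> sets borel"
      by (intro borel_closed compact_imp_closed compact_translation that)
    have "emeasure lborel ((\<lambda>x. c + x) ` S) = emeasure (distr lborel borel ((+) c)) ((\<lambda>x. c + x) ` S)"
      by (simp add: lborel_distr_plus)
    also have "\<dots> = emeasure lborel ((+) c -` ((\<lambda>x. c + x) ` S))" using cS by (subst emeasure_distr) auto
    also have "(+) c -` ((\<lambda>x. c + x) ` S) = S" by auto
    finally show ?thesis .
  qed
  have [simp]: "compact ((\<lambda>x. c + x) ` S)" if "compact S" for c and S :: "real set"
    using that by (rule compact_translation)
  have cl: "(\<lambda>x. m + x) ` A \<in> sets borel" "(\<lambda>x. M + x) ` B \<in> sets borel"
    using A B by (auto intro!: borel_closed compact_imp_closed)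
  let ?U = "(\<lambda>x. m + x) ` A" and ?V = "(\<lambda>x. M + x) ` B"
  have "?U \<inter> ?V \<subseteq> {M + m}"
  proof
    fix z assume "z \<in> ?U \<inter> ?V"
    then obtain x y where "z = m + x" "z = M + y" "x \<in> A" "y \<in> B" by blast
    then show "z \<in> {M + m}" using M(2)[of x] m(2)[of y] by simp
  qed
  then have "emeasure lborel (?U \<inter> ?V) \<le> emeasure lborel {M + m}" by (rule emeasure_mono) simp
  then have z: "emeasure lborel (?U \<inter> ?V) = 0" by simp
  have "emeasure lborel A + emeasure lborel B = emeasure lborel ?U + emeasure lborel ?V" by (simp add: tr A B)
  also have "\<dots> = emeasure lborel (?U \<union> ?V)"
  proof -
    have "?V = (?V - ?U) \<union> (?U \<inter> ?V)" by auto
    then have "emeasure lborel ?V = emeasure lborel ((?V - ?U) \<union> (?U \<inter> ?V))" by metis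
    also have "\<dots> = emeasure lborel (?V - ?U) + emeasure lborel (?U \<inter> ?V)"
      using cl by (intro plus_emeasure[symmetric]) auto
    finally have "emeasure lborel ?V = emeasure lborel (?V - ?U)" using z by simp
    moreover have "emeasure lborel ?U + emeasure lborel (?V - ?U) = emeasure lborel (?U \<union> (?V - ?U))"
      using cl by (intro plus_emeasure) auto
    ultimately show ?thesis by simp
  qed
  also have "\<dots> \<le> emeasure lborel C"
  proof (rule emeasure_mono)
    show "?U \<union> ?V \<subseteq> C" using sub[OF _ m(1)] sub[OF M(1)] by (auto simp: add.commute)
  qed (use C in simp)
  finally show ?thesis .
qed

lemma emeasure_compact_approx:
  fixes A :: "real set"
  assumes "A \<in> sets borel" "bounded A" "0 < e"
  obtains T where "compact T" "T \<subseteq> A" "emeasure lborel A \<le> emeasure lborel T + ennreal e"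
proof -
  have "A \<in> sets lebesgue" using assms(1) by simp
  then obtain T where T: "closed T" "T \<subseteq> A" "emeasure lebesgue (A - T) < ennreal e"
    using sets_lebesgue_inner_closed[of A e] assms(3) by metis
  have "compact T" using T assms(2) bounded_subset compact_eq_bounded_closed by blast
  moreover have "emeasure lborel A \<le> emeasure lborel T + emeasure lborel (A - T)"
    using emeasure_subadditive[of T lborel "A - T"] T assms(1) by (simp add: Un_absorb1 borel_closed)
  moreover have "emeasure lborel (A - T) \<le> ennreal e" using T assms(1) by (simp add: borel_closed less_imp_le)
  ultimately show ?thesis using that[of T] T(2) by (meson add_left_mono order_trans)
qed

lemma brunn_minkowski_1:
  fixes A B :: "real set"
  assumes A: "A \<in> sets borel" "bounded A" "A \<noteq> {}" and B: "B \<in> sets borel" "bounded B" "B \<noteq> {}"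
    and C: "C \<in> sets borel" and sub: "\<And>x y. x \<in> A \<Longrightarrow> y \<in> B \<Longrightarrow> x + y \<in> C"
  shows "emeasure lborel A + emeasure lborel B \<le> emeasure lborel C"
proof (rule ennreal_le_epsilon)
  fix e :: real assume "0 < e"
  then have e: "0 < e / 2" by simp
  obtain u v where uv: "u \<in> A" "v \<in> B" using A B by blast
  obtain K where K: "compact K" "K \<subseteq> A" "emeasure lborel A \<le> emeasure lborel K + ennreal (e/2)"
    using emeasure_compact_approx[OF A(1,2) e] by metis
  obtain L where L: "compact L" "L \<subseteq> B" "emeasure lborel B \<le> emeasure lborel L + ennreal (e/2)"
    using emeasure_compact_approx[OF B(1,2) e] by metis
  have mono: "emeasure lborel S \<le> emeasure lborel (insert x S)" if "compact S" for S and x :: real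
    using that by (intro emeasure_mono) (auto intro!: borel_closed compact_imp_closed compact_insert)
  have "emeasure lborel A + emeasure lborel B
      \<le> (emeasure lborel K + ennreal (e/2)) + (emeasure lborel L + ennreal (e/2))"
    using K L by (intro add_mono)
  also have "\<dots> = (emeasure lborel K + emeasure lborel L) + (ennreal (e/2) + ennreal (e/2))" by (simp only: add_ac)
  also have "ennreal (e/2) + ennreal (e/2) = ennreal e" using e by (simp flip: ennreal_plus)
  \<comment> \<open>The inner approximations may be empty; adding a point of \<open>A\<close> and a
    point of \<open>B\<close> makes them nonempty, as the compact case requires.\<close>
  also have "emeasure lborel K + emeasure lborel L \<le> emeasure lborel (insert u K) + emeasure lborel (insert v L)"
    using K L by (intro add_mono mono)
  also have "\<dots> \<le> emeasure lborel C"
    using K L uv by (intro brunn_minkowski_1_compact C sub compact_insert) auto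
  finally show "emeasure lborel A + emeasure lborel B \<le> emeasure lborel C + ennreal e"
    by (simp add: add_right_mono)
qed

text \<open>Fubini for the region under the graph, truncated at height \<open>M\<close>. The level
  is rescaled to the unit interval so that functions with different suprema can be compared at the
  same relative level.\<close>

lemma layer_cake:
  fixes f :: "real \<Rightarrow> real"
  assumes [measurable]: "f \<in> borel_measurable borel" and f: "\<And>x. 0 \<le> f x" and M: "0 < M"
  shows "ennreal M * (\<integral>\<^sup>+\<tau>. emeasure lborel {x. M * \<tau> < f x} * indicator {0<..<1} \<tau> \<partial>lborel)
       = (\<integral>\<^sup>+x. ennreal (min M (f x)) \<partial>lborel)"
proof -
  define h :: "real \<Rightarrow> real \<Rightarrow> ennreal" where "h x \<tau> = (if M * \<tau> < f x then 1 else 0) * indicator {0<..<1} \<tau>" for x \<tau>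
  have hm: "case_prod h \<in> borel_measurable (lborel \<Otimes>\<^sub>M lborel)"
    unfolding h_def split_beta' by measurable
  have "(\<integral>\<^sup>+\<tau>. emeasure lborel {x. M * \<tau> < f x} * indicator {0<..<1} \<tau> \<partial>lborel)
      = (\<integral>\<^sup>+\<tau>. \<integral>\<^sup>+x. h x \<tau> \<partial>lborel \<partial>lborel)"
  proof (rule nn_integral_cong)
    fix \<tau> :: real
    have [measurable]: "{x. M * \<tau> < f x} \<in> sets borel" by measurable
    have "(\<integral>\<^sup>+x. h x \<tau> \<partial>lborel) = (\<integral>\<^sup>+x. indicator {x. M * \<tau> < f x} x * indicator {0<..<1} \<tau> \<partial>lborel)"
      by (intro nn_integral_cong) (simp add: h_def indicator_def)
    also have "\<dots> = emeasure lborel {x. M * \<tau> < f x} * indicator {0<..<1} \<tau>"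
      by (subst nn_integral_multc) auto
    finally show "emeasure lborel {x. M * \<tau> < f x} * indicator {0<..<1} \<tau> = (\<integral>\<^sup>+x. h x \<tau> \<partial>lborel)" ..
  qed
  also have "\<dots> = (\<integral>\<^sup>+x. \<integral>\<^sup>+\<tau>. h x \<tau> \<partial>lborel \<partial>lborel)"
    by (rule lborel_pair.Fubini'[OF hm])
  also have "\<dots> = (\<integral>\<^sup>+x. ennreal (min M (f x) / M) \<partial>lborel)"
  proof (rule nn_integral_cong)
    fix x :: real
    have "(\<integral>\<^sup>+\<tau>. h x \<tau> \<partial>lborel) = (\<integral>\<^sup>+\<tau>. indicator {0<..<min M (f x) / M} \<tau> \<partial>lborel)"
    proof (intro nn_integral_cong)
      fix \<tau> :: real
      have "M * \<tau> < f x \<and> \<tau> \<in> {0<..<1} \<longleftrightarrow> \<tau> \<in> {0<..<min M (f x) / M}"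
        using M by (auto simp: pos_less_divide_eq mult.commute)
      then show "h x \<tau> = indicator {0<..<min M (f x) / M} \<tau>"
        by (auto simp: h_def indicator_def)
    qed
    also have "\<dots> = ennreal (min M (f x) / M)" using M f[of x] by simp
    finally show "(\<integral>\<^sup>+\<tau>. h x \<tau> \<partial>lborel) = ennreal (min M (f x) / M)" .
  qed
  finally have eq: "(\<integral>\<^sup>+\<tau>. emeasure lborel {x. M * \<tau> < f x} * indicator {0<..<1} \<tau> \<partial>lborel)
    = (\<integral>\<^sup>+x. ennreal (min M (f x) / M) \<partial>lborel)" .
  show ?thesis unfolding eq using M f
    by (subst nn_integral_cmult[symmetric]) (auto intro!: nn_integral_cong simp flip: ennreal_mult)
qed

section \<open>Vertical slices of a bounded open plane set and their lengths\<close>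

definition slice :: "(real^2) set \<Rightarrow> real \<Rightarrow> real set" where "slice A x = {y. xy (x, y) \<in> A}"

definition slice_length :: "(real^2) set \<Rightarrow> real \<Rightarrow> real" where
  "slice_length A x = measure lborel (slice A x)"

context
  fixes A :: "(real^2) set"
  assumes A: "open A" "bounded A"
begin

lemma slice_borel [measurable]: "slice A x \<in> sets borel"
proof -
  have "(\<lambda>y. xy (x, y)) \<in> borel_measurable borel"
    by (intro borel_measurable_continuous_onI continuous_on_compose2[OF continuous_on_xy[of UNIV]] continuous_intros) auto
  from measurable_sets[OF this, of A] show ?thesis using A by (simp add: slice_def vimage_def)
qed

lemma slice_indicator: "(indicator A (xy (x, y)) :: ennreal) = indicator (slice A x) y"
  by (simp add: slice_def indicator_def)

lemma slice_length_bound: obtains B where "\<And>x. slice_length A x \<le> B" "\<And>x. emeasure lborel (slice A x) = ennreal (slice_length A x)"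
proof -
  obtain B where B: "B > 0" "\<And>z. z \<in> A \<Longrightarrow> norm z \<le> B" using A(2) bounded_pos by metis
  have sub: "slice A x \<subseteq> {-B..B}" for x
  proof
    fix y assume "y \<in> slice A x"
    then have "norm (xy (x, y)) \<le> B" using B by (simp add: slice_def)
    moreover have "\<bar>y\<bar> \<le> norm (xy (x, y))" using component_le_norm_cart[of "xy (x,y)" 2] by simp
    ultimately show "y \<in> {-B..B}" by auto
  qed
  have le: "emeasure lborel (slice A x) \<le> ennreal (2 * B)" for x
    using emeasure_mono[OF sub[of x], of lborel] B by simp
  have fin: "emeasure lborel (slice A x) < \<infinity>" for x
    using le[of x] by (simp add: order_le_less_trans)
  have eq: "emeasure lborel (slice A x) = ennreal (slice_length A x)" for x
    unfolding slice_length_def using fin[of x] by (intro emeasure_eq_ennreal_measure) auto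
  have "slice_length A x \<le> 2 * B" for x
    using le[of x] B unfolding eq by (simp add: ennreal_le_iff)
  with eq show ?thesis using that by blast
qed

lemma slice_bounded: obtains B where "\<And>x. slice A x \<subseteq> {-B..B}" "\<And>x. slice A x \<noteq> {} \<Longrightarrow> \<bar>x\<bar> \<le> B"
proof -
  obtain B where B: "B > 0" "\<And>z. z \<in> A \<Longrightarrow> norm z \<le> B" using A(2) bounded_pos by metis
  have "\<bar>x\<bar> \<le> B \<and> \<bar>y\<bar> \<le> B" if "y \<in> slice A x" for x y
    using that B(2)[of "xy (x, y)"] component_le_norm_cart[of "xy (x,y)" 1] component_le_norm_cart[of "xy (x,y)" 2]
    by (simp add: slice_def)
  then show ?thesis using that[of B] by (force simp: abs_le_iff)
qed

lemma bounded_slice: "bounded (slice A x)"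
  using slice_bounded bounded_closed_interval bounded_subset by metis

lemma bounded_slice_level:
  assumes "0 < t"
  shows "bounded {x. t < slice_length A x}"
proof -
  obtain B where B: "\<And>x. slice A x \<noteq> {} \<Longrightarrow> \<bar>x\<bar> \<le> B" using slice_bounded by metis
  have "\<bar>x\<bar> \<le> B" if "t < slice_length A x" for x
    using that assms by (intro B) (auto simp: slice_length_def)
  then show ?thesis by (auto simp: bounded_iff)
qed

lemma emeasure_slice: "emeasure lborel (slice A x) = ennreal (slice_length A x)"
  using slice_length_bound by metis

lemma slice_length_nonneg: "0 \<le> slice_length A x" by (simp add: slice_length_def)

lemma borel_measurable_slice_length [measurable]: "slice_length A \<in> borel_measurable borel"
proof -
  have [measurable]: "A \<in> sets borel" using A by simp
  have "(\<lambda>p. indicator A (xy p) :: ennreal) \<in> borel_measurable borel" by measurable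
  then have [measurable]: "(\<lambda>p. indicator A (xy p) :: ennreal) \<in> borel_measurable (borel \<Otimes>\<^sub>M borel)" by (simp add: borel_prod)
  have "(\<lambda>x. \<integral>\<^sup>+y. indicator A (xy (x, y)) \<partial>lborel) \<in> borel_measurable borel" by measurable
  moreover have "(\<integral>\<^sup>+y. indicator A (xy (x, y)) \<partial>lborel) = emeasure lborel (slice A x)" for x
    by (simp add: slice_indicator)
  ultimately have [measurable]: "(\<lambda>x. emeasure lborel (slice A x)) \<in> borel_measurable borel" by simp
  show ?thesis unfolding slice_length_def[abs_def] measure_def by measurable
qed

lemma emeasure_via_slices: "emeasure lborel A = (\<integral>\<^sup>+x. ennreal (slice_length A x) \<partial>lborel)"
proof -
  have [measurable]: "A \<in> sets borel" using A by simp
  have "emeasure lborel A = (\<integral>\<^sup>+z. indicator A z \<partial>lborel)" by simp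
  also have "\<dots> = (\<integral>\<^sup>+x. \<integral>\<^sup>+y. indicator A (xy (x, y)) \<partial>lborel \<partial>lborel)" by (rule nn_integral_lborel_vec2) measurable
  also have "\<dots> = (\<integral>\<^sup>+x. ennreal (slice_length A x) \<partial>lborel)"
  proof (rule nn_integral_cong)
    fix x
    have "(\<integral>\<^sup>+y. indicator A (xy (x, y)) \<partial>lborel) = emeasure lborel (slice A x)"
      by (simp add: slice_indicator)
    then show "(\<integral>\<^sup>+y. indicator A (xy (x, y)) \<partial>lborel) = ennreal (slice_length A x)" by (simp add: emeasure_slice)
  qed
  finally show ?thesis .
qed

text \<open>A nonempty open set has positive area, so not all slices are null. The last claim makes
  every relative superlevel set nonempty, a condition of the one-dimensional inequality.\<close>

lemma slice_sup:
  assumes "A \<noteq> {}"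
  shows "0 < (SUP x. slice_length A x)" and "slice_length A x \<le> (SUP x. slice_length A x)"
    and "\<tau> < 1 \<Longrightarrow> \<exists>x. (SUP x. slice_length A x) * \<tau> < slice_length A x"
proof -
  obtain B where B: "\<And>x. slice_length A x \<le> B" using slice_length_bound by metis
  have bdd: "bdd_above (range (slice_length A))" using B by (auto simp: bdd_above_def)
  show le: "slice_length A x \<le> (SUP x. slice_length A x)" for x by (intro cSUP_upper bdd) auto
  show pos: "0 < (SUP x. slice_length A x)"
  proof (rule ccontr)
    assume "\<not> ?thesis"
    then have "slice_length A x = 0" for x using le[of x] slice_length_nonneg[of x] by simp
    then have "emeasure lborel A = 0" by (simp add: emeasure_via_slices)
    moreover have "emeasure lborel A > 0" using open_not_negligible[OF A(1) assms] A(1)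
      by (simp add: negligible_iff_null_sets null_sets_def zero_less_iff_neq_zero)
    ultimately show False by simp
  qed
  show "\<exists>x. (SUP x. slice_length A x) * \<tau> < slice_length A x" if "\<tau> < 1"
  proof -
    have "(SUP x. slice_length A x) * \<tau> < (SUP x. slice_length A x)" using that pos by simp
    then show ?thesis using less_cSUP_iff[OF _ bdd] by auto
  qed
qed

end

lemma xy_add: "xy (a + b, c + d) = xy (a, c) + xy (b, d)"
  by (simp add: xy_def algebra_simps)

text \<open>Bonnesen's argument: the superlevel sets of the slice lengths, normalised by their suprema
  \<open>\<alpha>\<close> and \<open>\<beta>\<close>, satisfy the one-dimensional inequality; integrating over the level gives
  \<open>(\<alpha> + \<beta>) (\<bar>A\<bar>/\<alpha> + \<bar>B\<bar>/\<beta>)\<close> as a lower bound.\<close>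

lemma brunn_minkowski_2:
  fixes A B C :: "(real^2) set"
  assumes A: "open A" "bounded A" "A \<noteq> {}" and B: "open B" "bounded B" "B \<noteq> {}"
    and C: "open C" "bounded C" and sub: "\<And>x y. x \<in> A \<Longrightarrow> y \<in> B \<Longrightarrow> x + y \<in> C"
  shows "measure lborel A + measure lborel B + 2 * sqrt (measure lborel A * measure lborel B) \<le> measure lborel C"
proof -
  let ?a = "slice_length A" and ?b = "slice_length B" and ?c = "slice_length C"
  define \<alpha> where "\<alpha> = (SUP x. ?a x)"
  define \<beta> where "\<beta> = (SUP x. ?b x)"
  note as = slice_sup[OF A, folded \<alpha>_def] and bs = slice_sup[OF B, folded \<beta>_def]
  \<comment> \<open>The one-dimensional inequality in the vertical direction: the slice of
    \<open>C\<close> over \<open>x + y\<close> contains the sum of the two slices.\<close>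
  have sup_add: "?a x + ?b y \<le> ?c (x + y)" if "0 < ?a x" "0 < ?b y" for x y
  proof -
    have ne: "slice A x \<noteq> {}" "slice B y \<noteq> {}" using that by (auto simp: slice_length_def)
    have "ennreal (?a x) + ennreal (?b y) \<le> ennreal (?c (x + y))"
      unfolding emeasure_slice[OF A(1,2), symmetric] emeasure_slice[OF B(1,2), symmetric] emeasure_slice[OF C, symmetric]
    proof (rule brunn_minkowski_1)
      fix u v assume "u \<in> slice A x" "v \<in> slice B y"
      then show "u + v \<in> slice C (x + y)" using sub by (simp add: slice_def xy_add)
    qed (use ne A B C in \<open>simp_all add: slice_borel bounded_slice\<close>)
    then show ?thesis by (simp add: slice_length_nonneg A B C ennreal_le_iff flip: ennreal_plus)
  qed
  define I where "I f M = (\<integral>\<^sup>+\<tau>. emeasure lborel {x. M * \<tau> < f x} * indicator {0<..<1} \<tau> \<partial>lborel)"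
    for f :: "real \<Rightarrow> real" and M :: real
  have IA: "ennreal \<alpha> * I ?a \<alpha> = emeasure lborel A"
    unfolding I_def layer_cake[OF borel_measurable_slice_length[OF A(1,2)] slice_length_nonneg[OF A(1,2)] as(1)]
      emeasure_via_slices[OF A(1,2)] using as(2) by (simp add: min_absorb2)
  have IB: "ennreal \<beta> * I ?b \<beta> = emeasure lborel B"
    unfolding I_def layer_cake[OF borel_measurable_slice_length[OF B(1,2)] slice_length_nonneg[OF B(1,2)] bs(1)]
      emeasure_via_slices[OF B(1,2)] using bs(2) by (simp add: min_absorb2)
  \<comment> \<open>Only an inequality: slices of \<open>C\<close> may be longer than
    \<open>\<alpha> + \<beta>\<close>, and the truncated layer formula ignores the excess.\<close>
  have IC: "ennreal (\<alpha> + \<beta>) * I ?c (\<alpha> + \<beta>) \<le> emeasure lborel C"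
  proof -
    have "0 < \<alpha> + \<beta>" using as(1) bs(1) by simp
    then show ?thesis
      unfolding I_def layer_cake[OF borel_measurable_slice_length[OF C] slice_length_nonneg[OF C] \<open>0 < \<alpha> + \<beta>\<close>]
        emeasure_via_slices[OF C] by (intro nn_integral_mono ennreal_leI) simp
  qed
  have [measurable]: "?a \<in> borel_measurable borel" "?b \<in> borel_measurable borel" "?c \<in> borel_measurable borel"
    using borel_measurable_slice_length A B C by auto
  have Im: "(\<lambda>\<tau>. emeasure lborel {x. M * \<tau> < f x} * indicator {0<..<1} \<tau>) \<in> borel_measurable borel"
    if f: "f \<in> borel_measurable borel" for f :: "real \<Rightarrow> real" and M :: real
  proof -
    have [measurable]: "(\<lambda>p. f (snd p)) \<in> borel_measurable (borel \<Otimes>\<^sub>M lborel)"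
      by (rule measurable_compose[OF measurable_snd]) (use f in simp)
    have "{p \<in> space (borel \<Otimes>\<^sub>M lborel). M * fst p < f (snd p)} \<in> sets (borel \<Otimes>\<^sub>M lborel)"
      by measurable
    from lborel.measurable_emeasure_Pair[OF this]
    have "(\<lambda>\<tau>. emeasure lborel (Pair \<tau> -` {p \<in> space (borel \<Otimes>\<^sub>M lborel). M * fst p < f (snd p)})) \<in> borel_measurable borel" .
    moreover have "Pair \<tau> -` {p \<in> space (borel \<Otimes>\<^sub>M lborel). M * fst p < f (snd p)} = {x. M * \<tau> < f x}" for \<tau>
      by (auto simp: space_pair_measure)
    ultimately have [measurable]: "(\<lambda>\<tau>. emeasure lborel {x. M * \<tau> < f x}) \<in> borel_measurable borel" by simp
    show ?thesis by measurable
  qed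
  have "I ?a \<alpha> + I ?b \<beta> = (\<integral>\<^sup>+\<tau>. emeasure lborel {x. \<alpha> * \<tau> < ?a x} * indicator {0<..<1} \<tau>
      + emeasure lborel {x. \<beta> * \<tau> < ?b x} * indicator {0<..<1} \<tau> \<partial>lborel)"
    unfolding I_def by (rule nn_integral_add[symmetric]) (use Im in auto)
  also have "\<dots> \<le> I ?c (\<alpha> + \<beta>)"
    unfolding I_def
  proof (rule nn_integral_mono)
    fix \<tau> :: real
    show "emeasure lborel {x. \<alpha> * \<tau> < ?a x} * indicator {0<..<1} \<tau> + emeasure lborel {x. \<beta> * \<tau> < ?b x} * indicator {0<..<1} \<tau>
      \<le> emeasure lborel {x. (\<alpha> + \<beta>) * \<tau> < ?c x} * indicator {0<..<1} \<tau>"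
    proof (cases "\<tau> \<in> {0<..<1}")
      case True
      \<comment> \<open>The one-dimensional inequality a second time, now horizontally, between
        superlevel sets at the same relative level.\<close>
      have "emeasure lborel {x. \<alpha> * \<tau> < ?a x} + emeasure lborel {x. \<beta> * \<tau> < ?b x} \<le> emeasure lborel {x. (\<alpha> + \<beta>) * \<tau> < ?c x}"
      proof (rule brunn_minkowski_1)
        show "{x. \<alpha> * \<tau> < ?a x} \<noteq> {}" "{x. \<beta> * \<tau> < ?b x} \<noteq> {}" using as(3) bs(3) True by auto
        show "bounded {x. \<alpha> * \<tau> < ?a x}" "bounded {x. \<beta> * \<tau> < ?b x}"
          using True as(1) bs(1) A B by (auto intro!: bounded_slice_level)
        fix x y assume "x \<in> {x. \<alpha> * \<tau> < ?a x}" "y \<in> {x. \<beta> * \<tau> < ?b x}"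
        then have xy: "\<alpha> * \<tau> < ?a x" "\<beta> * \<tau> < ?b y" by auto
        moreover have "0 < \<alpha> * \<tau>" "0 < \<beta> * \<tau>" using True as(1) bs(1) by auto
        ultimately have "?a x + ?b y \<le> ?c (x + y)" by (intro sup_add) linarith+
        then show "x + y \<in> {x. (\<alpha> + \<beta>) * \<tau> < ?c x}" using xy by (simp add: distrib_right)
      qed measurable
      then show ?thesis using True by simp
    qed simp
  qed
  finally have key: "ennreal (\<alpha> + \<beta>) * (I ?a \<alpha> + I ?b \<beta>) \<le> emeasure lborel C"
    using IC mult_left_mono order_trans by (metis zero_le)
  have fin: "emeasure lborel S = ennreal (measure lborel S)" if "bounded S" "open S" for S :: "(real^2) set"
    using emeasure_bounded_finite[OF that(1)] by (intro emeasure_eq_ennreal_measure) auto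
  let ?A = "measure lborel A" and ?B = "measure lborel B"
  have Ia: "I ?a \<alpha> = ennreal (?A / \<alpha>)"
  proof -
    have "I ?a \<alpha> = ennreal (1 / \<alpha>) * (ennreal \<alpha> * I ?a \<alpha>)"
      using as(1) by (simp add: mult.assoc[symmetric] flip: ennreal_mult)
    then show ?thesis unfolding IA fin[OF A(2,1)] using as(1) by (simp flip: ennreal_mult)
  qed
  have Ib: "I ?b \<beta> = ennreal (?B / \<beta>)"
  proof -
    have "I ?b \<beta> = ennreal (1 / \<beta>) * (ennreal \<beta> * I ?b \<beta>)"
      using bs(1) by (simp add: mult.assoc[symmetric] flip: ennreal_mult)
    then show ?thesis unfolding IB fin[OF B(2,1)] using bs(1) by (simp flip: ennreal_mult)
  qed
  have ab: "0 < \<alpha>" "0 < \<beta>" "0 \<le> ?A" "0 \<le> ?B" using as(1) bs(1) by auto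
  have "(\<alpha> + \<beta>) * (?A / \<alpha> + ?B / \<beta>) \<le> measure lborel C"
    using key ab unfolding Ia Ib fin[OF C(2,1)]
    by (simp add: ennreal_le_iff flip: ennreal_plus ennreal_mult)
  moreover have "(\<alpha> + \<beta>) * (?A / \<alpha> + ?B / \<beta>) = ?A + ?B + (\<beta> / \<alpha> * ?A + \<alpha> / \<beta> * ?B)"
    using ab by (simp add: field_simps)
  \<comment> \<open>The product of the two cross terms does not depend on \<open>\<alpha>\<close>
    and \<open>\<beta>\<close>, so the inequality of arithmetic and geometric means removes the
    unknown suprema.\<close>
  moreover have "2 * sqrt (?A * ?B) \<le> \<beta> / \<alpha> * ?A + \<alpha> / \<beta> * ?B"
  proof -
    have "\<beta> / \<alpha> * ?A * (\<alpha> / \<beta> * ?B) = ?A * ?B" using ab by simp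
    then show ?thesis using arith_geo_mean_sqrt[of "\<beta> / \<alpha> * ?A" "\<alpha> / \<beta> * ?B"] ab by simp
  qed
  ultimately show ?thesis by simp
qed

text \<open>Minkowski's argument with the unit disk: the sum with it lies in the parallel set at
  distance 1, whose area is at most \<open>|\<Omega>| + L + \<pi>\<close> by Steiner's formula, and
  Brunn-Minkowski bounds that area below by
  \<open>|\<Omega>| + \<pi> + 2 sqrt (\<pi> |\<Omega>|)\<close>.\<close>

theorem isoperimetric_inequality:
  assumes "convex_smooth_domain \<Omega>" "\<Omega> \<noteq> {}"
  shows "2 * sqrt (pi * measure lborel \<Omega>) \<le> perimeter \<Omega>"
proof -
  have dom: "open \<Omega>" "convex \<Omega>" "\<Omega> \<noteq> {}" "bounded \<Omega>"
    using assms by (auto simp: convex_smooth_domain_def)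
  let ?K = "closure \<Omega>" and ?A = "{y. y \<notin> closure \<Omega> \<and> infdist y (closure \<Omega>) < 1}"
  define C where "C = {y. infdist y ?K < 1}"
  have C: "open C" unfolding C_def by (intro open_Collect_less continuous_intros)
  obtain x0 D where D: "?K \<subseteq> ball x0 D"
    using bounded_subset_ballD[OF bounded_closure[OF dom(4)]] by blast
  have "C \<subseteq> ball x0 (D + 1)"
  proof
    fix y assume y: "y \<in> C"
    have cp: "closest_point ?K y \<in> ?K" using dom by (intro closest_point_in_set) auto
    have "dist x0 y \<le> dist x0 (closest_point ?K y) + dist (closest_point ?K y) y" by (rule dist_triangle)
    also have "\<dots> < D + 1" using D cp y dom
      by (intro add_strict_mono) (auto simp: C_def infdist_closest_point dist_commute)
    finally show "y \<in> ball x0 (D + 1)" by simp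
  qed
  then have bC: "bounded C" by (rule bounded_subset[OF bounded_ball])
  have "measure lborel \<Omega> + measure lborel (ball (0::real^2) 1) + 2 * sqrt (measure lborel \<Omega> * measure lborel (ball (0::real^2) 1)) \<le> measure lborel C"
  proof (rule brunn_minkowski_2[OF dom(1,4,3) _ _ _ C bC])
    fix x y :: "real^2" assume "x \<in> \<Omega>" "y \<in> ball 0 1"
    then have "infdist (x + y) ?K \<le> dist (x + y) x" by (intro infdist_le closure_subset[THEN subsetD])
    also have "\<dots> < 1" using \<open>y \<in> ball 0 1\<close> by (simp add: dist_norm)
    finally show "x + y \<in> C" by (simp add: C_def)
  qed auto
  moreover have "measure lborel (ball (0::real^2) 1) = pi"
    using emeasure_ball_2[of 1 0] by (simp add: measure_def)
  moreover have "measure lborel C \<le> measure lborel \<Omega> + (perimeter \<Omega> + pi)"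
  proof -
    have Ab: "?A \<in> sets borel"
      using closest_point_fibre_borel[of ?K UNIV 1] dom by (simp add: convex_closure)
    \<comment> \<open>The boundary of a convex set is a null set, so passing to the closure costs no
      area.\<close>
    have KO: "emeasure lborel ?K = emeasure lborel \<Omega>"
    proof -
      have "emeasure lborel (frontier \<Omega>) = 0"
        using negligible_convex_frontier[OF dom(2)] by (simp add: negligible_iff_null_sets null_sets_def borel_closed)
      moreover have "?K = \<Omega> \<union> frontier \<Omega>" using dom(1) closure_subset[of \<Omega>] by (auto simp: frontier_def interior_open)
      ultimately show ?thesis using emeasure_Un_null_set[of \<Omega> lborel "frontier \<Omega>"] dom(1)
        by (simp add: null_sets_def borel_closed)
    qed
    have "C \<subseteq> ?K \<union> ?A" by (auto simp: C_def)
    then have "emeasure lborel C \<le> emeasure lborel (?K \<union> ?A)" using Ab by (intro emeasure_mono) auto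
    also have "\<dots> \<le> emeasure lborel ?K + emeasure lborel ?A" using Ab by (intro emeasure_subadditive) auto
    also have "\<dots> = emeasure lborel \<Omega> + ennreal (perimeter \<Omega> + pi)"
      using steiner_formula(2)[OF assms, of 1] KO by simp
    also have "\<dots> = ennreal (measure lborel \<Omega> + (perimeter \<Omega> + pi))"
      using emeasure_bounded_finite[OF dom(4)] by (simp add: emeasure_eq_ennreal_measure perimeter_def less_top)
    finally have "ennreal (measure lborel C) \<le> ennreal (measure lborel \<Omega> + (perimeter \<Omega> + pi))"
      using emeasure_bounded_finite[OF bC] by (simp add: emeasure_eq_ennreal_measure less_top del: ennreal_plus)
    moreover have "0 \<le> measure lborel \<Omega> + (perimeter \<Omega> + pi)" by (simp add: perimeter_def)
    ultimately show ?thesis by (simp only: ennreal_le_iff)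
  qed
  ultimately show ?thesis by (simp add: mult.commute)
qed

section \<open>Smooth functions and disks\<close>

text \<open>Since derivatives are unique, any candidate derivative may stand in for
  \<open>frechet_derivative\<close>; the closure properties of \<open>Ck\<close> then go by
  induction on the order.\<close>

lemma Ck_SucI:
  assumes "\<And>x. (f has_derivative f' x) (at x)" "\<And>b. b \<in> Basis \<Longrightarrow> Ck k (\<lambda>x. f' x b)"
  shows "Ck (Suc k) f"
proof -
  have "frechet_derivative f (at x) = f' x" for x using frechet_derivative_at[OF assms(1)] by simp
  then show ?thesis using assms by (auto simp: differentiable_def)
qed

lemma Ck_SucE:
  assumes "Ck (Suc k) f"
  obtains f' where "\<And>x. (f has_derivative f' x) (at x)" "\<And>b. b \<in> Basis \<Longrightarrow> Ck k (\<lambda>x. f' x b)"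
proof (rule that)
  show "(f has_derivative frechet_derivative f (at x)) (at x)" for x
    using assms by (intro iffD1[OF frechet_derivative_works]) simp
  show "Ck k (\<lambda>x. frechet_derivative f (at x) b)" if "b \<in> Basis" for b using assms that by simp
qed

lemma Ck_continuous: "Ck k f \<Longrightarrow> continuous_on UNIV f"
  by (cases k) (auto intro!: continuous_at_imp_continuous_on differentiable_imp_continuous_within)

lemma Ck_decr: "Ck (Suc k) f \<Longrightarrow> Ck k f"
proof (induction k arbitrary: f)
  case 0 then show ?case using Ck_continuous[OF 0] by simp
next
  case (Suc k)
  then show ?case by (metis Ck.simps(2))
qed

lemma Ck_const: "Ck k (\<lambda>_. c)"
  by (induction k arbitrary: c) (auto intro!: Ck_SucI[where f'="\<lambda>_ _. 0"])

lemma Ck_add: "Ck k f \<Longrightarrow> Ck k g \<Longrightarrow> Ck k (\<lambda>x. f x + g x)"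
proof (induction k arbitrary: f g)
  case 0 then show ?case by (simp add: continuous_on_add)
next
  case (Suc k)
  obtain f' g' where d: "\<And>x. (f has_derivative f' x) (at x)" "\<And>b. b \<in> Basis \<Longrightarrow> Ck k (\<lambda>x. f' x b)"
    "\<And>x. (g has_derivative g' x) (at x)" "\<And>b. b \<in> Basis \<Longrightarrow> Ck k (\<lambda>x. g' x b)"
    using Ck_SucE[OF Suc.prems(1)] Ck_SucE[OF Suc.prems(2)] by metis
  show ?case
    by (rule Ck_SucI[where f'="\<lambda>x h. f' x h + g' x h"]) (use d Suc.IH in \<open>auto intro: has_derivative_add\<close>)
qed

lemma Ck_bilinear:
  assumes "bounded_bilinear B"
  shows "Ck k f \<Longrightarrow> Ck k g \<Longrightarrow> Ck k (\<lambda>x. B (f x) (g x))"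
proof (induction k arbitrary: f g)
  case 0 then show ?case using bounded_bilinear.continuous_on[OF assms] by simp
next
  case (Suc k)
  obtain f' g' where d: "\<And>x. (f has_derivative f' x) (at x)" "\<And>b. b \<in> Basis \<Longrightarrow> Ck k (\<lambda>x. f' x b)"
    "\<And>x. (g has_derivative g' x) (at x)" "\<And>b. b \<in> Basis \<Longrightarrow> Ck k (\<lambda>x. g' x b)"
    using Ck_SucE[OF Suc.prems(1)] Ck_SucE[OF Suc.prems(2)] by metis
  show ?case
  proof (rule Ck_SucI[where f'="\<lambda>x h. B (f x) (g' x h) + B (f' x h) (g x)"])
    show "((\<lambda>x. B (f x) (g x)) has_derivative (\<lambda>h. B (f x) (g' x h) + B (f' x h) (g x))) (at x)" for x
      by (rule bounded_bilinear.FDERIV[OF assms d(1,3)])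
    show "Ck k (\<lambda>x. B (f x) (g' x b) + B (f' x b) (g x))" if "b \<in> Basis" for b
      by (intro Ck_add Suc.IH Ck_decr[OF Suc.prems(1)] Ck_decr[OF Suc.prems(2)] d(2,4) that)
  qed
qed

lemmas Ck_mult = Ck_bilinear[OF bounded_bilinear_mult]
lemmas Ck_inner = Ck_bilinear[OF bounded_bilinear_inner]

lemma Ck_linear: "bounded_linear h \<Longrightarrow> Ck k h"
proof (cases k)
  case 0
  assume "bounded_linear h"
  then show ?thesis using 0 by (simp add: linear_continuous_on)
next
  case (Suc j)
  assume "bounded_linear h"
  then show ?thesis unfolding Suc
    by (intro Ck_SucI[where f'="\<lambda>_. h"] Ck_const bounded_linear_imp_has_derivative)
qed

lemma Ck_linear_compose:
  assumes "bounded_linear h"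
  shows "Ck k f \<Longrightarrow> Ck k (\<lambda>x. h (f x))"
proof (induction k arbitrary: f)
  case 0 then show ?case using bounded_linear.continuous_on[OF assms] by simp
next
  case (Suc k)
  obtain f' where d: "\<And>x. (f has_derivative f' x) (at x)" "\<And>b. b \<in> Basis \<Longrightarrow> Ck k (\<lambda>x. f' x b)"
    using Ck_SucE[OF Suc.prems(1)] by metis
  show ?case
    by (rule Ck_SucI[where f'="\<lambda>x b. h (f' x b)"])
       (intro bounded_linear.has_derivative[OF assms d(1)], intro Suc.IH d(2))
qed

lemma Ck_diff:
  assumes "Ck k f" "Ck k g" shows "Ck k (\<lambda>x. f x - g x)"
  using Ck_add[OF assms(1) Ck_linear_compose[OF bounded_linear_minus[OF bounded_linear_ident] assms(2)]] by simp

text \<open>Differentiation lowers the exponent by one, so the induction runs over all exponents at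
  once. The exponents 1/2 and -1 provide square roots and reciprocals.\<close>

lemma Ck_powr:
  fixes f :: "'a::euclidean_space \<Rightarrow> real"
  assumes pos: "\<And>x. 0 < f x"
  shows "Ck k f \<Longrightarrow> Ck k (\<lambda>x. f x powr a)"
proof (induction k arbitrary: a)
  case 0 then show ?case using pos by (auto intro!: continuous_on_powr continuous_on_const) (metis less_irrefl)
next
  case (Suc k)
  obtain f' where d: "\<And>x. (f has_derivative f' x) (at x)" "\<And>b. b \<in> Basis \<Longrightarrow> Ck k (\<lambda>x. f' x b)"
    using Ck_SucE[OF Suc.prems(1)] by metis
  show ?case
  proof (rule Ck_SucI[where f'="\<lambda>x h. (a * f x powr (a - 1)) * f' x h"])
    show "((\<lambda>x. f x powr a) has_derivative (\<lambda>h. (a * f x powr (a - 1)) * f' x h)) (at x)" for x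
    proof -
      have "((\<lambda>y. y powr a) has_derivative (\<lambda>h. (a * f x powr (a - 1)) * h)) (at (f x))"
        using has_real_derivative_powr[OF pos[of x], of a] by (simp add: has_field_derivative_def)
      from has_derivative_compose[OF d(1) this] show ?thesis .
    qed
    show "Ck k (\<lambda>x. (a * f x powr (a - 1)) * f' x b)" if "b \<in> Basis" for b
      by (intro Ck_mult Ck_const d(2) that Suc.IH Ck_decr[OF Suc.prems])
  qed
qed

text \<open>The family closed under differentiation that contains the flat function \<open>exp (- 1/t)\<close>.\<close>

definition flat :: "nat \<Rightarrow> real \<Rightarrow> real" where
  "flat m t = (if 0 < t then (1/t)^m * exp (- (1/t)) else 0)"

lemma flat_tendsto_0: "(flat m \<longlongrightarrow> 0) (at 0)"
proof (rule filterlim_split_at)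
  have "((\<lambda>t::real. 0) \<longlongrightarrow> (0::real)) (at_left 0)" by simp
  then show "(flat m \<longlongrightarrow> 0) (at_left 0)"
    by (rule Lim_transform_eventually) (auto simp: eventually_at_filter flat_def)
  have "((\<lambda>t. (inverse t)^m / exp (inverse t)) \<longlongrightarrow> (0::real)) (at_right 0)"
    by (rule filterlim_compose[OF tendsto_power_div_exp_0 filterlim_inverse_at_top_right])
  then show "(flat m \<longlongrightarrow> 0) (at_right 0)"
    by (rule Lim_transform_eventually)
       (auto simp: eventually_at_filter flat_def exp_minus inverse_eq_divide)
qed

lemma flat_deriv: "(flat m has_real_derivative (flat (m+2) t - real m * flat (m+1) t)) (at t)"
proof -
  consider "t < 0" | "t = 0" | "0 < t" by linarith
  then show ?thesis
  proof cases
    case 1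
    have "((\<lambda>_. 0) has_real_derivative 0) (at t)" by simp
    then have "(flat m has_real_derivative 0) (at t)"
      by (rule has_field_derivative_transform_within_open[of _ _ _ "{..<0}"]) (use 1 in \<open>auto simp: flat_def\<close>)
    then show ?thesis using 1 by (simp add: flat_def)
  next
    case 2
    \<comment> \<open>The difference quotient at 0 is \<open>flat (m+1)\<close>, which tends to 0
      because the exponential beats every power.\<close>
    have "((\<lambda>h. (flat m h - flat m 0) / (h - 0)) \<longlongrightarrow> 0) (at 0)"
      by (rule Lim_transform_eventually[OF flat_tendsto_0[of "m+1"]])
         (auto simp: eventually_at_filter flat_def)
    then show ?thesis using 2 by (simp add: has_field_derivative_iff flat_def)
  next
    case 3
    have "((\<lambda>t. (1/t)^m * exp (- (1/t))) has_real_derivative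
        ((1/t)^(m+2) * exp (- (1/t)) - real m * ((1/t)^(m+1) * exp (- (1/t))))) (at t)"
      using 3 by (auto intro!: derivative_eq_intros simp: field_simps power2_eq_square) (cases m; simp add: field_simps power2_eq_square)
    then have "((\<lambda>t. (1/t)^m * exp (- (1/t))) has_real_derivative (flat (m+2) t - real m * flat (m+1) t)) (at t)"
      using 3 by (simp add: flat_def)
    then show ?thesis
      by (rule has_field_derivative_transform_within_open[of _ _ _ "{0<..}"]) (use 3 in \<open>auto simp: flat_def\<close>)
  qed
qed

lemma Ck_flat: "Ck k f \<Longrightarrow> Ck k (\<lambda>x. flat m (f x))"
proof (induction k arbitrary: m)
  case 0
  have "continuous_on UNIV (flat m)"
    using flat_deriv by (auto intro!: DERIV_isCont continuous_at_imp_continuous_on)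
  with 0 show ?case by (auto intro: continuous_on_compose2)
next
  case (Suc k)
  obtain f' where d: "\<And>x. (f has_derivative f' x) (at x)" "\<And>b. b \<in> Basis \<Longrightarrow> Ck k (\<lambda>x. f' x b)"
    using Ck_SucE[OF Suc.prems(1)] by metis
  show ?case
  proof (rule Ck_SucI[where f'="\<lambda>x h. (flat (m+2) (f x) - real m * flat (m+1) (f x)) * f' x h"])
    show "((\<lambda>x. flat m (f x)) has_derivative (\<lambda>h. (flat (m+2) (f x) - real m * flat (m+1) (f x)) * f' x h)) (at x)" for x
      by (rule has_derivative_compose[OF d(1)]) (use flat_deriv[of m "f x"] in \<open>simp add: has_field_derivative_def\<close>)
    show "Ck k (\<lambda>x. (flat (m+2) (f x) - real m * flat (m+1) (f x)) * f' x b)" if "b \<in> Basis" for b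
      by (intro Ck_mult Ck_diff Ck_const d(2) that Suc.IH Ck_decr[OF Suc.prems])
  qed
qed

lemma flat_nonneg: "0 \<le> flat m t" by (simp add: flat_def)
lemma flat_pos_iff: "0 < flat m t \<longleftrightarrow> 0 < t" by (simp add: flat_def)
lemma flat_zero: "t \<le> 0 \<Longrightarrow> flat m t = 0" by (simp add: flat_def)

text \<open>\<open>smooth_boundary\<close> demands a function smooth on the whole line, whereas the
  height of a circle has a square root singularity at the ends of the diameter. A cutoff inside the
  radicand agrees with the circle near \<open>s0\<close> and keeps the radicand positive
  elsewhere.\<close>

lemma smooth_arc_height:
  fixes R s0 h0 :: real
  assumes "R > 0"
  obtains \<gamma> where "smooth \<gamma>" "\<And>s. \<bar>s - s0\<bar> \<le> R / 2 \<Longrightarrow> \<gamma> s = h0 - sqrt (R\<^sup>2 - (s - s0)\<^sup>2)"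
proof -
  define \<sigma> where "\<sigma> s = (s - s0)^2 / R\<^sup>2" for s :: real
  \<comment> \<open>The quotient \<open>A / (A + B)\<close> is a smooth cutoff: it is 1 where
    \<open>\<sigma>\<close> \<le> 1/4, that is within R/2 of \<open>s0\<close>, and 0 where
    \<open>\<sigma>\<close> \<ge> 1/2. The radicand therefore never falls below half of R
    squared.\<close>
  define A where "A s = flat 0 (1/2 - \<sigma> s)" for s
  define B where "B s = flat 0 (\<sigma> s - 1/4)" for s
  define \<kappa> where "\<kappa> s = R\<^sup>2 - R\<^sup>2 * (\<sigma> s * (A s * (A s + B s) powr (-1)))" for s
  have AB: "0 < A s + B s" for s
  proof (cases "\<sigma> s < 1/2")
    case True then show ?thesis using flat_nonneg[of 0 "\<sigma> s - 1/4"] flat_pos_iff[of 0 "1/2 - \<sigma> s"] by (simp add: A_def B_def)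
  next
    case False then show ?thesis using flat_nonneg[of 0 "1/2 - \<sigma> s"] flat_pos_iff[of 0 "\<sigma> s - 1/4"] by (simp add: A_def B_def)
  qed
  have frac: "A s * (A s + B s) powr (-1) = A s / (A s + B s)" for s
    using AB[of s] by (simp add: powr_minus_divide)
  have le: "\<sigma> s * (A s / (A s + B s)) \<le> 1/2" for s
  proof (cases "\<sigma> s < 1/2")
    case True
    have "A s / (A s + B s) \<le> 1" using AB[of s] flat_nonneg by (simp add: B_def)
    moreover have "0 \<le> \<sigma> s" by (simp add: \<sigma>_def)
    ultimately have "\<sigma> s * (A s / (A s + B s)) \<le> \<sigma> s * 1" by (intro mult_left_mono)
    then show ?thesis using True by linarith
  qed (simp add: A_def flat_zero)
  have pos: "0 < \<kappa> s" for s
  proof -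
    have "R\<^sup>2 * (\<sigma> s * (A s / (A s + B s))) \<le> R\<^sup>2 * (1/2)" by (intro mult_left_mono le) simp
    also have "\<dots> < R\<^sup>2" using assms by simp
    finally show ?thesis unfolding \<kappa>_def frac by simp
  qed
  have "Ck k (\<lambda>s. h0 - \<kappa> s powr (1/2))" for k
  proof -
    have \<sigma>: "Ck k \<sigma>" unfolding \<sigma>_def divide_inverse power2_eq_square
      by (intro Ck_mult Ck_diff Ck_const Ck_linear bounded_linear_ident)
    have "Ck k A" "Ck k B" unfolding A_def[abs_def] B_def[abs_def] by (intro Ck_flat Ck_diff Ck_const \<sigma>)+
    then have "Ck k \<kappa>" unfolding \<kappa>_def[abs_def] using AB
      by (intro Ck_diff Ck_mult Ck_const \<sigma> Ck_powr Ck_add) auto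
    then show ?thesis using pos by (intro Ck_diff Ck_const Ck_powr)
  qed
  moreover have "h0 - \<kappa> s powr (1/2) = h0 - sqrt (R\<^sup>2 - (s - s0)\<^sup>2)" if "\<bar>s - s0\<bar> \<le> R / 2" for s
  proof -
    have "(s - s0)\<^sup>2 \<le> (R/2)\<^sup>2" using power_mono[OF that, of 2] by simp
    then have "\<sigma> s \<le> 1/4" using assms by (simp add: \<sigma>_def power2_eq_square field_simps)
    then have B0: "B s = 0" by (simp add: B_def flat_zero)
    then have "\<kappa> s = R\<^sup>2 - (s - s0)\<^sup>2"
      using AB[of s] assms unfolding \<kappa>_def frac by (simp add: \<sigma>_def)
    then show ?thesis using pos[of s] by (simp add: powr_half_sqrt)
  qed
  ultimately show ?thesis
    by (intro that[of "\<lambda>s. h0 - \<kappa> s powr (1/2)"]) (simp_all add: smooth_def)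
qed

lemma convex_smooth_domain_ball:
  assumes R: "R > 0"
  shows "convex_smooth_domain (ball (p :: real^2) R)"
  unfolding convex_smooth_domain_def smooth_boundary_def
proof (intro conjI ballI)
  fix z assume "z \<in> frontier (ball p R)"
  then have z: "dist p z = R" using R by simp
  define w where "w = (1/R) *\<^sub>R (z - p)"
  have w: "norm w = 1" "z = p + R *\<^sub>R w" using z R by (auto simp: w_def dist_norm norm_minus_commute)
  \<comment> \<open>An orthogonal map taking the outward radius \<open>w\<close> to the downward
    axis makes the disk lie locally above its lower arc; within R/2 of the boundary point the
    horizontal offset stays in the range where the cutoff is 1.\<close>
  have "norm (- axis 2 1 :: real^2) = 1" by simp
  then obtain T :: "real^2 \<Rightarrow> real^2" where T: "orthogonal_transformation T" "T w = - axis 2 1"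
    using orthogonal_transformation_exists_1[OF w(1)] by metis
  obtain \<gamma> where \<gamma>: "smooth \<gamma>" "\<And>s. \<bar>s - T p $ 1\<bar> \<le> R / 2 \<Longrightarrow> \<gamma> s = T p $ 2 - sqrt (R\<^sup>2 - (s - T p $ 1)\<^sup>2)"
    using smooth_arc_height[OF R] by metis
  have lin: "linear T" using T(1) by (simp add: orthogonal_transformation_def)
  have "ball p R \<inter> ball z (R/2) = {x \<in> ball z (R/2). T x $ 2 > \<gamma> (T x $ 1)}"
  proof (intro set_eqI)
    fix x
    show "x \<in> ball p R \<inter> ball z (R/2) \<longleftrightarrow> x \<in> {x \<in> ball z (R/2). T x $ 2 > \<gamma> (T x $ 1)}"
    proof (cases "x \<in> ball z (R/2)")
      case True
      define y where "y = T x - T p"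
      have "T x - T z = y - R *\<^sub>R T w" unfolding y_def w(2) by (simp add: linear_add[OF lin] linear_scale[OF lin])
      then have "norm (T (x - z)) = norm (y + R *\<^sub>R axis 2 1)" by (simp add: linear_diff[OF lin] T(2))
      then have n: "norm (y + R *\<^sub>R axis 2 1) < R / 2"
        using True orthogonal_transformation_norm[OF T(1), of "x - z"] by (simp add: dist_norm norm_minus_commute)
      have y1: "\<bar>y$1\<bar> < R/2" and y2: "\<bar>y$2 + R\<bar> < R/2"
        using n component_le_norm_cart[of "y + R *\<^sub>R axis 2 1" 1] component_le_norm_cart[of "y + R *\<^sub>R axis 2 1" 2]
        by (auto simp: axis_def)
      have "norm (x - p) = norm y" using orthogonal_transformation_norm[OF T(1), of "x - p"]
        by (simp add: y_def linear_diff[OF lin])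
      then have "x \<in> ball p R \<longleftrightarrow> (norm y)\<^sup>2 < R\<^sup>2"
        using R power_strict_mono[of "norm y" R 2] power2_less_imp_less[of "norm y" R]
        by (auto simp: dist_norm norm_minus_commute)
      also have "(norm y)\<^sup>2 = (y$1)\<^sup>2 + (y$2)\<^sup>2" by (simp add: norm_vec_def L2_set_def sum_2)
      also have "(y$1)\<^sup>2 + (y$2)\<^sup>2 < R\<^sup>2 \<longleftrightarrow> - (y$2) < sqrt (R\<^sup>2 - (y$1)\<^sup>2)"
      proof -
        have "0 \<le> - (y$2)" using y2 R by linarith
        then have eq: "- (y$2) = sqrt ((y$2)\<^sup>2)" by simp
        show ?thesis unfolding eq real_sqrt_less_iff by auto
      qed
      also have "\<dots> \<longleftrightarrow> T x $ 2 > \<gamma> (T x $ 1)"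
        using \<gamma>(2)[of "T x $ 1"] y1 by (auto simp: y_def)
      finally show ?thesis using True by simp
    qed simp
  qed
  then show "\<exists>r>0. \<exists>(T :: real^2 \<Rightarrow> real^2) \<gamma>. orthogonal_transformation T \<and> smooth \<gamma> \<and>
      ball p R \<inter> ball z r = {x \<in> ball z r. T x $ 2 > \<gamma> (T x $ 1)}"
    using T(1) \<gamma>(1) R by (intro exI[of _ "R/2"] conjI exI[of _ T] exI[of _ \<gamma>]) simp_all
qed auto

lemma infdist_cball:
  fixes p y :: "'a::euclidean_space"
  assumes R: "R > 0" and y: "y \<notin> cball p R"
  shows "infdist y (cball p R) = dist p y - R"
proof (rule antisym)
  have d: "dist p y > R" using y by simp
  let ?q = "p + (R / dist p y) *\<^sub>R (y - p)"
  have "?q \<in> cball p R" using d R by (simp add: dist_norm norm_minus_commute)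
  then have "infdist y (cball p R) \<le> dist y ?q" by (rule infdist_le)
  also have "y - ?q = (1 - R / dist p y) *\<^sub>R (y - p)" by (simp add: algebra_simps)
  then have "dist y ?q = \<bar>1 - R / dist p y\<bar> * dist p y" by (simp add: dist_norm norm_minus_commute)
  also have "\<dots> = dist p y - R"
  proof -
    have "R / dist p y \<le> 1" using d R by (simp add: divide_le_eq_1)
    moreover have "p \<noteq> y" using d R by auto
    ultimately show ?thesis by (simp add: left_diff_distrib)
  qed
  finally show "infdist y (cball p R) \<le> dist p y - R" .
  have "dist p y - R \<le> dist y u" if "u \<in> cball p R" for u
    using dist_triangle[of p y u] that by (simp add: dist_commute)
  then show "dist p y - R \<le> infdist y (cball p R)"
    using R by (auto simp: infdist_def intro!: cINF_greatest)
qed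

text \<open>Steiner's formula read backwards: the parallel ring at distance 1 is an annulus of known
  area.\<close>

lemma perimeter_ball:
  assumes R: "R > 0"
  shows "perimeter (ball (p :: real^2) R) = 2 * pi * R"
proof -
  let ?B = "ball p R"
  have ne: "?B \<noteq> {}" using R by simp
  have cl: "closure ?B = cball p R" using R by simp
  have inf: "infdist y (cball p R) = dist p y - R" if "y \<notin> cball p R" for y
    by (rule infdist_cball[OF R that])
  have "{y. y \<notin> closure ?B \<and> infdist y (closure ?B) < 1} = ball p (R + 1) - cball p R"
    unfolding cl using inf by auto
  then have "ennreal (perimeter ?B * 1 + pi * 1\<^sup>2) = emeasure lborel (ball p (R + 1) - cball p R)"
    using steiner_formula(2)[OF convex_smooth_domain_ball[OF R] ne, of 1] by simp
  also have "\<dots> = emeasure lborel (ball p (R + 1)) - emeasure lborel (cball p R)"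
    by (rule emeasure_Diff) (use emeasure_lborel_cball_finite[of p R] in auto)
  also have "\<dots> = ennreal (pi * (R+1)\<^sup>2) - ennreal (pi * R\<^sup>2)"
    using R by (simp add: emeasure_ball_2 emeasure_cball unit_ball_vol_2)
  also have "\<dots> = ennreal (pi * (R+1)\<^sup>2 - pi * R\<^sup>2)" using R by (simp add: ennreal_minus)
  finally have "ennreal (perimeter ?B + pi) = ennreal (pi * (R+1)\<^sup>2 - pi * R\<^sup>2)" by simp
  moreover have "0 \<le> perimeter ?B + pi" by (simp add: perimeter_def)
  moreover have "0 \<le> pi * (R+1)\<^sup>2 - pi * R\<^sup>2" using R by (simp add: algebra_simps power2_eq_square)
  ultimately have "perimeter ?B + pi = pi * (R+1)\<^sup>2 - pi * R\<^sup>2" by (simp only: ennreal_inj)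
  then show ?thesis by (simp add: algebra_simps power2_eq_square)
qed

section \<open>Mollification\<close>

lemma integrable_lborel_compact_support:
  fixes f :: "'a::euclidean_space \<Rightarrow> 'b::{banach, second_countable_topology}"
  assumes "compact S" "continuous_on S f" "\<And>x. x \<notin> S \<Longrightarrow> f x = 0"
  shows "integrable lborel f"
proof -
  have "integrable lborel (\<lambda>x. indicator S x *\<^sub>R f x)" by (rule borel_integrable_compact[OF assms(1,2)])
  moreover have "(\<lambda>x. indicator S x *\<^sub>R f x) = f" using assms(3) by (auto simp: indicator_def)
  ultimately show ?thesis by simp
qed

lemma distr_lborel_reflect: "distr lborel borel (\<lambda>y. x - y) = (lborel :: 'a::euclidean_space measure)"
proof -
  have "lborel = density (distr lborel borel (\<lambda>y. x + (-1) *\<^sub>R y)) (\<lambda>_. ennreal (\<bar>-1\<bar> ^ DIM('a)))"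
    by (rule lborel_affine) simp
  then show ?thesis by (simp add: density_1)
qed

lemma integral_lborel_reflect:
  fixes f :: "'a::euclidean_space \<Rightarrow> 'b::{banach, second_countable_topology}"
  assumes "f \<in> borel_measurable borel"
  shows "(LINT y|lborel. f (x - y)) = (LINT y|lborel. f y)"
proof -
  have "(LINT y|lborel. f y) = (LINT y|distr lborel borel (\<lambda>y. x - y). f y)" by (simp add: distr_lborel_reflect)
  also have "\<dots> = (LINT y|lborel. f (x - y))" by (rule integral_distr) (use assms in auto)
  finally show ?thesis ..
qed

text \<open>Differentiation under the integral falls on the kernel alone, and the directional
  derivatives of the kernel serve as kernels for the next order.\<close>

lemma Ck_integral_kernel:
  fixes u :: "'a::euclidean_space \<Rightarrow> real"
  assumes u: "continuous_on (cbox a b) u"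
  shows "Ck m k \<Longrightarrow> Ck m (\<lambda>x. integral (cbox a b) (\<lambda>y. k (x - y) * u y))"
proof (induction m arbitrary: k)
  case 0
  then have k: "continuous_on UNIV k" by simp
  have "continuous_on (UNIV \<times> cbox a b) (\<lambda>(x, y). k (x - y) * u y)"
    unfolding split_beta
    by (intro continuous_intros continuous_on_compose2[OF k] continuous_on_compose2[OF u]) auto
  then show ?case using integral_continuous_on_param[of UNIV a b "\<lambda>x y. k (x - y) * u y"] by simp
next
  case (Suc m)
  obtain k' where k': "\<And>x. (k has_derivative k' x) (at x)" "\<And>b. b \<in> Basis \<Longrightarrow> Ck m (\<lambda>x. k' x b)"
    using Ck_SucE[OF Suc.prems] by metis
  have k: "continuous_on UNIV k" by (rule Ck_continuous[OF Suc.prems])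
  \<comment> \<open>The Leibniz rule asks for joint continuity of the derivative as a map into
    bounded linear operators; in finite dimension this is checked on basis vectors.\<close>
  define fx where "fx x t = Blinfun (\<lambda>h. k' (x - t) h * u t)" for x t
  have bl: "bounded_linear (\<lambda>h. k' (x - t) h * u t)" for x t
    by (intro bounded_linear_mult_const has_derivative_bounded_linear[OF k'(1)])
  have fx: "blinfun_apply (fx x t) h = k' (x - t) h * u t" for x t h
    unfolding fx_def by (simp add: bounded_linear_Blinfun_apply[OF bl])
  have cfx: "continuous_on (UNIV \<times> cbox a b) (\<lambda>(x, t). fx x t)"
    unfolding split_beta
  proof (rule continuous_on_blinfun_componentwise)
    fix i :: 'a assume i: "i \<in> Basis"
    have ki: "continuous_on UNIV (\<lambda>x. k' x i)" by (rule Ck_continuous[OF k'(2)[OF i]])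
    show "continuous_on (UNIV \<times> cbox a b) (\<lambda>p. blinfun_apply (fx (fst p) (snd p)) i)"
      unfolding fx by (intro continuous_intros continuous_on_compose2[OF ki] continuous_on_compose2[OF u]) auto
  qed
  have cfx1: "continuous_on (cbox a b) (fx x)" for x
  proof -
    have "continuous_on (cbox a b) (\<lambda>t. (\<lambda>(x, t). fx x t) (x, t))"
      by (rule continuous_on_compose2[OF cfx]) (auto intro!: continuous_intros)
    then show ?thesis by simp
  qed
  have D: "((\<lambda>x. integral (cbox a b) (\<lambda>y. k (x - y) * u y)) has_derivative blinfun_apply (integral (cbox a b) (fx x))) (at x within UNIV)" for x
  proof (rule leibniz_rule[where U=UNIV])
    fix x t
    have "((\<lambda>x. k (x - t)) has_derivative k' (x - t)) (at x)"
      by (rule has_derivative_compose[where f="\<lambda>x. x - t" and f'="\<lambda>h. h", OF _ k'(1)]) (auto intro!: derivative_eq_intros)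
    then show "((\<lambda>x. k (x - t) * u t) has_derivative blinfun_apply (fx x t)) (at x within UNIV)"
      unfolding fx[abs_def] by (intro has_derivative_mult_left)
  next
    fix x show "(\<lambda>y. k (x - y) * u y) integrable_on cbox a b"
      by (intro integrable_continuous continuous_intros continuous_on_compose2[OF k] u) auto
  qed (use cfx in auto)
  show ?case
  proof (rule Ck_SucI)
    show "((\<lambda>x. integral (cbox a b) (\<lambda>y. k (x - y) * u y)) has_derivative blinfun_apply (integral (cbox a b) (fx x))) (at x)" for x
      using D by simp
    fix i :: 'a assume i: "i \<in> Basis"
    have "blinfun_apply (integral (cbox a b) (fx x)) i = integral (cbox a b) (\<lambda>y. k' (x - y) i * u y)" for x
      by (subst blinfun_apply_integral) (auto simp: fx intro!: integrable_continuous cfx1)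
    then show "Ck m (\<lambda>x. blinfun_apply (integral (cbox a b) (fx x)) i)"
      using Suc.IH[OF k'(2)[OF i]] by simp
  qed
qed

locale mollifier =
  fixes \<eta> :: "real^2 \<Rightarrow> real" and \<epsilon> :: real
  assumes eps: "0 < \<epsilon>"
    and Ck_\<eta>: "\<And>k. Ck k \<eta>"
    and nonneg: "\<And>y. 0 \<le> \<eta> y"
    and supp: "\<And>y. \<epsilon> \<le> norm y \<Longrightarrow> \<eta> y = 0"
    and mass: "(LINT y|lborel. \<eta> y) = 1"
begin

definition mollify :: "(real^2 \<Rightarrow> real) \<Rightarrow> real^2 \<Rightarrow> real" where
  "mollify u x = (LINT y|lborel. \<eta> y * u (x - y))"

lemma continuous_\<eta>: "continuous_on A \<eta>"
  using Ck_continuous[OF Ck_\<eta>[of 0]] continuous_on_subset by blast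

lemma integrable_kernel:
  assumes "continuous_on UNIV w"
  shows "integrable lborel (\<lambda>y. \<eta> y * w y)"
proof (rule integrable_lborel_compact_support)
  show "compact (cball (0::real^2) \<epsilon>)" by simp
  show "continuous_on (cball 0 \<epsilon>) (\<lambda>y. \<eta> y * w y)"
    by (intro continuous_intros continuous_\<eta> continuous_on_subset[OF assms]) auto
qed (auto simp: supp)

text \<open>Averaging against a nonnegative kernel of mass one keeps a function within
  \<open>e\<close> of any constant to which it is \<open>e\<close>-close on the support; the
  approximation properties of mollification are instances.\<close>

lemma kernel_average:
  assumes w: "continuous_on UNIV w" and close: "\<And>y. norm y < \<epsilon> \<Longrightarrow> \<bar>w y - m\<bar> \<le> e"
  shows "\<bar>(LINT y|lborel. \<eta> y * w y) - m\<bar> \<le> e"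
proof -
  have i1: "integrable lborel \<eta>" using integrable_kernel[of "\<lambda>_. 1"] by simp
  have "(LINT y|lborel. \<eta> y * w y) - m = (LINT y|lborel. \<eta> y * w y) - (LINT y|lborel. \<eta> y * m)"
    using mass by simp
  also have "\<dots> = (LINT y|lborel. \<eta> y * w y - \<eta> y * m)"
    using i1 integrable_kernel[OF w] by (intro Bochner_Integration.integral_diff[symmetric]) auto
  finally have "\<bar>(LINT y|lborel. \<eta> y * w y) - m\<bar> = \<bar>LINT y|lborel. \<eta> y * w y - \<eta> y * m\<bar>" by simp
  also have "\<dots> \<le> (LINT y|lborel. \<bar>\<eta> y * w y - \<eta> y * m\<bar>)" by (rule integral_abs_bound)
  also have "\<dots> \<le> (LINT y|lborel. \<eta> y * e)"
  proof (rule integral_mono)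
    show "integrable lborel (\<lambda>y. \<bar>\<eta> y * w y - \<eta> y * m\<bar>)"
      using i1 integrable_kernel[OF w] by (intro integrable_abs Bochner_Integration.integrable_diff) auto
    show "integrable lborel (\<lambda>y. \<eta> y * e)" using i1 by simp
    fix y
    show "\<bar>\<eta> y * w y - \<eta> y * m\<bar> \<le> \<eta> y * e"
    proof (cases "norm y < \<epsilon>")
      case True
      have "\<bar>\<eta> y * w y - \<eta> y * m\<bar> = \<eta> y * \<bar>w y - m\<bar>"
        using nonneg[of y] by (simp add: abs_mult flip: right_diff_distrib)
      then show ?thesis using close[OF True] nonneg[of y] by (simp add: mult_left_mono)
    qed (simp add: supp)
  qed
  also have "\<dots> = e" using mass by simp
  finally show ?thesis .
qed

context
  fixes u :: "real^2 \<Rightarrow> real"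
  assumes u: "continuous_on UNIV u"
begin

lemma continuous_shift: "continuous_on UNIV (\<lambda>y. u (x - y))"
  by (intro continuous_on_compose2[OF u] continuous_intros) auto

lemma mollify_close:
  assumes "\<And>y. norm y < \<epsilon> \<Longrightarrow> \<bar>u (x - y) - u x\<bar> \<le> e"
  shows "\<bar>mollify u x - u x\<bar> \<le> e"
  unfolding mollify_def by (rule kernel_average[OF continuous_shift assms])

text \<open>The increment of the mollified function is the average of increments of \<open>u\<close>
  over shifted pairs of points. This carries Lipschitz bounds and first-order expansions over to the
  mollification without differentiating \<open>u\<close>.\<close>

lemma mollify_increment:
  assumes "\<And>y. norm y < \<epsilon> \<Longrightarrow> \<bar>u (p - y) - u (q - y) - m\<bar> \<le> e"
  shows "\<bar>mollify u p - mollify u q - m\<bar> \<le> e"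
proof -
  have "mollify u p - mollify u q = (LINT y|lborel. \<eta> y * u (p - y) - \<eta> y * u (q - y))"
    unfolding mollify_def
    by (intro Bochner_Integration.integral_diff[symmetric] integrable_kernel continuous_shift)
  also have "\<dots> = (LINT y|lborel. \<eta> y * (u (p - y) - u (q - y)))" by (simp add: right_diff_distrib)
  finally show ?thesis
    using kernel_average[of "\<lambda>y. u (p - y) - u (q - y)" m e] assms
    by (simp add: continuous_on_diff continuous_shift)
qed

lemma mollify_zero: "(\<And>y. norm y < \<epsilon> \<Longrightarrow> u (x - y) = 0) \<Longrightarrow> mollify u x = 0"
  using kernel_average[OF continuous_shift, of x 0 0] by (simp add: mollify_def)

lemma smooth_mollify:
  assumes "\<And>x. M < norm x \<Longrightarrow> u x = 0"
  shows "smooth (mollify u)"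
proof -
  obtain a b where ab: "cball (0::real^2) M \<subseteq> cbox a b" using bounded_subset_cbox_symmetric[OF bounded_cball] by metis
  have "mollify u x = integral (cbox a b) (\<lambda>y. \<eta> (x - y) * u y)" for x
  proof -
    have c: "continuous_on A (\<lambda>y. \<eta> (x - y) * u y)" for A
      by (intro continuous_intros continuous_on_compose2[OF continuous_\<eta>[of UNIV]] continuous_on_subset[OF u]) auto
    \<comment> \<open>Reflecting the variable moves the dependence on \<open>x\<close> from
      \<open>u\<close> to the smooth kernel.\<close>
    have "mollify u x = (LINT y|lborel. (\<lambda>z. \<eta> (x - z) * u z) (x - y))"
      by (simp add: mollify_def)
    also have "\<dots> = (LINT y|lborel. \<eta> (x - y) * u y)"
      by (rule integral_lborel_reflect) (rule borel_measurable_continuous_onI[OF c])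
    also have "\<dots> = (LINT y:cbox a b|lborel. \<eta> (x - y) * u y)"
      unfolding set_lebesgue_integral_def
    proof (rule Bochner_Integration.integral_cong)
      fix y show "\<eta> (x - y) * u y = indicat_real (cbox a b) y *\<^sub>R (\<eta> (x - y) * u y)"
      proof (cases "y \<in> cbox a b")
        case False
        then have "M < norm y" using ab by (meson mem_cball_0 not_le subsetD)
        then show ?thesis by (simp add: assms)
      qed simp
    qed simp
    also have "\<dots> = integral (cbox a b) (\<lambda>y. \<eta> (x - y) * u y)"
      by (intro set_borel_integral_eq_integral(2)) (unfold set_integrable_def, rule borel_integrable_compact[OF compact_cbox c])
    finally show ?thesis .
  qed
  moreover have "Ck k (\<lambda>x. integral (cbox a b) (\<lambda>y. \<eta> (x - y) * u y))" for k
    by (rule Ck_integral_kernel[OF continuous_on_subset[OF u] Ck_\<eta>]) simp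
  ultimately show ?thesis unfolding smooth_def by presburger
qed

end

end

lemma mollifier_exists:
  assumes "0 < \<epsilon>"
  obtains \<eta> where "mollifier \<eta> \<epsilon>"
proof -
  \<comment> \<open>A smooth bump that is positive exactly on the open disk of radius
    \<open>\<epsilon>\<close>; it can be normalised because that disk is not a null set.\<close>
  define b where "b y = flat 0 (\<epsilon>\<^sup>2 - y \<bullet> y)" for y :: "real^2"
  have Ck: "Ck k b" for k unfolding b_def[abs_def]
    by (intro Ck_flat Ck_diff Ck_const Ck_inner Ck_linear bounded_linear_ident)
  have b0: "b y = 0" if "\<epsilon> \<le> norm y" for y
    using power_mono[OF that, of 2] assms by (simp add: b_def flat_zero dot_square_norm)
  have cb: "continuous_on A b" for A using Ck_continuous[OF Ck[of 0]] continuous_on_subset by blast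
  have ib: "integrable lborel b"
    by (rule integrable_lborel_compact_support[of "cball 0 \<epsilon>"]) (use b0 cb in auto)
  define Z where "Z = (LINT y|lborel. b y)"
  have "Z \<noteq> 0"
  proof
    assume "Z = 0"
    then have ae: "AE y in lborel. b y = 0"
      using integral_nonneg_eq_0_iff_AE[OF ib] flat_nonneg unfolding Z_def b_def by auto
    have "0 < b y" if "y \<in> ball 0 \<epsilon>" for y
    proof -
      have "(norm y)\<^sup>2 < \<epsilon>\<^sup>2" using that by (intro power_strict_mono) auto
      then show ?thesis by (simp add: b_def flat_pos_iff dot_square_norm)
    qed
    then have pos: "b y \<noteq> 0" if "y \<in> ball 0 \<epsilon>" for y using that by (metis less_irrefl)
    have "AE y in lborel. y \<notin> ball (0::real^2) \<epsilon>" by (rule eventually_mono[OF ae]) (use pos in blast)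
    then have "ball (0::real^2) \<epsilon> \<in> null_sets lborel" by (subst (asm) AE_iff_null_sets[symmetric]) auto
    then have "negligible (ball (0::real^2) \<epsilon>)" by (simp add: negligible_iff_null_sets null_sets_completionI)
    then show False using open_not_negligible[of "ball (0::real^2) \<epsilon>"] assms by simp
  qed
  moreover have "0 \<le> Z" unfolding Z_def by (intro Bochner_Integration.integral_nonneg) (simp add: b_def flat_nonneg)
  ultimately have Z: "0 < Z" by simp
  have "mollifier (\<lambda>y. b y * (1/Z)) \<epsilon>"
  proof
    show "Ck k (\<lambda>y. b y * (1/Z))" for k by (intro Ck_mult Ck Ck_const)
    show "(LINT y|lborel. b y * (1/Z)) = 1" using Z unfolding Z_def by simp
  qed (use assms Z b0 in \<open>auto simp: b_def flat_nonneg\<close>)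
  then show ?thesis using that by blast
qed

section \<open>Gradients of mollified functions\<close>

lemma derivative_close_linear:
  fixes v :: "'a::real_normed_vector \<Rightarrow> real"
  assumes D: "(v has_derivative D) (at x)" and \<delta>: "0 < \<delta>" and A: "bounded_linear A"
    and close: "\<And>q. dist q x < \<delta> \<Longrightarrow> \<bar>v q - v x - A (q - x)\<bar> \<le> e * norm (q - x)"
  shows "\<bar>D h - A h\<bar> \<le> e * norm h"
proof (cases "h = 0")
  case True
  then show ?thesis using has_derivative_bounded_linear[OF D] A by (simp add: linear_0 bounded_linear.linear)
next
  case False
  interpret A: bounded_linear A by fact
  define w where "w t = v (x + t *\<^sub>R h) - A (t *\<^sub>R h)" for t :: real
  have lin: "D (t *\<^sub>R h) = t * D h" for t
    using linear_scale[OF has_derivative_linear[OF D]] by simp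
  have "((\<lambda>t. v (x + t *\<^sub>R h)) has_derivative (\<lambda>t. D (t *\<^sub>R h))) (at 0)"
    by (rule has_derivative_compose[where f="\<lambda>t. x + t *\<^sub>R h"]) (use D in \<open>auto intro!: derivative_eq_intros\<close>)
  then have "((\<lambda>t. v (x + t *\<^sub>R h)) has_real_derivative D h) (at 0)"
    by (simp add: has_field_derivative_def lin mult.commute[of _ "D h"])
  moreover have "((\<lambda>t. A (t *\<^sub>R h)) has_real_derivative A h) (at 0)"
    unfolding A.scaleR by (auto intro!: derivative_eq_intros)
  ultimately have "(w has_real_derivative (D h - A h)) (at 0)"
    unfolding w_def by (intro DERIV_diff)
  then have lim: "((\<lambda>t. \<bar>(w t - w 0) / t\<bar>) \<longlongrightarrow> \<bar>D h - A h\<bar>) (at 0)"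
    unfolding has_field_derivative_iff by (intro tendsto_rabs) simp
  show ?thesis
  proof (rule tendsto_upperbound[OF lim])
    show "\<forall>\<^sub>F t in at 0. \<bar>(w t - w 0) / t\<bar> \<le> e * norm h"
      unfolding eventually_at
    proof (intro exI[of _ "\<delta> / norm h"] conjI ballI impI)
      show "0 < \<delta> / norm h" using \<delta> False by simp
      fix t :: real assume t: "t \<noteq> 0 \<and> dist t 0 < \<delta> / norm h"
      have "dist (x + t *\<^sub>R h) x < \<delta>" using t False by (simp add: dist_norm field_simps)
      from close[OF this] have "\<bar>w t - w 0\<bar> \<le> e * (\<bar>t\<bar> * norm h)"
        by (simp add: w_def A.zero algebra_simps)
      then show "\<bar>(w t - w 0) / t\<bar> \<le> e * norm h" using t by (simp add: abs_divide field_simps)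
    qed
  qed simp
qed

lemma grad_close:
  fixes v :: "real^2 \<Rightarrow> real"
  assumes D: "v differentiable (at x)" and \<delta>: "0 < \<delta>" and e: "0 \<le> e"
    and close: "\<And>q. dist q x < \<delta> \<Longrightarrow> \<bar>v q - v x - a \<bullet> (q - x)\<bar> \<le> e * norm (q - x)"
  shows "norm (grad v x - a) \<le> e"
proof -
  let ?D = "frechet_derivative v (at x)"
  have D': "(v has_derivative ?D) (at x)" by (rule iffD1[OF frechet_derivative_works D])
  \<comment> \<open>Testing the directional estimate in the direction of the error itself bounds the
    square of its norm by \<open>e\<close> times its norm.\<close>
  let ?h = "grad v x - a"
  have lin: "linear ?D" by (rule has_derivative_linear[OF D'])
  have Dh: "?D h = grad v x \<bullet> h" for h
  proof -
    have "?D h = ?D (\<Sum>i\<in>UNIV. h$i *\<^sub>R axis i 1)" using basis_expansion[of h] by (simp add: scalar_mult_eq_scaleR)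
    also have "\<dots> = (\<Sum>i\<in>UNIV. h$i * ?D (axis i 1))" by (simp add: linear_sum[OF lin] linear_scale[OF lin])
    also have "\<dots> = grad v x \<bullet> h" by (simp add: inner_vec_def grad_def mult.commute)
    finally show ?thesis .
  qed
  have "\<bar>?D ?h - a \<bullet> ?h\<bar> \<le> e * norm ?h"
    by (rule derivative_close_linear[OF D' \<delta> bounded_linear_inner_right close])
  then have "norm ?h * norm ?h \<le> e * norm ?h"
    unfolding Dh by (simp flip: inner_diff_left add: dot_square_norm power2_eq_square)
  then show ?thesis using e by (cases "norm ?h = 0") (auto simp: mult_le_cancel_right)
qed

text \<open>Strict differentiability: both points of the increment vary near \<open>x\<close>. The
  increment of a mollification between \<open>q\<close> and \<open>x\<close> averages increments of
  \<open>u\<close> between \<open>q - y\<close> and \<open>x - y\<close>, so the expansion has to be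
  uniform over such pairs.\<close>

definition strict_gradient :: "(real^2 \<Rightarrow> real) \<Rightarrow> real^2 \<Rightarrow> real^2 \<Rightarrow> bool" where
  "strict_gradient u a x \<longleftrightarrow> (\<forall>e>0. \<exists>\<delta>>0. \<forall>p q. dist p x < \<delta> \<longrightarrow> dist q x < \<delta> \<longrightarrow>
     \<bar>u p - u q - a \<bullet> (p - q)\<bar> \<le> e * norm (p - q))"

lemma smooth_approximation:
  fixes u :: "real^2 \<Rightarrow> real"
  assumes L: "0 \<le> L" and lip: "\<And>p q. \<bar>u p - u q\<bar> \<le> L * norm (p - q)"
    and supp: "\<And>x. M < norm x \<Longrightarrow> u x = 0"
  obtains v where "\<And>n. smooth (v n)" "\<And>n x. M + 1 < norm x \<Longrightarrow> v n x = 0"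
    "\<And>n x. \<bar>v n x - u x\<bar> \<le> L / Suc n" "\<And>n x. norm (grad (v n) x) \<le> L"
    "\<And>a x. strict_gradient u a x \<Longrightarrow> (\<lambda>n. grad (v n) x) \<longlonglongrightarrow> a"
proof -
  have u: "continuous_on UNIV u" unfolding continuous_on_iff
  proof (intro ballI allI impI)
    fix x and e :: real assume e: "0 < e"
    \<comment> \<open>The divisor is \<open>L + 1\<close> because \<open>L\<close> may be 0.\<close>
    have "\<bar>u y - u x\<bar> < e" if "dist y x < e / (L + 1)" for y
    proof -
      have "\<bar>u y - u x\<bar> \<le> L * dist y x" using lip by (simp add: dist_norm)
      also have "\<dots> \<le> (L + 1) * dist y x" by (simp add: mult_right_mono)
      also have "\<dots> < e" using that L by (simp add: field_simps)
      finally show ?thesis .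
    qed
    then show "\<exists>d>0. \<forall>x'\<in>UNIV. dist x' x < d \<longrightarrow> dist (u x') (u x) < e"
      using e L by (intro exI[of _ "e / (L + 1)"]) (auto simp: dist_real_def)
  qed
  have "\<exists>\<eta>. mollifier \<eta> (1 / real (Suc n))" for n by (rule mollifier_exists[of "1 / real (Suc n)"]) auto
  then obtain \<eta> where \<eta>: "\<And>n. mollifier (\<eta> n) (1 / real (Suc n))" by metis
  define v where "v n = mollifier.mollify (\<eta> n) u" for n
  have sm: "smooth (v n)" for n
    unfolding v_def using mollifier.smooth_mollify[OF \<eta> u supp] by blast
  have diff: "v n differentiable (at x)" for n x
  proof -
    have "Ck (Suc 0) (v n)" using sm[of n] unfolding smooth_def by blast
    then show ?thesis by simp
  qed
  show ?thesis
  proof (rule that[of v])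
    show "smooth (v n)" for n by (rule sm)
    show "v n x = 0" if "M + 1 < norm x" for n x
      unfolding v_def
    proof (rule mollifier.mollify_zero[OF \<eta> u])
      fix y :: "real^2" assume "norm y < 1 / real (Suc n)"
      also have "\<dots> \<le> 1" by simp
      finally have "M < norm (x - y)" using that norm_triangle_ineq2[of x y] by linarith
      then show "u (x - y) = 0" by (rule supp)
    qed
    show "\<bar>v n x - u x\<bar> \<le> L / Suc n" for n x
      unfolding v_def
    proof (rule mollifier.mollify_close[OF \<eta> u])
      fix y :: "real^2" assume "norm y < 1 / real (Suc n)"
      then have "L * norm y \<le> L * (1 / real (Suc n))" using L by (intro mult_left_mono) auto
      then show "\<bar>u (x - y) - u x\<bar> \<le> L / real (Suc n)" using lip[of "x - y" x] by simp
    qed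
    show "norm (grad (v n) x) \<le> L" for n x
    proof -
      have "\<bar>v n q - v n x - 0 \<bullet> (q - x)\<bar> \<le> L * norm (q - x)" for q
        unfolding v_def inner_zero_left
      proof (rule mollifier.mollify_increment[OF \<eta> u])
        show "\<bar>u (q - y) - u (x - y) - 0\<bar> \<le> L * norm (q - x)" for y using lip[of "q - y" "x - y"] by simp
      qed
      then have "norm (grad (v n) x - 0) \<le> L"
        by (intro grad_close[OF diff zero_less_one L])
      then show ?thesis by simp
    qed
    show "(\<lambda>n. grad (v n) x) \<longlonglongrightarrow> a" if sg: "strict_gradient u a x" for a x
      unfolding tendsto_iff
    proof (intro allI impI)
      fix e :: real assume e: "0 < e"
      then obtain \<delta> where \<delta>: "\<delta> > 0" "\<And>p q. dist p x < \<delta> \<Longrightarrow> dist q x < \<delta> \<Longrightarrow> \<bar>u p - u q - a \<bullet> (p - q)\<bar> \<le> (e/2) * norm (p - q)"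
        using sg unfolding strict_gradient_def by (metis half_gt_zero)
      obtain N where N: "1 / real (Suc N) < \<delta> / 2" using nat_approx_posE[of "\<delta>/2"] \<delta>(1) by auto
      have "dist (grad (v n) x) a < e" if "N \<le> n" for n
      proof -
        have "1 / real (Suc n) \<le> 1 / real (Suc N)" using that by (simp add: frac_le)
        then have en: "1 / real (Suc n) < \<delta> / 2" using N by simp
        have "norm (grad (v n) x - a) \<le> e/2"
        proof (rule grad_close[OF diff, of "\<delta>/2"])
          fix q assume q: "dist q x < \<delta>/2"
          show "\<bar>v n q - v n x - a \<bullet> (q - x)\<bar> \<le> e/2 * norm (q - x)"
            unfolding v_def
          proof (rule mollifier.mollify_increment[OF \<eta> u])
            fix y :: "real^2" assume y: "norm y < 1 / real (Suc n)"
            have "dist (q - y) x \<le> dist q x + norm y"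
              using norm_triangle_ineq4[of "q - x" y] by (simp add: dist_norm algebra_simps)
            then have "dist (q - y) x < \<delta>" using q y en by linarith
            moreover have "norm y < \<delta>" using y en \<delta>(1) by linarith
            then have "dist (x - y) x < \<delta>" by (simp add: dist_norm)
            ultimately show "\<bar>u (q - y) - u (x - y) - a \<bullet> (q - x)\<bar> \<le> e/2 * norm (q - x)"
              using \<delta>(2)[of "q - y" "x - y"] by simp
          qed
        qed (use \<delta> e in auto)
        then show ?thesis using e by (simp add: dist_norm)
      qed
      then show "\<forall>\<^sub>F n in sequentially. dist (grad (v n) x) a < e" unfolding eventually_sequentially by blast
    qed
  qed
qed

section \<open>Square-integrable functions\<close>

lemma borel_measurable_lebesgue_on:
  "f \<in> borel_measurable borel \<Longrightarrow> f \<in> borel_measurable (lebesgue_on E)"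
  by (intro measurable_restrict_space1 measurable_completion) simp

lemma nn_integral_lebesgue_on:
  "E \<in> sets borel \<Longrightarrow> (\<integral>\<^sup>+x. f x \<partial>lebesgue_on E) = (\<integral>\<^sup>+x. f x * indicator E x \<partial>lborel)"
  by (subst nn_integral_restrict_space) (auto simp: nn_integral_completion)

lemma integral_lebesgue_on_borel:
  fixes f :: "'a::euclidean_space \<Rightarrow> 'b::{banach, second_countable_topology}"
  assumes [measurable]: "E \<in> sets borel" "f \<in> borel_measurable borel"
  shows "(LINT x|lebesgue_on E. f x) = (LINT x|lborel. indicator E x *\<^sub>R f x)"
proof -
  have "(LINT x|lebesgue_on E. f x) = (LINT x|lebesgue. indicator E x *\<^sub>R f x)"
    using assms by (intro integral_restrict_space) simp
  also have "\<dots> = (LINT x|lborel. indicator E x *\<^sub>R f x)"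
    using assms by (intro integral_completion) simp
  finally show ?thesis .
qed

lemma L2_component:
  assumes "G \<in> L2 M"
  shows "(\<lambda>x. (G x :: complex^2) $ i) \<in> L2 M"
proof -
  have m: "G \<in> borel_measurable M" and int: "integrable M (\<lambda>x. (norm (G x))\<^sup>2)" using assms by (auto simp: L2_def)
  have "(\<lambda>y::complex^2. y $ i) \<in> borel_measurable borel"
    by (intro borel_measurable_continuous_onI continuous_intros)
  from measurable_compose[OF m this] have m': "(\<lambda>x. G x $ i) \<in> borel_measurable M" .
  have "integrable M (\<lambda>x. (norm (G x $ i))\<^sup>2)"
  proof (rule Bochner_Integration.integrable_bound[OF int])
    show "(\<lambda>x. (norm (G x $ i))\<^sup>2) \<in> borel_measurable M" using m' by measurable
    show "AE x in M. norm ((norm (G x $ i))\<^sup>2) \<le> norm ((norm (G x))\<^sup>2)"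
      by (intro AE_I2) (simp add: power_mono Finite_Cartesian_Product.norm_nth_le)
  qed
  then show ?thesis using m' by (simp add: L2_def)
qed

lemma L2_tendsto_component:
  assumes "L2_tendsto M V G"
  shows "L2_tendsto M (\<lambda>n x. (V n x :: complex^2) $ i) (\<lambda>x. G x $ i)"
  unfolding L2_tendsto_def
proof (rule tendsto_sandwich[OF always_eventually always_eventually tendsto_const assms[unfolded L2_tendsto_def]]; intro allI)
  fix n
  show "(\<integral>\<^sup>+x. ennreal ((norm (V n x $ i - G x $ i))\<^sup>2) \<partial>M) \<le> (\<integral>\<^sup>+x. ennreal ((norm (V n x - G x))\<^sup>2) \<partial>M)"
    by (intro nn_integral_mono ennreal_leI power_mono)
       (auto simp: Finite_Cartesian_Product.norm_nth_le simp flip: vector_minus_component)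
qed simp

lemma L2_product_integrable:
  fixes g :: "'a \<Rightarrow> real" and u :: "'a \<Rightarrow> complex"
  assumes "g \<in> L2 M" "u \<in> L2 M"
  shows "integrable M (\<lambda>x. g x *\<^sub>R u x)"
proof -
  have m[measurable]: "g \<in> borel_measurable M" "u \<in> borel_measurable M" using assms by (auto simp: L2_def)
  have "integrable M (\<lambda>x. (norm (g x))\<^sup>2 + (norm (u x))\<^sup>2)"
    using assms by (intro Bochner_Integration.integrable_add) (auto simp: L2_def)
  then show ?thesis
  proof (rule Bochner_Integration.integrable_bound)
    show "AE x in M. norm (g x *\<^sub>R u x) \<le> norm ((norm (g x))\<^sup>2 + (norm (u x))\<^sup>2)"
    proof (intro AE_I2)
      fix x
      have "2 * (\<bar>g x\<bar> * norm (u x)) \<le> (norm (g x))\<^sup>2 + (norm (u x))\<^sup>2"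
        using sum_squares_bound[of "\<bar>g x\<bar>" "norm (u x)"] by (simp add: mult.assoc)
      moreover have "0 \<le> \<bar>g x\<bar> * norm (u x)" by simp
      ultimately have "\<bar>g x\<bar> * norm (u x) \<le> (norm (g x))\<^sup>2 + (norm (u x))\<^sup>2" by linarith
      then show "norm (g x *\<^sub>R u x) \<le> norm ((norm (g x))\<^sup>2 + (norm (u x))\<^sup>2)" by simp
    qed
  qed measurable
qed

text \<open>Cauchy-Schwarz against \<open>v n - u\<close>; the estimate is squared because
  \<open>L2_tendsto\<close> controls the squared norm.\<close>

lemma L2_pairing_tendsto:
  fixes g :: "'a \<Rightarrow> real" and u :: "'a \<Rightarrow> complex"
  assumes g: "g \<in> L2 M" and u: "u \<in> L2 M" and v: "\<And>n. v n \<in> L2 M" and lim: "L2_tendsto M v u"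
  shows "(\<lambda>n. LINT x|M. g x *\<^sub>R v n x) \<longlonglongrightarrow> (LINT x|M. g x *\<^sub>R u x)"
proof -
  have m[measurable]: "g \<in> borel_measurable M" "u \<in> borel_measurable M" "\<And>n. v n \<in> borel_measurable M"
    using assms by (auto simp: L2_def)
  define C where "C = (\<integral>\<^sup>+x. ennreal ((norm (g x))\<^sup>2) \<partial>M)"
  have C: "C < \<infinity>" using g by (auto simp: L2_def C_def integrable_iff_bounded)
  define I where "I n = (\<integral>\<^sup>+x. ennreal (\<bar>g x\<bar> * norm (v n x - u x)) \<partial>M)" for n
  define e where "e n = (\<integral>\<^sup>+x. ennreal ((norm (v n x - u x))\<^sup>2) \<partial>M)" for n
  have e0: "e \<longlonglongrightarrow> 0" using lim unfolding L2_tendsto_def e_def[abs_def] .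
  have CS: "(I n)\<^sup>2 \<le> C * e n" for n
  proof -
    have "I n = (\<integral>\<^sup>+x. ennreal \<bar>g x\<bar> * ennreal (norm (v n x - u x)) \<partial>M)"
      unfolding I_def by (simp add: ennreal_mult)
    then have "(I n)\<^sup>2 \<le> (\<integral>\<^sup>+x. (ennreal \<bar>g x\<bar>)\<^sup>2 \<partial>M) * (\<integral>\<^sup>+x. (ennreal (norm (v n x - u x)))\<^sup>2 \<partial>M)"
      using Cauchy_Schwarz_nn_integral[of "\<lambda>x. ennreal \<bar>g x\<bar>" M "\<lambda>x. ennreal (norm (v n x - u x))"] by simp
    then show ?thesis by (simp add: C_def e_def ennreal_power)
  qed
  have diff: "ennreal (norm ((LINT x|M. g x *\<^sub>R v n x) - (LINT x|M. g x *\<^sub>R u x))) \<le> I n" for n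
  proof -
    have i: "integrable M (\<lambda>x. g x *\<^sub>R v n x)" "integrable M (\<lambda>x. g x *\<^sub>R u x)"
      by (intro L2_product_integrable g u v)+
    then have "(LINT x|M. g x *\<^sub>R v n x) - (LINT x|M. g x *\<^sub>R u x) = (LINT x|M. g x *\<^sub>R (v n x - u x))"
      by (simp add: scaleR_diff_right)
    moreover have "integrable M (\<lambda>x. g x *\<^sub>R (v n x - u x))"
      using i by (simp add: scaleR_diff_right)
    ultimately show ?thesis
      using integral_norm_bound_ennreal[of M "\<lambda>x. g x *\<^sub>R (v n x - u x)"] by (simp add: I_def)
  qed
  have "(\<lambda>n. ennreal ((norm ((LINT x|M. g x *\<^sub>R v n x) - (LINT x|M. g x *\<^sub>R u x)))\<^sup>2)) \<longlonglongrightarrow> 0"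
  proof (rule tendsto_sandwich[OF always_eventually always_eventually tendsto_const])
    show "\<forall>n. ennreal ((norm ((LINT x|M. g x *\<^sub>R v n x) - (LINT x|M. g x *\<^sub>R u x)))\<^sup>2) \<le> C * e n"
    proof
      fix n
      have "ennreal ((norm ((LINT x|M. g x *\<^sub>R v n x) - (LINT x|M. g x *\<^sub>R u x)))\<^sup>2) \<le> (I n)\<^sup>2"
        using power_mono[OF diff[of n], of 2] by (simp add: ennreal_power)
      then show "ennreal ((norm ((LINT x|M. g x *\<^sub>R v n x) - (LINT x|M. g x *\<^sub>R u x)))\<^sup>2) \<le> C * e n"
        using CS[of n] by simp
    qed
    show "(\<lambda>n. C * e n) \<longlonglongrightarrow> 0"
      using tendsto_mult_ennreal[OF tendsto_const e0, of C] C by simp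
  qed simp
  then have "(\<lambda>n. (norm ((LINT x|M. g x *\<^sub>R v n x) - (LINT x|M. g x *\<^sub>R u x)))\<^sup>2) \<longlonglongrightarrow> 0"
    by (simp add: tendsto_ennreal_iff flip: ennreal_0)
  then have "(\<lambda>n. sqrt ((norm ((LINT x|M. g x *\<^sub>R v n x) - (LINT x|M. g x *\<^sub>R u x)))\<^sup>2)) \<longlonglongrightarrow> sqrt 0"
    by (rule tendsto_real_sqrt)
  then have "(\<lambda>n. norm ((LINT x|M. g x *\<^sub>R v n x) - (LINT x|M. g x *\<^sub>R u x))) \<longlonglongrightarrow> 0" by simp
  then show ?thesis by (simp only: tendsto_norm_zero_iff LIM_zero_iff)
qed

text \<open>Translation invariance: every difference quotient of \<open>w\<close> in the direction
  \<open>b\<close> integrates to 0, and the quotients converge boundedly on a fixed ball. Applied to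
  a product it yields integration by parts.\<close>

lemma integral_directional_derivative_zero:
  fixes w :: "'a::euclidean_space \<Rightarrow> 'b::{banach, second_countable_topology}"
  assumes D: "\<And>x. (w has_derivative D x) (at x)" and cont: "continuous_on UNIV (\<lambda>x. D x b)"
    and supp: "\<And>x. M < norm x \<Longrightarrow> w x = 0"
  shows "(LINT x|lborel. D x b) = 0"
proof -
  have cw: "continuous_on UNIV w" by (intro continuous_at_imp_continuous_on ballI has_derivative_continuous[OF D])
  have [measurable]: "w \<in> borel_measurable borel" by (rule borel_measurable_continuous_onI[OF cw])
  have [measurable]: "(\<lambda>x. D x b) \<in> borel_measurable borel" by (rule borel_measurable_continuous_onI[OF cont])
  \<comment> \<open>Radius of a ball outside which all difference quotients with step at most 1
    vanish.\<close>
  define M' where "M' = \<bar>M\<bar> + norm b"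
  obtain C where C: "\<And>x. norm x \<le> M' + norm b \<Longrightarrow> norm (D x b) \<le> C" and C0: "0 \<le> C"
  proof -
    have "compact ((\<lambda>x. D x b) ` cball 0 (M' + norm b))"
      by (intro compact_continuous_image continuous_on_subset[OF cont]) auto
    then obtain C where "\<forall>x\<in>cball 0 (M' + norm b). norm (D x b) \<le> C"
      by (auto dest!: compact_imp_bounded simp: bounded_iff)
    then show ?thesis using that[of "max C 0"] by (auto simp: le_max_iff_disj)
  qed
  have int_w: "integrable lborel w"
    by (rule integrable_lborel_compact_support[of "cball 0 M"]) (use supp continuous_on_subset[OF cw] in auto)
  define g where "g n x = real (Suc n) *\<^sub>R (w ((1 / real (Suc n)) *\<^sub>R b + x) - w x)" for n x
  have shift: "(LINT x|lborel. w (c + x)) = (LINT x|lborel. w x)" "integrable lborel (\<lambda>x. w (c + x))" for c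
  proof -
    have "(LINT x|lborel. w x) = (LINT x|distr lborel borel ((+) c). w x)" by (simp add: lborel_distr_plus)
    also have "\<dots> = (LINT x|lborel. w (c + x))" by (rule integral_distr) auto
    finally show "(LINT x|lborel. w (c + x)) = (LINT x|lborel. w x)" ..
    have "integrable (distr lborel borel ((+) c)) w" using int_w by (simp add: lborel_distr_plus)
    then show "integrable lborel (\<lambda>x. w (c + x))" by (subst (asm) integrable_distr_eq) auto
  qed
  have g0: "(LINT x|lborel. g n x) = 0" for n
    unfolding g_def using shift int_w by simp
  have lim: "(\<lambda>n. g n x) \<longlonglongrightarrow> D x b" for x
  proof -
    have "((\<lambda>t. w (t *\<^sub>R b + x)) has_derivative (\<lambda>t. D x (t *\<^sub>R b))) (at 0)"
      by (rule has_derivative_compose[where f="\<lambda>t. t *\<^sub>R b + x"]) (use D in \<open>auto intro!: derivative_eq_intros\<close>)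
    then have "((\<lambda>t. (1 / norm (t - 0)) *\<^sub>R (w (t *\<^sub>R b + x) - (w (0 *\<^sub>R b + x) + D x ((t - 0) *\<^sub>R b)))) \<longlongrightarrow> 0) (at 0)"
      unfolding has_derivative_within by blast
    moreover have "filterlim (\<lambda>n. 1 / real (Suc n)) (at 0) sequentially"
      using LIMSEQ_Suc[OF lim_1_over_n] by (auto simp: filterlim_at)
    ultimately have "(\<lambda>n. (1 / norm (1 / real (Suc n) - 0)) *\<^sub>R (w ((1 / real (Suc n)) *\<^sub>R b + x)
        - (w (0 *\<^sub>R b + x) + D x ((1 / real (Suc n) - 0) *\<^sub>R b)))) \<longlonglongrightarrow> 0"
      by (rule filterlim_compose)
    moreover have "(1 / norm (1 / real (Suc n) - 0)) *\<^sub>R (w ((1 / real (Suc n)) *\<^sub>R b + x)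
        - (w (0 *\<^sub>R b + x) + D x ((1 / real (Suc n) - 0) *\<^sub>R b))) = g n x - D x b" for n
      by (simp add: g_def linear_scale[OF has_derivative_linear[OF D]] scaleR_diff_right scaleR_add_right)
    ultimately show ?thesis by (simp add: LIM_zero_iff)
  qed
  have bound: "norm (g n x) \<le> C * indicator (cball 0 M') x" for n x
  proof (cases "norm x \<le> M'")
    case True
    define t where "t = 1 / real (Suc n)"
    have t: "0 < t" "t \<le> 1" by (auto simp: t_def)
    have "norm (w (x + t *\<^sub>R b) - w x) \<le> C * t"
    proof -
      have "norm ((\<lambda>s. w (x + s *\<^sub>R b)) t - (\<lambda>s. w (x + s *\<^sub>R b)) 0) \<le> C * norm (t - 0)"
      proof (rule differentiable_bound[of "{0..t}" _ "\<lambda>s h. h *\<^sub>R D (x + s *\<^sub>R b) b"])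
        fix s assume s: "s \<in> {0..t}"
        have "((\<lambda>s. w (x + s *\<^sub>R b)) has_derivative (\<lambda>h. D (x + s *\<^sub>R b) (h *\<^sub>R b))) (at s within {0..t})"
          by (rule has_derivative_at_withinI, rule has_derivative_compose[where f="\<lambda>s. x + s *\<^sub>R b"])
             (use D in \<open>auto intro!: derivative_eq_intros\<close>)
        then show "((\<lambda>s. w (x + s *\<^sub>R b)) has_derivative (\<lambda>h. h *\<^sub>R D (x + s *\<^sub>R b) b)) (at s within {0..t})"
          by (simp add: linear_scale[OF has_derivative_linear[OF D]])
        have "norm (x + s *\<^sub>R b) \<le> norm x + s * norm b" using s norm_triangle_ineq[of x "s *\<^sub>R b"] by simp
        also have "\<dots> \<le> M' + norm b" using True s t mult_left_le_one_le[of "norm b" s] by (intro add_mono) auto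
        finally have "norm (D (x + s *\<^sub>R b) b) \<le> C" by (rule C)
        then show "onorm (\<lambda>h. h *\<^sub>R D (x + s *\<^sub>R b) b) \<le> C"
          by (intro onorm_le) (simp, subst mult.commute, rule mult_right_mono, simp_all)
      qed (use t in auto)
      then show ?thesis using t by simp
    qed
    moreover have "norm (g n x) = real (Suc n) * norm (w (x + t *\<^sub>R b) - w x)"
      by (simp add: g_def t_def add.commute)
    ultimately have "norm (g n x) \<le> real (Suc n) * (C * t)" by (simp only: mult_left_mono of_nat_0_le_iff)
    also have "\<dots> = C" by (simp add: t_def)
    finally show ?thesis using True by simp
  next
    case False
    have "norm ((1 / real (Suc n)) *\<^sub>R b) \<le> norm b" by (simp add: divide_le_eq distrib_left)
    then have "M < norm ((1 / real (Suc n)) *\<^sub>R b + x)"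
      using False norm_diff_ineq[of x "(1 / real (Suc n)) *\<^sub>R b"] by (simp add: M'_def add.commute)
    moreover have "M < norm x" using False norm_ge_zero[of b] unfolding M'_def by linarith
    ultimately show ?thesis using False by (simp add: g_def supp)
  qed
  have "(\<lambda>n. LINT x|lborel. g n x) \<longlonglongrightarrow> (LINT x|lborel. D x b)"
  proof (rule integral_dominated_convergence[where w="\<lambda>x. C * indicator (cball 0 M') x"])
    show "integrable lborel (\<lambda>x. C * indicator (cball (0::'a) M') x)"
      by (intro integrable_mult_right integrable_real_indicator) (use emeasure_lborel_cball_finite in \<open>auto simp: less_top\<close>)
  qed (use lim bound in \<open>auto simp: g_def\<close>)
  then show ?thesis by (simp add: g0 LIMSEQ_const_iff)
qed

section \<open>Test functions and Sobolev functions\<close>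

definition cvec :: "real^2 \<Rightarrow> complex^2" where "cvec x = (\<chi> i. complex_of_real (x $ i))"

lemma norm_cvec [simp]: "norm (cvec x) = norm x"
  by (simp add: cvec_def norm_vec_def)

lemma cvec_diff: "cvec x - cvec y = cvec (x - y)"
  by (simp add: cvec_def vec_eq_iff)

lemma continuous_on_cvec: "continuous_on A cvec"
  unfolding cvec_def by (intro continuous_intros)

lemma smooth_differentiable: "smooth f \<Longrightarrow> f differentiable (at x)"
  unfolding smooth_def using Ck.simps(2)[of 0 f] by blast

lemma smooth_has_derivative: "smooth f \<Longrightarrow> (f has_derivative frechet_derivative f (at x)) (at x)"
  by (rule iffD1[OF frechet_derivative_works smooth_differentiable])

lemma smooth_continuous: "smooth f \<Longrightarrow> continuous_on A f"
  using Ck_continuous[of 0 f] continuous_on_subset unfolding smooth_def by blast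

lemma smooth_continuous_derivative:
  assumes "smooth f" "b \<in> Basis"
  shows "continuous_on A (\<lambda>x. frechet_derivative f (at x) b)"
proof -
  have "Ck (Suc 0) f" using assms(1) unfolding smooth_def by blast
  then have "continuous_on UNIV (\<lambda>x. frechet_derivative f (at x) b)" using assms(2) by simp
  then show ?thesis by (rule continuous_on_subset) simp
qed

lemma smooth_continuous_grad: "smooth f \<Longrightarrow> continuous_on A (grad f)"
  unfolding grad_def[abs_def]
  by (intro continuous_on_vec_lambda smooth_continuous_derivative) (simp_all add: axis_in_Basis_iff)

lemma test_function_support:
  assumes "f \<in> test_functions E"
  obtains S where "compact S" "S \<subseteq> E" "\<And>x. x \<notin> S \<Longrightarrow> f x = 0"
    "\<And>x h. x \<notin> S \<Longrightarrow> frechet_derivative f (at x) h = 0"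
proof -
  define S where "S = closure {x. f x \<noteq> 0}"
  have S: "compact S" "S \<subseteq> E" using assms by (auto simp: test_functions_def S_def)
  have z: "f x = 0" if "x \<notin> S" for x using that closure_subset[of "{x. f x \<noteq> 0}"] by (auto simp: S_def)
  have "frechet_derivative f (at x) h = 0" if x: "x \<notin> S" for x h
  proof -
    have "((\<lambda>_. 0) has_derivative (\<lambda>_. 0)) (at x)" by simp
    then have "(f has_derivative (\<lambda>_. 0)) (at x)"
    proof (rule has_derivative_transform_within_open)
      show "open (- S)" unfolding S_def by (intro open_Compl closed_closure)
      show "x \<in> - S" using x by simp
      show "0 = f y" if "y \<in> - S" for y using z[of y] that by simp
    qed
    from fun_cong[OF frechet_derivative_at[OF this], of h] show ?thesis by simp
  qed
  then show ?thesis using that[OF S z] by blast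
qed

lemma L2_compact_support:
  fixes f :: "'a::euclidean_space \<Rightarrow> 'b::euclidean_space"
  assumes "continuous_on UNIV f" "compact S" "\<And>x. x \<notin> S \<Longrightarrow> f x = 0" and E: "E \<in> sets borel"
  shows "f \<in> L2 (lebesgue_on E)"
proof -
  have "integrable lborel (\<lambda>x. (norm (f x))\<^sup>2)"
    by (rule integrable_lborel_compact_support[OF assms(2)])
       (use assms in \<open>auto intro!: continuous_intros continuous_on_subset[OF assms(1)]\<close>)
  then have "integrable lebesgue (\<lambda>x. (norm (f x))\<^sup>2)" by (subst integrable_completion) auto
  then have "integrable (lebesgue_on E) (\<lambda>x. (norm (f x))\<^sup>2)"
    using E integrable_mult_indicator[of E lebesgue "\<lambda>x. (norm (f x))\<^sup>2"]
    by (subst integrable_restrict_space) auto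
  then show ?thesis
    by (simp add: L2_def borel_measurable_lebesgue_on borel_measurable_continuous_onI[OF assms(1)])
qed

lemma test_function_L2:
  fixes v :: "real^2 \<Rightarrow> complex"
  assumes "v \<in> test_functions UNIV" and E: "E \<in> sets borel"
  shows "v \<in> L2 (lebesgue_on E)" "grad v \<in> L2 (lebesgue_on E)"
proof -
  have sm: "smooth v" using assms by (simp add: test_functions_def)
  obtain S where S: "compact S" "\<And>x. x \<notin> S \<Longrightarrow> v x = 0" "\<And>x h. x \<notin> S \<Longrightarrow> frechet_derivative v (at x) h = 0"
    using test_function_support[OF assms(1)] by metis
  show "v \<in> L2 (lebesgue_on E)" by (rule L2_compact_support[OF smooth_continuous[OF sm] S(1,2) E])
  show "grad v \<in> L2 (lebesgue_on E)"
    by (rule L2_compact_support[OF smooth_continuous_grad[OF sm] S(1) _ E]) (simp add: grad_def S(3) vec_eq_iff)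
qed

text \<open>The derivative of the product \<open>\<phi> v\<close> has integral zero; its support is
  compact inside \<open>E\<close> because that of \<open>\<phi>\<close> is, so no boundary term
  arises.\<close>

lemma test_function_parts:
  fixes v :: "real^2 \<Rightarrow> complex" and \<phi> :: "real^2 \<Rightarrow> real"
  assumes v: "smooth v" and \<phi>: "\<phi> \<in> test_functions E" and E: "E \<in> sets borel"
  shows "(LINT x|lebesgue_on E. (grad \<phi> x $ i) *\<^sub>R v x) = - (LINT x|lebesgue_on E. \<phi> x *\<^sub>R (grad v x $ i))"
proof -
  have sm: "smooth \<phi>" using \<phi> by (simp add: test_functions_def)
  obtain S where S: "compact S" "S \<subseteq> E" "\<And>x. x \<notin> S \<Longrightarrow> \<phi> x = 0" "\<And>x h. x \<notin> S \<Longrightarrow> frechet_derivative \<phi> (at x) h = 0"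
    using test_function_support[OF \<phi>] by metis
  let ?b = "axis i 1 :: real^2"
  have b: "?b \<in> Basis" by (simp add: axis_in_Basis_iff)
  define D where "D x h = \<phi> x *\<^sub>R frechet_derivative v (at x) h + frechet_derivative \<phi> (at x) h *\<^sub>R v x" for x h
  have D: "((\<lambda>x. \<phi> x *\<^sub>R v x) has_derivative D x) (at x)" for x
    unfolding D_def by (intro has_derivative_scaleR smooth_has_derivative sm v)
  have c1: "continuous_on A (\<lambda>x. \<phi> x *\<^sub>R frechet_derivative v (at x) ?b)" for A
    by (intro continuous_intros smooth_continuous sm smooth_continuous_derivative v b)
  have c2: "continuous_on A (\<lambda>x. frechet_derivative \<phi> (at x) ?b *\<^sub>R v x)" for A
    by (intro continuous_intros smooth_continuous v smooth_continuous_derivative sm b)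
  have i1: "integrable lborel (\<lambda>x. \<phi> x *\<^sub>R frechet_derivative v (at x) ?b)"
    by (rule integrable_lborel_compact_support[OF S(1) c1]) (simp add: S)
  have i2: "integrable lborel (\<lambda>x. frechet_derivative \<phi> (at x) ?b *\<^sub>R v x)"
    by (rule integrable_lborel_compact_support[OF S(1) c2]) (simp add: S)
  obtain M where M: "\<And>x. x \<in> S \<Longrightarrow> norm x \<le> M" using compact_imp_bounded[OF S(1)] by (auto simp: bounded_iff)
  have "(LINT x|lborel. D x ?b) = 0"
  proof (rule integral_directional_derivative_zero[OF D])
    show "continuous_on UNIV (\<lambda>x. D x ?b)" unfolding D_def by (intro continuous_on_add c1 c2)
    show "\<phi> x *\<^sub>R v x = 0" if "M < norm x" for x using M[of x] that S(3)[of x] by force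
  qed
  then have "(LINT x|lborel. frechet_derivative \<phi> (at x) ?b *\<^sub>R v x) = - (LINT x|lborel. \<phi> x *\<^sub>R frechet_derivative v (at x) ?b)"
    unfolding D_def using i1 i2 by (simp add: eq_neg_iff_add_eq_0 add.commute)
  moreover have "(LINT x|lebesgue_on E. (grad \<phi> x $ i) *\<^sub>R v x) = (LINT x|lborel. frechet_derivative \<phi> (at x) ?b *\<^sub>R v x)"
  proof -
    have "(LINT x|lebesgue_on E. (grad \<phi> x $ i) *\<^sub>R v x) = (LINT x|lborel. indicator E x *\<^sub>R (frechet_derivative \<phi> (at x) ?b *\<^sub>R v x))"
      unfolding grad_def vec_lambda_beta
      by (rule integral_lebesgue_on_borel[OF E borel_measurable_continuous_onI[OF c2]])
    also have "\<dots> = (LINT x|lborel. frechet_derivative \<phi> (at x) ?b *\<^sub>R v x)"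
      using S(2,4) by (intro Bochner_Integration.integral_cong) (auto simp: indicator_def)
    finally show ?thesis .
  qed
  moreover have "(LINT x|lebesgue_on E. \<phi> x *\<^sub>R (grad v x $ i)) = (LINT x|lborel. \<phi> x *\<^sub>R frechet_derivative v (at x) ?b)"
  proof -
    have "(LINT x|lebesgue_on E. \<phi> x *\<^sub>R (grad v x $ i)) = (LINT x|lborel. indicator E x *\<^sub>R (\<phi> x *\<^sub>R frechet_derivative v (at x) ?b))"
      unfolding grad_def vec_lambda_beta
      by (rule integral_lebesgue_on_borel[OF E borel_measurable_continuous_onI[OF c1]])
    also have "\<dots> = (LINT x|lborel. \<phi> x *\<^sub>R frechet_derivative v (at x) ?b)"
      using S(2,3) by (intro Bochner_Integration.integral_cong) (auto simp: indicator_def)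
    finally show ?thesis .
  qed
  ultimately show ?thesis by simp
qed

text \<open>Both sides of the integration by parts identity are continuous for square-integrable
  convergence, so the identity survives in the limit of test functions.\<close>

lemma W12_of_limit:
  assumes E: "E \<in> sets borel" and v: "\<And>n. v n \<in> test_functions UNIV"
    and u: "u \<in> L2 (lebesgue_on E)" "G \<in> L2 (lebesgue_on E)"
    and lim: "L2_tendsto (lebesgue_on E) v u" "L2_tendsto (lebesgue_on E) (\<lambda>n. grad (v n)) G"
  shows "W12_with_grad E u G"
  unfolding W12_with_grad_def
proof (intro conjI u allI impI)
  fix \<phi> :: "real^2 \<Rightarrow> real" and i :: 2 assume \<phi>: "\<phi> \<in> test_functions E"
  have sm: "smooth \<phi>" using \<phi> by (simp add: test_functions_def)
  obtain S where S: "compact S" "\<And>x. x \<notin> S \<Longrightarrow> \<phi> x = 0" "\<And>x h. x \<notin> S \<Longrightarrow> frechet_derivative \<phi> (at x) h = 0"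
    using test_function_support[OF \<phi>] by metis
  have l1: "\<phi> \<in> L2 (lebesgue_on E)" by (rule L2_compact_support[OF smooth_continuous[OF sm] S(1,2) E])
  have l2: "(\<lambda>x. grad \<phi> x $ i) \<in> L2 (lebesgue_on E)"
    unfolding grad_def vec_lambda_beta
    by (rule L2_compact_support[OF smooth_continuous_derivative[OF sm] S(1) _ E]) (simp_all add: axis_in_Basis_iff S(3))
  have "(\<lambda>n. LINT x|lebesgue_on E. (grad \<phi> x $ i) *\<^sub>R v n x) \<longlonglongrightarrow> (LINT x|lebesgue_on E. (grad \<phi> x $ i) *\<^sub>R u x)"
    by (rule L2_pairing_tendsto[OF l2 u(1) test_function_L2(1)[OF v E] lim(1)])
  moreover have "(\<lambda>n. LINT x|lebesgue_on E. \<phi> x *\<^sub>R (grad (v n) x $ i)) \<longlonglongrightarrow> (LINT x|lebesgue_on E. \<phi> x *\<^sub>R (G x $ i))"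
    by (rule L2_pairing_tendsto[OF l1 L2_component[OF u(2)] L2_component[OF test_function_L2(2)[OF v E]]
        L2_tendsto_component[OF lim(2)]])
  then have "(\<lambda>n. - (LINT x|lebesgue_on E. \<phi> x *\<^sub>R (grad (v n) x $ i))) \<longlonglongrightarrow> - (LINT x|lebesgue_on E. \<phi> x *\<^sub>R (G x $ i))"
    by (rule tendsto_minus)
  moreover have "(LINT x|lebesgue_on E. (grad \<phi> x $ i) *\<^sub>R v n x) = - (LINT x|lebesgue_on E. \<phi> x *\<^sub>R (grad (v n) x $ i))" for n
    using v[of n] by (intro test_function_parts \<phi> E) (simp add: test_functions_def)
  ultimately show "(LINT x|lebesgue_on E. (grad \<phi> x $ i) *\<^sub>R u x) = - (LINT x|lebesgue_on E. \<phi> x *\<^sub>R (G x $ i))"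
    by (simp add: LIMSEQ_unique)
qed

section \<open>Strict differentiability of the distance to a convex set\<close>

locale convex_distance =
  fixes K :: "(real^2) set"
  assumes K: "closed K" "convex K" "K \<noteq> {}"
begin

abbreviation d where "d x \<equiv> infdist x K"

definition n :: "real^2 \<Rightarrow> real^2" where "n x = (1 / d x) *\<^sub>R (x - closest_point K x)"

lemma d_pos: "x \<notin> K \<Longrightarrow> 0 < d x"
  using K in_closed_iff_infdist_zero[of K x] infdist_nonneg[of x K] by (metis less_eq_real_def)

lemma norm_n: "x \<notin> K \<Longrightarrow> norm (n x) = 1"
  using d_pos[of x] infdist_closest_point[OF K(1,3), of x] by (simp add: n_def dist_norm)

text \<open>The distance to a convex set is convex, and \<open>n w\<close> is its gradient at
  \<open>w\<close>. The vector from \<open>w\<close> to \<open>z\<close> is split at the two foot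
  points; the middle piece is controlled by the obtuse angle at the projection, the last by
  Cauchy-Schwarz.\<close>

lemma subgradient:
  assumes w: "w \<notin> K"
  shows "n w \<bullet> (z - w) \<le> d z - d w"
proof -
  let ?P = "closest_point K w" and ?Q = "closest_point K z"
  have Q: "?Q \<in> K" using K by (intro closest_point_in_set)
  have dw: "d w > 0" by (rule d_pos[OF w])
  have "(w - ?P) \<bullet> (?Q - ?P) \<le> 0" by (rule closest_point_dot[OF K(2,1) Q])
  then have 1: "n w \<bullet> (?Q - ?P) \<le> 0" using dw by (simp add: n_def divide_le_0_iff)
  have "n w \<bullet> (z - ?Q) \<le> norm (n w) * norm (z - ?Q)" by (rule norm_cauchy_schwarz)
  also have "\<dots> = d z" using norm_n[OF w] infdist_closest_point[OF K(1,3), of z] by (simp add: dist_norm)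
  finally have 2: "n w \<bullet> (z - ?Q) \<le> d z" .
  have "(w - ?P) \<bullet> (w - ?P) = (d w)\<^sup>2"
    using infdist_closest_point[OF K(1,3), of w] by (simp add: dist_norm dot_square_norm)
  then have 3: "n w \<bullet> (w - ?P) = d w" using dw by (simp add: n_def power2_eq_square)
  have "n w \<bullet> (z - w) = n w \<bullet> (z - ?Q) + n w \<bullet> (?Q - ?P) - n w \<bullet> (w - ?P)"
    by (simp add: inner_diff_right)
  then show ?thesis using 1 2 3 by simp
qed

lemma continuous_n: "continuous_on (- K) n"
  unfolding n_def using d_pos
  by (intro continuous_intros continuous_on_closest_point K) (metis ComplD less_irrefl)

text \<open>The subgradients at \<open>p\<close> and \<open>q\<close> bracket
  \<open>d p - d q\<close> between two linear functions of \<open>p - q\<close>, both close to the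
  one given by \<open>n x\<close> because \<open>n\<close> is continuous outside \<open>K\<close>.
  The mean value theorem brings in a slope of \<open>\<psi>\<close>, close to the one at
  \<open>d x\<close>.\<close>

lemma strict_gradient_profile:
  fixes \<psi> \<psi>' :: "real \<Rightarrow> real"
  assumes der: "\<And>t. (\<psi> has_real_derivative \<psi>' t) (at t)" and cont: "continuous_on UNIV \<psi>'" and x: "x \<notin> K"
  shows "strict_gradient (\<lambda>y. \<psi> (d y)) (\<psi>' (d x) *\<^sub>R n x) x"
  unfolding strict_gradient_def
proof (intro allI impI)
  fix e :: real assume e: "0 < e"
  define B where "B = \<bar>\<psi>' (d x)\<bar> + 1"
  \<comment> \<open>Half of the error \<open>e\<close> goes to the change of the slope
    \<open>\<psi>'\<close>, half to the expansion of the distance, which is multiplied by at most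
    \<open>B\<close>; the 1 in \<open>B\<close> avoids division by 0.\<close>
  define e' where "e' = e / (2 * B)"
  have B: "1 \<le> B" by (simp add: B_def)
  have e': "0 < e'" "B * e' = e / 2" using e B by (auto simp: e'_def)
  have oK: "open (- K)" using K by (simp add: open_Compl)
  obtain d1 where d1: "d1 > 0" "\<And>y. dist y x < d1 \<Longrightarrow> y \<in> - K"
    using oK x unfolding open_dist by (metis ComplI)
  have "isCont n x" using continuous_n oK x by (simp add: continuous_on_eq_continuous_at)
  then obtain d2 where d2: "d2 > 0" "\<And>y. dist y x < d2 \<Longrightarrow> dist (n y) (n x) < e'"
    using e'(1) unfolding continuous_at_eps_delta by blast
  obtain d3 where d3: "d3 > 0" "\<And>s. dist s (d x) < d3 \<Longrightarrow> dist (\<psi>' s) (\<psi>' (d x)) < e / 2"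
    using cont e unfolding continuous_on_iff by (metis UNIV_I half_gt_zero)
  define \<delta> where "\<delta> = min d1 (min d2 d3)"
  show "\<exists>\<delta>>0. \<forall>p q. dist p x < \<delta> \<longrightarrow> dist q x < \<delta> \<longrightarrow>
      \<bar>\<psi> (d p) - \<psi> (d q) - (\<psi>' (d x) *\<^sub>R n x) \<bullet> (p - q)\<bar> \<le> e * norm (p - q)"
  proof (intro exI[of _ \<delta>] conjI allI impI)
    show "0 < \<delta>" using d1 d2 d3 by (simp add: \<delta>_def)
    fix p q assume p: "dist p x < \<delta>" and q: "dist q x < \<delta>"
    have pK: "p \<notin> K" "q \<notin> K" using p q d1(2) by (auto simp: \<delta>_def)
    have np: "norm (n p - n x) \<le> e'" "norm (n q - n x) \<le> e'"
      using d2(2)[of p] d2(2)[of q] p q by (auto simp: \<delta>_def dist_norm)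
    have lip: "\<bar>d y - d z\<bar> \<le> dist y z" for y z
      using infdist_triangle[of y K z] infdist_triangle[of z K y] by (simp add: dist_commute)
    have lo: "n q \<bullet> (p - q) \<le> d p - d q" by (rule subgradient[OF pK(2)])
    have "n p \<bullet> (q - p) \<le> d q - d p" by (rule subgradient[OF pK(1)])
    then have hi: "d p - d q \<le> n p \<bullet> (p - q)" by (simp add: inner_diff_right)
    have cs: "\<bar>n y \<bullet> (p - q) - n x \<bullet> (p - q)\<bar> \<le> e' * norm (p - q)" if "norm (n y - n x) \<le> e'" for y
      using Cauchy_Schwarz_ineq2[of "n y - n x" "p - q"] mult_right_mono[OF that, of "norm (p - q)"]
      by (simp add: inner_diff_left)
    have dd: "\<bar>(d p - d q) - n x \<bullet> (p - q)\<bar> \<le> e' * norm (p - q)"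
      using lo hi cs[OF np(1)] cs[OF np(2)] by linarith
    have mvt: "\<exists>s. dist s (d x) < d3 \<and> \<psi> (d p) - \<psi> (d q) = (d p - d q) * \<psi>' s"
    proof -
      have close: "dist (d p) (d x) < d3" "dist (d q) (d x) < d3"
        using lip[of p x] lip[of q x] p q by (auto simp: \<delta>_def dist_real_def)
      consider "d p < d q" | "d p = d q" | "d q < d p" by linarith
      then show ?thesis
      proof cases
        case 1
        then have "\<exists>s>d p. s < d q \<and> \<psi> (d q) - \<psi> (d p) = (d q - d p) * \<psi>' s" by (rule MVT2) (rule der)
        then obtain s where "d p < s" "s < d q" "\<psi> (d q) - \<psi> (d p) = (d q - d p) * \<psi>' s" by blast
        moreover from this have "\<psi> (d p) - \<psi> (d q) = (d p - d q) * \<psi>' s" by (simp add: algebra_simps)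
        ultimately show ?thesis using close by (intro exI[of _ s]) (auto simp: dist_real_def abs_less_iff)
      next
        case 2 then show ?thesis using close by (intro exI[of _ "d p"]) auto
      next
        case 3
        then have "\<exists>s>d q. s < d p \<and> \<psi> (d p) - \<psi> (d q) = (d p - d q) * \<psi>' s" by (rule MVT2) (rule der)
        then obtain s where "d q < s" "s < d p" "\<psi> (d p) - \<psi> (d q) = (d p - d q) * \<psi>' s" by blast
        then show ?thesis using close by (intro exI[of _ s]) (auto simp: dist_real_def abs_less_iff)
      qed
    qed
    then obtain s where s: "dist s (d x) < d3" "\<psi> (d p) - \<psi> (d q) = (d p - d q) * \<psi>' s" by blast
    have "\<psi> (d p) - \<psi> (d q) - (\<psi>' (d x) *\<^sub>R n x) \<bullet> (p - q)
       = (d p - d q) * (\<psi>' s - \<psi>' (d x)) + \<psi>' (d x) * ((d p - d q) - n x \<bullet> (p - q))"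
      unfolding s(2) by (simp add: algebra_simps)
    also have "\<bar>\<dots>\<bar> \<le> \<bar>(d p - d q) * (\<psi>' s - \<psi>' (d x))\<bar> + \<bar>\<psi>' (d x) * ((d p - d q) - n x \<bullet> (p - q))\<bar>"
      by (rule abs_triangle_ineq)
    also have "\<dots> \<le> norm (p - q) * (e/2) + B * (e' * norm (p - q))"
      unfolding abs_mult using lip[of p q] d3(2)[OF s(1)] dd
      by (intro add_mono mult_mono) (auto simp: dist_norm dist_real_def B_def)
    also have "\<dots> = norm (p - q) * (e/2) + (B * e') * norm (p - q)" by simp
    also have "\<dots> = e * norm (p - q)" unfolding e'(2) by (simp add: field_simps)
    finally show "\<bar>\<psi> (d p) - \<psi> (d q) - (\<psi>' (d x) *\<^sub>R n x) \<bullet> (p - q)\<bar> \<le> e * norm (p - q)" .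
  qed
qed

end

section \<open>Radial trial functions outside a convex domain\<close>

lemma L2_tendsto_dominated:
  fixes f :: "'a \<Rightarrow> 'b::real_normed_vector"
  assumes m: "\<And>n. (\<lambda>x. norm (v n x - f x)) \<in> borel_measurable M"
    and bound: "\<And>n x. x \<in> space M \<Longrightarrow> norm (v n x - f x) \<le> C * indicator S x" and C: "0 \<le> C"
    and S: "S \<inter> space M \<in> sets M" "emeasure M (S \<inter> space M) < \<infinity>"
    and lim: "\<And>x. x \<in> space M \<Longrightarrow> (\<lambda>n. v n x) \<longlonglongrightarrow> f x"
  shows "L2_tendsto M v f"
proof -
  have "(\<lambda>n. \<integral>\<^sup>+x. ennreal ((norm (v n x - f x))\<^sup>2) \<partial>M) \<longlonglongrightarrow> (\<integral>\<^sup>+x. 0 \<partial>M)"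
  proof (rule nn_integral_dominated_convergence[where w="\<lambda>x. ennreal (C\<^sup>2) * indicator (S \<inter> space M) x"])
    show "(\<lambda>x. ennreal ((norm (v n x - f x))\<^sup>2)) \<in> borel_measurable M" for n
      using m by measurable
    show "(\<lambda>x. ennreal (C\<^sup>2) * indicator (S \<inter> space M) x) \<in> borel_measurable M" using S by measurable
    show "AE x in M. ennreal ((norm (v n x - f x))\<^sup>2) \<le> ennreal (C\<^sup>2) * indicator (S \<inter> space M) x" for n
    proof (rule AE_I2)
      fix x assume x: "x \<in> space M"
      have "(norm (v n x - f x))\<^sup>2 \<le> (C * indicator S x)\<^sup>2" using bound[OF x] by (intro power_mono) auto
      then show "ennreal ((norm (v n x - f x))\<^sup>2) \<le> ennreal (C\<^sup>2) * indicator (S \<inter> space M) x"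
        using x by (cases "x \<in> S") (auto simp: ennreal_leI)
    qed
    show "(\<integral>\<^sup>+x. ennreal (C\<^sup>2) * indicator (S \<inter> space M) x \<partial>M) < \<infinity>"
      using S by (simp add: nn_integral_cmult_indicator ennreal_mult_less_top)
    show "AE x in M. (\<lambda>n. ennreal ((norm (v n x - f x))\<^sup>2)) \<longlonglongrightarrow> 0"
    proof (rule AE_I2)
      fix x assume "x \<in> space M"
      from tendsto_power[OF tendsto_norm[OF LIM_zero[OF lim[OF this]]], of 2]
      have "(\<lambda>n. ennreal ((norm (v n x - f x))\<^sup>2)) \<longlonglongrightarrow> ennreal ((norm (0::'b))\<^sup>2)" by (rule tendsto_ennrealI)
      then show "(\<lambda>n. ennreal ((norm (v n x - f x))\<^sup>2)) \<longlonglongrightarrow> 0" by simp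
    qed
  qed simp
  then show ?thesis by (simp add: L2_tendsto_def)
qed

text \<open>By Steiner's formula \<open>L + 2 \<pi> t\<close> is the length of the exterior parallel curve at
  distance \<open>t\<close> from a convex set of perimeter \<open>L\<close>.\<close>

definition weighted :: "real \<Rightarrow> (real \<Rightarrow> real) \<Rightarrow> real" where
  "weighted L f = enn2real (\<integral>\<^sup>+t. ennreal (f t) * (ennreal (L + t * (2 * pi)) * indicator {0<..} t) \<partial>lborel)"

text \<open>Differentiability on the whole line, rather than on \<open>t \<ge> 0\<close>, spares
  one-sided derivatives at the boundary of the domain. Continuous differentiability is the chosen
  regularity, so that squares of truncated linear functions qualify.\<close>

definition profile :: "(real \<Rightarrow> real) \<Rightarrow> (real \<Rightarrow> real) \<Rightarrow> real \<Rightarrow> bool" where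
  "profile \<psi> \<psi>' T \<longleftrightarrow> 0 \<le> T \<and> (\<forall>t. (\<psi> has_real_derivative \<psi>' t) (at t)) \<and> continuous_on UNIV \<psi>' \<and> (\<forall>t\<ge>T. \<psi> t = 0)"

lemma profile_derivative_zero:
  assumes "profile \<psi> \<psi>' T" "T < t"
  shows "\<psi>' t = 0"
proof -
  have "((\<lambda>_. 0) has_real_derivative 0) (at t)" by simp
  then have "(\<psi> has_real_derivative 0) (at t)"
    by (rule has_field_derivative_transform_within_open[of _ _ _ "{T<..}"]) (use assms in \<open>auto simp: profile_def\<close>)
  moreover have "(\<psi> has_real_derivative \<psi>' t) (at t)" using assms(1) by (simp add: profile_def)
  ultimately show ?thesis by (simp add: DERIV_unique)
qed

lemma profile_continuous: "profile \<psi> \<psi>' T \<Longrightarrow> continuous_on A \<psi>" "profile \<psi> \<psi>' T \<Longrightarrow> continuous_on A \<psi>'"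
  unfolding profile_def
  by (blast intro: DERIV_isCont continuous_at_imp_continuous_on) (meson continuous_on_subset subset_UNIV)

lemma profile_lipschitz:
  assumes "profile \<psi> \<psi>' T"
  obtains B where "0 \<le> B" "\<And>t. 0 \<le> t \<Longrightarrow> \<bar>\<psi>' t\<bar> \<le> B" "\<And>s t. 0 \<le> s \<Longrightarrow> 0 \<le> t \<Longrightarrow> \<bar>\<psi> s - \<psi> t\<bar> \<le> B * \<bar>s - t\<bar>"
proof -
  have "compact (\<psi>' ` {0..T})" by (intro compact_continuous_image profile_continuous(2)[OF assms]) auto
  then obtain C where C: "\<forall>t\<in>{0..T}. norm (\<psi>' t) \<le> C"
    by (auto dest!: compact_imp_bounded simp: bounded_iff)
  have B: "\<bar>\<psi>' t\<bar> \<le> max C 0" if "0 \<le> t" for t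
    using bspec[OF C, of t] profile_derivative_zero[OF assms, of t] that by (cases "t \<le> T") auto
  have "\<bar>\<psi> s - \<psi> t\<bar> \<le> max C 0 * \<bar>s - t\<bar>" if "0 \<le> s" "0 \<le> t" for s t
  proof -
    have "norm (\<psi> s - \<psi> t) \<le> max C 0 * norm (s - t)"
    proof (rule field_differentiable_bound[of "{0..}" \<psi> \<psi>'])
      show "(\<psi> has_real_derivative \<psi>' z) (at z within {0..})" for z
        using assms by (auto simp: profile_def intro: DERIV_subset)
      show "norm (\<psi>' z) \<le> max C 0" if "z \<in> {0..}" for z using B that by simp
    qed (use that in auto)
    then show ?thesis by simp
  qed
  with B show ?thesis using that[of "max C 0"] by auto
qed

lemma integral_ext_radial:
  assumes dom: "convex_smooth_domain \<Omega>" "\<Omega> \<noteq> {}" and F: "F \<in> borel_measurable (borel :: real measure)" "\<And>t. 0 \<le> F t"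
  shows "(LINT x|lebesgue_on (ext \<Omega>). F (infdist x (closure \<Omega>))) = weighted (perimeter \<Omega>) F"
proof -
  have E: "ext \<Omega> \<in> sets borel" unfolding ext_def by auto
  have m: "(\<lambda>x. F (infdist x (closure \<Omega>))) \<in> borel_measurable borel"
    by (rule measurable_compose[OF borel_measurable_continuous_onI F(1)]) (intro continuous_intros)
  have "(LINT x|lebesgue_on (ext \<Omega>). F (infdist x (closure \<Omega>)))
      = enn2real (\<integral>\<^sup>+x. ennreal (F (infdist x (closure \<Omega>))) \<partial>lebesgue_on (ext \<Omega>))"
    by (rule integral_eq_nn_integral) (use F borel_measurable_lebesgue_on[OF m] in auto)
  also have "(\<integral>\<^sup>+x. ennreal (F (infdist x (closure \<Omega>))) \<partial>lebesgue_on (ext \<Omega>))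
      = (\<integral>\<^sup>+x. ennreal (F (infdist x (closure \<Omega>))) * indicator (- closure \<Omega>) x \<partial>lborel)"
    unfolding nn_integral_lebesgue_on[OF E] by (simp add: ext_def)
  also have "\<dots> = (\<integral>\<^sup>+t. ennreal (F t) * (ennreal (perimeter \<Omega> + t * (2 * pi)) * indicator {0<..} t) \<partial>lborel)"
    by (rule nn_integral_parallel[OF dom]) (use F in measurable)
  finally show ?thesis by (simp add: weighted_def)
qed

lemma of_real_test_function:
  fixes v :: "real^2 \<Rightarrow> real"
  assumes sm: "smooth v" and supp: "\<And>x. M < norm x \<Longrightarrow> v x = 0"
  shows "(\<lambda>x. complex_of_real (v x)) \<in> test_functions UNIV"
    and "grad (\<lambda>x. complex_of_real (v x)) x = cvec (grad v x)"
proof -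
  have "closure {x. complex_of_real (v x) \<noteq> 0} \<subseteq> cball 0 M"
  proof (rule closure_minimal)
    show "{x. complex_of_real (v x) \<noteq> 0} \<subseteq> cball 0 M"
    proof
      fix x assume "x \<in> {x. complex_of_real (v x) \<noteq> 0}"
      then have "\<not> M < norm x" using supp[of x] by auto
      then show "x \<in> cball 0 M" by simp
    qed
  qed simp
  then have "compact (closure {x. complex_of_real (v x) \<noteq> 0})"
    by (metis bounded_cball bounded_subset closed_closure compact_eq_bounded_closed)
  moreover have "smooth (\<lambda>x. complex_of_real (v x))"
    using sm Ck_linear_compose[OF bounded_linear_of_real] unfolding smooth_def by blast
  ultimately show "(\<lambda>x. complex_of_real (v x)) \<in> test_functions UNIV" by (simp add: test_functions_def)
  have "((\<lambda>x. complex_of_real (v x)) has_derivative (\<lambda>h. complex_of_real (frechet_derivative v (at x) h))) (at x)"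
    by (rule bounded_linear.has_derivative[OF bounded_linear_of_real smooth_has_derivative[OF sm]])
  from frechet_derivative_at[OF this] have "frechet_derivative (\<lambda>x. complex_of_real (v x)) (at x) h
      = complex_of_real (frechet_derivative v (at x) h)" for h
    by (metis)
  then show "grad (\<lambda>x. complex_of_real (v x)) x = cvec (grad v x)" by (simp add: grad_def cvec_def)
qed

text \<open>The mollified trial functions are the test functions that \<open>has_trace\<close> asks
  for: they converge uniformly, and their gradients converge pointwise off the closure with a common
  bound, so dominated convergence gives all three limits. The trace is the constant
  \<open>\<psi> 0\<close>.\<close>

theorem robin_upper:
  assumes dom: "convex_smooth_domain \<Omega>" "\<Omega> \<noteq> {}" and \<psi>: "profile \<psi> \<psi>' T"
    and N: "weighted (perimeter \<Omega>) (\<lambda>t. (\<psi> t)\<^sup>2) \<noteq> 0"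
  shows "robin_ext_eigenvalue \<alpha> \<Omega> \<le> ereal ((weighted (perimeter \<Omega>) (\<lambda>t. (\<psi>' t)\<^sup>2) + \<alpha> * (perimeter \<Omega> * (\<psi> 0)\<^sup>2))
           / weighted (perimeter \<Omega>) (\<lambda>t. (\<psi> t)\<^sup>2))"
proof -
  have dom': "open \<Omega>" "convex \<Omega>" "bounded \<Omega>" using dom by (auto simp: convex_smooth_domain_def)
  let ?K = "closure \<Omega>" and ?L = "perimeter \<Omega>" and ?E = "ext \<Omega>" and ?F = "frontier \<Omega>"
  interpret convex_distance ?K by standard (use dom dom' in \<open>auto simp: convex_closure\<close>)
  have E: "?E \<in> sets borel" "?E = - ?K" unfolding ext_def by auto
  have T0: "0 \<le> T" and \<psi>0: "\<And>t. T \<le> t \<Longrightarrow> \<psi> t = 0" and der: "\<And>t. (\<psi> has_real_derivative \<psi>' t) (at t)"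
    using \<psi> by (auto simp: profile_def)
  obtain B where B: "0 \<le> B" "\<And>t. 0 \<le> t \<Longrightarrow> \<bar>\<psi>' t\<bar> \<le> B" "\<And>s t. 0 \<le> s \<Longrightarrow> 0 \<le> t \<Longrightarrow> \<bar>\<psi> s - \<psi> t\<bar> \<le> B * \<bar>s - t\<bar>"
    using profile_lipschitz[OF \<psi>] by metis
  have d0: "0 \<le> d x" for x by (rule infdist_nonneg)
  have lipd: "\<bar>d y - d z\<bar> \<le> norm (y - z)" for y z
    using infdist_triangle[of y ?K z] infdist_triangle[of z ?K y] by (simp add: dist_norm norm_minus_commute)
  have contd: "continuous_on A d" for A by (intro continuous_intros)
  obtain R0 where R0: "\<And>y. y \<in> ?K \<Longrightarrow> norm y \<le> R0" using bounded_closure[OF dom'(3)] by (auto simp: bounded_iff)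
  define M where "M = R0 + T"
  have far: "T < d x" if "M < norm x" for x
  proof -
    have cp: "closest_point ?K x \<in> ?K" using K by (intro closest_point_in_set)
    have "norm x \<le> norm (closest_point ?K x) + dist x (closest_point ?K x)"
      using norm_triangle_ineq[of "closest_point ?K x" "x - closest_point ?K x"] by (simp add: dist_norm)
    then show ?thesis using that R0[OF cp] infdist_closest_point[OF K(1,3), of x] by (simp add: M_def)
  qed
  \<comment> \<open>On the closure the distance is 0, so \<open>u\<close> is extended by the
    constant \<open>\<psi> 0\<close> to a Lipschitz function on the whole plane, which can be
    mollified across the boundary.\<close>
  define u where "u x = \<psi> (d x)" for x
  define a where "a x = \<psi>' (d x) *\<^sub>R n x" for x
  have u_lip: "\<bar>u p - u q\<bar> \<le> B * norm (p - q)" for p q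
  proof -
    have "\<bar>u p - u q\<bar> \<le> B * \<bar>d p - d q\<bar>" unfolding u_def by (intro B d0)
    also have "\<dots> \<le> B * norm (p - q)" by (intro mult_left_mono lipd B)
    finally show ?thesis .
  qed
  have u_supp: "u x = 0" if "M < norm x" for x using far[OF that] \<psi>0[of "d x"] by (simp add: u_def)
  have cont_u: "continuous_on A u" for A
    unfolding u_def by (intro continuous_on_compose2[OF profile_continuous(1)[OF \<psi>, of UNIV] contd]) auto
  obtain v where v: "\<And>n. smooth (v n)" "\<And>n x. M + 1 < norm x \<Longrightarrow> v n x = 0"
    "\<And>n x. \<bar>v n x - u x\<bar> \<le> B / Suc n" "\<And>n x. norm (grad (v n) x) \<le> B"
    "\<And>a x. strict_gradient u a x \<Longrightarrow> (\<lambda>n. grad (v n) x) \<longlonglongrightarrow> a"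
    using smooth_approximation[OF B(1) u_lip u_supp] by blast
  define w where "w n x = complex_of_real (v n x)" for n x
  define uC where "uC x = complex_of_real (u x)" for x
  define G where "G x = cvec (a x)" for x
  define g where "g = (\<lambda>x::real^2. complex_of_real (\<psi> 0))"
  have w: "w n \<in> test_functions UNIV" "grad (w n) x = cvec (grad (v n) x)" for n x
    unfolding w_def[abs_def] using of_real_test_function[OF v(1) v(2)] by auto
  have v_lim: "(\<lambda>n. v n x) \<longlonglongrightarrow> u x" for x
  proof -
    have "(\<lambda>n. B / real (Suc n)) \<longlonglongrightarrow> 0" using LIMSEQ_Suc[OF lim_const_over_n[of B]] .
    then have "(\<lambda>n. v n x - u x) \<longlonglongrightarrow> 0" by (rule Lim_null_comparison[rotated]) (intro always_eventually allI, unfold real_norm_def, rule v(3))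
    then show ?thesis by (simp add: LIM_zero_iff)
  qed
  have w_lim: "(\<lambda>n. w n x) \<longlonglongrightarrow> uC x" for x unfolding w_def uC_def by (intro tendsto_of_real v_lim)
  have w_close: "norm (w n x - uC x) \<le> B / Suc n" for n x
  proof -
    have "w n x - uC x = complex_of_real (v n x - u x)" by (simp add: w_def uC_def)
    then have "norm (w n x - uC x) = \<bar>v n x - u x\<bar>" by (simp only: norm_of_real)
    then show ?thesis using v(3)[of n x] by simp
  qed
  have w_close': "norm (w n x - uC x) \<le> B" for n x
  proof -
    have "B / real (Suc n) \<le> B / 1" by (intro divide_left_mono) (use B in auto)
    then show ?thesis using w_close[of n x] by simp
  qed
  have grad_lim: "(\<lambda>n. grad (w n) x) \<longlonglongrightarrow> G x" if "x \<notin> ?K" for x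
  proof -
    have "strict_gradient u (a x) x" unfolding u_def[abs_def] a_def
      by (rule strict_gradient_profile[OF der profile_continuous(2)[OF \<psi>] that])
    then have "(\<lambda>n. grad (v n) x) \<longlonglongrightarrow> a x" by (rule v(5))
    moreover have "isCont cvec (a x)" using continuous_on_cvec[of UNIV] by (simp add: continuous_on_eq_continuous_at)
    ultimately show ?thesis unfolding w(2) G_def by (rule isCont_tendsto_compose[rotated])
  qed
  have norm_a: "norm (a x) = \<bar>\<psi>' (d x)\<bar>" if "x \<notin> ?K" for x using norm_n[OF that] by (simp add: a_def)
  have a_zero: "a x = 0" if "M < norm x" for x using profile_derivative_zero[OF \<psi> far[OF that]] by (simp add: a_def)
  have [measurable]: "closest_point ?K \<in> borel_measurable borel" "(\<lambda>x. d x) \<in> borel_measurable borel" "\<psi>' \<in> borel_measurable borel"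
      "\<psi> \<in> borel_measurable borel" "cvec \<in> borel_measurable borel"
    using K by (intro borel_measurable_continuous_onI continuous_on_closest_point contd profile_continuous[OF \<psi>] continuous_on_cvec; simp)+
  have "a \<in> borel_measurable borel" unfolding a_def[abs_def] n_def by measurable
  then have G_borel: "G \<in> borel_measurable borel" unfolding G_def[abs_def] by measurable
  have cont_uC: "continuous_on UNIV uC" unfolding uC_def by (intro continuous_intros cont_u)
  have uL2: "uC \<in> L2 (lebesgue_on ?E)"
    by (rule L2_compact_support[OF cont_uC compact_cball[of 0 M] _ E(1)]) (simp add: uC_def u_supp not_le)
  have sp: "space (lebesgue_on ?E) = ?E" by (simp add: space_restrict_space)
  have cb: "cball (0::real^2) r \<inter> ?E \<in> sets (lebesgue_on ?E)" for r
    using E by (auto simp: sets_restrict_space)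
  have cbf: "emeasure (lebesgue_on ?E) (cball (0::real^2) r \<inter> ?E) < \<infinity>" for r
  proof -
    have "emeasure (lebesgue_on ?E) (cball (0::real^2) r \<inter> ?E) = emeasure lborel (cball (0::real^2) r \<inter> ?E)"
      using E by (subst emeasure_restrict_space) auto
    also have "\<dots> \<le> emeasure lborel (cball (0::real^2) r)" by (rule emeasure_mono) auto
    also have "\<dots> < \<infinity>" using emeasure_lborel_cball_finite by blast
    finally show ?thesis .
  qed
  have GL2: "G \<in> L2 (lebesgue_on ?E)"
  proof -
    have i: "integrable (lebesgue_on ?E) (\<lambda>x. B\<^sup>2 * indicator (cball 0 M \<inter> ?E) x)"
      using cb cbf by (intro integrable_mult_right integrable_real_indicator)
    have "integrable (lebesgue_on ?E) (\<lambda>x. (norm (G x))\<^sup>2)"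
    proof (rule Bochner_Integration.integrable_bound[OF i])
      show "(\<lambda>x. (norm (G x))\<^sup>2) \<in> borel_measurable (lebesgue_on ?E)"
        using borel_measurable_lebesgue_on[OF G_borel, of ?E] by measurable
      show "AE x in lebesgue_on ?E. norm ((norm (G x))\<^sup>2) \<le> norm (B\<^sup>2 * indicator (cball 0 M \<inter> ?E) x)"
      proof (rule AE_I2)
        fix x assume "x \<in> space (lebesgue_on ?E)"
        then have x: "x \<in> ?E" "x \<notin> ?K" using E sp by auto
        show "norm ((norm (G x))\<^sup>2) \<le> norm (B\<^sup>2 * indicator (cball 0 M \<inter> ?E) x)"
        proof (cases "norm x \<le> M")
          case True
          have "norm (G x) \<le> B" using B(2)[OF d0] by (simp add: G_def norm_a x)
          then show ?thesis using True x by (simp add: power_mono)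
        qed (simp add: G_def a_zero not_le)
      qed
    qed
    then show ?thesis using borel_measurable_lebesgue_on[OF G_borel] by (simp add: L2_def)
  qed
  have mw: "(\<lambda>x. norm (w n x - uC x)) \<in> borel_measurable borel" for n
    by (intro borel_measurable_continuous_onI continuous_intros cont_uC smooth_continuous)
       (use w(1)[of n] in \<open>simp add: test_functions_def\<close>)
  have lim1: "L2_tendsto (lebesgue_on ?E) w uC"
  proof (rule L2_tendsto_dominated[where C=B and S="cball 0 (M+1)"])
    show "norm (w n x - uC x) \<le> B * indicator (cball 0 (M + 1)) x" for n x
      using w_close'[of n x] v(2)[of x n] u_supp[of x] by (cases "norm x \<le> M + 1") (auto simp: w_def uC_def)
  qed (use B w_lim cb cbf borel_measurable_lebesgue_on[OF mw] sp in auto)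
  have mg: "(\<lambda>x. norm (grad (w n) x - G x)) \<in> borel_measurable borel" for n
  proof -
    have "grad (w n) \<in> borel_measurable borel"
      by (intro borel_measurable_continuous_onI smooth_continuous_grad)
         (use w(1)[of n] in \<open>simp add: test_functions_def\<close>)
    then show ?thesis using G_borel by measurable
  qed
  have gv0: "grad (v n) x = 0" if "M + 1 < norm x" for n x
  proof -
    have "((\<lambda>_. 0) has_derivative (\<lambda>_. 0)) (at x)" by simp
    then have "(v n has_derivative (\<lambda>_. 0)) (at x)"
    proof (rule has_derivative_transform_within_open)
      show "open (- cball (0::real^2) (M + 1))" by (intro open_Compl closed_cball)
      show "x \<in> - cball 0 (M + 1)" using that by simp
      show "0 = v n y" if "y \<in> - cball 0 (M + 1)" for y using that by (simp add: v(2))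
    qed
    from frechet_derivative_at[OF this] show ?thesis unfolding grad_def vec_eq_iff by (metis vec_lambda_beta zero_index)
  qed
  have lim2: "L2_tendsto (lebesgue_on ?E) (\<lambda>n. grad (w n)) G"
  proof (rule L2_tendsto_dominated[where C="2*B" and S="cball 0 (M+1)"])
    fix n x assume "x \<in> space (lebesgue_on ?E)"
    then have x: "x \<notin> ?K" using E sp by auto
    show "norm (grad (w n) x - G x) \<le> 2 * B * indicator (cball 0 (M + 1)) x"
    proof (cases "norm x \<le> M + 1")
      case True
      have "norm (grad (w n) x - G x) = norm (grad (v n) x - a x)" by (simp add: w(2) G_def cvec_diff)
      also have "\<dots> \<le> norm (grad (v n) x) + norm (a x)" by (rule norm_triangle_ineq4)
      also have "\<dots> \<le> B + B" using v(4)[of n x] B(2)[OF d0] by (intro add_mono) (auto simp: norm_a x)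
      finally show ?thesis using True by simp
    next
      case False
      then show ?thesis using gv0[of x n] a_zero[of x] by (simp add: w(2) G_def cvec_diff flip: norm_cvec)
    qed
  next
    fix x assume "x \<in> space (lebesgue_on ?E)"
    then show "(\<lambda>n. grad (w n) x) \<longlonglongrightarrow> G x" using E sp by (intro grad_lim) auto
  qed (use B cb cbf borel_measurable_lebesgue_on[OF mg] sp in auto)
  have W: "W12_with_grad ?E uC G" by (rule W12_of_limit[OF E(1) w(1) uL2 GL2 lim1 lim2])
  have F: "?F \<in> sets borel" by (simp add: borel_closed)
  have spF: "space (arc_length_on ?F) = ?F" by (simp add: space_restrict_space)
  have emF: "emeasure (arc_length_on ?F) ?F = ennreal ?L"
    using F steiner_formula(1)[OF dom] by (subst emeasure_restrict_space) auto
  have setF: "?F \<in> sets (arc_length_on ?F)" using spF sets.top[of "arc_length_on ?F"] by simp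
  have finF: "finite_measure (arc_length_on ?F)" by standard (simp add: spF emF)
  have u_front: "uC x = g x" if "x \<in> ?F" for x
  proof -
    have "x \<in> ?K" using that by (simp add: frontier_def)
    then have "d x = 0" by simp
    then show ?thesis by (simp add: uC_def g_def u_def)
  qed
  have lim3: "L2_tendsto (arc_length_on ?F) w g"
  proof (rule L2_tendsto_dominated[where C=B and S="?F"])
    show "(\<lambda>x. norm (w n x - g x)) \<in> borel_measurable (arc_length_on ?F)" for n
    proof (rule measurable_restrict_space1)
      have "(\<lambda>x. norm (w n x - g x)) \<in> borel_measurable borel"
        unfolding g_def by (intro borel_measurable_continuous_onI continuous_intros smooth_continuous)
           (use w(1)[of n] in \<open>simp add: test_functions_def\<close>)
      then show "(\<lambda>x. norm (w n x - g x)) \<in> borel_measurable hausdorff1"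
        by (simp cong: measurable_cong_sets)
    qed
    show "norm (w n x - g x) \<le> B * indicator ?F x" if "x \<in> space (arc_length_on ?F)" for n x
      using that w_close'[of n x] u_front[of x] by (simp add: spF)
    show "(\<lambda>n. w n x) \<longlonglongrightarrow> g x" if "x \<in> space (arc_length_on ?F)" for x
      using that w_lim[of x] u_front[of x] by (simp add: spF)
  qed (use B spF setF emF in auto)
  have gL2: "g \<in> L2 (arc_length_on ?F)"
    unfolding L2_def g_def using finite_measure.integrable_const[OF finF] by simp
  have tr: "has_trace \<Omega> uC g"
    unfolding has_trace_def using gL2 W w(1) lim1 lim2 lim3 by blast
  have iu: "(LINT x|lebesgue_on ?E. (norm (uC x))\<^sup>2) = weighted ?L (\<lambda>t. (\<psi> t)\<^sup>2)"
    unfolding uC_def u_def using integral_ext_radial[OF dom, of "\<lambda>t. (\<psi> t)\<^sup>2"] by simp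
  have iG: "(LINT x|lebesgue_on ?E. (norm (G x))\<^sup>2) = weighted ?L (\<lambda>t. (\<psi>' t)\<^sup>2)"
  proof -
    have "(LINT x|lebesgue_on ?E. (norm (G x))\<^sup>2) = (LINT x|lebesgue_on ?E. (\<psi>' (d x))\<^sup>2)"
      by (rule Bochner_Integration.integral_cong) (use sp E in \<open>auto simp: G_def norm_a\<close>)
    then show ?thesis using integral_ext_radial[OF dom, of "\<lambda>t. (\<psi>' t)\<^sup>2"] by simp
  qed
  have ig: "(LINT x|arc_length_on ?F. (norm (g x))\<^sup>2) = ?L * (\<psi> 0)\<^sup>2"
  proof -
    have "measure (arc_length_on ?F) (space (arc_length_on ?F)) = ?L"
      unfolding spF measure_def emF by (simp add: perimeter_def)
    then show ?thesis by (simp add: g_def)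
  qed
  have "\<not> (AE x in lebesgue_on ?E. uC x = 0)"
  proof
    assume "AE x in lebesgue_on ?E. uC x = 0"
    then have "(LINT x|lebesgue_on ?E. (norm (uC x))\<^sup>2) = (LINT x|lebesgue_on ?E. 0)"
      by (intro integral_cong_AE) (use borel_measurable_lebesgue_on[OF borel_measurable_continuous_onI[OF cont_uC]] in auto)
    then show False using N iu by simp
  qed
  with W tr have "robin_ext_eigenvalue \<alpha> \<Omega> \<le> ereal (((LINT x|lebesgue_on ?E. (norm (G x))\<^sup>2) +
       \<alpha> * (LINT x|arc_length_on ?F. (norm (g x))\<^sup>2)) / (LINT x|lebesgue_on ?E. (norm (uC x))\<^sup>2))"
    unfolding robin_ext_eigenvalue_def by (intro Inf_lower) blast
  then show ?thesis unfolding iu iG ig .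
qed

section \<open>Polar coordinates outside a disk\<close>

definition circ :: "real \<Rightarrow> real^2" where "circ \<theta> = xy (cos \<theta>, sin \<theta>)"

definition rot :: "real \<Rightarrow> real^2 \<Rightarrow> real^2" where
  "rot \<theta> z = xy (cos \<theta> * z$1 - sin \<theta> * z$2, sin \<theta> * z$1 + cos \<theta> * z$2)"

lemma norm_circ [simp]: "norm (circ \<theta>) = 1"
  by (simp add: circ_def norm_vec_def L2_set_def sum_2)

lemma circ_periodic: "circ (\<theta> + 2 * pi) = circ \<theta>"
  by (simp add: circ_def)

lemma rot_circ: "rot \<theta> (r *\<^sub>R circ \<phi>) = r *\<^sub>R circ (\<theta> + \<phi>)"
  by (simp add: rot_def circ_def vec_eq_iff forall_2 cos_add sin_add algebra_simps)

lemma polar_form: obtains \<phi> where "0 \<le> \<phi>" "\<phi> < 2 * pi" "z = norm z *\<^sub>R circ \<phi>"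
proof (cases "z = 0")
  case True then show ?thesis using that[of 0] by simp
next
  case False
  define y where "y = (1 / norm z) *\<^sub>R z"
  have "norm y = 1" "z = norm z *\<^sub>R y" using False by (simp_all add: y_def)
  moreover from this have "(y$1)\<^sup>2 + (y$2)\<^sup>2 = 1" by (simp add: norm_vec_def L2_set_def sum_2)
  then obtain t where "0 \<le> t" "t < 2 * pi" "y$1 = cos t" "y$2 = sin t" using sincos_total_2pi by metis
  moreover from this have "y = circ t" by (simp add: circ_def vec_eq_iff forall_2)
  ultimately show ?thesis using that by metis
qed

lemma continuous_on_circ [continuous_intros]: "continuous_on A f \<Longrightarrow> continuous_on A (\<lambda>x. circ (f x))" for f :: "'a::t2_space \<Rightarrow> real"
  unfolding circ_def by (intro continuous_on_compose2[OF continuous_on_xy[of UNIV]] continuous_intros continuous_on_cos continuous_on_sin) auto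

lemma continuous_on_rot [continuous_intros]:
  "continuous_on A f \<Longrightarrow> continuous_on A g \<Longrightarrow> continuous_on A (\<lambda>x. rot (f x) (g x))" for f :: "'a::t2_space \<Rightarrow> real"
  unfolding rot_def by (intro continuous_on_compose2[OF continuous_on_xy[of UNIV]] continuous_intros continuous_on_cos continuous_on_sin) auto

lemma orthogonal_rot: "orthogonal_transformation (rot \<theta>)"
  unfolding orthogonal_transformation_def
proof (intro conjI allI)
  show "linear (rot \<theta>)"
    by (rule linearI) (simp_all add: rot_def vec_eq_iff forall_2 algebra_simps)
  fix v w :: "real^2"
  have key: "(u * a - w * b) * (u * c - w * k) + (w * a + u * b) * (w * c + u * k) = a * c + b * k"
    if "u * u + w * w = 1" for a b c k u w :: real
    using that by algebra
  have "cos \<theta> * cos \<theta> + sin \<theta> * sin \<theta> = 1" using sin_cos_squared_add2[of \<theta>] by (simp add: power2_eq_square)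
  then show "rot \<theta> v \<bullet> rot \<theta> w = v \<bullet> w"
    unfolding inner_vec_def sum_2 rot_def xy_nth fst_conv snd_conv inner_real_def by (rule key)
qed

definition turn :: "real^2 \<Rightarrow> real \<Rightarrow> real^2 \<Rightarrow> real^2" where "turn p \<theta> x = p + rot \<theta> (x - p)"

lemma dist_turn: "dist (turn p \<theta> x) (turn p \<theta> y) = dist x y"
proof -
  have "turn p \<theta> x - turn p \<theta> y = rot \<theta> (x - y)"
    using orthogonal_transformation_linear[OF orthogonal_rot[of \<theta>]] by (simp add: turn_def flip: linear_diff)
  then show ?thesis by (simp add: dist_norm orthogonal_transformation_norm[OF orthogonal_rot])
qed

lemma dist_turn_center: "dist p (turn p \<theta> x) = dist p x"
  by (simp add: turn_def dist_norm orthogonal_transformation_norm[OF orthogonal_rot] norm_minus_commute)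

lemma turn_inverse: "turn p (-\<theta>) (turn p \<theta> x) = x" "turn p \<theta> (turn p (-\<theta>) x) = x"
proof -
  have "rot a (rot (-a) z) = z" for a z
    by (rule polar_form[of z]) (metis rot_circ add.inverse_inverse add.right_inverse add_0 add.assoc add.commute)
  from this[of \<theta>] this[of "-\<theta>"] show "turn p (-\<theta>) (turn p \<theta> x) = x" "turn p \<theta> (turn p (-\<theta>) x) = x"
    by (simp_all add: turn_def)
qed

lemma turn_vimage: "turn p \<theta> -` A = turn p (-\<theta>) ` A"
  using turn_inverse[of p \<theta>] by (auto simp: image_iff) metis

lemma borel_measurable_turn [measurable]: "turn p \<theta> \<in> borel_measurable borel"
  unfolding turn_def by (intro borel_measurable_continuous_onI continuous_intros)

text \<open>Conjugating by a translation reduces to a rotation about the origin, an orthogonal map,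
  which preserves the measure of boxes.\<close>

lemma distr_turn_lborel: "distr lborel borel (turn p \<theta>) = (lborel :: (real^2) measure)"
proof (rule lborel_eqI[symmetric])
  fix l u :: "real^2" assume le: "\<And>b. b \<in> Basis \<Longrightarrow> l \<bullet> b \<le> u \<bullet> b"
  have m: "turn p \<theta> -` box l u \<in> sets borel" using measurable_sets[OF borel_measurable_turn, of "box l u" p \<theta>] by simp
  have "turn p \<theta> -` box l u = (\<lambda>x. p + x) ` (rot (-\<theta>) ` ((\<lambda>x. -p + x) ` box l u))"
    unfolding turn_vimage by (auto simp: turn_def image_image)
  then have "measure lebesgue (turn p \<theta> -` box l u) = measure lebesgue (rot (-\<theta>) ` ((\<lambda>x. -p + x) ` box l u))"
    by (simp only: measure_translation)
  also have "\<dots> = measure lebesgue ((\<lambda>x. -p + x) ` box l u)"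
    by (rule measure_orthogonal_image[OF orthogonal_rot]) (intro measurable_translation lmeasurable_box)
  also have "\<dots> = measure lebesgue (box l u)" by (rule measure_translation)
  finally have eq: "measure lebesgue (turn p \<theta> -` box l u) = measure lebesgue (box l u)" .
  have "bounded (turn p (-\<theta>) ` box l u)"
    using bounded_box[of l u] dist_turn[of p "-\<theta>"] unfolding bounded_def by (metis imageE)
  then have "emeasure lborel (turn p \<theta> -` box l u) < \<infinity>" unfolding turn_vimage by (rule emeasure_bounded_finite)
  then have "emeasure lborel (turn p \<theta> -` box l u) = emeasure lborel (box l u)"
    using eq m emeasure_bounded_finite[OF bounded_box[of l u]] by (simp add: emeasure_eq_ennreal_measure less_top)
  then have "emeasure (distr lborel borel (turn p \<theta>)) (box l u) = emeasure lborel (box l u)"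
    by (subst emeasure_distr) auto
  then show "emeasure (distr lborel borel (turn p \<theta>)) (box l u) = ennreal (prod ((\<bullet>) (u - l)) Basis)"
    using le by (simp add: emeasure_lborel_box)
qed simp

text \<open>Rotations and their inverses are Lipschitz with constant 1, so they cannot change the
  outer measure.\<close>

lemma distr_turn_hausdorff1: "distr hausdorff1 borel (turn p \<theta>) = (hausdorff1 :: (real^2) measure)"
proof (rule measure_eqI)
  fix A :: "(real^2) set" assume "A \<in> sets (distr hausdorff1 borel (turn p \<theta>))"
  then have A: "A \<in> sets borel" by simp
  have tm: "turn p \<theta> \<in> hausdorff1 \<rightarrow>\<^sub>M borel" using borel_measurable_turn by (simp cong: measurable_cong_sets)
  have m: "turn p \<theta> -` A \<in> sets borel" using measurable_sets[OF borel_measurable_turn A] by simp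
  have le: "hausdorff1_outer (turn p \<phi> ` S) \<le> hausdorff1_outer S" for \<phi> S
    using hausdorff1_outer_lipschitz_image[of 1 S "turn p \<phi>"] by (simp add: dist_turn)
  have "hausdorff1_outer (turn p (-\<theta>) ` A) = hausdorff1_outer A"
  proof (rule antisym[OF le])
    have "turn p \<theta> ` (turn p (-\<theta>) ` A) = A" by (simp add: image_image turn_inverse)
    then show "hausdorff1_outer A \<le> hausdorff1_outer (turn p (-\<theta>) ` A)" using le[of \<theta> "turn p (-\<theta>) ` A"] by simp
  qed
  then have "emeasure hausdorff1 (turn p \<theta> -` A) = emeasure hausdorff1 A"
    using A m by (simp add: emeasure_hausdorff1 turn_vimage)
  then show "emeasure (distr hausdorff1 borel (turn p \<theta>)) A = emeasure hausdorff1 A"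
    using A by (subst emeasure_distr[OF tm]) auto
qed simp

lemma nn_integral_shift:
  fixes f :: "real \<Rightarrow> ennreal"
  assumes [measurable]: "f \<in> borel_measurable borel"
  shows "(\<integral>\<^sup>+x. f (c + x) \<partial>lborel) = (\<integral>\<^sup>+x. f x \<partial>lborel)"
proof -
  have "(\<integral>\<^sup>+x. f x \<partial>lborel) = (\<integral>\<^sup>+x. f x \<partial>distr lborel borel ((+) c))" by (simp add: lborel_distr_plus)
  also have "\<dots> = (\<integral>\<^sup>+x. f (c + x) \<partial>lborel)" by (rule nn_integral_distr) auto
  finally show ?thesis ..
qed

text \<open>The part of the shifted period that sticks out beyond \<open>P\<close> is moved back by
  one period.\<close>

lemma nn_integral_period:
  fixes h :: "real \<Rightarrow> ennreal"
  assumes [measurable]: "h \<in> borel_measurable borel" and per: "\<And>x. h (x + P) = h x" and \<phi>: "0 \<le> \<phi>" "\<phi> \<le> P"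
  shows "(\<integral>\<^sup>+\<theta>. h (\<theta> + \<phi>) * indicator {0..<P} \<theta> \<partial>lborel) = (\<integral>\<^sup>+\<theta>. h \<theta> * indicator {0..<P} \<theta> \<partial>lborel)"
proof -
  have "(\<integral>\<^sup>+\<theta>. h (\<theta> + \<phi>) * indicator {0..<P} \<theta> \<partial>lborel) = (\<integral>\<^sup>+\<theta>. h (\<phi> + \<theta>) * indicator {\<phi>..<\<phi>+P} (\<phi> + \<theta>) \<partial>lborel)"
    by (intro nn_integral_cong) (auto simp: indicator_def add.commute)
  also have "\<dots> = (\<integral>\<^sup>+\<theta>. h \<theta> * indicator {\<phi>..<\<phi>+P} \<theta> \<partial>lborel)"
    by (rule nn_integral_shift[where f="\<lambda>s. h s * indicator {\<phi>..<\<phi>+P} s"]) measurable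
  also have "\<dots> = (\<integral>\<^sup>+\<theta>. h \<theta> * indicator {\<phi>..<P} \<theta> + h \<theta> * indicator {P..<P+\<phi>} \<theta> \<partial>lborel)"
    using \<phi> by (intro nn_integral_cong) (auto simp: indicator_def)
  also have "\<dots> = (\<integral>\<^sup>+\<theta>. h \<theta> * indicator {\<phi>..<P} \<theta> \<partial>lborel) + (\<integral>\<^sup>+\<theta>. h \<theta> * indicator {P..<P+\<phi>} \<theta> \<partial>lborel)"
    by (rule nn_integral_add) auto
  also have "(\<integral>\<^sup>+\<theta>. h \<theta> * indicator {P..<P+\<phi>} \<theta> \<partial>lborel) = (\<integral>\<^sup>+\<theta>. h (P + \<theta>) * indicator {P..<P+\<phi>} (P + \<theta>) \<partial>lborel)"
    by (rule nn_integral_shift[where f="\<lambda>s. h s * indicator {P..<P+\<phi>} s", symmetric]) measurable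
  also have "\<dots> = (\<integral>\<^sup>+\<theta>. h \<theta> * indicator {0..<\<phi>} \<theta> \<partial>lborel)"
    using per by (intro nn_integral_cong) (auto simp: indicator_def add.commute)
  also have "(\<integral>\<^sup>+\<theta>. h \<theta> * indicator {\<phi>..<P} \<theta> \<partial>lborel) + \<dots>
      = (\<integral>\<^sup>+\<theta>. h \<theta> * indicator {\<phi>..<P} \<theta> + h \<theta> * indicator {0..<\<phi>} \<theta> \<partial>lborel)"
    by (rule nn_integral_add[symmetric]) auto
  also have "\<dots> = (\<integral>\<^sup>+\<theta>. h \<theta> * indicator {0..<P} \<theta> \<partial>lborel)"
    using \<phi> by (intro nn_integral_cong) (auto simp: indicator_def)
  finally show ?thesis .
qed

context
  fixes p :: "real^2" and R :: real and F :: "real^2 \<Rightarrow> ennreal"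
  assumes R: "R > 0" and F[measurable]: "F \<in> borel_measurable borel"
begin

lemma pair_borel:
  fixes g :: "real \<times> 'b::second_countable_topology \<Rightarrow> real^2"
  assumes "continuous_on UNIV g"
  shows "(\<lambda>q. F (g q)) \<in> borel_measurable (borel \<Otimes>\<^sub>M borel)"
  using assms unfolding borel_prod by (rule measurable_compose[OF borel_measurable_continuous_onI F])

lemma turn_pair_borel [measurable]: "(\<lambda>q. F (turn p (fst q) (snd q))) \<in> borel_measurable (borel \<Otimes>\<^sub>M borel)"
  by (rule pair_borel) (unfold turn_def, intro continuous_intros)

text \<open>Rotating \<open>x\<close> by \<open>\<theta>\<close> adds \<open>\<theta>\<close> to its
  polar angle, and over a full period the starting angle does not matter; the mean depends on the
  distance to the centre alone.\<close>

lemma angular_mean: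
  "(\<integral>\<^sup>+\<theta>. F (turn p \<theta> x) * indicator {0..<2*pi} \<theta> \<partial>lborel)
   = (\<integral>\<^sup>+\<theta>. F (p + dist p x *\<^sub>R circ \<theta>) * indicator {0..<2*pi} \<theta> \<partial>lborel)"
proof -
  obtain \<phi> where \<phi>: "0 \<le> \<phi>" "\<phi> < 2 * pi" "x - p = norm (x - p) *\<^sub>R circ \<phi>" by (rule polar_form)
  have "F (turn p \<theta> x) = F (p + dist p x *\<^sub>R circ (\<theta> + \<phi>))" for \<theta>
    unfolding turn_def by (subst \<phi>(3)) (simp add: rot_circ dist_norm norm_minus_commute)
  moreover have "(\<lambda>\<theta>. F (p + dist p x *\<^sub>R circ \<theta>)) \<in> borel_measurable borel"
    by (rule measurable_compose[OF borel_measurable_continuous_onI F]) (intro continuous_intros)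
  ultimately show ?thesis
    using nn_integral_period[of "\<lambda>\<theta>. F (p + dist p x *\<^sub>R circ \<theta>)" "2*pi" \<phi>] \<phi> by (simp add: circ_periodic)
qed

text \<open>Polar coordinates without a Jacobian: the integral is averaged over rotations about
  \<open>p\<close>, which turns the integrand into a function of the distance to the disk, and the
  integrated Steiner formula applies to that. The factor 2 \<pi> on the left is the total angle of
  the averaging.\<close>

lemma polar_exterior:
  "ennreal (2 * pi) * (\<integral>\<^sup>+x. F x * indicator (- cball p R) x \<partial>lborel)
   = (\<integral>\<^sup>+\<theta>. (\<integral>\<^sup>+t. F (p + (R + t) *\<^sub>R circ \<theta>) * (ennreal (2*pi*R + t * (2*pi)) * indicator {0<..} t) \<partial>lborel)
       * indicator {0..<2*pi} \<theta> \<partial>lborel)"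
proof -
  have cb[measurable]: "- cball p R \<in> sets borel" by auto
  have inv: "(\<integral>\<^sup>+x. F (turn p \<theta> x) * indicator (- cball p R) x \<partial>lborel) = (\<integral>\<^sup>+x. F x * indicator (- cball p R) x \<partial>lborel)" for \<theta>
  proof -
    have "(\<integral>\<^sup>+x. F x * indicator (- cball p R) x \<partial>lborel) = (\<integral>\<^sup>+x. F x * indicator (- cball p R) x \<partial>distr lborel borel (turn p \<theta>))"
      by (simp add: distr_turn_lborel)
    also have "\<dots> = (\<integral>\<^sup>+x. F (turn p \<theta> x) * indicator (- cball p R) (turn p \<theta> x) \<partial>lborel)"
      by (rule nn_integral_distr) auto
    also have "\<dots> = (\<integral>\<^sup>+x. F (turn p \<theta> x) * indicator (- cball p R) x \<partial>lborel)"
      by (intro nn_integral_cong) (simp add: indicator_def dist_turn_center)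
    finally show ?thesis ..
  qed
  have "ennreal (2 * pi) * (\<integral>\<^sup>+x. F x * indicator (- cball p R) x \<partial>lborel)
      = (\<integral>\<^sup>+\<theta>. (\<integral>\<^sup>+x. F x * indicator (- cball p R) x \<partial>lborel) * indicator {0..<2*pi} \<theta> \<partial>lborel)"
    by (subst nn_integral_cmult_indicator) (auto simp: mult.commute)
  also have "\<dots> = (\<integral>\<^sup>+\<theta>. \<integral>\<^sup>+x. F (turn p \<theta> x) * indicator (- cball p R) x * indicator {0..<2*pi} \<theta> \<partial>lborel \<partial>lborel)"
  proof (rule nn_integral_cong)
    fix \<theta> :: real
    have "(\<integral>\<^sup>+x. F x * indicator (- cball p R) x \<partial>lborel) * indicator {0..<2*pi} \<theta>
       = (\<integral>\<^sup>+x. F (turn p \<theta> x) * indicator (- cball p R) x \<partial>lborel) * indicator {0..<2*pi} \<theta>" by (simp only: inv)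
    also have "\<dots> = (\<integral>\<^sup>+x. F (turn p \<theta> x) * indicator (- cball p R) x * indicator {0..<2*pi} \<theta> \<partial>lborel)"
      by (rule nn_integral_multc[symmetric]) measurable
    finally show "(\<integral>\<^sup>+x. F x * indicator (- cball p R) x \<partial>lborel) * indicator {0..<2*pi} \<theta>
       = (\<integral>\<^sup>+x. F (turn p \<theta> x) * indicator (- cball p R) x * indicator {0..<2*pi} \<theta> \<partial>lborel)" .
  qed
  also have "\<dots> = (\<integral>\<^sup>+x. \<integral>\<^sup>+\<theta>. F (turn p \<theta> x) * indicator (- cball p R) x * indicator {0..<2*pi} \<theta> \<partial>lborel \<partial>lborel)"
  proof (rule lborel_pair.Fubini')
    have "(\<lambda>q. F (turn p (fst q) (snd q)) * indicator (- cball p R) (snd q) * indicator {0..<2*pi} (fst q))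
      \<in> borel_measurable (borel \<Otimes>\<^sub>M borel)" by measurable
    from measurable_compose[OF measurable_pair_swap' this]
    show "case_prod (\<lambda>x \<theta>. F (turn p \<theta> x) * indicator (- cball p R) x * indicator {0..<2*pi} \<theta>) \<in> borel_measurable (lborel \<Otimes>\<^sub>M lborel)"
      by (simp add: split_beta' case_prod_beta' cong: measurable_cong_sets sets_pair_measure_cong)
  qed
  also have "\<dots> = (\<integral>\<^sup>+x. (\<integral>\<^sup>+\<theta>. F (p + (R + infdist x (cball p R)) *\<^sub>R circ \<theta>) * indicator {0..<2*pi} \<theta> \<partial>lborel) * indicator (- cball p R) x \<partial>lborel)"
  proof (rule nn_integral_cong)
    fix x
    have "(\<integral>\<^sup>+\<theta>. F (turn p \<theta> x) * indicator (- cball p R) x * indicator {0..<2*pi} \<theta> \<partial>lborel)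
       = (\<integral>\<^sup>+\<theta>. F (turn p \<theta> x) * indicator {0..<2*pi} \<theta> * indicator (- cball p R) x \<partial>lborel)" by (simp add: mult_ac)
    also have "\<dots> = (\<integral>\<^sup>+\<theta>. F (turn p \<theta> x) * indicator {0..<2*pi} \<theta> \<partial>lborel) * indicator (- cball p R) x"
    proof (rule nn_integral_multc)
      have "(\<lambda>\<theta>. F (turn p \<theta> x)) \<in> borel_measurable borel"
        by (rule measurable_compose[OF borel_measurable_continuous_onI F]) (unfold turn_def, intro continuous_intros)
      then show "(\<lambda>\<theta>. F (turn p \<theta> x) * indicator {0..<2*pi} \<theta>) \<in> borel_measurable lborel" by measurable
    qed
    also have "\<dots> = (\<integral>\<^sup>+\<theta>. F (p + (R + infdist x (cball p R)) *\<^sub>R circ \<theta>) * indicator {0..<2*pi} \<theta> \<partial>lborel) * indicator (- cball p R) x"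
      unfolding angular_mean using infdist_cball[OF R, of x p] by (cases "x \<in> cball p R") auto
    finally show "(\<integral>\<^sup>+\<theta>. F (turn p \<theta> x) * indicator (- cball p R) x * indicator {0..<2*pi} \<theta> \<partial>lborel)
       = (\<integral>\<^sup>+\<theta>. F (p + (R + infdist x (cball p R)) *\<^sub>R circ \<theta>) * indicator {0..<2*pi} \<theta> \<partial>lborel) * indicator (- cball p R) x" .
  qed
  also have "\<dots> = (\<integral>\<^sup>+t. (\<integral>\<^sup>+\<theta>. F (p + (R + t) *\<^sub>R circ \<theta>) * indicator {0..<2*pi} \<theta> \<partial>lborel) * (ennreal (2*pi*R + t * (2*pi)) * indicator {0<..} t) \<partial>lborel)"
  proof -
    have [measurable]: "(\<lambda>q. F (p + (R + fst q) *\<^sub>R circ (snd q))) \<in> borel_measurable (borel \<Otimes>\<^sub>M borel)"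
      by (rule pair_borel) (intro continuous_intros)
    have "(\<lambda>t. \<integral>\<^sup>+\<theta>. F (p + (R + t) *\<^sub>R circ \<theta>) * indicator {0..<2*pi} \<theta> \<partial>lborel) \<in> borel_measurable borel"
      by measurable
    from nn_integral_parallel[OF convex_smooth_domain_ball[OF R] _ this, of p] show ?thesis
      using R by (simp add: perimeter_ball)
  qed
  also have "\<dots> = (\<integral>\<^sup>+t. \<integral>\<^sup>+\<theta>. F (p + (R + t) *\<^sub>R circ \<theta>) * indicator {0..<2*pi} \<theta> * (ennreal (2*pi*R + t * (2*pi)) * indicator {0<..} t) \<partial>lborel \<partial>lborel)"
  proof (intro nn_integral_cong nn_integral_multc[symmetric])
    fix t
    have "(\<lambda>\<theta>. F (p + (R + t) *\<^sub>R circ \<theta>)) \<in> borel_measurable borel"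
      by (rule measurable_compose[OF borel_measurable_continuous_onI F]) (intro continuous_intros)
    then show "(\<lambda>\<theta>. F (p + (R + t) *\<^sub>R circ \<theta>) * indicator {0..<2*pi} \<theta>) \<in> borel_measurable lborel" by measurable
  qed
  also have "\<dots> = (\<integral>\<^sup>+\<theta>. \<integral>\<^sup>+t. F (p + (R + t) *\<^sub>R circ \<theta>) * indicator {0..<2*pi} \<theta> * (ennreal (2*pi*R + t * (2*pi)) * indicator {0<..} t) \<partial>lborel \<partial>lborel)"
  proof (rule lborel_pair.Fubini')
    have [measurable]: "(\<lambda>q. F (p + (R + snd q) *\<^sub>R circ (fst q))) \<in> borel_measurable (borel \<Otimes>\<^sub>M borel)"
      by (rule pair_borel) (intro continuous_intros)
    have "(\<lambda>q. F (p + (R + snd q) *\<^sub>R circ (fst q)) * indicator {0..<2*pi} (fst q) * (ennreal (2*pi*R + snd q * (2*pi)) * indicator {0<..} (snd q)))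
      \<in> borel_measurable (borel \<Otimes>\<^sub>M borel)" by measurable
    then show "case_prod (\<lambda>\<theta> t. F (p + (R + t) *\<^sub>R circ \<theta>) * indicator {0..<2*pi} \<theta> * (ennreal (2*pi*R + t * (2*pi)) * indicator {0<..} t))
      \<in> borel_measurable (lborel \<Otimes>\<^sub>M lborel)"
      by (simp add: split_beta' case_prod_beta' cong: measurable_cong_sets sets_pair_measure_cong)
  qed
  also have "\<dots> = (\<integral>\<^sup>+\<theta>. (\<integral>\<^sup>+t. F (p + (R + t) *\<^sub>R circ \<theta>) * (ennreal (2*pi*R + t * (2*pi)) * indicator {0<..} t) \<partial>lborel) * indicator {0..<2*pi} \<theta> \<partial>lborel)"
    by (intro nn_integral_cong) (simp add: indicator_def)
  finally show ?thesis .
qed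

text \<open>The same averaging over rotations, for arc length on the circle, which is invariant
  because rotations preserve the Hausdorff measure.\<close>

lemma polar_circle:
  "ennreal (2 * pi) * (\<integral>\<^sup>+x. F x * indicator (sphere p R) x \<partial>hausdorff1)
   = (\<integral>\<^sup>+\<theta>. ennreal (2*pi*R) * F (p + R *\<^sub>R circ \<theta>) * indicator {0..<2*pi} \<theta> \<partial>lborel)"
proof -
  \<comment> \<open>Cutting down to the circle gives a finite measure; exchanging the integrals
    needs sigma-finiteness, which \<open>hausdorff1\<close> on the plane does not have.\<close>
  define M :: "(real^2) measure" where "M = density hausdorff1 (indicator (sphere p R))"
  have sp[measurable]: "sphere p R \<in> sets borel" by (simp add: borel_closed)
  have sM[measurable_cong]: "sets M = sets borel" by (simp add: M_def)
  have M: "(\<integral>\<^sup>+x. f x \<partial>M) = (\<integral>\<^sup>+x. f x * indicator (sphere p R) x \<partial>hausdorff1)" if f[measurable]: "f \<in> borel_measurable borel" for f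
    unfolding M_def by (subst nn_integral_density) (auto simp: mult.commute)
  have eM: "emeasure M (space M) = ennreal (2 * pi * R)"
  proof -
    have "emeasure M (space M) = (\<integral>\<^sup>+x. 1 \<partial>M)" by simp
    also have "\<dots> = emeasure hausdorff1 (sphere p R)" by (subst M) auto
    also have "\<dots> = ennreal (2 * pi * R)"
      using steiner_formula(1)[OF convex_smooth_domain_ball[OF R], of p] R by (simp add: perimeter_ball)
    finally show ?thesis .
  qed
  interpret finite_measure M by standard (simp add: eM)
  interpret P: pair_sigma_finite lborel M by standard
  have inv: "(\<integral>\<^sup>+x. F (turn p \<theta> x) \<partial>M) = (\<integral>\<^sup>+x. F x \<partial>M)" for \<theta>
  proof -
    have tm: "turn p \<theta> \<in> hausdorff1 \<rightarrow>\<^sub>M borel" using borel_measurable_turn by (simp cong: measurable_cong_sets)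
    have "(\<integral>\<^sup>+x. F x \<partial>M) = (\<integral>\<^sup>+x. F x * indicator (sphere p R) x \<partial>distr hausdorff1 borel (turn p \<theta>))"
      by (simp add: M distr_turn_hausdorff1)
    also have "\<dots> = (\<integral>\<^sup>+x. F (turn p \<theta> x) * indicator (sphere p R) (turn p \<theta> x) \<partial>hausdorff1)"
      by (rule nn_integral_distr[OF tm]) auto
    also have "\<dots> = (\<integral>\<^sup>+x. F (turn p \<theta> x) * indicator (sphere p R) x \<partial>hausdorff1)"
      by (intro nn_integral_cong) (simp add: indicator_def dist_turn_center)
    also have "\<dots> = (\<integral>\<^sup>+x. F (turn p \<theta> x) \<partial>M)" by (rule M[symmetric]) measurable
    finally show ?thesis ..
  qed
  have [measurable]: "(\<lambda>\<theta>. F (turn p \<theta> x)) \<in> borel_measurable borel" for x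
    by (rule measurable_compose[OF borel_measurable_continuous_onI F]) (unfold turn_def, intro continuous_intros)
  have "ennreal (2 * pi) * (\<integral>\<^sup>+x. F x \<partial>M) = (\<integral>\<^sup>+\<theta>. (\<integral>\<^sup>+x. F x \<partial>M) * indicator {0..<2*pi} \<theta> \<partial>lborel)"
    by (subst nn_integral_cmult_indicator) (auto simp: mult.commute)
  also have "\<dots> = (\<integral>\<^sup>+\<theta>. \<integral>\<^sup>+x. F (turn p \<theta> x) * indicator {0..<2*pi} \<theta> \<partial>M \<partial>lborel)"
  proof (rule nn_integral_cong)
    fix \<theta> :: real
    have "(\<integral>\<^sup>+x. F x \<partial>M) * indicator {0..<2*pi} \<theta> = (\<integral>\<^sup>+x. F (turn p \<theta> x) \<partial>M) * indicator {0..<2*pi} \<theta>"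
      by (simp only: inv)
    also have "\<dots> = (\<integral>\<^sup>+x. F (turn p \<theta> x) * indicator {0..<2*pi} \<theta> \<partial>M)"
      by (rule nn_integral_multc[symmetric]) measurable
    finally show "(\<integral>\<^sup>+x. F x \<partial>M) * indicator {0..<2*pi} \<theta> = (\<integral>\<^sup>+x. F (turn p \<theta> x) * indicator {0..<2*pi} \<theta> \<partial>M)" .
  qed
  also have "\<dots> = (\<integral>\<^sup>+x. \<integral>\<^sup>+\<theta>. F (turn p \<theta> x) * indicator {0..<2*pi} \<theta> \<partial>lborel \<partial>M)"
  proof (rule P.Fubini'[symmetric])
    have "(\<lambda>q. F (turn p (fst q) (snd q)) * indicator {0..<2*pi} (fst q)) \<in> borel_measurable (borel \<Otimes>\<^sub>M borel)" by measurable
    then show "case_prod (\<lambda>\<theta> x. F (turn p \<theta> x) * indicator {0..<2*pi} \<theta>) \<in> borel_measurable (lborel \<Otimes>\<^sub>M M)"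
      by (simp add: split_beta' case_prod_beta' sM cong: measurable_cong_sets sets_pair_measure_cong)
  qed
  also have "\<dots> = (\<integral>\<^sup>+x. (\<integral>\<^sup>+\<theta>. F (p + dist p x *\<^sub>R circ \<theta>) * indicator {0..<2*pi} \<theta> \<partial>lborel) \<partial>M)"
    by (simp only: angular_mean)
  also have "\<dots> = (\<integral>\<^sup>+x. (\<integral>\<^sup>+\<theta>. F (p + R *\<^sub>R circ \<theta>) * indicator {0..<2*pi} \<theta> \<partial>lborel) \<partial>M)"
  proof (rule nn_integral_cong_AE)
    have "AE x in M. x \<in> sphere p R" unfolding M_def by (subst AE_density) (auto intro!: AE_I2 split: split_indicator_asm)
    then show "AE x in M. (\<integral>\<^sup>+\<theta>. F (p + dist p x *\<^sub>R circ \<theta>) * indicator {0..<2*pi} \<theta> \<partial>lborel)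
      = (\<integral>\<^sup>+\<theta>. F (p + R *\<^sub>R circ \<theta>) * indicator {0..<2*pi} \<theta> \<partial>lborel)"
      by (rule eventually_mono) simp
  qed
  also have "\<dots> = ennreal (2*pi*R) * (\<integral>\<^sup>+\<theta>. F (p + R *\<^sub>R circ \<theta>) * indicator {0..<2*pi} \<theta> \<partial>lborel)"
    by (simp add: eM mult.commute)
  also have "\<dots> = (\<integral>\<^sup>+\<theta>. ennreal (2*pi*R) * (F (p + R *\<^sub>R circ \<theta>) * indicator {0..<2*pi} \<theta>) \<partial>lborel)"
  proof (rule nn_integral_cmult[symmetric])
    have "(\<lambda>\<theta>. F (p + R *\<^sub>R circ \<theta>)) \<in> borel_measurable borel"
      by (rule measurable_compose[OF borel_measurable_continuous_onI F]) (intro continuous_intros)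
    then show "(\<lambda>\<theta>. F (p + R *\<^sub>R circ \<theta>) * indicator {0..<2*pi} \<theta>) \<in> borel_measurable lborel" by measurable
  qed
  finally show ?thesis by (simp add: M mult.assoc)
qed

end

section \<open>The quadratic form outside a disk\<close>

lemma weighted_finite:
  assumes L: "0 \<le> L" and C: "\<And>t. 0 < t \<Longrightarrow> f t \<le> C" and T: "\<And>t. T < t \<Longrightarrow> f t = 0"
  shows "(\<integral>\<^sup>+t. ennreal (f t) * (ennreal (L + t * (2 * pi)) * indicator {0<..} t) \<partial>lborel) < \<infinity>"
proof -
  have "(\<integral>\<^sup>+t. ennreal (f t) * (ennreal (L + t * (2 * pi)) * indicator {0<..} t) \<partial>lborel)
      \<le> (\<integral>\<^sup>+t. (ennreal C * ennreal (L + T * (2 * pi))) * indicator {0..T} t \<partial>lborel)"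
  proof (rule nn_integral_mono)
    fix t show "ennreal (f t) * (ennreal (L + t * (2 * pi)) * indicator {0<..} t)
      \<le> (ennreal C * ennreal (L + T * (2 * pi))) * indicator {0..T} t"
    proof (cases "0 < t \<and> t \<le> T")
      case True
      have "ennreal (f t) * ennreal (L + t * (2 * pi)) \<le> ennreal C * ennreal (L + T * (2 * pi))"
        using True C by (intro mult_mono ennreal_leI) auto
      then show ?thesis using True by simp
    next
      case False
      then consider "t \<le> 0" | "T < t" by linarith
      then show ?thesis by cases (auto simp: T)
    qed
  qed
  also have "\<dots> = (ennreal C * ennreal (L + T * (2 * pi))) * emeasure lborel {0..T}"
    by (rule nn_integral_cmult_indicator) simp
  also have "\<dots> < \<infinity>" by (cases "0 \<le> T") (auto simp: ennreal_mult_less_top)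
  finally show ?thesis .
qed

lemma weighted_add:
  assumes L: "0 \<le> L" and f: "f \<in> borel_measurable borel" "\<And>t. 0 \<le> f t" "\<And>t. 0 < t \<Longrightarrow> f t \<le> C" "\<And>t. T < t \<Longrightarrow> f t = 0"
    and g: "g \<in> borel_measurable borel" "\<And>t. 0 \<le> g t" "\<And>t. 0 < t \<Longrightarrow> g t \<le> D" "\<And>t. T < t \<Longrightarrow> g t = 0"
  shows "weighted L (\<lambda>t. f t + g t) = weighted L f + weighted L g"
proof -
  note [measurable] = f(1) g(1)
  have "(\<integral>\<^sup>+t. ennreal (f t + g t) * (ennreal (L + t * (2 * pi)) * indicator {0<..} t) \<partial>lborel)
     = (\<integral>\<^sup>+t. ennreal (f t) * (ennreal (L + t * (2 * pi)) * indicator {0<..} t)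
          + ennreal (g t) * (ennreal (L + t * (2 * pi)) * indicator {0<..} t) \<partial>lborel)"
    using f(2) g(2) by (intro nn_integral_cong) (simp add: distrib_right)
  also have "\<dots> = (\<integral>\<^sup>+t. ennreal (f t) * (ennreal (L + t * (2 * pi)) * indicator {0<..} t) \<partial>lborel)
     + (\<integral>\<^sup>+t. ennreal (g t) * (ennreal (L + t * (2 * pi)) * indicator {0<..} t) \<partial>lborel)"
    by (rule nn_integral_add) measurable
  finally show ?thesis unfolding weighted_def
    using weighted_finite[OF L f(3,4)] weighted_finite[OF L g(3,4)] by (simp add: enn2real_plus)
qed

lemma weighted_mono:
  assumes L: "0 \<le> L" and le: "\<And>t. 0 < t \<Longrightarrow> f t \<le> g t" and g: "\<And>t. 0 < t \<Longrightarrow> g t \<le> D" "\<And>t. T < t \<Longrightarrow> g t = 0"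
  shows "weighted L f \<le> weighted L g"
  unfolding weighted_def
proof (rule enn2real_mono)
  show "(\<integral>\<^sup>+t. ennreal (f t) * (ennreal (L + t * (2 * pi)) * indicator {0<..} t) \<partial>lborel)
      \<le> (\<integral>\<^sup>+t. ennreal (g t) * (ennreal (L + t * (2 * pi)) * indicator {0<..} t) \<partial>lborel)"
    using le by (intro nn_integral_mono) (auto simp: indicator_def intro!: mult_right_mono ennreal_leI)
qed (use weighted_finite[OF L g] in simp)

lemma integral_enn2real:
  assumes [measurable]: "h \<in> borel_measurable M" and fin: "\<And>x. h x < \<infinity>" and I: "(\<integral>\<^sup>+x. h x \<partial>M) < \<infinity>"
  shows "integrable M (\<lambda>x. enn2real (h x))" "(LINT x|M. enn2real (h x)) = enn2real (\<integral>\<^sup>+x. h x \<partial>M)"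
proof -
  have eq: "ennreal (enn2real (h x)) = h x" for x using fin[of x] by simp
  show "integrable M (\<lambda>x. enn2real (h x))"
    using I by (intro integrableI_nonneg) (simp_all add: eq)
  show "(LINT x|M. enn2real (h x)) = enn2real (\<integral>\<^sup>+x. h x \<partial>M)"
    by (subst integral_eq_nn_integral) (simp_all add: eq)
qed

context
  fixes p :: "real^2" and R :: real and F :: "real^2 \<Rightarrow> real" and M :: real
  assumes R: "R > 0" and cont: "continuous_on UNIV F" and F0: "\<And>x. 0 \<le> F x" and supp: "\<And>x. M < norm x \<Longrightarrow> F x = 0"
begin

lemma F_bounded: obtains C where "\<And>x. F x \<le> C" "0 \<le> C"
proof -
  have "compact (F ` cball 0 M)" by (intro compact_continuous_image continuous_on_subset[OF cont]) auto
  then obtain C where C: "\<forall>x\<in>cball 0 M. norm (F x) \<le> C" by (auto dest!: compact_imp_bounded simp: bounded_iff)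
  have "F x \<le> max C 0" for x
    using bspec[OF C, of x] supp[of x] by (cases "norm x \<le> M") auto
  then show ?thesis using that[of "max C 0"] by simp
qed

lemma radial_support: "M + norm p < t \<Longrightarrow> F (p + (R + t) *\<^sub>R circ \<theta>) = 0"
proof (rule supp)
  assume t: "M + norm p < t"
  have "norm ((R + t) *\<^sub>R circ \<theta>) \<le> norm (p + (R + t) *\<^sub>R circ \<theta>) + norm p"
    using norm_triangle_ineq4[of "p + (R + t) *\<^sub>R circ \<theta>" p] by simp
  then show "M < norm (p + (R + t) *\<^sub>R circ \<theta>)" using t R by simp
qed

lemma polar_exterior_real:
  shows "integrable lborel (\<lambda>\<theta>. weighted (2*pi*R) (\<lambda>t. F (p + (R + t) *\<^sub>R circ \<theta>)) * indicator {0..<2*pi} \<theta>)"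
    and "(LINT \<theta>|lborel. weighted (2*pi*R) (\<lambda>t. F (p + (R + t) *\<^sub>R circ \<theta>)) * indicator {0..<2*pi} \<theta>)
      = 2 * pi * (LINT x|lebesgue_on (ext (ball p R)). F x)"
proof -
  obtain C where C: "\<And>x. F x \<le> C" "0 \<le> C" using F_bounded by metis
  have [measurable]: "F \<in> borel_measurable borel" by (rule borel_measurable_continuous_onI[OF cont])
  define h where "h \<theta> = (\<integral>\<^sup>+t. ennreal (F (p + (R + t) *\<^sub>R circ \<theta>)) * (ennreal (2*pi*R + t * (2*pi)) * indicator {0<..} t) \<partial>lborel)
    * indicator {0..<2*pi} \<theta>" for \<theta>
  have h: "enn2real (h \<theta>) = weighted (2*pi*R) (\<lambda>t. F (p + (R + t) *\<^sub>R circ \<theta>)) * indicator {0..<2*pi} \<theta>" for \<theta>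
    by (cases "\<theta> \<in> {0..<2*pi}") (simp_all add: h_def weighted_def enn2real_mult)
  have hfin: "h \<theta> < \<infinity>" for \<theta>
  proof -
    have "(\<integral>\<^sup>+t. ennreal (F (p + (R + t) *\<^sub>R circ \<theta>)) * (ennreal (2*pi*R + t * (2*pi)) * indicator {0<..} t) \<partial>lborel) < \<infinity>"
      using R by (intro weighted_finite[of _ _ C "M + norm p"] radial_support C) auto
    then show ?thesis by (simp add: h_def ennreal_mult_less_top indicator_def)
  qed
  have [measurable]: "(\<lambda>q. ennreal (F (p + (R + snd q) *\<^sub>R circ (fst q)))) \<in> borel_measurable (borel \<Otimes>\<^sub>M borel)"
    by (rule pair_borel[OF R]) (measurable, intro continuous_intros)
  have hm: "h \<in> borel_measurable lborel" unfolding h_def[abs_def] by measurable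
  have E: "ext (ball p R) \<in> sets borel" "ext (ball p R) = - cball p R" unfolding ext_def using R by auto
  let ?I = "\<integral>\<^sup>+x. ennreal (F x) * indicator (- cball p R) x \<partial>lborel"
  have I: "?I < \<infinity>"
  proof -
    have "?I \<le> (\<integral>\<^sup>+x. ennreal C * indicator (cball (0::real^2) M) x \<partial>lborel)"
    proof (rule nn_integral_mono)
      fix x show "ennreal (F x) * indicator (- cball p R) x \<le> ennreal C * indicator (cball (0::real^2) M) x"
        using supp[of x] C(1)[of x] by (cases "norm x \<le> M") (auto simp: indicator_def intro: ennreal_leI)
    qed
    also have "\<dots> < \<infinity>" using emeasure_lborel_cball_finite[of "0::real^2" M]
      by (simp add: nn_integral_cmult_indicator ennreal_mult_less_top)
    finally show ?thesis .
  qed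
  have hI: "(\<integral>\<^sup>+\<theta>. h \<theta> \<partial>lborel) = ennreal (2*pi) * ?I"
    unfolding h_def by (rule polar_exterior[OF R, symmetric]) measurable
  have hI': "(\<integral>\<^sup>+\<theta>. h \<theta> \<partial>lborel) < \<infinity>" unfolding hI using I by (simp add: ennreal_mult_less_top)
  show "integrable lborel (\<lambda>\<theta>. weighted (2*pi*R) (\<lambda>t. F (p + (R + t) *\<^sub>R circ \<theta>)) * indicator {0..<2*pi} \<theta>)"
    using integral_enn2real(1)[OF hm hfin hI'] unfolding h .
  have "(LINT x|lebesgue_on (ext (ball p R)). F x) = enn2real (\<integral>\<^sup>+x. ennreal (F x) \<partial>lebesgue_on (ext (ball p R)))"
    by (rule integral_eq_nn_integral) (use F0 in \<open>auto intro!: borel_measurable_lebesgue_on\<close>)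
  also have "(\<integral>\<^sup>+x. ennreal (F x) \<partial>lebesgue_on (ext (ball p R))) = ?I"
    unfolding nn_integral_lebesgue_on[OF E(1)] by (simp only: E(2))
  finally show "(LINT \<theta>|lborel. weighted (2*pi*R) (\<lambda>t. F (p + (R + t) *\<^sub>R circ \<theta>)) * indicator {0..<2*pi} \<theta>)
      = 2 * pi * (LINT x|lebesgue_on (ext (ball p R)). F x)"
    using integral_enn2real(2)[OF hm hfin hI'] unfolding h hI by (simp add: enn2real_mult)
qed

lemma polar_circle_real:
  shows "integrable lborel (\<lambda>\<theta>. (2*pi*R * F (p + R *\<^sub>R circ \<theta>)) * indicator {0..<2*pi} \<theta>)"
    and "(LINT \<theta>|lborel. (2*pi*R * F (p + R *\<^sub>R circ \<theta>)) * indicator {0..<2*pi} \<theta>)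
      = 2 * pi * (LINT x|arc_length_on (frontier (ball p R)). F x)"
proof -
  obtain C where C: "\<And>x. F x \<le> C" "0 \<le> C" using F_bounded by metis
  have [measurable]: "F \<in> borel_measurable borel" by (rule borel_measurable_continuous_onI[OF cont])
  define h where "h \<theta> = ennreal (2*pi*R) * ennreal (F (p + R *\<^sub>R circ \<theta>)) * indicator {0..<2*pi} \<theta>" for \<theta>
  have h: "enn2real (h \<theta>) = (2*pi*R * F (p + R *\<^sub>R circ \<theta>)) * indicator {0..<2*pi} \<theta>" for \<theta>
    using R F0 by (cases "\<theta> \<in> {0..<2*pi}") (simp_all add: h_def enn2real_mult)
  have hfin: "h \<theta> < \<infinity>" for \<theta> by (simp add: h_def ennreal_mult_less_top indicator_def)
  have [measurable]: "(\<lambda>\<theta>. F (p + R *\<^sub>R circ \<theta>)) \<in> borel_measurable borel"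
    by (intro borel_measurable_continuous_onI continuous_on_compose2[OF cont] continuous_intros) auto
  have hm: "h \<in> borel_measurable lborel" unfolding h_def[abs_def] by measurable
  have fr: "frontier (ball p R) = sphere p R" using R by simp
  have sp: "sphere p R \<in> sets borel" by (simp add: borel_closed)
  let ?I = "\<integral>\<^sup>+x. ennreal (F x) * indicator (sphere p R) x \<partial>hausdorff1"
  have I: "?I < \<infinity>"
  proof -
    have "?I \<le> (\<integral>\<^sup>+x. ennreal C * indicator (sphere p R) x \<partial>hausdorff1)"
      by (intro nn_integral_mono mult_right_mono ennreal_leI C) simp
    also have "\<dots> = ennreal C * emeasure hausdorff1 (sphere p R)"
      using sp by (intro nn_integral_cmult_indicator) simp
    also have "\<dots> < \<infinity>"
      using steiner_formula(1)[OF convex_smooth_domain_ball[OF R], of p] R by (simp add: ennreal_mult_less_top)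
    finally show ?thesis .
  qed
  have hI: "(\<integral>\<^sup>+\<theta>. h \<theta> \<partial>lborel) = ennreal (2*pi) * ?I"
    unfolding h_def by (rule polar_circle[OF R, symmetric]) measurable
  have hI': "(\<integral>\<^sup>+\<theta>. h \<theta> \<partial>lborel) < \<infinity>" unfolding hI using I by (simp add: ennreal_mult_less_top)
  show "integrable lborel (\<lambda>\<theta>. (2*pi*R * F (p + R *\<^sub>R circ \<theta>)) * indicator {0..<2*pi} \<theta>)"
    using integral_enn2real(1)[OF hm hfin hI'] unfolding h .
  have Fh: "F \<in> borel_measurable hausdorff1" by (simp cong: measurable_cong_sets)
  have "(LINT x|arc_length_on (sphere p R). F x) = enn2real (\<integral>\<^sup>+x. ennreal (F x) \<partial>arc_length_on (sphere p R))"
    by (rule integral_eq_nn_integral) (use F0 measurable_restrict_space1[OF Fh] in auto)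
  also have "(\<integral>\<^sup>+x. ennreal (F x) \<partial>arc_length_on (sphere p R)) = ?I"
    using sp by (intro nn_integral_restrict_space) simp
  finally show "(LINT \<theta>|lborel. (2*pi*R * F (p + R *\<^sub>R circ \<theta>)) * indicator {0..<2*pi} \<theta>)
      = 2 * pi * (LINT x|arc_length_on (frontier (ball p R)). F x)"
    using integral_enn2real(2)[OF hm hfin hI'] unfolding h hI fr by (simp add: enn2real_mult)
qed

end

lemma frechet_derivative_grad:
  fixes v :: "real^2 \<Rightarrow> 'b::real_normed_vector"
  assumes "smooth v"
  shows "frechet_derivative v (at x) h = h$1 *\<^sub>R (grad v x $ 1) + h$2 *\<^sub>R (grad v x $ 2)"
proof -
  have lin: "linear (frechet_derivative v (at x))"
    by (rule has_derivative_linear[OF smooth_has_derivative[OF assms]])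
  have "frechet_derivative v (at x) h = frechet_derivative v (at x) (h$1 *\<^sub>R axis 1 1 + h$2 *\<^sub>R axis 2 1)"
    by (rule arg_cong[where f="frechet_derivative v (at x)"]) (simp add: vec_eq_iff forall_2 axis_def)
  also have "\<dots> = h$1 *\<^sub>R (grad v x $ 1) + h$2 *\<^sub>R (grad v x $ 2)"
    by (simp add: linear_add[OF lin] linear_scale[OF lin] grad_def)
  finally show ?thesis .
qed

lemma directional_le_grad:
  fixes v :: "real^2 \<Rightarrow> complex"
  assumes "smooth v" "norm h = 1"
  shows "(norm (frechet_derivative v (at x) h))\<^sup>2 \<le> (norm (grad v x))\<^sup>2"
proof -
  let ?a = "grad v x $ 1" and ?b = "grad v x $ 2"
  have h: "(h$1)\<^sup>2 + (h$2)\<^sup>2 = 1" using assms(2) by (simp add: norm_vec_def L2_set_def sum_2)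
  have "norm (frechet_derivative v (at x) h) \<le> \<bar>h$1\<bar> * norm ?a + \<bar>h$2\<bar> * norm ?b"
    unfolding frechet_derivative_grad[OF assms(1)] by (rule norm_triangle_le) simp
  then have "(norm (frechet_derivative v (at x) h))\<^sup>2 \<le> (\<bar>h$1\<bar> * norm ?a + \<bar>h$2\<bar> * norm ?b)\<^sup>2"
    by (rule power_mono) simp
  also have "\<dots> \<le> ((h$1)\<^sup>2 + (h$2)\<^sup>2) * ((norm ?a)\<^sup>2 + (norm ?b)\<^sup>2)"
  proof -
    have "(u * a + w * b)\<^sup>2 \<le> (u\<^sup>2 + w\<^sup>2) * (a\<^sup>2 + b\<^sup>2)" for u w a b :: real
    proof -
      have "(u\<^sup>2 + w\<^sup>2) * (a\<^sup>2 + b\<^sup>2) - (u * a + w * b)\<^sup>2 = (u * b - w * a)\<^sup>2" by algebra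
      then show ?thesis using zero_le_power2[of "u * b - w * a"] by linarith
    qed
    from this[of "\<bar>h$1\<bar>" "norm ?a" "\<bar>h$2\<bar>" "norm ?b"] show ?thesis by simp
  qed
  also have "\<dots> = (norm (grad v x))\<^sup>2" unfolding h by (simp add: norm_vec_def L2_set_def sum_2)
  finally show ?thesis .
qed

text \<open>Profiles are real, so along each ray the real and imaginary parts of \<open>v\<close>
  are treated separately and added; dropping the angular derivative from the gradient is the only
  loss. The weight in the hypothesis is that of polar coordinates, up to the common factor 2
  \<pi>.\<close>

lemma ball_form_test:
  fixes v :: "real^2 \<Rightarrow> complex"
  assumes R: "R > 0"
    and H: "\<And>\<psi> \<psi>' T. profile \<psi> \<psi>' T \<Longrightarrow> \<mu> * weighted (2*pi*R) (\<lambda>t. (\<psi> t)\<^sup>2)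
      \<le> weighted (2*pi*R) (\<lambda>t. (\<psi>' t)\<^sup>2) + \<alpha> * (2*pi*R * (\<psi> 0)\<^sup>2)"
    and v: "v \<in> test_functions UNIV"
  shows "\<mu> * (LINT x|lebesgue_on (ext (ball p R)). (norm (v x))\<^sup>2)
     \<le> (LINT x|lebesgue_on (ext (ball p R)). (norm (grad v x))\<^sup>2)
      + \<alpha> * (LINT x|arc_length_on (frontier (ball p R)). (norm (v x))\<^sup>2)"
proof -
  have sm: "smooth v" using v by (simp add: test_functions_def)
  obtain S where S: "compact S" "\<And>x. x \<notin> S \<Longrightarrow> v x = 0" "\<And>x h. x \<notin> S \<Longrightarrow> frechet_derivative v (at x) h = 0"
    using test_function_support[OF v] by metis
  obtain M where M: "\<forall>x\<in>S. norm x \<le> M" using compact_imp_bounded[OF S(1)] by (auto simp: bounded_iff)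
  have out: "x \<notin> S" if "M < norm x" for x using M that by force
  let ?L = "2*pi*R"
  have L0: "0 \<le> ?L" using R by simp
  define F1 where "F1 x = (norm (v x))\<^sup>2" for x
  define F2 where "F2 x = (norm (grad v x))\<^sup>2" for x
  have c1: "continuous_on UNIV F1" unfolding F1_def by (intro continuous_intros smooth_continuous sm)
  have c2: "continuous_on UNIV F2" unfolding F2_def by (intro continuous_intros smooth_continuous_grad sm)
  have s1: "F1 x = 0" if "M < norm x" for x using S(2)[OF out[OF that]] by (simp add: F1_def)
  have s2: "F2 x = 0" if "M < norm x" for x
  proof -
    have "grad v x = 0" unfolding grad_def using S(3)[OF out[OF that]] by (simp add: vec_eq_iff)
    then show ?thesis by (simp add: F2_def)
  qed
  have n1: "0 \<le> F1 x" and n2: "0 \<le> F2 x" for x by (simp_all add: F1_def F2_def)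
  define T where "T = \<bar>M\<bar> + norm p + 1"
  have T: "F1 (p + (R + t) *\<^sub>R circ \<theta>) = 0" "F2 (p + (R + t) *\<^sub>R circ \<theta>) = 0" if "T \<le> t" for t \<theta>
    using radial_support[of R F1 M p t \<theta>, OF R c1 n1 s1] radial_support[of R F2 M p t \<theta>, OF R c2 n2 s2] that
    by (simp_all add: T_def)
  obtain C1 where C1: "\<And>x. F1 x \<le> C1" using F_bounded[OF R c1 n1 s1] by metis
  obtain C2 where C2: "\<And>x. F2 x \<le> C2" using F_bounded[OF R c2 n2 s2] by metis
  have ray: "\<mu> * weighted ?L (\<lambda>t. F1 (p + (R + t) *\<^sub>R circ \<theta>))
     \<le> weighted ?L (\<lambda>t. F2 (p + (R + t) *\<^sub>R circ \<theta>)) + \<alpha> * (?L * F1 (p + R *\<^sub>R circ \<theta>))" for \<theta>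
  proof -
    define y where "y t = p + (R + t) *\<^sub>R circ \<theta>" for t
    define w where "w t = v (y t)" for t
    define w' where "w' t = frechet_derivative v (at (y t)) (circ \<theta>)" for t
    have yD: "(y has_derivative (\<lambda>h. h *\<^sub>R circ \<theta>)) (at t)" for t
      unfolding y_def by (auto intro!: derivative_eq_intros)
    have wD: "(w has_derivative (\<lambda>h. h *\<^sub>R w' t)) (at t)" for t
    proof -
      have "(w has_derivative (\<lambda>h. frechet_derivative v (at (y t)) (h *\<^sub>R circ \<theta>))) (at t)"
        unfolding w_def[abs_def] by (rule has_derivative_compose[OF yD smooth_has_derivative[OF sm]])
      then show ?thesis
        by (simp add: w'_def linear_scale[OF has_derivative_linear[OF smooth_has_derivative[OF sm]]])
    qed
    have cy: "continuous_on UNIV y" unfolding y_def by (intro continuous_intros)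
    have "continuous_on UNIV (\<lambda>t. grad v (y t))"
      by (intro continuous_on_compose2[OF smooth_continuous_grad[OF sm, of UNIV] cy]) auto
    then have cw': "continuous_on UNIV w'"
      unfolding w'_def[abs_def] frechet_derivative_grad[OF sm] by (intro continuous_intros)
    have w0: "w t = 0" if "T \<le> t" for t using T(1)[OF that, of \<theta>] by (simp add: w_def F1_def y_def)
    have T0: "0 \<le> T" by (simp add: T_def)
    have dRe: "((\<lambda>t. Re (w t)) has_real_derivative Re (w' t)) (at t)" for t
      using bounded_linear.has_derivative[OF bounded_linear_Re wD[of t]]
      by (simp add: has_field_derivative_def mult.commute[of _ "Re (w' t)"])
    have dIm: "((\<lambda>t. Im (w t)) has_real_derivative Im (w' t)) (at t)" for t
      using bounded_linear.has_derivative[OF bounded_linear_Im wD[of t]]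
      by (simp add: has_field_derivative_def mult.commute[of _ "Im (w' t)"])
    have pr: "profile (\<lambda>t. Re (w t)) (\<lambda>t. Re (w' t)) T" "profile (\<lambda>t. Im (w t)) (\<lambda>t. Im (w' t)) T"
      unfolding profile_def using T0 w0 dRe dIm by (auto intro!: continuous_intros cw')
    have wF: "(Re (w t))\<^sup>2 + (Im (w t))\<^sup>2 = F1 (y t)" for t by (simp add: w_def F1_def cmod_power2)
    have wF': "(Re (w' t))\<^sup>2 + (Im (w' t))\<^sup>2 \<le> F2 (y t)" for t
      using directional_le_grad[OF sm norm_circ, of "y t" \<theta>] by (simp add: w'_def F2_def cmod_power2)
    have W1: "weighted ?L (\<lambda>t. F1 (y t)) = weighted ?L (\<lambda>t. (Re (w t))\<^sup>2) + weighted ?L (\<lambda>t. (Im (w t))\<^sup>2)"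
      unfolding wF[symmetric]
    proof (rule weighted_add[OF L0])
      show "(\<lambda>t. (Re (w t))\<^sup>2) \<in> borel_measurable borel" "(\<lambda>t. (Im (w t))\<^sup>2) \<in> borel_measurable borel"
        by (intro borel_measurable_continuous_onI continuous_intros profile_continuous(1)[OF pr(1)] profile_continuous(1)[OF pr(2)])+
      show "(Re (w t))\<^sup>2 \<le> C1" "(Im (w t))\<^sup>2 \<le> C1" for t
        using C1[of "y t"] wF[of t] zero_le_power2[of "Re (w t)"] zero_le_power2[of "Im (w t)"] by linarith+
      show "T < t \<Longrightarrow> (Re (w t))\<^sup>2 = 0" "T < t \<Longrightarrow> (Im (w t))\<^sup>2 = 0" for t using w0[of t] by auto
    qed auto
    have w'0: "Re (w' t) = 0" "Im (w' t) = 0" if "T < t" for t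
      using profile_derivative_zero[OF pr(1) that] profile_derivative_zero[OF pr(2) that] by auto
    have "weighted ?L (\<lambda>t. (Re (w' t))\<^sup>2) + weighted ?L (\<lambda>t. (Im (w' t))\<^sup>2) = weighted ?L (\<lambda>t. (Re (w' t))\<^sup>2 + (Im (w' t))\<^sup>2)"
    proof (rule weighted_add[OF L0, symmetric])
      show "(\<lambda>t. (Re (w' t))\<^sup>2) \<in> borel_measurable borel" "(\<lambda>t. (Im (w' t))\<^sup>2) \<in> borel_measurable borel"
        by (intro borel_measurable_continuous_onI continuous_intros cw')+
      show "(Re (w' t))\<^sup>2 \<le> C2" "(Im (w' t))\<^sup>2 \<le> C2" for t
        using C2[of "y t"] wF'[of t] zero_le_power2[of "Re (w' t)"] zero_le_power2[of "Im (w' t)"] by linarith+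
      show "T < t \<Longrightarrow> (Re (w' t))\<^sup>2 = 0" "T < t \<Longrightarrow> (Im (w' t))\<^sup>2 = 0" for t using w'0[of t] by auto
    qed auto
    also have "\<dots> \<le> weighted ?L (\<lambda>t. F2 (y t))"
      by (rule weighted_mono[OF L0 wF' C2, where T=T]) (use T(2) in \<open>auto simp: y_def\<close>)
    finally have W2: "weighted ?L (\<lambda>t. (Re (w' t))\<^sup>2) + weighted ?L (\<lambda>t. (Im (w' t))\<^sup>2) \<le> weighted ?L (\<lambda>t. F2 (y t))" .
    have "\<mu> * weighted ?L (\<lambda>t. F1 (y t)) = \<mu> * weighted ?L (\<lambda>t. (Re (w t))\<^sup>2) + \<mu> * weighted ?L (\<lambda>t. (Im (w t))\<^sup>2)"
      unfolding W1 by (rule distrib_left)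
    also have "\<dots> \<le> (weighted ?L (\<lambda>t. (Re (w' t))\<^sup>2) + \<alpha> * (?L * (Re (w 0))\<^sup>2))
        + (weighted ?L (\<lambda>t. (Im (w' t))\<^sup>2) + \<alpha> * (?L * (Im (w 0))\<^sup>2))"
      by (intro add_mono H[OF pr(1)] H[OF pr(2)])
    also have "\<dots> = (weighted ?L (\<lambda>t. (Re (w' t))\<^sup>2) + weighted ?L (\<lambda>t. (Im (w' t))\<^sup>2)) + \<alpha> * (?L * F1 (y 0))"
      unfolding wF[symmetric] by (simp add: algebra_simps)
    also have "\<dots> \<le> weighted ?L (\<lambda>t. F2 (y t)) + \<alpha> * (?L * F1 (y 0))" using W2 by simp
    finally show ?thesis by (simp add: y_def)
  qed
  note p1 = polar_exterior_real[OF R c1 n1 s1, where p=p] and p2 = polar_exterior_real[OF R c2 n2 s2, where p=p]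
    and p3 = polar_circle_real[OF R c1 n1 s1, where p=p]
  let ?ind = "\<lambda>\<theta>. indicator {0..<2*pi} \<theta> :: real"
  have "(LINT \<theta>|lborel. \<mu> * (weighted ?L (\<lambda>t. F1 (p + (R + t) *\<^sub>R circ \<theta>)) * ?ind \<theta>))
      \<le> (LINT \<theta>|lborel. weighted ?L (\<lambda>t. F2 (p + (R + t) *\<^sub>R circ \<theta>)) * ?ind \<theta>
           + \<alpha> * ((?L * F1 (p + R *\<^sub>R circ \<theta>)) * ?ind \<theta>))"
  proof (rule integral_mono)
    show "integrable lborel (\<lambda>\<theta>. \<mu> * (weighted ?L (\<lambda>t. F1 (p + (R + t) *\<^sub>R circ \<theta>)) * ?ind \<theta>))"
      by (intro integrable_mult_right p1(1))
    show "integrable lborel (\<lambda>\<theta>. weighted ?L (\<lambda>t. F2 (p + (R + t) *\<^sub>R circ \<theta>)) * ?ind \<theta>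
           + \<alpha> * ((?L * F1 (p + R *\<^sub>R circ \<theta>)) * ?ind \<theta>))"
      by (intro Bochner_Integration.integrable_add integrable_mult_right p2(1) p3(1))
    fix \<theta>
    show "\<mu> * (weighted ?L (\<lambda>t. F1 (p + (R + t) *\<^sub>R circ \<theta>)) * ?ind \<theta>)
      \<le> weighted ?L (\<lambda>t. F2 (p + (R + t) *\<^sub>R circ \<theta>)) * ?ind \<theta> + \<alpha> * ((?L * F1 (p + R *\<^sub>R circ \<theta>)) * ?ind \<theta>)"
      using ray[of \<theta>] by (cases "\<theta> \<in> {0..<2*pi}") auto
  qed
  also have "(LINT \<theta>|lborel. \<mu> * (weighted ?L (\<lambda>t. F1 (p + (R + t) *\<^sub>R circ \<theta>)) * ?ind \<theta>))
      = \<mu> * (2 * pi * (LINT x|lebesgue_on (ext (ball p R)). F1 x))"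
    by (simp only: integral_mult_right_zero p1(2))
  also have "(LINT \<theta>|lborel. weighted ?L (\<lambda>t. F2 (p + (R + t) *\<^sub>R circ \<theta>)) * ?ind \<theta>
           + \<alpha> * ((?L * F1 (p + R *\<^sub>R circ \<theta>)) * ?ind \<theta>))
      = 2 * pi * (LINT x|lebesgue_on (ext (ball p R)). F2 x) + \<alpha> * (2 * pi * (LINT x|arc_length_on (frontier (ball p R)). F1 x))"
  proof -
    have e3: "(LINT \<theta>|lborel. \<alpha> * ((?L * F1 (p + R *\<^sub>R circ \<theta>)) * ?ind \<theta>))
        = \<alpha> * (2 * pi * (LINT x|arc_length_on (frontier (ball p R)). F1 x))"
      by (rule trans[OF integral_mult_right_zero]) (rule arg_cong[OF p3(2)])
    show ?thesis
      by (rule trans[OF Bochner_Integration.integral_add[OF p2(1) integrable_mult_right[OF p3(1)]]], assumption, assumption)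
         (rule arg_cong2[where f="(+)", OF p2(2) e3])
  qed
  finally have "2 * pi * (\<mu> * (LINT x|lebesgue_on (ext (ball p R)). F1 x))
      \<le> 2 * pi * ((LINT x|lebesgue_on (ext (ball p R)). F2 x) + \<alpha> * (LINT x|arc_length_on (frontier (ball p R)). F1 x))"
    by (simp add: algebra_simps)
  then show ?thesis unfolding F1_def F2_def by simp
qed

section \<open>Uniqueness of the weak gradient\<close>

text \<open>The squared norms of \<open>v n\<close> and \<open>u\<close> differ pointwise by at most
  \<open>|v - u|^2 + 2 |u| |v - u|\<close>; the integral of the first term tends to 0 by assumption,
  that of the second by pairing \<open>|v - u|\<close> with the fixed function
  \<open>|u|\<close>.\<close>

lemma L2_norm_tendsto:
  fixes u :: "'a \<Rightarrow> 'b::euclidean_space"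
  assumes v: "\<And>n. v n \<in> L2 M" and u: "u \<in> L2 M" and lim: "L2_tendsto M v u"
  shows "(\<lambda>n. LINT x|M. (norm (v n x))\<^sup>2) \<longlonglongrightarrow> (LINT x|M. (norm (u x))\<^sup>2)"
proof -
  have m[measurable]: "u \<in> borel_measurable M" "\<And>n. v n \<in> borel_measurable M" using v u by (auto simp: L2_def)
  have iv: "integrable M (\<lambda>x. (norm (v n x))\<^sup>2)" for n using v by (auto simp: L2_def)
  have iu: "integrable M (\<lambda>x. (norm (u x))\<^sup>2)" using u by (auto simp: L2_def)
  have sq: "(norm (v n x - u x))\<^sup>2 \<le> 2 * (norm (v n x))\<^sup>2 + 2 * (norm (u x))\<^sup>2" for n x
  proof -
    have "(norm (v n x - u x))\<^sup>2 \<le> (norm (v n x) + norm (u x))\<^sup>2" by (intro power_mono norm_triangle_ineq4) simp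
    also have "\<dots> \<le> 2 * (norm (v n x))\<^sup>2 + 2 * (norm (u x))\<^sup>2"
      using sum_squares_bound[of "norm (v n x)" "norm (u x)"] by (simp add: power2_sum)
    finally show ?thesis .
  qed
  have id: "integrable M (\<lambda>x. (norm (v n x - u x))\<^sup>2)" for n
    by (rule Bochner_Integration.integrable_bound[where f="\<lambda>x. 2 * (norm (v n x))\<^sup>2 + 2 * (norm (u x))\<^sup>2"])
       (use iv iu sq in \<open>auto intro!: AE_I2 simp: order_trans[OF _ abs_ge_self]\<close>)
  define D where "D n = (LINT x|M. (norm (v n x - u x))\<^sup>2)" for n
  have D0: "D \<longlonglongrightarrow> 0"
  proof -
    have "ennreal (D n) = (\<integral>\<^sup>+x. ennreal ((norm (v n x - u x))\<^sup>2) \<partial>M)" for n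
      unfolding D_def by (intro nn_integral_eq_integral[symmetric] id) auto
    then have "(\<lambda>n. ennreal (D n)) \<longlonglongrightarrow> ennreal 0" using lim by (simp add: L2_tendsto_def)
    then show ?thesis by (subst (asm) tendsto_ennreal_iff) (auto simp: D_def)
  qed
  define g where "g x = norm (u x)" for x
  define z where "z n x = complex_of_real (norm (v n x - u x))" for n x
  have [measurable]: "g \<in> borel_measurable M" "z n \<in> borel_measurable M" for n
    unfolding g_def z_def by measurable
  have gL2: "g \<in> L2 M" using iu by (simp add: L2_def) (simp add: g_def)
  have zL2: "z n \<in> L2 M" for n using id[of n] by (simp add: L2_def) (simp add: z_def)
  have "(\<lambda>n. LINT x|M. g x *\<^sub>R z n x) \<longlonglongrightarrow> (LINT x|M. g x *\<^sub>R 0)"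
  proof (rule L2_pairing_tendsto[OF gL2 _ zL2])
    show "(\<lambda>x. 0) \<in> L2 M" by (simp add: L2_def)
    show "L2_tendsto M z (\<lambda>x. 0)" using lim by (simp add: L2_tendsto_def z_def)
  qed
  then have "(\<lambda>n. complex_of_real (LINT x|M. norm (u x) * norm (v n x - u x))) \<longlonglongrightarrow> 0"
    by (simp add: g_def z_def scaleR_conv_of_real flip: of_real_mult integral_complex_of_real)
  then have I0: "(\<lambda>n. LINT x|M. norm (u x) * norm (v n x - u x)) \<longlonglongrightarrow> 0"
    using tendsto_of_real_iff[of _ 0 sequentially, where 'a=complex] by simp
  have ip: "integrable M (\<lambda>x. norm (u x) * norm (v n x - u x))" for n
    using integrable_norm[OF L2_product_integrable[OF gL2 zL2[of n]]] by (simp add: g_def z_def)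
  have est: "\<bar>(LINT x|M. (norm (v n x))\<^sup>2) - (LINT x|M. (norm (u x))\<^sup>2)\<bar> \<le> D n + 2 * (LINT x|M. norm (u x) * norm (v n x - u x))" for n
  proof -
    have "(LINT x|M. (norm (v n x))\<^sup>2) - (LINT x|M. (norm (u x))\<^sup>2) = (LINT x|M. (norm (v n x))\<^sup>2 - (norm (u x))\<^sup>2)"
      by (rule Bochner_Integration.integral_diff[symmetric]) (use iv iu in auto)
    also have "\<bar>\<dots>\<bar> \<le> (LINT x|M. \<bar>(norm (v n x))\<^sup>2 - (norm (u x))\<^sup>2\<bar>)" by (rule integral_abs_bound)
    also have "\<dots> \<le> (LINT x|M. (norm (v n x - u x))\<^sup>2 + 2 * (norm (u x) * norm (v n x - u x)))"
    proof (rule integral_mono)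
      show "integrable M (\<lambda>x. \<bar>(norm (v n x))\<^sup>2 - (norm (u x))\<^sup>2\<bar>)" using iv iu by (intro integrable_abs) auto
      show "integrable M (\<lambda>x. (norm (v n x - u x))\<^sup>2 + 2 * (norm (u x) * norm (v n x - u x)))" using id ip by auto
      fix x
      let ?a = "norm (v n x)" and ?b = "norm (u x)" and ?d = "norm (v n x - u x)"
      have d: "\<bar>?a - ?b\<bar> \<le> ?d" by (rule norm_triangle_ineq3)
      have "\<bar>?a\<^sup>2 - ?b\<^sup>2\<bar> = \<bar>?a - ?b\<bar> * (?a + ?b)"
        by (simp add: power2_eq_square square_diff_square_factored abs_mult)
      also have "\<dots> \<le> ?d * (?d + 2 * ?b)" using d by (intro mult_mono) (auto simp: abs_le_iff)
      finally show "\<bar>?a\<^sup>2 - ?b\<^sup>2\<bar> \<le> ?d\<^sup>2 + 2 * (?b * ?d)" by (simp add: power2_eq_square algebra_simps)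
    qed
    also have "\<dots> = D n + 2 * (LINT x|M. norm (u x) * norm (v n x - u x))"
      unfolding D_def using id ip by simp
    finally show ?thesis .
  qed
  have "(\<lambda>n. D n + 2 * (LINT x|M. norm (u x) * norm (v n x - u x))) \<longlonglongrightarrow> 0 + 2 * 0"
    by (intro tendsto_intros D0 I0)
  then have lim0: "(\<lambda>n. D n + 2 * (LINT x|M. norm (u x) * norm (v n x - u x))) \<longlonglongrightarrow> 0" by simp
  have "(\<lambda>n. (LINT x|M. (norm (v n x))\<^sup>2) - (LINT x|M. (norm (u x))\<^sup>2)) \<longlonglongrightarrow> 0"
    by (rule Lim_null_comparison[OF always_eventually lim0]) (simp only: real_norm_def est simp_thms)
  then show ?thesis by (rule LIM_zero_cancel)
qed

text \<open>Lipschitz cutoffs of width 1/k around \<open>C\<close> are mollified at a scale adapted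
  to that width; all supports stay in a fixed compact neighbourhood of \<open>C\<close> inside
  \<open>E\<close>.\<close>

lemma test_function_approx_indicator:
  fixes C E :: "(real^2) set"
  assumes C: "compact C" "C \<noteq> {}" and E: "open E" "C \<subseteq> E"
  obtains \<phi> :: "nat \<Rightarrow> real^2 \<Rightarrow> real" and S where "\<And>n. \<phi> n \<in> test_functions E" "compact S" "S \<subseteq> E" "C \<subseteq> S"
    "\<And>n x. \<bar>\<phi> n x\<bar> \<le> 2 * indicator S x" "\<And>x. (\<lambda>n. \<phi> n x) \<longlonglongrightarrow> indicator C x"
proof -
  obtain \<delta> where \<delta>: "\<delta> > 0" "{x. infdist x C \<le> \<delta>} \<subseteq> E"
    using compact_in_open_separated[OF C(2,1) E] by metis
  obtain k0 :: nat where k0: "2 / real (Suc k0) < \<delta>"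
    using nat_approx_posE[of "\<delta>/2"] \<delta>(1) by (auto simp: field_simps)
  obtain R0 where R0: "\<And>x. x \<in> C \<Longrightarrow> norm x \<le> R0" using compact_imp_bounded[OF C(1)] by (auto simp: bounded_iff)
  let ?d = "\<lambda>x. infdist x C"
  \<comment> \<open>The offset makes 2/k less than \<delta> from the start, so every mollified
    cutoff is supported in \<open>E\<close>.\<close>
  define k where "k n = n + Suc k0" for n
  have kpos: "0 < real (k n)" "1 \<le> real (k n)" for n by (auto simp: k_def)
  have k\<delta>: "2 / real (k n) < \<delta>" for n
  proof -
    have "2 / real (k n) \<le> 2 / real (Suc k0)" by (intro divide_left_mono) (auto simp: k_def)
    then show ?thesis using k0 by simp
  qed
  define u where "u n x = max 0 (1 - real (k n) * ?d x)" for n x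
  have cu: "continuous_on UNIV (u n)" for n unfolding u_def by (intro continuous_intros)
  have lip: "\<bar>u n x - u n y\<bar> \<le> real (k n) * norm (x - y)" for n x y
  proof -
    have "\<bar>?d x - ?d y\<bar> \<le> norm (x - y)"
      using infdist_triangle[of x C y] infdist_triangle[of y C x] by (simp add: dist_norm norm_minus_commute)
    then have "real (k n) * \<bar>?d x - ?d y\<bar> \<le> real (k n) * norm (x - y)" by (intro mult_left_mono) auto
    moreover have "\<bar>max 0 (1 - a) - max 0 (1 - b)\<bar> \<le> \<bar>a - b\<bar>" for a b :: real by linarith
    then have "\<bar>u n x - u n y\<bar> \<le> \<bar>real (k n) * ?d x - real (k n) * ?d y\<bar>" unfolding u_def .
    ultimately show ?thesis by (simp add: abs_mult flip: right_diff_distrib)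
  qed
  \<comment> \<open>The cutoff has Lipschitz constant \<open>k\<close>, so mollifying at radius
    1/k^2 moves it by at most 1/k, while the support grows from width 1/k to at most 2/k.\<close>
  define \<epsilon> where "\<epsilon> n = 1 / (real (k n))\<^sup>2" for n
  have \<epsilon>: "0 < \<epsilon> n" "\<epsilon> n \<le> 1 / real (k n)" for n
    using kpos[of n] by (auto simp: \<epsilon>_def power2_eq_square intro!: divide_left_mono)
  have "\<exists>\<eta>. mollifier \<eta> (\<epsilon> n)" for n using mollifier_exists[OF \<epsilon>(1)] by metis
  then obtain \<eta> where \<eta>: "\<And>n. mollifier (\<eta> n) (\<epsilon> n)" by metis
  define \<phi> where "\<phi> n = mollifier.mollify (\<eta> n) (u n)" for n
  have u0: "u n x = 0" if "1 / real (k n) \<le> ?d x" for n x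
    using that kpos[of n] by (simp add: u_def field_simps)
  have near: "\<bar>\<phi> n x - u n x\<bar> \<le> 1 / real (k n)" for n x
    unfolding \<phi>_def
  proof (rule mollifier.mollify_close[OF \<eta> cu])
    fix y :: "real^2" assume y: "norm y < \<epsilon> n"
    have "real (k n) * norm y \<le> real (k n) * \<epsilon> n" using y by (intro mult_left_mono) auto
    also have "\<dots> = 1 / real (k n)" using kpos[of n] by (simp add: \<epsilon>_def power2_eq_square)
    finally show "\<bar>u n (x - y) - u n x\<bar> \<le> 1 / real (k n)" using lip[of n "x - y" x] by simp
  qed
  have \<phi>0: "\<phi> n x = 0" if x: "2 / real (k n) \<le> ?d x" for n x
    unfolding \<phi>_def
  proof (rule mollifier.mollify_zero[OF \<eta> cu])
    fix y :: "real^2" assume y: "norm y < \<epsilon> n"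
    have "?d x \<le> ?d (x - y) + norm y" using infdist_triangle[of x C "x - y"] by (simp add: dist_norm)
    then have "1 / real (k n) \<le> ?d (x - y)" using x y \<epsilon>(2)[of n] by (simp add: field_simps)
    then show "u n (x - y) = 0" by (rule u0)
  qed
  define S where "S = {x. ?d x \<le> \<delta>}"
  have clS: "closed S" unfolding S_def by (intro closed_Collect_le continuous_intros)
  have S_norm: "norm x \<le> R0 + \<delta>" if "x \<in> S" for x
  proof -
    obtain y where y: "y \<in> C" "infdist x C = dist x y" using infdist_attains_inf[OF compact_imp_closed[OF C(1)] C(2)] by metis
    have "norm x \<le> norm y + dist x y" using norm_triangle_ineq[of y "x - y"] by (simp add: dist_norm)
    then show ?thesis using R0[OF y(1)] y(2) that by (simp add: S_def)
  qed
  then have bS: "bounded S" unfolding bounded_iff by blast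
  have cS: "compact S" using clS bS by (simp add: compact_eq_bounded_closed)
  have out: "\<phi> n x = 0" if "x \<notin> S" for n x
    using that k\<delta>[of n] by (intro \<phi>0) (simp add: S_def)
  show ?thesis
  proof (rule that[of \<phi> S])
    show "compact S" "S \<subseteq> E" "C \<subseteq> S" using cS \<delta> by (auto simp: S_def)
    show "\<phi> n \<in> test_functions E" for n
    proof -
      have cl: "closure {x. \<phi> n x \<noteq> 0} \<subseteq> S" using out clS by (intro closure_minimal) auto
      have "smooth (\<phi> n)" unfolding \<phi>_def
      proof (rule mollifier.smooth_mollify[OF \<eta> cu, of "R0 + \<delta>"])
        fix x :: "real^2" assume "R0 + \<delta> < norm x"
        then have "x \<notin> S" using S_norm[of x] by auto
        then have "2 / real (k n) \<le> ?d x" using k\<delta>[of n] by (simp add: S_def)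
        then have "1 / real (k n) \<le> ?d x" using kpos[of n] by (simp add: field_simps)
        then show "u n x = 0" by (rule u0)
      qed
      moreover have "compact (closure {x. \<phi> n x \<noteq> 0})"
        using cl cS by (meson bS bounded_subset closed_closure compact_eq_bounded_closed)
      ultimately show ?thesis using cl \<open>S \<subseteq> E\<close> by (auto simp: test_functions_def)
    qed
    show "\<bar>\<phi> n x\<bar> \<le> 2 * indicator S x" for n x
    proof (cases "x \<in> S")
      case True
      have "0 \<le> u n x" "u n x \<le> 1" using kpos[of n] infdist_nonneg[of x C] by (auto simp: u_def)
      moreover have "1 / real (k n) \<le> 1" using kpos[of n] by simp
      ultimately show ?thesis using near[of n x] True by (simp add: abs_le_iff)
    qed (simp add: out)
    show "(\<lambda>n. \<phi> n x) \<longlonglongrightarrow> indicator C x" for x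
    proof -
      have k_lim: "(\<lambda>n. c / real (k n)) \<longlonglongrightarrow> 0" for c
        unfolding k_def by (rule LIMSEQ_ignore_initial_segment[OF lim_const_over_n])
      show ?thesis
      proof (cases "x \<in> C")
        case True
        then have "u n x = 1" for n by (simp add: u_def)
        then have "norm (\<phi> n x - 1) \<le> 1 / real (k n)" for n using near[of n x] by simp
        then have "(\<lambda>n. \<phi> n x - 1) \<longlonglongrightarrow> 0"
          by (intro Lim_null_comparison[OF always_eventually k_lim]) auto
        then show ?thesis using True by (simp add: LIM_zero_iff)
      next
        case False
        then have "0 < ?d x" using in_closed_iff_infdist_zero[OF compact_imp_closed[OF C(1)] C(2)] infdist_nonneg[of x C]
          by (metis less_eq_real_def)
        then have "\<forall>\<^sub>F n in sequentially. 2 / real (k n) < ?d x" using order_tendstoD(2)[OF k_lim] by blast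
        then have "\<forall>\<^sub>F n in sequentially. \<phi> n x = 0" by (rule eventually_mono) (simp add: \<phi>0)
        then show ?thesis using False by (simp add: tendsto_eventually)
      qed
    qed
  qed
qed

text \<open>Test functions approximating the indicator of a compact subset \<open>C\<close> of the
  set where \<open>f\<close> is positive show that the integral of \<open>f\<close> over
  \<open>C\<close> is 0, so \<open>C\<close> is null; inner regularity extends this to the whole
  set.\<close>

lemma positive_set_null:
  fixes f :: "real^2 \<Rightarrow> real"
  assumes E: "open E" and f: "f \<in> L2 (lebesgue_on E)"
    and ortho: "\<And>\<phi>. \<phi> \<in> test_functions E \<Longrightarrow> (LINT x|lebesgue_on E. \<phi> x * f x) = 0"
  shows "emeasure lebesgue {x \<in> E. 0 < f x} = 0"
proof -
  have Eb: "E \<in> sets borel" using E by simp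
  have El: "E \<in> sets lebesgue" using E by simp
  have sp: "space (lebesgue_on E) = E" by (simp add: space_restrict_space)
  have fm: "f \<in> borel_measurable (lebesgue_on E)" and fi: "integrable (lebesgue_on E) (\<lambda>x. (norm (f x))\<^sup>2)"
    using f by (auto simp: L2_def)
  define A where "A = {x \<in> E. 0 < f x}"
  have "{x \<in> space (lebesgue_on E). 0 < f x} \<in> sets (lebesgue_on E)" using fm by measurable
  then have A: "A \<in> sets lebesgue" unfolding sp A_def[symmetric] using El by (simp add: sets_restrict_space_iff)
  have null: "emeasure lebesgue C = 0" if C: "compact C" "C \<subseteq> A" for C
  proof (cases "C = {}")
    case False
    have CE: "C \<subseteq> E" using C by (auto simp: A_def)
    obtain \<phi> :: "nat \<Rightarrow> real^2 \<Rightarrow> real" and S where \<phi>: "\<And>n. \<phi> n \<in> test_functions E" and S: "compact S" "S \<subseteq> E" "C \<subseteq> S"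
      and \<phi>b: "\<And>n x. \<bar>\<phi> n x\<bar> \<le> 2 * indicator S x" and \<phi>l: "\<And>x. (\<lambda>n. \<phi> n x) \<longlonglongrightarrow> indicator C x"
      using test_function_approx_indicator[OF C(1) False E CE] by blast
    have Sl: "S \<in> sets (lebesgue_on E)" using S El by (auto simp: sets_restrict_space_iff borel_closed compact_imp_closed)
    have Sfin: "emeasure (lebesgue_on E) S < \<infinity>"
      using S El emeasure_bounded_finite[OF compact_imp_bounded[OF S(1)]]
      by (subst emeasure_restrict_space) (auto simp: borel_closed compact_imp_closed)
    have iS: "integrable (lebesgue_on E) (\<lambda>x. indicator S x :: real)" using Sl Sfin by (rule integrable_real_indicator)
    have \<phi>m: "\<phi> n \<in> borel_measurable (lebesgue_on E)" for n
      using \<phi>[of n] by (intro borel_measurable_lebesgue_on borel_measurable_continuous_onI smooth_continuous) (simp add: test_functions_def)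
    have Cm: "(indicator C :: real^2 \<Rightarrow> real) \<in> borel_measurable (lebesgue_on E)"
      using C by (intro borel_measurable_lebesgue_on) (simp add: borel_closed compact_imp_closed)
    have "(\<lambda>n. LINT x|lebesgue_on E. \<phi> n x * f x) \<longlonglongrightarrow> (LINT x|lebesgue_on E. indicator C x * f x)"
    proof (rule integral_dominated_convergence[where w="\<lambda>x. 2 * (indicator S x + (norm (f x))\<^sup>2)"])
      show "integrable (lebesgue_on E) (\<lambda>x. 2 * (indicator S x + (norm (f x))\<^sup>2))"
        by (intro integrable_mult_right Bochner_Integration.integrable_add iS fi)
      show "AE x in lebesgue_on E. norm (\<phi> n x * f x) \<le> 2 * (indicator S x + (norm (f x))\<^sup>2)" for n
      proof (rule AE_I2)
        fix x
        have "\<bar>\<phi> n x\<bar> * \<bar>f x\<bar> \<le> (2 * indicator S x) * \<bar>f x\<bar>" by (intro mult_right_mono \<phi>b) simp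
        also have "\<dots> \<le> 2 * (indicator S x + (norm (f x))\<^sup>2)"
          using sum_squares_bound[of 1 "\<bar>f x\<bar>"] by (cases "x \<in> S") (auto simp: abs_mult power2_eq_square)
        finally show "norm (\<phi> n x * f x) \<le> 2 * (indicator S x + (norm (f x))\<^sup>2)" by (simp add: abs_mult)
      qed
      show "AE x in lebesgue_on E. (\<lambda>n. \<phi> n x * f x) \<longlonglongrightarrow> indicator C x * f x"
        by (intro AE_I2 tendsto_mult \<phi>l tendsto_const)
    qed (use \<phi>m Cm fm in measurable)
    then have I0: "(LINT x|lebesgue_on E. indicator C x * f x) = 0"
      using ortho[OF \<phi>] by (simp add: LIMSEQ_const_iff)
    have iC: "integrable (lebesgue_on E) (\<lambda>x. indicator C x * f x)"
    proof (rule Bochner_Integration.integrable_bound[where f="\<lambda>x. indicator S x + (norm (f x))\<^sup>2"])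
      show "integrable (lebesgue_on E) (\<lambda>x. indicator S x + (norm (f x))\<^sup>2)"
        by (intro Bochner_Integration.integrable_add iS fi)
      show "AE x in lebesgue_on E. norm (indicator C x * f x) \<le> norm (indicator S x + (norm (f x))\<^sup>2)"
      proof (rule AE_I2)
        fix x
        have "2 * \<bar>f x\<bar> \<le> 1 + (f x)\<^sup>2" using sum_squares_bound[of 1 "\<bar>f x\<bar>"] by simp
        then show "norm (indicator C x * f x) \<le> norm (indicator S x + (norm (f x))\<^sup>2)"
          using S(3) by (auto simp: indicator_def)
      qed
    qed (use Cm fm in measurable)
    have "AE x in lebesgue_on E. indicator C x * f x = 0"
    proof (subst integral_nonneg_eq_0_iff_AE[symmetric, OF iC])
      show "AE x in lebesgue_on E. 0 \<le> indicator C x * f x"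
        by (rule AE_I2) (use C in \<open>auto simp: indicator_def A_def\<close>)
    qed (rule I0)
    then have ae: "AE x in lebesgue_on E. x \<notin> C"
      by (rule eventually_mono) (use C in \<open>auto simp: indicator_def A_def split: if_splits\<close>)
    have "C \<in> sets (lebesgue_on E)" using C CE El by (auto simp: sets_restrict_space_iff borel_closed compact_imp_closed)
    then have "emeasure (lebesgue_on E) C = 0" using ae by (simp add: AE_iff_null_sets[symmetric] null_sets_def)
    then show ?thesis using CE El by (subst (asm) emeasure_restrict_space) auto
  qed simp
  \<comment> \<open>Inner regularity supplies closed sets, which are countable unions of compact
    ones.\<close>
  have closed_null: "emeasure lebesgue T = 0" if T: "closed T" "T \<subseteq> A" for T
  proof -
    have "T = (\<Union>k::nat. T \<inter> cball 0 (real k))" using real_arch_simple by auto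
    moreover have "emeasure lebesgue (\<Union>k::nat. T \<inter> cball 0 (real k)) = 0"
    proof (rule emeasure_UN_eq_0)
      fix k :: nat
      have "compact (T \<inter> cball 0 (real k))" using T by (intro closed_Int_compact) auto
      then show "emeasure lebesgue (T \<inter> cball 0 (real k)) = 0" using T by (intro null) auto
    qed (use T in auto)
    ultimately show ?thesis by simp
  qed
  have "emeasure lebesgue A \<le> 0"
  proof (rule ennreal_le_epsilon)
    fix e :: real assume e: "0 < e"
    obtain T where T: "closed T" "T \<subseteq> A" "A - T \<in> lmeasurable" "emeasure lebesgue (A - T) < ennreal e"
      using sets_lebesgue_inner_closed[OF A e] by metis
    have "emeasure lebesgue A \<le> emeasure lebesgue T + emeasure lebesgue (A - T)"
      using emeasure_subadditive[of T lebesgue "A - T"] T A by (simp add: Un_absorb1 borel_closed)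
    then show "emeasure lebesgue A \<le> 0 + ennreal e" using closed_null[OF T(1,2)] T(4) by simp
  qed
  then show ?thesis by (simp add: A_def)
qed

lemma AE_zero_of_test:
  fixes f :: "real^2 \<Rightarrow> real"
  assumes E: "open E" and f: "f \<in> L2 (lebesgue_on E)"
    and ortho: "\<And>\<phi>. \<phi> \<in> test_functions E \<Longrightarrow> (LINT x|lebesgue_on E. \<phi> x * f x) = 0"
  shows "AE x in lebesgue_on E. f x = 0"
proof -
  have El: "E \<in> sets lebesgue" using E by simp
  have sp: "space (lebesgue_on E) = E" by (simp add: space_restrict_space)
  have fm: "f \<in> borel_measurable (lebesgue_on E)" using f by (auto simp: L2_def)
  have p: "emeasure lebesgue {x \<in> E. 0 < f x} = 0" by (rule positive_set_null[OF E f ortho])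
  have m: "emeasure lebesgue {x \<in> E. 0 < - f x} = 0"
    by (rule positive_set_null[OF E]) (use f ortho in \<open>auto simp: L2_def\<close>)
  have nul: "{x \<in> space (lebesgue_on E). 0 < h x} \<in> null_sets (lebesgue_on E)"
    if "h \<in> borel_measurable (lebesgue_on E)" "emeasure lebesgue {x \<in> E. 0 < h x} = 0" for h :: "real^2 \<Rightarrow> real"
  proof -
    have s: "{x \<in> space (lebesgue_on E). 0 < h x} \<in> sets (lebesgue_on E)" using that(1) by measurable
    have "emeasure (lebesgue_on E) {x \<in> space (lebesgue_on E). 0 < h x} = 0"
      using that(2) El unfolding sp by (subst emeasure_restrict_space) auto
    then show ?thesis using s by (simp add: null_sets_def)
  qed
  have "(\<lambda>x. - f x) \<in> borel_measurable (lebesgue_on E)" using fm by measurable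
  from AE_not_in[OF nul[OF fm p]] AE_not_in[OF nul[OF this m]] show ?thesis
    using AE_space[of "lebesgue_on E"] by eventually_elim auto
qed

text \<open>The Rayleigh quotient and \<open>has_trace\<close> each choose a distributional gradient
  of \<open>u\<close>; this identifies their energies. The difference of two candidates is
  orthogonal to every test function, hence zero almost everywhere, componentwise and separately in
  real and imaginary part.\<close>

lemma weak_gradient_unique:
  assumes E: "open E" and G: "W12_with_grad E u G" and G': "W12_with_grad E u G'"
  shows "(LINT x|lebesgue_on E. (norm (G x))\<^sup>2) = (LINT x|lebesgue_on E. (norm (G' x))\<^sup>2)"
proof -
  have L: "G \<in> L2 (lebesgue_on E)" "G' \<in> L2 (lebesgue_on E)" using G G' by (auto simp: W12_with_grad_def)
  have comp: "AE x in lebesgue_on E. G x $ i = G' x $ i" for i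
  proof -
    let ?M = "lebesgue_on E"
    define h where "h x = G x $ i - G' x $ i" for x
    have g: "(\<lambda>x. G x $ i) \<in> L2 ?M" "(\<lambda>x. G' x $ i) \<in> L2 ?M" using L2_component[OF L(1)] L2_component[OF L(2)] by auto
    have hm: "h \<in> borel_measurable ?M" using g unfolding h_def L2_def by (auto intro: borel_measurable_diff)
    have hi: "integrable ?M (\<lambda>x. (norm (h x))\<^sup>2)"
    proof (rule Bochner_Integration.integrable_bound[where f="\<lambda>x. 2 * (norm (G x $ i))\<^sup>2 + 2 * (norm (G' x $ i))\<^sup>2"])
      show "integrable ?M (\<lambda>x. 2 * (norm (G x $ i))\<^sup>2 + 2 * (norm (G' x $ i))\<^sup>2)" using g by (auto simp: L2_def)
      show "AE x in ?M. norm ((norm (h x))\<^sup>2) \<le> norm (2 * (norm (G x $ i))\<^sup>2 + 2 * (norm (G' x $ i))\<^sup>2)"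
      proof (rule AE_I2)
        fix x
        have "(norm (h x))\<^sup>2 \<le> (norm (G x $ i) + norm (G' x $ i))\<^sup>2" unfolding h_def by (intro power_mono norm_triangle_ineq4) simp
        also have "\<dots> \<le> 2 * (norm (G x $ i))\<^sup>2 + 2 * (norm (G' x $ i))\<^sup>2"
          using sum_squares_bound[of "norm (G x $ i)" "norm (G' x $ i)"] by (simp add: power2_sum)
        finally show "norm ((norm (h x))\<^sup>2) \<le> norm (2 * (norm (G x $ i))\<^sup>2 + 2 * (norm (G' x $ i))\<^sup>2)" by simp
      qed
    qed (use hm in measurable)
    have ortho: "(LINT x|?M. \<phi> x *\<^sub>R h x) = 0" "integrable ?M (\<lambda>x. \<phi> x *\<^sub>R h x)" if \<phi>: "\<phi> \<in> test_functions E" for \<phi>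
    proof -
      have sm: "smooth \<phi>" using \<phi> by (simp add: test_functions_def)
      obtain S where S: "compact S" "\<And>x. x \<notin> S \<Longrightarrow> \<phi> x = 0" using test_function_support[OF \<phi>] by metis
      have \<phi>L: "\<phi> \<in> L2 ?M" by (rule L2_compact_support[OF smooth_continuous[OF sm] S]) (use E in auto)
      note i = L2_product_integrable[OF \<phi>L g(1)] L2_product_integrable[OF \<phi>L g(2)]
      have "(LINT x|?M. \<phi> x *\<^sub>R (G x $ i)) = (LINT x|?M. \<phi> x *\<^sub>R (G' x $ i))"
      proof -
        have "(LINT x|?M. (grad \<phi> x $ i) *\<^sub>R u x) = - (LINT x|?M. \<phi> x *\<^sub>R (G x $ i))"
          using G \<phi> unfolding W12_with_grad_def by blast
        moreover have "(LINT x|?M. (grad \<phi> x $ i) *\<^sub>R u x) = - (LINT x|?M. \<phi> x *\<^sub>R (G' x $ i))"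
          using G' \<phi> unfolding W12_with_grad_def by blast
        ultimately show ?thesis by simp
      qed
      then show "(LINT x|?M. \<phi> x *\<^sub>R h x) = 0" unfolding h_def scaleR_diff_right using i by simp
      show "integrable ?M (\<lambda>x. \<phi> x *\<^sub>R h x)" unfolding h_def scaleR_diff_right using i by simp
    qed
    have re: "(\<lambda>x. Re (h x)) \<in> L2 ?M" and im: "(\<lambda>x. Im (h x)) \<in> L2 ?M"
    proof -
      have "integrable ?M (\<lambda>x. (norm (Re (h x)))\<^sup>2)"
        by (rule Bochner_Integration.integrable_bound[OF hi]) (use hm in \<open>auto intro!: AE_I2 simp: cmod_power2\<close>)
      then show "(\<lambda>x. Re (h x)) \<in> L2 ?M" using hm by (simp add: L2_def)
      have "integrable ?M (\<lambda>x. (norm (Im (h x)))\<^sup>2)"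
        by (rule Bochner_Integration.integrable_bound[OF hi]) (use hm in \<open>auto intro!: AE_I2 simp: cmod_power2\<close>)
      then show "(\<lambda>x. Im (h x)) \<in> L2 ?M" using hm by (simp add: L2_def)
    qed
    have "AE x in ?M. Re (h x) = 0"
    proof (rule AE_zero_of_test[OF E re])
      show "(LINT x|?M. \<phi> x * Re (h x)) = 0" if "\<phi> \<in> test_functions E" for \<phi>
        using integral_Re[OF ortho(2)[OF that]] ortho(1)[OF that] by simp
    qed
    moreover have "AE x in ?M. Im (h x) = 0"
    proof (rule AE_zero_of_test[OF E im])
      show "(LINT x|?M. \<phi> x * Im (h x)) = 0" if "\<phi> \<in> test_functions E" for \<phi>
        using integral_Im[OF ortho(2)[OF that]] ortho(1)[OF that] by simp
    qed
    ultimately show ?thesis by eventually_elim (simp add: h_def complex_eq_iff)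
  qed
  have "AE x in lebesgue_on E. G x = G' x"
    using comp[of 1] comp[of 2] by eventually_elim (simp add: vec_eq_iff forall_2)
  then show ?thesis
    by (intro integral_cong_AE) (use L in \<open>auto simp: L2_def\<close>)
qed

section \<open>Comparison with the disk\<close>

lemma weighted_nonneg: "0 \<le> weighted L f"
  by (simp add: weighted_def)

lemma profile_bounds:
  assumes "profile \<psi> \<psi>' T"
  obtains C where "0 \<le> C" "\<And>t. 0 < t \<Longrightarrow> (\<psi> t)\<^sup>2 \<le> C" "\<And>t. 0 < t \<Longrightarrow> (\<psi>' t)\<^sup>2 \<le> C"
proof -
  obtain B where B: "0 \<le> B" "\<And>t. 0 \<le> t \<Longrightarrow> \<bar>\<psi>' t\<bar> \<le> B"
    "\<And>s t. 0 \<le> s \<Longrightarrow> 0 \<le> t \<Longrightarrow> \<bar>\<psi> s - \<psi> t\<bar> \<le> B * \<bar>s - t\<bar>" using profile_lipschitz[OF assms] by metis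
  have T: "0 \<le> T" "\<And>t. T \<le> t \<Longrightarrow> \<psi> t = 0" using assms by (auto simp: profile_def)
  have b: "\<bar>\<psi> t\<bar> \<le> B * T" if "0 < t" for t
  proof (cases "t \<le> T")
    case True
    have "\<bar>\<psi> t\<bar> \<le> B * \<bar>t - T\<bar>" using B(3)[of t T] T that by simp
    also have "\<dots> \<le> B * T" using True that B(1) by (intro mult_left_mono) auto
    finally show ?thesis .
  qed (use T B(1) in simp)
  have "(\<psi> t)\<^sup>2 \<le> max ((B * T)\<^sup>2) (B\<^sup>2)" "(\<psi>' t)\<^sup>2 \<le> max ((B * T)\<^sup>2) (B\<^sup>2)" if "0 < t" for t
  proof -
    have "\<bar>\<psi> t\<bar>\<^sup>2 \<le> (B * T)\<^sup>2" by (rule power_mono[OF b[OF that] abs_ge_zero])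
    moreover have "\<bar>\<psi>' t\<bar>\<^sup>2 \<le> B\<^sup>2" by (rule power_mono[OF B(2) abs_ge_zero]) (use that in simp)
    ultimately
    show "(\<psi> t)\<^sup>2 \<le> max ((B * T)\<^sup>2) (B\<^sup>2)" "(\<psi>' t)\<^sup>2 \<le> max ((B * T)\<^sup>2) (B\<^sup>2)" by auto
  qed
  moreover have "0 \<le> max ((B * T)\<^sup>2) (B\<^sup>2)" by (simp add: le_max_iff_disj)
  ultimately show thesis by (intro that)
qed

lemma weighted_upper:
  assumes L: "0 \<le> L" and C: "0 \<le> C" "\<And>t. 0 < t \<Longrightarrow> f t \<le> C" and T: "0 \<le> T" "\<And>t. T < t \<Longrightarrow> f t = 0"
  shows "weighted L f \<le> C * (L + T * (2 * pi)) * T"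
proof -
  have "(\<integral>\<^sup>+t. ennreal (f t) * (ennreal (L + t * (2 * pi)) * indicator {0<..} t) \<partial>lborel)
      \<le> (\<integral>\<^sup>+t. ennreal (C * (L + T * (2 * pi))) * indicator {0..T} t \<partial>lborel)"
  proof (rule nn_integral_mono)
    fix t show "ennreal (f t) * (ennreal (L + t * (2 * pi)) * indicator {0<..} t)
      \<le> ennreal (C * (L + T * (2 * pi))) * indicator {0..T} t"
    proof (cases "0 < t \<and> t \<le> T")
      case True
      then have "ennreal (f t) * ennreal (L + t * (2 * pi)) \<le> ennreal C * ennreal (L + T * (2 * pi))"
        using C(2)[of t] by (intro mult_mono ennreal_leI) auto
      then show ?thesis using True L C(1) T(1) by (simp add: ennreal_mult)
    next
      case False
      then show ?thesis using T(2)[of t] by (auto simp: indicator_def)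
    qed
  qed
  also have "\<dots> = ennreal (C * (L + T * (2 * pi)) * T)"
    using L C(1) T(1) by (simp add: nn_integral_cmult ennreal_mult)
  finally show ?thesis unfolding weighted_def using L C(1) T(1)
    by (simp add: enn2real_leI)
qed

lemma weighted_lower:
  assumes L: "0 \<le> L" and C: "\<And>t. 0 < t \<Longrightarrow> f t \<le> C" and T: "\<And>t. T < t \<Longrightarrow> f t = 0"
    and c: "0 < a" "a \<le> b" "0 \<le> c" "\<And>t. a \<le> t \<Longrightarrow> t \<le> b \<Longrightarrow> c \<le> f t"
  shows "c * (L + a * (2 * pi)) * (b - a) \<le> weighted L f"
proof -
  have "ennreal (c * (L + a * (2 * pi)) * (b - a)) = (\<integral>\<^sup>+t. ennreal (c * (L + a * (2 * pi))) * indicator {a..b} t \<partial>lborel)"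
    using L c(1-3) by (simp add: nn_integral_cmult ennreal_mult)
  also have "\<dots> \<le> (\<integral>\<^sup>+t. ennreal (f t) * (ennreal (L + t * (2 * pi)) * indicator {0<..} t) \<partial>lborel)"
  proof (rule nn_integral_mono)
    fix t show "ennreal (c * (L + a * (2 * pi))) * indicator {a..b} t
      \<le> ennreal (f t) * (ennreal (L + t * (2 * pi)) * indicator {0<..} t)"
    proof (cases "t \<in> {a..b}")
      case True
      then have "ennreal c * ennreal (L + a * (2 * pi)) \<le> ennreal (f t) * ennreal (L + t * (2 * pi))"
        using c(4)[of t] by (intro mult_mono ennreal_leI) auto
      then show ?thesis using True L c(1,3) by (simp add: ennreal_mult)
    qed simp
  qed
  finally have "enn2real (ennreal (c * (L + a * (2 * pi)) * (b - a))) \<le> weighted L f"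
    unfolding weighted_def by (rule enn2real_mono) (use weighted_finite[OF L C T] in simp)
  then show ?thesis using L c(1-3) by simp
qed

text \<open>Pointwise \<open>(L / L') (L' + 2 \<pi> t) = L + (L / L') 2 \<pi> t\<close>, which is at
  most \<open>L + 2 \<pi> t\<close>: relative to the perimeter, the parallel curves of a shorter
  curve grow faster.\<close>

lemma weighted_scale:
  assumes L: "0 < L" "L \<le> L'" and C: "\<And>t. 0 < t \<Longrightarrow> f t \<le> C" and T: "\<And>t. T < t \<Longrightarrow> f t = 0"
    and m [measurable]: "f \<in> borel_measurable borel"
  shows "L / L' * weighted L' f \<le> weighted L f"
proof -
  let ?I = "\<lambda>L. \<integral>\<^sup>+t. ennreal (f t) * (ennreal (L + t * (2 * pi)) * indicator {0<..} t) \<partial>lborel"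
  have "ennreal (L / L') * ?I L' = (\<integral>\<^sup>+t. ennreal (L / L') * (ennreal (f t) * (ennreal (L' + t * (2 * pi)) * indicator {0<..} t)) \<partial>lborel)"
    by (rule nn_integral_cmult[symmetric]) measurable
  also have "\<dots> \<le> ?I L"
  proof (rule nn_integral_mono)
    fix t :: real
    show "ennreal (L / L') * (ennreal (f t) * (ennreal (L' + t * (2 * pi)) * indicator {0<..} t))
        \<le> ennreal (f t) * (ennreal (L + t * (2 * pi)) * indicator {0<..} t)"
    proof (cases "0 < t")
      case True
      have "L / L' * (L' + t * (2 * pi)) = L + (L / L') * (t * (2 * pi))" using L by (simp add: field_simps)
      also have "\<dots> \<le> L + 1 * (t * (2 * pi))" using L True by (intro add_left_mono mult_right_mono) auto
      finally have "ennreal (L / L') * ennreal (L' + t * (2 * pi)) \<le> ennreal (L + t * (2 * pi))"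
        using L True by (subst ennreal_mult[symmetric]) (simp_all only: ennreal_leI, auto)
      then show ?thesis using True by (simp add: mult.left_commute mult_left_mono)
    qed simp
  qed
  finally have "enn2real (ennreal (L / L') * ?I L') \<le> enn2real (?I L)"
    using weighted_finite[OF less_imp_le[OF L(1)] C T] by (intro enn2real_mono) auto
  then show ?thesis using L by (simp add: weighted_def enn2real_mult)
qed

text \<open>Squaring removes the corner of the positive part, so a truncated linear function becomes
  an admissible profile.\<close>

lemma DERIV_square_pos_part: "((\<lambda>x. (max 0 x)\<^sup>2) has_real_derivative 2 * max 0 x) (at (x::real))"
proof -
  consider "x < 0" | "x > 0" | "x = 0" by linarith
  then show ?thesis
  proof cases
    case 1
    have "((\<lambda>_. 0) has_real_derivative 0) (at x)" by simp
    then have "((\<lambda>x. (max 0 x)\<^sup>2) has_real_derivative 0) (at x)"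
      by (rule has_field_derivative_transform_within_open[of _ _ _ "{..<0}"]) (use 1 in auto)
    then show ?thesis using 1 by simp
  next
    case 2
    have "((\<lambda>x. x\<^sup>2) has_real_derivative 2 * x) (at x)" by (auto intro!: derivative_eq_intros)
    then have "((\<lambda>x. (max 0 x)\<^sup>2) has_real_derivative 2 * x) (at x)"
      by (rule has_field_derivative_transform_within_open[of _ _ _ "{0<..}"]) (use 2 in auto)
    then show ?thesis using 2 by simp
  next
    case 3
    have "(\<lambda>h. (max 0 h)\<^sup>2 / h :: real) \<midarrow>0\<rightarrow> 0"
    proof (rule Lim_null_comparison)
      show "\<forall>\<^sub>F h::real in at 0. norm ((max 0 h)\<^sup>2 / h) \<le> \<bar>h\<bar>"
        by (rule always_eventually) (auto simp: max_def power2_eq_square)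
      show "(\<lambda>h::real. \<bar>h\<bar>) \<midarrow>0\<rightarrow> 0" using tendsto_rabs[OF tendsto_ident_at, of "0::real" UNIV] by simp
    qed
    then show ?thesis using 3 by (simp add: DERIV_def)
  qed
qed

text \<open>The square of a linear function decaying from 1 to 0 over \<open>[0, n]\<close> has
  slope of order 1/n, so its energy stays bounded under the linear weight, while its mass grows
  without bound; the boundary term has the favourable sign. A positive \<open>\<mu>\<close> is
  therefore impossible.\<close>

lemma form_nonpositive:
  assumes H: "\<And>\<psi> \<psi>' T. profile \<psi> \<psi>' T \<Longrightarrow> \<mu> * weighted L (\<lambda>t. (\<psi> t)\<^sup>2)
      \<le> weighted L (\<lambda>t. (\<psi>' t)\<^sup>2) + \<alpha> * (L * (\<psi> 0)\<^sup>2)"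
    and L: "0 \<le> L" and \<alpha>: "\<alpha> \<le> 0"
  shows "\<mu> \<le> 0"
proof (rule ccontr)
  assume "\<not> \<mu> \<le> 0"
  then have \<mu>: "0 < \<mu>" by simp
  \<comment> \<open>The mass is at least n/64 and the energy at most \<open>4 L + 8 \<pi>\<close>;
    this \<open>n\<close> makes \<open>\<mu>\<close> times n/64 larger than that bound.\<close>
  define n where "n = 1 + 64 * (4 * L + 8 * pi) / \<mu>"
  have n1: "1 < n" using \<mu> L pi_gt_zero by (simp add: n_def add_nonneg_pos)
  then have n: "0 < n" by simp
  define \<psi> \<psi>' where "\<psi> t = (max 0 (1 - t / n))\<^sup>2" and "\<psi>' t = 2 * max 0 (1 - t / n) * (- 1 / n)" for t
  have pr: "profile \<psi> \<psi>' n" unfolding profile_def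
  proof (intro conjI allI impI)
    show "(\<psi> has_real_derivative \<psi>' t) (at t)" for t
      unfolding \<psi>_def[abs_def] \<psi>'_def
      by (rule DERIV_chain2[OF DERIV_square_pos_part]) (use n in \<open>auto intro!: derivative_eq_intros\<close>)
    show "continuous_on UNIV \<psi>'" unfolding \<psi>'_def[abs_def] by (intro continuous_intros) (use n in auto)
    show "\<psi> t = 0" if "n \<le> t" for t using that n by (simp add: \<psi>_def)
  qed (use n in simp)
  have b1: "max 0 (1 - t / n) \<le> 1" if "0 < t" for t using that n by simp
  have up: "weighted L (\<lambda>t. (\<psi>' t)\<^sup>2) \<le> 4 / n\<^sup>2 * (L + n * (2 * pi)) * n"
  proof (rule weighted_upper[OF L])
    show "(\<psi>' t)\<^sup>2 \<le> 4 / n\<^sup>2" if "0 < t" for t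
    proof -
      have "(max 0 (1 - t / n))\<^sup>2 \<le> 1" using b1[OF that] by (intro power_le_one) auto
      then have "4 / n\<^sup>2 * (max 0 (1 - t / n))\<^sup>2 \<le> 4 / n\<^sup>2 * 1" by (intro mult_left_mono) auto
      then show ?thesis by (simp add: \<psi>'_def power_mult_distrib power_divide)
    qed
    show "(\<psi>' t)\<^sup>2 = 0" if "n < t" for t using profile_derivative_zero[OF pr that] by simp
  qed (use n in auto)
  \<comment> \<open>On \<open>[n/4, n/2]\<close> the linear function is at least 1/2, so the square
    of \<open>\<psi>\<close>, its fourth power, is at least 1/16; staying away from 0 makes the
    weight of order \<open>n\<close>.\<close>
  have low: "1 / 16 * (L + n / 4 * (2 * pi)) * (n / 2 - n / 4) \<le> weighted L (\<lambda>t. (\<psi> t)\<^sup>2)"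
  proof (rule weighted_lower[OF L, where C=1 and T=n])
    show "(\<psi> t)\<^sup>2 \<le> 1" if "0 < t" for t
      unfolding \<psi>_def using b1[OF that] by (intro power_le_one) (auto intro: power_le_one)
    show "1 / 16 \<le> (\<psi> t)\<^sup>2" if "n / 4 \<le> t" "t \<le> n / 2" for t
    proof -
      have "t / n \<le> 1 / 2" using that n by (simp add: field_simps)
      then have "1 / 2 \<le> max 0 (1 - t / n)" by linarith
      then have "((1 / 2)\<^sup>2)\<^sup>2 \<le> (\<psi> t)\<^sup>2" unfolding \<psi>_def by (rule power_mono[OF power_mono]) simp_all
      moreover have "((1 / 2)\<^sup>2)\<^sup>2 = (1 / 16 :: real)" by (simp add: power2_eq_square)
      ultimately show ?thesis by simp
    qed
  qed (use n in \<open>auto simp: \<psi>_def\<close>)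
  have "n / 64 \<le> 1 / 16 * (L + n / 4 * (2 * pi)) * (n / 2 - n / 4)"
  proof -
    have "1 * n \<le> n * n" using n1 by (intro mult_right_mono) auto
    then have "n \<le> n * n * 1" by simp
    also have "n * n * 1 \<le> n * n * (pi / 2)" using pi_ge_two by (intro mult_left_mono) auto
    also have "\<dots> \<le> L * n + n * n * (pi / 2)" using L n by simp
    also have "\<dots> = 64 * (1 / 16 * (L + n / 4 * (2 * pi)) * (n / 2 - n / 4))" by (simp add: algebra_simps)
    finally show ?thesis by simp
  qed
  then have "\<mu> * (n / 64) \<le> \<mu> * weighted L (\<lambda>t. (\<psi> t)\<^sup>2)" using low \<mu> by (intro mult_left_mono) auto
  also have "\<dots> \<le> weighted L (\<lambda>t. (\<psi>' t)\<^sup>2) + \<alpha> * (L * (\<psi> 0)\<^sup>2)" by (rule H[OF pr])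
  also have "\<dots> \<le> weighted L (\<lambda>t. (\<psi>' t)\<^sup>2)" using \<alpha> L by (simp add: mult_nonpos_nonneg)
  also have "\<dots> \<le> 4 * L / n + 8 * pi" 
  proof -
    have "4 / n\<^sup>2 * (L + n * (2 * pi)) * n = 4 * L / n + 8 * pi" using n by (simp add: power2_eq_square field_simps)
    then show ?thesis using up by simp
  qed
  also have "\<dots> \<le> 4 * L + 8 * pi" 
  proof -
    have "4 * L / n \<le> 4 * L / 1" using L n1 by (intro divide_left_mono) auto
    then show ?thesis by simp
  qed
  finally have "\<mu> * n \<le> 64 * (4 * L + 8 * pi)" by simp
  moreover have "\<mu> * n = \<mu> + 64 * (4 * L + 8 * pi)" using \<mu> by (simp add: n_def field_simps)
  ultimately show False using \<mu> by simp
qed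

lemma form_of_eigenvalue:
  assumes dom: "convex_smooth_domain \<Omega>" "\<Omega> \<noteq> {}" and \<mu>: "ereal \<mu> \<le> robin_ext_eigenvalue \<alpha> \<Omega>" and pr: "profile \<psi> \<psi>' T"
  shows "\<mu> * weighted (perimeter \<Omega>) (\<lambda>t. (\<psi> t)\<^sup>2)
      \<le> weighted (perimeter \<Omega>) (\<lambda>t. (\<psi>' t)\<^sup>2) + \<alpha> * (perimeter \<Omega> * (\<psi> 0)\<^sup>2)"
proof (cases "weighted (perimeter \<Omega>) (\<lambda>t. (\<psi> t)\<^sup>2) = 0")
  case False
  then have pos: "0 < weighted (perimeter \<Omega>) (\<lambda>t. (\<psi> t)\<^sup>2)" using weighted_nonneg[of "perimeter \<Omega>"] by (simp add: order.not_eq_order_implies_strict)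
  have "\<mu> \<le> (weighted (perimeter \<Omega>) (\<lambda>t. (\<psi>' t)\<^sup>2) + \<alpha> * (perimeter \<Omega> * (\<psi> 0)\<^sup>2)) / weighted (perimeter \<Omega>) (\<lambda>t. (\<psi> t)\<^sup>2)"
    using order_trans[OF \<mu> robin_upper[OF dom pr False]] by simp
  then show ?thesis using pos by (simp add: pos_le_divide_eq)
next
  case True
  have L: "0 \<le> perimeter \<Omega>" by (simp add: perimeter_def)
  \<comment> \<open>A profile with zero mass gives no admissible trial function. By continuity it
    vanishes at 0, so the boundary term disappears and the inequality is trivial.\<close>
  have "\<psi> 0 = 0"
  proof (rule ccontr)
    assume nz: "\<psi> 0 \<noteq> 0"
    have "isCont \<psi> 0" using pr unfolding profile_def by (blast intro: DERIV_isCont)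
    then obtain d where d: "0 < d" "\<And>t. \<bar>t\<bar> < d \<Longrightarrow> \<bar>\<psi> t - \<psi> 0\<bar> < \<bar>\<psi> 0\<bar> / 2"
      using nz unfolding continuous_at_eps_delta dist_norm real_norm_def
      by (metis diff_zero half_gt_zero zero_less_abs_iff)
    obtain C where C: "\<And>t. 0 < t \<Longrightarrow> (\<psi> t)\<^sup>2 \<le> C" using profile_bounds[OF pr] by metis
    have "(\<psi> 0 / 2)\<^sup>2 * (perimeter \<Omega> + d / 4 * (2 * pi)) * (d / 2 - d / 4) \<le> weighted (perimeter \<Omega>) (\<lambda>t. (\<psi> t)\<^sup>2)"
    proof (rule weighted_lower[OF L C, where T=T])
      show "(\<psi> 0 / 2)\<^sup>2 \<le> (\<psi> t)\<^sup>2" if "d / 4 \<le> t" "t \<le> d / 2" for t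
      proof -
        have "\<bar>\<psi> 0 / 2\<bar> \<le> \<bar>\<psi> t\<bar>" using d(2)[of t] d(1) that by (simp add: abs_if split: if_splits)
        then show ?thesis by (simp only: abs_le_square_iff)
      qed
    qed (use pr d(1) in \<open>auto simp: profile_def\<close>)
    moreover have "0 < (\<psi> 0 / 2)\<^sup>2 * (perimeter \<Omega> + d / 4 * (2 * pi)) * (d / 2 - d / 4)"
      using nz d(1) L by (intro mult_pos_pos add_nonneg_pos) auto
    ultimately show False using True by simp
  qed
  then show ?thesis using True weighted_nonneg by simp
qed

lemma form_monotone:
  assumes H: "\<And>\<psi> \<psi>' T. profile \<psi> \<psi>' T \<Longrightarrow> \<mu> * weighted L' (\<lambda>t. (\<psi> t)\<^sup>2)
      \<le> weighted L' (\<lambda>t. (\<psi>' t)\<^sup>2) + \<alpha> * (L' * (\<psi> 0)\<^sup>2)"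
    and \<mu>: "\<mu> \<le> 0" and L: "0 < L" "L \<le> L'" and pr: "profile \<psi> \<psi>' T"
  shows "\<mu> * weighted L (\<lambda>t. (\<psi> t)\<^sup>2) \<le> weighted L (\<lambda>t. (\<psi>' t)\<^sup>2) + \<alpha> * (L * (\<psi> 0)\<^sup>2)"
proof -
  obtain C where C: "\<And>t. 0 < t \<Longrightarrow> (\<psi> t)\<^sup>2 \<le> C" "\<And>t. 0 < t \<Longrightarrow> (\<psi>' t)\<^sup>2 \<le> C" using profile_bounds[OF pr] by metis
  have z: "\<And>t. T < t \<Longrightarrow> (\<psi> t)\<^sup>2 = 0" "\<And>t. T < t \<Longrightarrow> (\<psi>' t)\<^sup>2 = 0"
    using pr profile_derivative_zero[OF pr] by (auto simp: profile_def)
  have m: "(\<lambda>t. (\<psi> t)\<^sup>2) \<in> borel_measurable borel" "(\<lambda>t. (\<psi>' t)\<^sup>2) \<in> borel_measurable borel"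
    by (intro borel_measurable_continuous_onI continuous_intros profile_continuous[OF pr])+
  \<comment> \<open>Here \<open>\<mu>\<close> \<le> 0 enters: a lower bound on the mass becomes an
    upper bound on its nonpositive multiple. The boundary term scales exactly by L/L', and the
    energy obeys the same bound as the mass.\<close>
  have "\<mu> * weighted L (\<lambda>t. (\<psi> t)\<^sup>2) \<le> \<mu> * (L / L' * weighted L' (\<lambda>t. (\<psi> t)\<^sup>2))"
    using \<mu> by (intro mult_left_mono_neg weighted_scale[OF L C(1) z(1) m(1)])
  also have "\<dots> = L / L' * (\<mu> * weighted L' (\<lambda>t. (\<psi> t)\<^sup>2))" by simp
  also have "\<dots> \<le> L / L' * (weighted L' (\<lambda>t. (\<psi>' t)\<^sup>2) + \<alpha> * (L' * (\<psi> 0)\<^sup>2))"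
    using L by (intro mult_left_mono H[OF pr]) auto
  also have "\<dots> = L / L' * weighted L' (\<lambda>t. (\<psi>' t)\<^sup>2) + \<alpha> * (L * (\<psi> 0)\<^sup>2)" using L by (simp add: field_simps)
  also have "\<dots> \<le> weighted L (\<lambda>t. (\<psi>' t)\<^sup>2) + \<alpha> * (L * (\<psi> 0)\<^sup>2)"
    using weighted_scale[OF L C(2) z(2) m(2)] by simp
  finally show ?thesis .
qed

text \<open>The three squared norms in the inequality converge along the test functions that define
  the trace, so the inequality for test functions passes to the limit; the limit gradient has the
  same energy as \<open>G\<close> by uniqueness.\<close>

lemma ball_form_W12:
  assumes R: "R > 0"
    and H: "\<And>\<psi> \<psi>' T. profile \<psi> \<psi>' T \<Longrightarrow> \<mu> * weighted (2*pi*R) (\<lambda>t. (\<psi> t)\<^sup>2)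
      \<le> weighted (2*pi*R) (\<lambda>t. (\<psi>' t)\<^sup>2) + \<alpha> * (2*pi*R * (\<psi> 0)\<^sup>2)"
    and G: "W12_with_grad (ext (ball p R)) u G" and tr: "has_trace (ball p R) u g"
  shows "\<mu> * (LINT x|lebesgue_on (ext (ball p R)). (norm (u x))\<^sup>2)
     \<le> (LINT x|lebesgue_on (ext (ball p R)). (norm (G x))\<^sup>2)
      + \<alpha> * (LINT x|arc_length_on (frontier (ball p R)). (norm (g x))\<^sup>2)"
proof -
  let ?E = "ext (ball p R)" and ?F = "frontier (ball p R)"
  have opE: "open ?E" by (simp add: ext_def open_Compl)
  have Eb: "?E \<in> sets borel" using opE by simp
  have gL: "g \<in> L2 (arc_length_on ?F)" using tr by (simp add: has_trace_def)
  obtain G' v where G': "W12_with_grad ?E u G'" and v: "\<And>n. v n \<in> test_functions UNIV"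
    and lim: "L2_tendsto (lebesgue_on ?E) v u" "L2_tendsto (lebesgue_on ?E) (\<lambda>n. grad (v n)) G'"
      "L2_tendsto (arc_length_on ?F) v g"
    using tr unfolding has_trace_def by blast
  have uL: "u \<in> L2 (lebesgue_on ?E)" "G' \<in> L2 (lebesgue_on ?E)" using G' by (auto simp: W12_with_grad_def)
  have fin: "finite_measure (arc_length_on ?F)"
  proof (rule finite_measureI)
    have "emeasure hausdorff1 ?F = ennreal (perimeter (ball p R))"
      using R by (intro steiner_formula(1) convex_smooth_domain_ball) auto
    then show "emeasure (arc_length_on ?F) (space (arc_length_on ?F)) \<noteq> \<infinity>"
      by (simp add: space_restrict_space emeasure_restrict_space)
  qed
  have vL: "v n \<in> L2 (arc_length_on ?F)" for n
  proof -
    have c: "continuous_on UNIV (v n)" using v[of n] by (simp add: test_functions_def smooth_continuous)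
    obtain S where S: "compact S" "\<And>x. x \<notin> S \<Longrightarrow> v n x = 0" using test_function_support[OF v[of n]] by metis
    have "compact (v n ` S)" by (intro compact_continuous_image continuous_on_subset[OF c] S(1)) simp
    then obtain C where C: "\<forall>x\<in>S. norm (v n x) \<le> C" by (auto dest!: compact_imp_bounded simp: bounded_iff)
    have b: "norm (v n x) \<le> \<bar>C\<bar>" for x using bspec[OF C, of x] S(2)[of x] by (cases "x \<in> S") auto
    have "v n \<in> borel_measurable hausdorff1" using borel_measurable_continuous_onI[OF c]
      by (simp cong: measurable_cong_sets)
    then have m: "v n \<in> borel_measurable (arc_length_on ?F)" by (rule measurable_restrict_space1)
    have "integrable (arc_length_on ?F) (\<lambda>x. (norm (v n x))\<^sup>2)"
    proof (rule finite_measure.integrable_const_bound[OF fin, where B="\<bar>C\<bar>\<^sup>2"])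
      show "AE x in arc_length_on ?F. norm ((norm (v n x))\<^sup>2) \<le> \<bar>C\<bar>\<^sup>2"
        using power_mono[OF b norm_ge_zero, of _ 2] by (intro AE_I2) simp
    qed (use m in measurable)
    then show ?thesis using m by (simp add: L2_def)
  qed
  have l1: "(\<lambda>n. LINT x|lebesgue_on ?E. (norm (v n x))\<^sup>2) \<longlonglongrightarrow> (LINT x|lebesgue_on ?E. (norm (u x))\<^sup>2)"
    by (rule L2_norm_tendsto[OF test_function_L2(1)[OF v Eb] uL(1) lim(1)])
  have l2: "(\<lambda>n. LINT x|lebesgue_on ?E. (norm (grad (v n) x))\<^sup>2) \<longlonglongrightarrow> (LINT x|lebesgue_on ?E. (norm (G' x))\<^sup>2)"
    by (rule L2_norm_tendsto[OF test_function_L2(2)[OF v Eb] uL(2) lim(2)])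
  have l3: "(\<lambda>n. LINT x|arc_length_on ?F. (norm (v n x))\<^sup>2) \<longlonglongrightarrow> (LINT x|arc_length_on ?F. (norm (g x))\<^sup>2)"
    by (rule L2_norm_tendsto[OF vL gL lim(3)])
  have "\<mu> * (LINT x|lebesgue_on ?E. (norm (u x))\<^sup>2)
      \<le> (LINT x|lebesgue_on ?E. (norm (G' x))\<^sup>2) + \<alpha> * (LINT x|arc_length_on ?F. (norm (g x))\<^sup>2)"
    by (rule LIMSEQ_le[OF tendsto_mult[OF tendsto_const l1] tendsto_add[OF l2 tendsto_mult[OF tendsto_const l3]]])
       (intro exI[of _ 0] allI impI ball_form_test[OF R H v])
  then show ?thesis using weak_gradient_unique[OF opE G G'] by simp
qed

lemma eigenvalue_ball_lower:
  assumes R: "R > 0"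
    and H: "\<And>\<psi> \<psi>' T. profile \<psi> \<psi>' T \<Longrightarrow> \<mu> * weighted (2*pi*R) (\<lambda>t. (\<psi> t)\<^sup>2)
      \<le> weighted (2*pi*R) (\<lambda>t. (\<psi>' t)\<^sup>2) + \<alpha> * (2*pi*R * (\<psi> 0)\<^sup>2)"
  shows "ereal \<mu> \<le> robin_ext_eigenvalue \<alpha> (ball p R)"
  unfolding robin_ext_eigenvalue_def
proof (rule Inf_greatest, clarify)
  fix u G g
  let ?M = "lebesgue_on (ext (ball p R))"
  assume G: "W12_with_grad (ext (ball p R)) u G" and tr: "has_trace (ball p R) u g" and nz: "\<not> (AE x in ?M. u x = 0)"
  have i: "integrable ?M (\<lambda>x. (norm (u x))\<^sup>2)" using G by (auto simp: W12_with_grad_def L2_def)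
  have "(LINT x|?M. (norm (u x))\<^sup>2) \<noteq> 0" using integral_nonneg_eq_0_iff_AE[OF i] nz by simp
  then have "0 < (LINT x|?M. (norm (u x))\<^sup>2)" by (simp add: order.not_eq_order_implies_strict)
  then show "ereal \<mu> \<le> ereal (((LINT x|?M. (norm (G x))\<^sup>2) + \<alpha> * (LINT x|arc_length_on (frontier (ball p R)). (norm (g x))\<^sup>2))
      / (LINT x|?M. (norm (u x))\<^sup>2))"
    using ball_form_W12[OF R H G tr] by (simp add: pos_le_divide_eq)
qed

lemma eigenvalue_le_ball:
  assumes dom: "convex_smooth_domain \<Omega>" "\<Omega> \<noteq> {}" and R: "R > 0" "2 * pi * R \<le> perimeter \<Omega>" and \<alpha>: "\<alpha> \<le> 0"
  shows "robin_ext_eigenvalue \<alpha> \<Omega> \<le> robin_ext_eigenvalue \<alpha> (ball p R)"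
proof (rule dense_le)
  \<comment> \<open>The eigenvalue is an extended real whose finiteness is not established, so the
    comparison runs over all values strictly below it; the value -\<infinity> is trivial and
    \<infinity> cannot occur.\<close>
  fix z assume z: "z < robin_ext_eigenvalue \<alpha> \<Omega>"
  show "z \<le> robin_ext_eigenvalue \<alpha> (ball p R)"
  proof (cases z)
    case (real \<mu>)
    then have "ereal \<mu> \<le> robin_ext_eigenvalue \<alpha> \<Omega>" using z by simp
    note form = form_of_eigenvalue[OF dom this]
    have L: "0 < 2 * pi * R" using R by simp
    have "\<mu> \<le> 0" by (rule form_nonpositive[OF form _ \<alpha>], assumption) (use R L in linarith)
    from form_monotone[OF form this L R(2)] show ?thesis
      unfolding real by (rule eigenvalue_ball_lower[OF R(1)])
  qed (use z in auto)
qed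

theorem theorem1:
  fixes \<alpha> c\<^sub>1 c\<^sub>2 R\<^sub>1 R\<^sub>2 :: real and p\<^sub>1 p\<^sub>2 :: "real^2"
  assumes "\<alpha> < 0" and "c\<^sub>1 > 0" and "c\<^sub>2 > 0"
    and "R\<^sub>1 > 0" and "perimeter (ball p\<^sub>1 R\<^sub>1) = c\<^sub>1"
    and "R\<^sub>2 > 0" and "measure lebesgue (ball p\<^sub>2 R\<^sub>2) = c\<^sub>2"
  shows "is_maximum
           {robin_ext_eigenvalue \<alpha> \<Omega> | \<Omega>. convex_smooth_domain \<Omega> \<and> perimeter \<Omega> = c\<^sub>1}
           (robin_ext_eigenvalue \<alpha> (ball p\<^sub>1 R\<^sub>1)) \<and>
         is_maximum
           {robin_ext_eigenvalue \<alpha> \<Omega> | \<Omega>. convex_smooth_domain \<Omega> \<and> measure lebesgue \<Omega> = c\<^sub>2}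
           (robin_ext_eigenvalue \<alpha> (ball p\<^sub>2 R\<^sub>2))"
proof
  have \<alpha>: "\<alpha> \<le> 0" using assms(1) by simp
  have c1: "c\<^sub>1 = 2 * pi * R\<^sub>1" using perimeter_ball[OF assms(4), of p\<^sub>1] assms(5) by simp
  have "measure lborel (ball p\<^sub>2 R\<^sub>2) = pi * R\<^sub>2\<^sup>2" using assms(6) by (simp add: measure_def emeasure_ball_2)
  then have c2: "c\<^sub>2 = pi * R\<^sub>2\<^sup>2" using assms(7) by (simp add: measure_completion)
  have "robin_ext_eigenvalue \<alpha> \<Omega> \<le> robin_ext_eigenvalue \<alpha> (ball p\<^sub>1 R\<^sub>1)"
    if "convex_smooth_domain \<Omega>" "perimeter \<Omega> = c\<^sub>1" for \<Omega>
  proof -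
    \<comment> \<open>The empty set satisfies \<open>convex_smooth_domain\<close>; the positive
      perimeter excludes it.\<close>
    have "\<Omega> \<noteq> {}" using that(2) assms(2) by (auto simp: perimeter_def)
    then show ?thesis using that c1 by (intro eigenvalue_le_ball[OF _ _ assms(4) _ \<alpha>]) auto
  qed
  then show "is_maximum {robin_ext_eigenvalue \<alpha> \<Omega> | \<Omega>. convex_smooth_domain \<Omega> \<and> perimeter \<Omega> = c\<^sub>1}
      (robin_ext_eigenvalue \<alpha> (ball p\<^sub>1 R\<^sub>1))"
    using convex_smooth_domain_ball[OF assms(4), of p\<^sub>1] assms(5) unfolding is_maximum_def by blast
  have "robin_ext_eigenvalue \<alpha> \<Omega> \<le> robin_ext_eigenvalue \<alpha> (ball p\<^sub>2 R\<^sub>2)"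
    if dom: "convex_smooth_domain \<Omega>" and m: "measure lebesgue \<Omega> = c\<^sub>2" for \<Omega>
  proof -
    have ne: "\<Omega> \<noteq> {}" using m assms(3) by auto
    have "measure lborel \<Omega> = c\<^sub>2" using m dom by (simp add: measure_completion convex_smooth_domain_def)
    \<comment> \<open>For the given area, which is that of the disk, the isoperimetric lower bound
      is exactly the perimeter of the disk.\<close>
    then have "2 * sqrt ((pi * R\<^sub>2)\<^sup>2) \<le> perimeter \<Omega>"
      using isoperimetric_inequality[OF dom ne] by (simp add: c2 power2_eq_square mult_ac)
    then have "2 * pi * R\<^sub>2 \<le> perimeter \<Omega>" using assms(6) by simp
    then show ?thesis by (rule eigenvalue_le_ball[OF dom ne assms(6) _ \<alpha>])
  qed
  then show "is_maximum {robin_ext_eigenvalue \<alpha> \<Omega> | \<Omega>. convex_smooth_domain \<Omega> \<and> measure lebesgue \<Omega> = c\<^sub>2}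
      (robin_ext_eigenvalue \<alpha> (ball p\<^sub>2 R\<^sub>2))"
    using convex_smooth_domain_ball[OF assms(6), of p\<^sub>2] assms(7) unfolding is_maximum_def by blast
qed

end
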